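(* Suppose $p>0$ a.e. on $(a,b)$ and that $T_0$ is bounded from below by $\gamma_0\in\mathbb R$, $T_0\ge\gamma_0I$. Let $\mu\in\mathbb R$ and let $g_a,g_b$ be functions satisfying $g_a,g_b,g_a^{[1]},g_b^{[1]}\in AC_{\mathrm{loc}}((a,b))$, $g_a>0$ near $a$, $g_b>0$ near $b$, $$\int_a\frac{dx}{p(x)g_a(x)^2}<\infty,\qquad\int^b\frac{dx}{p(x)g_b(x)^2}=\infty,\tag{1}$$ and $$q\ge\mu r-s\frac{g_a^{[1]}}{g_a}+\frac{(g_a^{[1]})'}{g_a}\ \text{ a.e. near }a,\qquad q\ge\mu r-s\frac{g_b^{[1]}}{g_b}+\frac{(g_b^{[1]})'}{g_b}\ \text{ a.e. near }b.$$ Then the Friedrichs extension $S_F$ of $T_0$ is characterized by $S_Ff=\tau f$ for $$f\in\operatorname{dom}(S_F)=\left\{g\in\operatorname{dom}(T_{\max})\,\middle|\,\int^bpg_b^2\left|\left(\frac g{g_b}\right)'\right|^2dx<\infty,\ \int_apg_a^2\left|\left(\frac g{g_a}\right)'\right|^2dx<\infty,\ \lim_{x\downarrow a}\frac{g(x)}{g_a(x)}=0\right\}.$$ In particular, for every $f\in\operatorname{dom}(S_F)$, $$\int_a\left|q-\frac{(g_a^{[1]})'}{g_a}+s\frac{g_a^{[1]}}{g_a}\right||f|^2dx<\infty,\qquad\int^b\left|q-\frac{(g_b^{[1]})'}{g_b}+s\frac{g_b^{[1]}}{g_b}\right||f|^2dx<\infty.$$ If condition (1) is replaced by $$\int_a\frac{dx}{p(x)g_a(x)^2}<\infty,\qquad\int^b\frac{dx}{p(x)g_b(x)^2}<\infty,$$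 then instead $S_Ff=\tau f$ for $$f\in\operatorname{dom}(S_F)=\left\{g\in\operatorname{dom}(T_{\max})\,\middle|\,\int_apg_a^2\left|\left(\frac g{g_a}\right)'\right|^2dx<\infty,\ \int^bpg_b^2\left|\left(\frac g{g_b}\right)'\right|^2dx<\infty,\ \lim_{x\downarrow a}\frac{g(x)}{g_a(x)}=0,\ \lim_{x\uparrow b}\frac{g(x)}{g_b(x)}=0\right\}.$$
   Context: Setting. $(a,b)\subseteq\mathbb R$ is an open interval (possibly unbounded); $p,q,r,s$ are Lebesgue measurable and real-valued a.e. on $(a,b)$, with $p^{-1},q,r,s\in L^1_{\mathrm{loc}}((a,b);dx)$, $r>0$ and $p\neq0$ a.e. For $f\in AC_{\mathrm{loc}}((a,b))$ put $f^{[1]}=p(f'+sf)$, $\mathfrak D_\tau=\{f\in AC_{\mathrm{loc}}((a,b)) : f^{[1]}\in AC_{\mathrm{loc}}((a,b))\}$, and $\tau f=\frac1r\big(-(f^{[1]})'+sf^{[1]}+qf\big)$ for $f\in\mathfrak D_\tau$. In $L^2((a,b);r(x)dx)$ the maximal operator is $T_{\max}f=\tau f$, $\operatorname{dom}(T_{\max})=\{g\in L^2((a,b);r\,dx): g\in\mathfrak D_\tau,\ \tau g\in L^2((a,b);r\,dx)\}$; $T_0$ is the restriction of $T_{\max}$ to functions with compact support in $(a,b)$ (densely defined, symmetric, with $T_0^*=T_{\max}$). The functions $g_a,g_b$ are real-valued. The notations $\int_a$ and $\int^b$ denote integration over a sufficiently small neighborhood $(a,c)$ of $a$, respectively $(d,b)$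 of $b$. When $p>0$ a.e., the existence of $\mu,g_a,g_b$ as in the claim (with either version of the integral conditions) is equivalent to $T_0$ being bounded from below. The Friedrichs extension $S_F$ of $T_0$ is the self-adjoint operator associated with the closure of the form $(f,g)\mapsto\langle f,T_0g\rangle$, $f,g\in\operatorname{dom}(T_0)$. *)

theory Defs
  imports "HOL-Analysis.Analysis"
begin

section \<open>Locally absolutely continuous functions on an open interval\<close>

definition abs_cont_on_Icc :: "real \<Rightarrow> real \<Rightarrow> (real \<Rightarrow> 'a::real_normed_vector) \<Rightarrow> bool" where
  "abs_cont_on_Icc c d f \<longleftrightarrow>
     (\<forall>\<epsilon>>0. \<exists>\<delta>>0. \<forall>\<D>. \<D> division_of \<Union>\<D> \<and> \<Union>\<D> \<subseteq> {c..d} \<and> (\<Sum>K\<in>\<D>. Sup K - Inf K) < \<delta>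
        \<longrightarrow> (\<Sum>K\<in>\<D>. norm (f (Sup K) - f (Inf K))) < \<epsilon>)"

definition AC_loc :: "ereal \<Rightarrow> ereal \<Rightarrow> (real \<Rightarrow> 'a::real_normed_vector) \<Rightarrow> bool" where
  "AC_loc a b f \<longleftrightarrow> (\<forall>c d. {c..d} \<subseteq> einterval a b \<longrightarrow> abs_cont_on_Icc c d f)"

definition L1_loc :: "ereal \<Rightarrow> ereal \<Rightarrow> (real \<Rightarrow> real) \<Rightarrow> bool" where
  "L1_loc a b f \<longleftrightarrow> (\<forall>K. compact K \<and> K \<subseteq> einterval a b \<longrightarrow> f absolutely_integrable_on K)"


section \<open>The differential expression\<close>

text \<open>Since \<open>p\<close> and \<open>f'\<close> are only given almost everywhere, \<open>p (f' + s f) \<in> AC_loc\<close> means that this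
  function agrees almost everywhere with a locally absolutely continuous one. The latter is uniquely
  determined on the interval, and it is the one that is evaluated and differentiated in \<open>\<tau>\<close>.\<close>

definition is_quasi_deriv ::
  "ereal \<Rightarrow> ereal \<Rightarrow> (real \<Rightarrow> real) \<Rightarrow> (real \<Rightarrow> real) \<Rightarrow> (real \<Rightarrow> 'a::real_normed_vector) \<Rightarrow> (real \<Rightarrow> 'a) \<Rightarrow> bool" where
  "is_quasi_deriv a b p s f h \<longleftrightarrow> AC_loc a b h \<and>
     (AE x\<in>einterval a b in lebesgue. h x = p x *\<^sub>R (vector_derivative f (at x) + s x *\<^sub>R f x))"

definition quasi_deriv ::
  "ereal \<Rightarrow> ereal \<Rightarrow> (real \<Rightarrow> real) \<Rightarrow> (real \<Rightarrow> real) \<Rightarrow> (real \<Rightarrow> 'a::real_normed_vector) \<Rightarrow> real \<Rightarrow> 'a" where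
  "quasi_deriv a b p s f = (SOME h. is_quasi_deriv a b p s f h)"

definition D_tau ::
  "ereal \<Rightarrow> ereal \<Rightarrow> (real \<Rightarrow> real) \<Rightarrow> (real \<Rightarrow> real) \<Rightarrow> (real \<Rightarrow> 'a::real_normed_vector) set" where
  "D_tau a b p s = {f. AC_loc a b f \<and> (\<exists>h. is_quasi_deriv a b p s f h)}"

definition tau ::
  "ereal \<Rightarrow> ereal \<Rightarrow> (real \<Rightarrow> real) \<Rightarrow> (real \<Rightarrow> real) \<Rightarrow> (real \<Rightarrow> real) \<Rightarrow> (real \<Rightarrow> real)
    \<Rightarrow> (real \<Rightarrow> complex) \<Rightarrow> real \<Rightarrow> complex" where
  "tau a b p q r s f x = (1 / r x) *\<^sub>R
     (- vector_derivative (quasi_deriv a b p s f) (at x) + s x *\<^sub>R quasi_deriv a b p s f x + q x *\<^sub>R f x)"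


section \<open>Operators and forms in complex \<open>L\<^sup>2\<close> spaces\<close>

text \<open>Elements of \<open>L\<^sup>2(M)\<close> are represented by functions. An operator is represented by its graph, a
  set of pairs of functions that is closed under changes on null sets.\<close>

definition L2 :: "'a measure \<Rightarrow> ('a \<Rightarrow> complex) set" where
  "L2 M = {f \<in> borel_measurable M. integrable M (\<lambda>x. (cmod (f x))\<^sup>2)}"

definition L2_inner :: "'a measure \<Rightarrow> ('a \<Rightarrow> complex) \<Rightarrow> ('a \<Rightarrow> complex) \<Rightarrow> complex" where
  "L2_inner M f g = (LINT x|M. cnj (f x) * g x)"

definition L2_norm :: "'a measure \<Rightarrow> ('a \<Rightarrow> complex) \<Rightarrow> real" where
  "L2_norm M f = sqrt (LINT x|M. (cmod (f x))\<^sup>2)"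

definition L2_graph ::
  "'a measure \<Rightarrow> ('a \<Rightarrow> complex) set \<Rightarrow> (('a \<Rightarrow> complex) \<Rightarrow> ('a \<Rightarrow> complex)) \<Rightarrow> (('a \<Rightarrow> complex) \<times> ('a \<Rightarrow> complex)) set" where
  "L2_graph M D A = {(f, h). f \<in> L2 M \<and> h \<in> L2 M \<and>
     (\<exists>g\<in>D. (AE x in M. f x = g x) \<and> (AE x in M. h x = A g x))}"

definition bounded_below_by ::
  "'a measure \<Rightarrow> ('a \<Rightarrow> complex) set \<Rightarrow> (('a \<Rightarrow> complex) \<Rightarrow> ('a \<Rightarrow> complex)) \<Rightarrow> real \<Rightarrow> bool" where
  "bounded_below_by M D A \<gamma> \<longleftrightarrow> (\<forall>f\<in>D. Re (L2_inner M f (A f)) \<ge> \<gamma> * (L2_norm M f)\<^sup>2)"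

text \<open>Convergence with respect to a form \<open>t\<close> with domain \<open>D\<close>: \<open>u n \<rightarrow> f\<close> in \<open>L\<^sup>2(M)\<close> and
  \<open>t[u n - u m] \<rightarrow> 0\<close> for \<open>n, m \<rightarrow> \<infinity>\<close>.\<close>

definition form_conv ::
  "'a measure \<Rightarrow> ('a \<Rightarrow> complex) set \<Rightarrow> (('a \<Rightarrow> complex) \<Rightarrow> ('a \<Rightarrow> complex) \<Rightarrow> complex)
    \<Rightarrow> (nat \<Rightarrow> 'a \<Rightarrow> complex) \<Rightarrow> ('a \<Rightarrow> complex) \<Rightarrow> bool" where
  "form_conv M D t u f \<longleftrightarrow> (\<forall>n. u n \<in> D) \<and> f \<in> L2 M \<and>
     (\<lambda>n. L2_norm M (\<lambda>x. u n x - f x)) \<longlonglongrightarrow> 0 \<and>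
     (\<forall>\<epsilon>>0. \<exists>N. \<forall>m\<ge>N. \<forall>n\<ge>N. cmod (t (\<lambda>x. u n x - u m x) (\<lambda>x. u n x - u m x)) < \<epsilon>)"

definition form_closure_dom ::
  "'a measure \<Rightarrow> ('a \<Rightarrow> complex) set \<Rightarrow> (('a \<Rightarrow> complex) \<Rightarrow> ('a \<Rightarrow> complex) \<Rightarrow> complex)
    \<Rightarrow> ('a \<Rightarrow> complex) set" where
  "form_closure_dom M D t = {f. \<exists>u. form_conv M D t u f}"

definition form_closure ::
  "'a measure \<Rightarrow> ('a \<Rightarrow> complex) set \<Rightarrow> (('a \<Rightarrow> complex) \<Rightarrow> ('a \<Rightarrow> complex) \<Rightarrow> complex)
    \<Rightarrow> ('a \<Rightarrow> complex) \<Rightarrow> ('a \<Rightarrow> complex) \<Rightarrow> complex" where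
  "form_closure M D t f g = (THE l. \<exists>u v. form_conv M D t u f \<and> form_conv M D t v g \<and>
     (\<lambda>n. t (u n) (v n)) \<longlonglongrightarrow> l)"

text \<open>The operator associated with a closed form \<open>t\<close> with domain \<open>Q\<close> (first representation theorem).\<close>

definition form_operator ::
  "'a measure \<Rightarrow> ('a \<Rightarrow> complex) set \<Rightarrow> (('a \<Rightarrow> complex) \<Rightarrow> ('a \<Rightarrow> complex) \<Rightarrow> complex)
    \<Rightarrow> (('a \<Rightarrow> complex) \<times> ('a \<Rightarrow> complex)) set" where
  "form_operator M Q t = {(f, h). f \<in> Q \<and> h \<in> L2 M \<and> (\<forall>g\<in>Q. t g f = L2_inner M g h)}"

definition friedrichs_ext ::
  "'a measure \<Rightarrow> ('a \<Rightarrow> complex) set \<Rightarrow> (('a \<Rightarrow> complex) \<Rightarrow> ('a \<Rightarrow> complex))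
    \<Rightarrow> (('a \<Rightarrow> complex) \<times> ('a \<Rightarrow> complex)) set" where
  "friedrichs_ext M D A =
     (let t = (\<lambda>f g. L2_inner M f (A g)) in form_operator M (form_closure_dom M D t) (form_closure M D t))"


section \<open>The Sturm--Liouville operators\<close>

definition weighted_measure :: "ereal \<Rightarrow> ereal \<Rightarrow> (real \<Rightarrow> real) \<Rightarrow> real measure" where
  "weighted_measure a b r = density (lebesgue_on (einterval a b)) (\<lambda>x. ennreal (r x))"

text \<open>Domains consist of the locally absolutely continuous representatives.\<close>

definition dom_Tmax ::
  "ereal \<Rightarrow> ereal \<Rightarrow> (real \<Rightarrow> real) \<Rightarrow> (real \<Rightarrow> real) \<Rightarrow> (real \<Rightarrow> real) \<Rightarrow> (real \<Rightarrow> real)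
    \<Rightarrow> (real \<Rightarrow> complex) set" where
  "dom_Tmax a b p q r s = {g \<in> L2 (weighted_measure a b r).
     g \<in> D_tau a b p s \<and> tau a b p q r s g \<in> L2 (weighted_measure a b r)}"

definition dom_T0 ::
  "ereal \<Rightarrow> ereal \<Rightarrow> (real \<Rightarrow> real) \<Rightarrow> (real \<Rightarrow> real) \<Rightarrow> (real \<Rightarrow> real) \<Rightarrow> (real \<Rightarrow> real)
    \<Rightarrow> (real \<Rightarrow> complex) set" where
  "dom_T0 a b p q r s = {g \<in> dom_Tmax a b p q r s.
     \<exists>K. compact K \<and> K \<subseteq> einterval a b \<and> (\<forall>x\<in>einterval a b - K. g x = 0)}"

definition S_F ::
  "ereal \<Rightarrow> ereal \<Rightarrow> (real \<Rightarrow> real) \<Rightarrow> (real \<Rightarrow> real) \<Rightarrow> (real \<Rightarrow> real) \<Rightarrow> (real \<Rightarrow> real)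
    \<Rightarrow> ((real \<Rightarrow> complex) \<times> (real \<Rightarrow> complex)) set" where
  "S_F a b p q r s = friedrichs_ext (weighted_measure a b r) (dom_T0 a b p q r s) (tau a b p q r s)"

definition sl_coefficients ::
  "ereal \<Rightarrow> ereal \<Rightarrow> (real \<Rightarrow> real) \<Rightarrow> (real \<Rightarrow> real) \<Rightarrow> (real \<Rightarrow> real) \<Rightarrow> (real \<Rightarrow> real) \<Rightarrow> bool" where
  "sl_coefficients a b p q r s \<longleftrightarrow> a < b \<and>
     (\<forall>f\<in>{p, q, r, s}. f \<in> borel_measurable (lebesgue_on (einterval a b))) \<and>
     L1_loc a b (\<lambda>x. inverse (p x)) \<and> L1_loc a b q \<and> L1_loc a b r \<and> L1_loc a b s \<and>
     (AE x\<in>einterval a b in lebesgue. r x > 0) \<and> (AE x\<in>einterval a b in lebesgue. p x \<noteq> 0)"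


section \<open>Behaviour near the endpoints\<close>

text \<open>Integrals of nonnegative functions over \<open>(a, c)\<close> and \<open>(d, b)\<close>. The endpoint statements
  quantify over all \<open>c\<close> close to \<open>a\<close> and all \<open>d\<close> close to \<open>b\<close>.\<close>

definition nn_int :: "ereal \<Rightarrow> ereal \<Rightarrow> (real \<Rightarrow> real) \<Rightarrow> ennreal" where
  "nn_int c d F = (\<integral>\<^sup>+x\<in>einterval c d. ennreal (F x) \<partial>lebesgue)"

definition finite_int_left :: "ereal \<Rightarrow> (real \<Rightarrow> real) \<Rightarrow> bool" where
  "finite_int_left a F \<longleftrightarrow> (\<forall>\<^sub>F c in at_right a. nn_int a c F < \<infinity>)"

definition finite_int_right :: "ereal \<Rightarrow> (real \<Rightarrow> real) \<Rightarrow> bool" where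
  "finite_int_right b F \<longleftrightarrow> (\<forall>\<^sub>F d in at_left b. nn_int d b F < \<infinity>)"

definition infinite_int_right :: "ereal \<Rightarrow> (real \<Rightarrow> real) \<Rightarrow> bool" where
  "infinite_int_right b F \<longleftrightarrow> (\<forall>\<^sub>F d in at_left b. nn_int d b F = \<infinity>)"

end

theory Submission
  imports Defs
begin

text \<open>Write \<open>\<omega> = 1 / (p g\<^sup>2)\<close> and \<open>V = g f\<^sup>[\<^sup>1\<^sup>] - f g\<^sup>[\<^sup>1\<^sup>]\<close>, so that \<open>(f / g)' = \<omega> V\<close>. Jacobi's factorization
  turns \<open>\<langle>f, \<tau> f\<rangle>\<close> near an endpoint into the integral of \<open>\<omega> |V|\<^sup>2 + (Q - \<mu> r) |f|\<^sup>2 + \<mu> r |f|\<^sup>2\<close> plus boundary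
  terms, where \<open>Q = q - (g\<^sup>[\<^sup>1\<^sup>])' / g + s g\<^sup>[\<^sup>1\<^sup>] / g \<ge> \<mu> r\<close>; the middle part of the interval is
  controlled by a Sobolev inequality. Hence the form norm controls the Dirichlet integral of \<open>f / g\<close>
  and the point values of \<open>f\<close>, and passing to the limit along approximating sequences from the form
  domain gives one inclusion. Conversely, if \<open>f\<close> satisfies the boundary conditions, solve
  \<open>(S\<^sub>F - \<gamma> + 1) u = (\<tau> - \<gamma> + 1) f\<close> with \<open>\<gamma>\<close> a lower bound; then \<open>w = f - u\<close> lies in the kernel of \<open>\<tau> - \<gamma> + 1\<close> and
  satisfies the boundary conditions, and a sign argument for \<open>(|w / g|\<^sup>2)' = 2 \<omega> Re (cnj (w / g) V)\<close> shows
  \<open>w = 0\<close>.\<close>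

section \<open>Absolutely continuous functions\<close>

text \<open>Absolute continuity is given by epsilon-delta and the coefficients are only locally
  integrable. Hence all calculus runs through \<open>primitive_on\<close> (a function together with
  its a.e. derivative), and equations become first-order systems (\<open>sol\<close>) in which every
  identity is a product rule. Two obstacles shape the rest. Form convergence of u_n controls neither
  \<tau> u_n nor the quasi-derivatives. The limit is therefore first identified as a weak solution,
  pointwise convergence comes from a Sobolev inequality with arbitrarily small energy coefficient,
  and only then is the energy of the limit bounded. Secondly, the function w of the uniqueness step
  is not known to lie in the form domain. The coercivity estimate is therefore proved for all
  solutions with boundary terms kept, and \<gamma> = -C is read off from it. Together with the shift
  by 1 this puts a gap of size \<integral> r |w|^2 between the boundary forms at the two ends; if w
  \<noteq> 0, one of them has a fixed sign near its endpoint. Then |w/g| is monotone there, against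
  its vanishing or, at b, against a finite Dirichlet integral with divergent \<integral>
  \<omega>.\<close>

lemmas absolutely_integrable_imp_integrable = set_lebesgue_integral_eq_integral(1)
lemmas integral_combine_Icc = Henstock_Kurzweil_Integration.integral_combine

lemma integral_mono_AE_Icc:
  fixes f g :: "real \<Rightarrow> real"
  assumes "f absolutely_integrable_on S" "g absolutely_integrable_on S"
    and "AE x\<in>S in lebesgue. f x \<le> g x"
  shows "integral S f \<le> integral S g"
  using set_integral_mono_AE[OF assms] assms(1,2)
  by (simp add: set_lebesgue_integral_eq_integral(2))

lemma AE_lebesgue_negligible:
  "(AE x\<in>S in lebesgue. P x) \<longleftrightarrow> negligible {x\<in>S. \<not> P x}"
proof
  assume "AE x\<in>S in lebesgue. P x"
  then obtain N where "N \<in> null_sets lebesgue" "{x \<in> space lebesgue. \<not> (x \<in> S \<longrightarrow> P x)} \<subseteq> N"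
    by (auto simp: eventually_ae_filter)
  then show "negligible {x\<in>S. \<not> P x}"
    by (auto simp: negligible_iff_null_sets intro: negligible_subset[unfolded negligible_iff_null_sets])
next
  assume "negligible {x\<in>S. \<not> P x}"
  then show "AE x\<in>S in lebesgue. P x"
    by (intro AE_I'[of "{x\<in>S. \<not> P x}"]) (auto simp: negligible_iff_null_sets)
qed

lemma absolutely_integrable_cong_AE:
  fixes f g :: "real \<Rightarrow> 'a::euclidean_space"
  assumes "AE x\<in>S in lebesgue. f x = g x"
  shows "f absolutely_integrable_on S \<longleftrightarrow> g absolutely_integrable_on S"
  using assms unfolding AE_lebesgue_negligible
  by (intro absolutely_integrable_spike_eq[of "{x\<in>S. f x \<noteq> g x}"]) auto

lemma integral_cong_AE_set:
  fixes f g :: "real \<Rightarrow> 'a::euclidean_space"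
  assumes "AE x\<in>S in lebesgue. f x = g x"
  shows "integral S f = integral S g"
  using assms unfolding AE_lebesgue_negligible
  by (intro integral_spike[of "{x\<in>S. f x \<noteq> g x}"]) auto

subsection \<open>Lebesgue differentiation\<close>

text \<open>Every bad point lies in arbitrarily short intervals on which the Riemann term misses the
  integral by more than \<open>e\<close> times the length. By Henstock's lemma a disjoint fine
  family of such intervals has small total error, hence small total length; Vitali's covering lemma
  covers the whole bad set by 5-fold enlargements of such a family.\<close>

lemma Lebesgue_differentiation_exceptional:
  fixes g :: "real \<Rightarrow> 'a::euclidean_space"
  assumes g: "g integrable_on {c..d}" and e: "e > 0"
  shows "negligible {x\<in>{c..d}. \<forall>\<delta>>0. \<exists>u v. c \<le> u \<and> u \<le> x \<and> x \<le> v \<and> v \<le> d \<and> u < v \<and> v - u < \<delta> \<and>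
     norm ((v - u) *\<^sub>R g x - integral {u..v} g) > e * (v - u)}" (is "negligible ?E'")
proof -
  define E where "E = ?E'"
  have "\<exists>T. E \<subseteq> T \<and> T \<in> lmeasurable \<and> measure lebesgue T \<le> \<epsilon>" if eps: "\<epsilon> > 0" for \<epsilon> :: real
  proof -
  \<comment> \<open>A total error below \<epsilon> e / 5 forces a total length below \<epsilon> / 5;
    the 5 is the dilation factor in Vitali's lemma.\<close>
  obtain \<gamma> where gauge: "gauge \<gamma>"
    and \<gamma>: "\<And>p. \<lbrakk>p tagged_partial_division_of (cbox c d); \<gamma> fine p\<rbrakk> \<Longrightarrow>
             (\<Sum>(x,k)\<in>p. norm (measure lborel k *\<^sub>R g x - integral k g)) < \<epsilon> * e / 5"
    using Henstock_lemma[of g c d "\<epsilon> * e / 5"] g eps e by (auto simp: cbox_interval)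
  have "\<forall>x\<in>E. \<exists>u v. c \<le> u \<and> u \<le> x \<and> x \<le> v \<and> v \<le> d \<and> u < v \<and> v - u < 1 \<and> {u..v} \<subseteq> \<gamma> x \<and>
     norm ((v - u) *\<^sub>R g x - integral {u..v} g) > e * (v - u)"
  proof
    fix x assume x: "x \<in> E"
    obtain \<delta> where \<delta>: "\<delta> > 0" "ball x \<delta> \<subseteq> \<gamma> x"
      using gaugeD[OF gauge, of x] openE by blast
    then obtain u v where uv: "c \<le> u" "u \<le> x" "x \<le> v" "v \<le> d" "u < v" "v - u < min 1 \<delta>"
     "norm ((v - u) *\<^sub>R g x - integral {u..v} g) > e * (v - u)"
      using x unfolding E_def by (auto dest!: spec[of _ "min 1 \<delta>"])
    then have "{u..v} \<subseteq> ball x \<delta>" by (auto simp: dist_real_def)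
    with uv \<delta> show "\<exists>u v. c \<le> u \<and> u \<le> x \<and> x \<le> v \<and> v \<le> d \<and> u < v \<and> v - u < 1 \<and> {u..v} \<subseteq> \<gamma> x \<and>
     norm ((v - u) *\<^sub>R g x - integral {u..v} g) > e * (v - u)"
      by (intro exI[of _ u] exI[of _ v]) auto
  qed
  then have "\<forall>x\<in>E. \<exists>w. c \<le> fst w \<and> fst w \<le> x \<and> x \<le> snd w \<and> snd w \<le> d \<and> fst w < snd w \<and>
     snd w - fst w < 1 \<and> {fst w..snd w} \<subseteq> \<gamma> x \<and>
     norm ((snd w - fst w) *\<^sub>R g x - integral {fst w..snd w} g) > e * (snd w - fst w)" (is "\<forall>x\<in>E. \<exists>w. ?P x w")
    by (metis (no_types, lifting) fst_conv snd_conv)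
  from bchoice[OF this] obtain w where w: "\<forall>x\<in>E. ?P x (w x)" ..
  define u v where "u = (\<lambda>x. fst (w x))" and "v = (\<lambda>x. snd (w x))"
  have uv: "\<And>x. x \<in> E \<Longrightarrow> c \<le> u x \<and> u x \<le> x \<and> x \<le> v x \<and> v x \<le> d \<and> u x < v x \<and>
     v x - u x < 1 \<and> {u x..v x} \<subseteq> \<gamma> x \<and> norm ((v x - u x) *\<^sub>R g x - integral {u x..v x} g) > e * (v x - u x)"
    using w unfolding u_def v_def by blast
  \<comment> \<open>Centres and radii, since Vitali's lemma speaks of balls; the requirement that
    the lengths be below 1 supplies the bound on the radii.\<close>
  define a r where "a = (\<lambda>x. (u x + v x) / 2)" and "r = (\<lambda>x. (v x - u x) / 2)"
  have cb: "cball (a x) (r x) = {u x..v x}" for x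
    by (auto simp: a_def r_def cball_eq_atLeastAtMost field_simps)
  have sub: "E \<subseteq> (\<Union>i\<in>E. cball (a i) (r i))"
    unfolding cb using uv by (smt (verit, ccfv_SIG) UN_iff atLeastAtMost_iff subsetI)
  have rb: "\<And>i. i \<in> E \<Longrightarrow> 0 < r i \<and> r i \<le> 1"
    using uv by (fastforce simp: r_def)
  obtain C where C: "countable C" "C \<subseteq> E"
     "pairwise (\<lambda>i j. disjnt (cball (a i) (r i)) (cball (a j) (r j))) C"
     "E \<subseteq> (\<Union>i\<in>C. cball (a i) (5 * r i))"
    by (rule Vitali_covering_lemma_cballs[OF sub rb]) blast
  let ?T = "\<Union>i\<in>C. cball (a i) (5 * r i)"
  have fin: "(\<Sum>i\<in>C'. 5 * (v i - u i)) \<le> \<epsilon>" if C': "C' \<subseteq> C" "finite C'" for C'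
  proof -
    let ?p = "(\<lambda>x. (x, {u x..v x})) ` C'"
    have CE: "C' \<subseteq> E" using C' C by auto
    have "?p tagged_partial_division_of (cbox c d)"
      unfolding tagged_partial_division_of_def
    proof (intro conjI allI impI)
      fix x K assume "(x, K) \<in> ?p"
      then show "x \<in> K" "K \<subseteq> cbox c d" "\<exists>a b. K = cbox a b"
        using uv CE by (fastforce simp: cbox_interval)+
    next
      fix x K y L assume *: "(x, K) \<in> ?p \<and> (y, L) \<in> ?p \<and> (x, K) \<noteq> (y, L)"
      then have "K = {u x..v x}" "L = {u y..v y}" "x \<in> C" "y \<in> C" "x \<noteq> y" using C'(1) by auto
      then have "disjnt K L" using C(3) unfolding cb pairwise_def by blast
      then show "interior K \<inter> interior L = {}"
        by (metis disjnt_def interior_Int interior_empty)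
    qed (use C' in auto)
    moreover have "\<gamma> fine ?p" using uv CE by (auto simp: fine_def)
    ultimately have "(\<Sum>(x,k)\<in>?p. norm (measure lborel k *\<^sub>R g x - integral k g)) < \<epsilon> * e / 5"
      by (rule \<gamma>)
    moreover have "(\<Sum>(x,k)\<in>?p. norm (measure lborel k *\<^sub>R g x - integral k g))
        = (\<Sum>x\<in>C'. norm ((v x - u x) *\<^sub>R g x - integral {u x..v x} g))"
      using uv CE by (subst sum.reindex) (force simp: inj_on_def intro!: sum.cong)+
    moreover have "(\<Sum>x\<in>C'. e * (v x - u x)) \<le> (\<Sum>x\<in>C'. norm ((v x - u x) *\<^sub>R g x - integral {u x..v x} g))"
      using uv CE by (intro sum_mono) (meson less_imp_le subsetD)
    ultimately have "e * (\<Sum>x\<in>C'. (v x - u x)) \<le> \<epsilon> * e / 5"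
      by (simp add: sum_distrib_left)
    then have "5 * (\<Sum>x\<in>C'. (v x - u x)) \<le> \<epsilon>" using e by (simp add: field_simps)
    then show ?thesis by (simp add: sum_distrib_left)
  qed
  have bound: "measure lebesgue (\<Union>i\<in>C'. cball (a i) (5 * r i)) \<le> \<epsilon>" if C': "C' \<subseteq> C" "finite C'" for C'
  proof -
    have "measure lebesgue (\<Union>i\<in>C'. cball (a i) (5 * r i)) \<le> (\<Sum>i\<in>C'. measure lebesgue (cball (a i) (5 * r i)))"
      using C'(2) by (intro measure_UNION_le) simp_all
    also have "\<dots> = (\<Sum>i\<in>C'. 5 * (v i - u i))"
    proof (intro sum.cong refl)
      fix i assume "i \<in> C'"
      then have "i \<in> E" using C' C by blast
      then have "v i > u i" using uv by blast
      then show "measure lebesgue (cball (a i) (5 * r i)) = 5 * (v i - u i)"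
        by (simp add: cball_eq_atLeastAtMost r_def field_simps)
    qed
    also have "\<dots> \<le> \<epsilon>" by (rule fin[OF C'])
    finally show "measure lebesgue (\<Union>i\<in>C'. cball (a i) (5 * r i)) \<le> \<epsilon>" .
  qed
  have "?T \<in> lmeasurable" by (rule fmeasurable_UN_bound[OF C(1) _ bound]) auto
  moreover have "measure lebesgue ?T \<le> \<epsilon>" by (rule measure_UN_bound[OF C(1) _ bound]) auto
  ultimately
  show "\<exists>T. E \<subseteq> T \<and> T \<in> lmeasurable \<and> measure lebesgue T \<le> \<epsilon>" using C(4) by blast
  qed
  then show ?thesis unfolding E_def[symmetric] by (subst negligible_outer_le) blast
qed

text \<open>Intervals with \<open>x\<close> as an endpoint are among those tested in the exceptional
  sets, so both one-sided difference quotients are controlled at once. A countable union over the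
  thresholds 1/(n+1) remains negligible.\<close>

lemma Lebesgue_differentiation:
  fixes g :: "real \<Rightarrow> 'a::euclidean_space"
  assumes g: "g integrable_on {c..d}"
  shows "AE x\<in>{c<..<d} in lebesgue. ((\<lambda>x. integral {c..x} g) has_vector_derivative g x) (at x)"
proof -
  define E where "E = (\<lambda>e. {x\<in>{c..d}. \<forall>\<delta>>0. \<exists>u v. c \<le> u \<and> u \<le> x \<and> x \<le> v \<and> v \<le> d \<and> u < v \<and> v - u < \<delta> \<and>
     norm ((v - u) *\<^sub>R g x - integral {u..v} g) > e * (v - u)})"
  have "negligible (E (inverse (Suc n)))" for n
    unfolding E_def by (intro Lebesgue_differentiation_exceptional g) auto
  then have neg: "negligible (\<Union>n. E (inverse (Suc n)))" by (intro negligible_countable_Union) auto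
  have "((\<lambda>x. integral {c..x} g) has_vector_derivative g x) (at x)"
    if x: "x \<in> {c<..<d}" "x \<notin> (\<Union>n. E (inverse (Suc n)))" for x
    unfolding has_vector_derivative_def has_derivative_at_alt
  proof (intro conjI allI impI bounded_linear_scaleR_left)
    fix e :: real assume "e > 0"
    then obtain n where n: "inverse (Suc n) < e" using reals_Archimedean by blast
    have "x \<notin> E (inverse (Suc n))" using x by auto
    then obtain \<delta> where \<delta>: "\<delta> > 0" "\<And>u v. c \<le> u \<Longrightarrow> u \<le> x \<Longrightarrow> x \<le> v \<Longrightarrow> v \<le> d \<Longrightarrow> u < v \<Longrightarrow> v - u < \<delta> \<Longrightarrow>
       norm ((v - u) *\<^sub>R g x - integral {u..v} g) \<le> inverse (Suc n) * (v - u)"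
      using x unfolding E_def by (simp add: not_less) (metis linorder_not_le)
    show "\<exists>\<delta>>0. \<forall>y. norm (y - x) < \<delta> \<longrightarrow> norm (integral {c..y} g - integral {c..x} g - (y - x) *\<^sub>R g x) \<le> e * norm (y - x)"
    proof (intro exI[of _ "min \<delta> (min (x - c) (d - x))"] conjI allI impI)
      fix y assume y: "norm (y - x) < min \<delta> (min (x - c) (d - x))"
      have ig: "g integrable_on {c..z}" if "z \<le> d" for z
        by (rule integrable_subinterval_real[OF g]) (use that in auto)
      consider "y = x" | "x < y" | "y < x" by linarith
      then show "norm (integral {c..y} g - integral {c..x} g - (y - x) *\<^sub>R g x) \<le> e * norm (y - x)"
      proof cases
        case 2
        have "integral {c..x} g + integral {x..y} g = integral {c..y} g"
          using 2 y x by (intro integral_combine_Icc ig) auto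
        then have "norm (integral {c..y} g - integral {c..x} g - (y - x) *\<^sub>R g x) = norm ((y - x) *\<^sub>R g x - integral {x..y} g)"
          by (metis add_diff_cancel_left' norm_minus_commute)
        also have "\<dots> \<le> inverse (Suc n) * (y - x)" using 2 y x by (intro \<delta>(2)) auto
        also have "\<dots> \<le> e * norm (y - x)" using n 2 by (intro mult_mono) (auto simp: less_imp_le \<open>e > 0\<close>)
        finally show ?thesis .
      next
        case 3
        have "integral {c..y} g + integral {y..x} g = integral {c..x} g"
          using 3 y x by (intro integral_combine_Icc ig) auto
        then have "integral {c..y} g - integral {c..x} g - (y - x) *\<^sub>R g x = (x - y) *\<^sub>R g x - integral {y..x} g"
          by (simp add: algebra_simps)
        then have "norm (integral {c..y} g - integral {c..x} g - (y - x) *\<^sub>R g x) = norm ((x - y) *\<^sub>R g x - integral {y..x} g)"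
          by simp
        also have "\<dots> \<le> inverse (Suc n) * (x - y)" using 3 y x by (intro \<delta>(2)) auto
        also have "\<dots> \<le> e * norm (y - x)" using n 3 by (intro mult_mono) (auto simp: less_imp_le \<open>e > 0\<close>)
        finally show ?thesis .
      qed simp
    qed (use x \<delta> in auto)
  qed
  then show ?thesis unfolding AE_lebesgue_negligible
    by (intro negligible_subset[OF neg]) auto
qed

subsection \<open>Indefinite integrals are absolutely continuous\<close>

text \<open>Truncation: choose \<open>n\<close> such that the integral of |g| - min(|g|, n) is below
  e/2. On a set of measure below e/(2(n+1)) the truncated part contributes at most e/2.\<close>

lemma absolutely_integrable_small_sets:
  fixes g :: "real \<Rightarrow> 'a::euclidean_space"
  assumes g: "g absolutely_integrable_on T" and e: "e > 0"
  obtains \<delta> where "\<delta> > 0" "\<And>S. S \<in> lmeasurable \<Longrightarrow> S \<subseteq> T \<Longrightarrow> measure lebesgue S < \<delta> \<Longrightarrow>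
    integral S (\<lambda>x. norm (g x)) < e"
proof -
  let ?f = "\<lambda>x. indicat_real T x * norm (g x)"
  have int: "integrable lebesgue ?f"
    using set_integrable_norm[OF g] by (simp add: set_integrable_def)
  have meas[measurable]: "?f \<in> borel_measurable lebesgue" using int by auto
  have "(\<lambda>n. LINT x|lebesgue. min (?f x) (real n)) \<longlonglongrightarrow> (LINT x|lebesgue. ?f x)"
  proof (rule integral_dominated_convergence[where w="?f"])
    show "AE x in lebesgue. (\<lambda>n. min (?f x) (real n)) \<longlonglongrightarrow> ?f x"
    proof (rule AE_I2)
      fix x
      obtain N where "?f x \<le> real N" using real_arch_simple by blast
      then have "\<forall>\<^sub>F n in sequentially. min (?f x) (real n) = ?f x"
        by (intro eventually_sequentiallyI[of N]) auto
      then show "(\<lambda>n. min (?f x) (real n)) \<longlonglongrightarrow> ?f x" by (rule tendsto_eventually)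
    qed
  qed (use int in auto)
  then have "\<forall>\<^sub>F n in sequentially. (LINT x|lebesgue. ?f x) - e / 2 < (LINT x|lebesgue. min (?f x) (real n))"
    using e by (intro order_tendstoD) auto
  then obtain n where n: "(LINT x|lebesgue. ?f x) - e / 2 < (LINT x|lebesgue. min (?f x) (real n))"
    using eventually_happens'[OF sequentially_bot] by blast
  have intm: "integrable lebesgue (\<lambda>x. min (?f x) (real n))"
    by (rule Bochner_Integration.integrable_bound[OF int]) auto
  show ?thesis
  proof (rule that[of "e / (2 * (real n + 1))"])
    fix S assume S: "S \<in> lmeasurable" "S \<subseteq> T" "measure lebesgue S < e / (2 * (real n + 1))"
    have gS: "(\<lambda>x. norm (g x)) absolutely_integrable_on S"
      by (rule set_integrable_subset[OF set_integrable_norm[OF g]]) (use S in auto)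
    have iS: "integrable lebesgue (\<lambda>x. indicat_real S x * ?f x)"
      using integrable_mult_indicator[OF _ int, of S] S(1) by (simp add: fmeasurable_def)
    have "integral S (\<lambda>x. norm (g x)) = (LINT x|lebesgue. indicat_real S x * ?f x)"
      using S(2) unfolding set_lebesgue_integral_eq_integral(2)[OF gS, symmetric] set_lebesgue_integral_def
      by (intro Bochner_Integration.integral_cong) (auto simp: indicator_def)
    also have "\<dots> \<le> (LINT x|lebesgue. (?f x - min (?f x) (real n)) + real n * indicat_real S x)"
      using S(1) by (intro integral_mono iS Bochner_Integration.integrable_add Bochner_Integration.integrable_diff int intm)
        (auto simp: split: split_indicator intro!: integrable_mult_right integrable_real_indicator simp: fmeasurable_def)
    also have "\<dots> = (LINT x|lebesgue. ?f x) - (LINT x|lebesgue. min (?f x) (real n)) + real n * measure lebesgue S"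
      using S(1) int intm by (subst Bochner_Integration.integral_add) (auto simp: fmeasurable_def)
    also have "\<dots> < e / 2 + real n * measure lebesgue S" using n by simp
    also have "\<dots> \<le> e / 2 + (real n + 1) * (e / (2 * (real n + 1)))"
      using S(3) by (intro add_left_mono mult_mono) auto
    also have "\<dots> = e" by (simp add: field_simps)
    finally show "integral S (\<lambda>x. norm (g x)) < e" .
  qed (use e in auto)
qed

lemma division_Icc:
  assumes "\<D> division_of S" "K \<in> \<D>"
  shows "K = {Inf K..Sup K}" "Inf K \<le> (Sup K :: real)" "measure lborel K = Sup K - Inf K"
proof -
  obtain a b where "K = cbox a b" "K \<noteq> {}" using division_ofD(3,4)[OF assms] by metis
  then show "K = {Inf K..Sup K}" "Inf K \<le> Sup K" "measure lborel K = Sup K - Inf K" by auto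
qed

lemma abs_cont_indefinite_integral:
  fixes g :: "real \<Rightarrow> 'a::euclidean_space"
  assumes g: "g absolutely_integrable_on {c..d}"
    and f: "\<And>x y. c \<le> x \<Longrightarrow> x \<le> y \<Longrightarrow> y \<le> d \<Longrightarrow> f y - f x = integral {x..y} g"
  shows "abs_cont_on_Icc c d f"
  unfolding abs_cont_on_Icc_def
proof (intro allI impI)
  fix \<epsilon> :: real assume "\<epsilon> > 0"
  then obtain \<delta> where \<delta>: "\<delta> > 0" "\<And>S. S \<in> lmeasurable \<Longrightarrow> S \<subseteq> {c..d} \<Longrightarrow> measure lebesgue S < \<delta> \<Longrightarrow>
    integral S (\<lambda>x. norm (g x)) < \<epsilon>"
    using absolutely_integrable_small_sets[OF g] by metis
  show "\<exists>\<delta>>0. \<forall>\<D>. \<D> division_of \<Union>\<D> \<and> \<Union>\<D> \<subseteq> {c..d} \<and> (\<Sum>K\<in>\<D>. Sup K - Inf K) < \<delta>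
        \<longrightarrow> (\<Sum>K\<in>\<D>. norm (f (Sup K) - f (Inf K))) < \<epsilon>"
  proof (intro exI[of _ \<delta>] conjI allI impI \<delta>(1))
    fix \<D> assume D: "\<D> division_of \<Union>\<D> \<and> \<Union>\<D> \<subseteq> {c..d} \<and> (\<Sum>K\<in>\<D>. Sup K - Inf K) < \<delta>"
    then have div: "\<D> division_of \<Union>\<D>" by simp
    note dI = division_Icc[OF div]
    have sub: "K \<subseteq> {c..d}" if "K \<in> \<D>" for K using that D by auto
    have ng: "(\<lambda>x. norm (g x)) absolutely_integrable_on {c..d}" by (rule set_integrable_norm[OF g])
    have gK: "g absolutely_integrable_on K" if "K \<in> \<D>" for K
      by (rule set_integrable_subset[OF g]) (use that sub dI(1)[OF that] in \<open>auto, metis lmeasurable_interval(1) fmeasurableD\<close>)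
    have "(\<Sum>K\<in>\<D>. norm (f (Sup K) - f (Inf K))) \<le> (\<Sum>K\<in>\<D>. integral K (\<lambda>x. norm (g x)))"
    proof (rule sum_mono)
      fix K assume K: "K \<in> \<D>"
      have "Inf K \<in> {c..d}" "Sup K \<in> {c..d}" using sub[OF K] dI(1,2)[OF K] by (metis atLeastAtMost_iff order_refl subsetD)+
      then have "f (Sup K) - f (Inf K) = integral K g"
        using f[of "Inf K" "Sup K"] dI[OF K] by auto
      also have "norm (integral K g) \<le> integral K (\<lambda>x. norm (g x))"
        using gK[OF K] by (intro integral_norm_bound_integral) (auto simp: absolutely_integrable_on_def)
      finally show "norm (f (Sup K) - f (Inf K)) \<le> integral K (\<lambda>x. norm (g x))" by simp
    qed
    also have "\<dots> = integral (\<Union>\<D>) (\<lambda>x. norm (g x))"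
      using D by (intro integral_unique[symmetric] has_integral_combine_division_topdown[OF _ div]) (use ng in \<open>auto simp: absolutely_integrable_on_def\<close>)
    also have "\<dots> < \<epsilon>"
    proof (rule \<delta>(2))
      have fm: "\<And>K. K \<in> \<D> \<Longrightarrow> K \<in> lmeasurable" using dI(1) by (metis lmeasurable_interval(1))
      have finD: "finite \<D>" using div by auto
      then show "\<Union>\<D> \<in> lmeasurable" using fm by (auto intro: fmeasurable.finite_Union)
      have "measure lebesgue (\<Union>\<D>) \<le> (\<Sum>K\<in>\<D>. measure lebesgue K)"
        using measure_Union_le[OF finD, of lebesgue] fm by auto
      also have "\<dots> = (\<Sum>K\<in>\<D>. Sup K - Inf K)" proof (intro sum.cong refl)
        fix K assume K: "K \<in> \<D>"
        have "measure lebesgue {Inf K..Sup K} = Sup K - Inf K" using dI(2)[OF K] by simp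
        then show "measure lebesgue K = Sup K - Inf K" using dI(1)[OF K] by simp
      qed
      finally show "measure lebesgue (\<Union>\<D>) < \<delta>" using D by simp
    qed (use D in auto)
    finally show "(\<Sum>K\<in>\<D>. norm (f (Sup K) - f (Inf K))) < \<epsilon>" .
  qed
qed

lemma division_IccE:
  assumes "\<D> division_of S" "K \<in> \<D>"
  obtains k l where "K = {k..l}" "k \<le> (l::real)"
  by (rule that[OF division_Icc(1,2)[OF assms]])

lemma abs_cont_on_IccE:
  assumes "abs_cont_on_Icc c d f" "\<epsilon> > 0"
  obtains \<delta> where "\<delta> > 0" "\<And>\<D>. \<D> division_of \<Union>\<D> \<Longrightarrow> \<Union>\<D> \<subseteq> {c..d} \<Longrightarrow> (\<Sum>K\<in>\<D>. Sup K - Inf K) < \<delta>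
        \<Longrightarrow> (\<Sum>K\<in>\<D>. norm (f (Sup K) - f (Inf K))) < \<epsilon>"
proof -
  obtain \<delta> where "\<delta> > 0" and \<delta>: "\<forall>\<D>. \<D> division_of \<Union>\<D> \<and> \<Union>\<D> \<subseteq> {c..d} \<and> (\<Sum>K\<in>\<D>. Sup K - Inf K) < \<delta>
        \<longrightarrow> (\<Sum>K\<in>\<D>. norm (f (Sup K) - f (Inf K))) < \<epsilon>"
    using assms(1)[unfolded abs_cont_on_Icc_def, rule_format, OF assms(2)] by auto
  show ?thesis by (rule that[OF \<open>\<delta> > 0\<close>]) (rule \<delta>[rule_format], simp)
qed

subsection \<open>Total variation\<close>

definition subdivisions :: "real \<Rightarrow> real \<Rightarrow> real set set set" where
  "subdivisions c d = {\<D>. \<D> division_of \<Union>\<D> \<and> \<Union>\<D> \<subseteq> {c..d}}"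

definition variation_sum :: "(real \<Rightarrow> real) \<Rightarrow> real set set \<Rightarrow> real" where
  "variation_sum f \<D> = (\<Sum>K\<in>\<D>. \<bar>f (Sup K) - f (Inf K)\<bar>)"

definition total_variation :: "(real \<Rightarrow> real) \<Rightarrow> real \<Rightarrow> real \<Rightarrow> real" where
  "total_variation f c d = Sup (variation_sum f ` subdivisions c d)"

lemma empty_subdivisions: "{} \<in> subdivisions c d"
  by (simp add: subdivisions_def)

lemma subdivisions_mono: "c \<le> x \<Longrightarrow> y \<le> d \<Longrightarrow> subdivisions x y \<subseteq> subdivisions c d"
proof -
  assume "c \<le> x" "y \<le> d"
  then have "{x..y} \<subseteq> {c..d}" by simp
  then show ?thesis unfolding subdivisions_def by blast
qed

text \<open>The interior of the common part would lie in two disjoint interiors. This disposes of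
  degenerate cells, the only ones that can occur twice when cells are clipped or collected from
  several divisions.\<close>

lemma division_same_interval:
  assumes "\<D> division_of S" "K \<in> \<D>" "L \<in> \<D>" "K \<noteq> L" "M \<subseteq> K" "M \<subseteq> L" "M = {u..v}" "u \<le> (v::real)"
  shows "u = v"
proof -
  have "interior M \<subseteq> interior K \<inter> interior L" using assms(5,6) interior_mono by blast
  also have "\<dots> = {}" using division_ofD(5)[OF assms(1-4)] .
  finally have "{u<..<v} = {}" using assms(7) by simp
  then show ?thesis using assms(8) by simp
qed

lemma total_variation_upper:
  assumes "\<And>\<D>. \<D> \<in> subdivisions c d \<Longrightarrow> variation_sum f \<D> \<le> B"
    and "c \<le> x" "y \<le> d" "\<D> \<in> subdivisions x y"
  shows "variation_sum f \<D> \<le> total_variation f x y"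
proof -
  have "bdd_above (variation_sum f ` subdivisions x y)"
    using assms(1) subdivisions_mono[OF assms(2,3)] by (intro bdd_aboveI2[of _ _ B]) blast
  then show ?thesis unfolding total_variation_def using assms(4) by (intro cSup_upper imageI)
qed

lemma total_variation_least:
  assumes "\<And>\<D>. \<D> \<in> subdivisions x y \<Longrightarrow> variation_sum f \<D> \<le> B"
  shows "total_variation f x y \<le> B"
  unfolding total_variation_def
proof (rule cSup_least)
  show "variation_sum f ` subdivisions x y \<noteq> {}" using empty_subdivisions[of x y] by blast
qed (use assms in auto)

text \<open>A subdivision of {c..x} can be extended by the single cell {x..y}. Consequently both the
  variation function and its difference with \<open>f\<close> are nondecreasing in the right
  endpoint.\<close>

lemma total_variation_superadditive:
  assumes B: "\<And>\<D>. \<D> \<in> subdivisions c d \<Longrightarrow> variation_sum f \<D> \<le> B"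
    and xy: "c \<le> x" "x \<le> y" "y \<le> d"
  shows "total_variation f c x + \<bar>f y - f x\<bar> \<le> total_variation f c y"
proof (cases "x = y")
  case False
  with xy have "x < y" by simp
  have "total_variation f c x \<le> total_variation f c y - \<bar>f y - f x\<bar>"
  proof (rule total_variation_least)
    fix \<D> assume D: "\<D> \<in> subdivisions c x"
    then have div: "\<D> division_of \<Union>\<D>" and sub: "\<Union>\<D> \<subseteq> {c..x}" by (auto simp: subdivisions_def)
    have nin: "{x..y} \<notin> \<D>" using sub \<open>x < y\<close> by (meson Sup_upper atLeastAtMost_iff less_imp_le not_less order_refl subsetD)
    have "insert {x..y} \<D> division_of \<Union>(insert {x..y} \<D>)"
    proof (rule division_ofI)
      show "finite (insert {x..y} \<D>)" using div by auto
      fix K assume K: "K \<in> insert {x..y} \<D>"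
      then show "K \<subseteq> \<Union>(insert {x..y} \<D>)" "K \<noteq> {}" "\<exists>a b. K = cbox a b"
        using \<open>x < y\<close> division_ofD(3,4)[OF div] box_real(2)[of x y] by (auto simp del: box_real) metis
      fix L assume L: "L \<in> insert {x..y} \<D>" and "K \<noteq> L"
      have *: "interior {x..y} \<inter> interior M = {}" if "M \<in> \<D>" for M
      proof -
        have "interior M \<subseteq> interior {c..x}" using sub that by (intro interior_mono) auto
        then show ?thesis by auto
      qed
      show "interior K \<inter> interior L = {}"
        using K L \<open>K \<noteq> L\<close> * division_ofD(5)[OF div] by (metis inf_commute insert_iff)
    qed auto
    moreover have "\<Union>(insert {x..y} \<D>) \<subseteq> {c..y}" using sub xy by auto
    ultimately have "insert {x..y} \<D> \<in> subdivisions c y" by (auto simp: subdivisions_def)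
    then have "variation_sum f (insert {x..y} \<D>) \<le> total_variation f c y"
      using xy by (intro total_variation_upper[where c=c and d=d and B=B, OF B]) auto
    moreover have "variation_sum f (insert {x..y} \<D>) = \<bar>f y - f x\<bar> + variation_sum f \<D>"
      using nin div \<open>x < y\<close> by (simp add: variation_sum_def division_of_def)
    ultimately show "variation_sum f \<D> \<le> total_variation f c y - \<bar>f y - f x\<bar>" by simp
  qed
  then show ?thesis by simp
qed simp

text \<open>The cells are clipped to {x..y}. Two of them can be clipped to the same set only if it
  is a point, which contributes 0, so the sum over the clipped family can be indexed by the original
  cells.\<close>

lemma variation_sum_restrict:
  assumes D: "\<D> \<in> subdivisions c d" and xy: "x \<le> y"
  obtains \<D>' where "\<D>' \<in> subdivisions x y"
    "variation_sum f \<D>' = (\<Sum>K\<in>{K\<in>\<D>. K \<inter> {x..y} \<noteq> {}}. \<bar>f (min (Sup K) y) - f (max (Inf K) x)\<bar>)"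
proof -
  have div: "\<D> division_of \<Union>\<D>" using D by (auto simp: subdivisions_def)
  let ?A = "{K\<in>\<D>. K \<inter> {x..y} \<noteq> {}}"
  let ?E = "(\<lambda>K. K \<inter> {x..y}) ` ?A"
  have finA: "finite ?A" using div by auto
  have KI: "K \<inter> {x..y} = {max (Inf K) x..min (Sup K) y}" "max (Inf K) x \<le> min (Sup K) y" if "K \<in> ?A" for K
  proof -
    have "K \<in> \<D>" using that by simp
    then obtain k l where kl: "K = {k..l}" "k \<le> l" by (rule division_IccE[OF div])
    show "K \<inter> {x..y} = {max (Inf K) x..min (Sup K) y}" using kl by simp
    show "max (Inf K) x \<le> min (Sup K) y" using kl that by auto
  qed
  have "?E division_of \<Union>?E"
  proof (rule division_ofI)
    fix M assume "M \<in> ?E"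
    then obtain K where K: "K \<in> ?A" "M = K \<inter> {x..y}" by auto
    show "M \<noteq> {}" unfolding K(2) KI(1)[OF K(1)] using KI(2)[OF K(1)] by simp
    show "\<exists>a b. M = cbox a b" unfolding K(2) KI(1)[OF K(1)] by (metis box_real(2))
    fix N assume "N \<in> ?E" "M \<noteq> N"
    then obtain L where L: "L \<in> ?A" "N = L \<inter> {x..y}" by auto
    have "interior K \<inter> interior L = {}" using division_ofD(5)[OF div, of K L] K L \<open>M \<noteq> N\<close> by auto
    then show "interior M \<inter> interior N = {}" using K L by auto
  qed (use finA in auto)
  then have "?E \<in> subdivisions x y" by (auto simp: subdivisions_def)
  moreover have "variation_sum f ?E = (\<Sum>K\<in>?A. \<bar>f (Sup (K \<inter> {x..y})) - f (Inf (K \<inter> {x..y}))\<bar>)"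
    unfolding variation_sum_def
  proof (subst sum.reindex_nontrivial[OF finA])
    fix K L assume KL: "K \<in> ?A" "L \<in> ?A" "K \<noteq> L" "K \<inter> {x..y} = L \<inter> {x..y}"
    have "max (Inf K) x = min (Sup K) y"
      by (rule division_same_interval[OF div, of K L "K \<inter> {x..y}"]) (use KL KI[of K] in auto)
    then show "\<bar>f (Sup (K \<inter> {x..y})) - f (Inf (K \<inter> {x..y}))\<bar> = 0" using KI[OF KL(1)] by simp
  qed (simp add: o_def)
  moreover have "\<dots> = (\<Sum>K\<in>?A. \<bar>f (min (Sup K) y) - f (max (Inf K) x)\<bar>)"
  proof (intro sum.cong refl)
    fix K assume "K \<in> ?A"
    note KI[OF this]
    then show "\<bar>f (Sup (K \<inter> {x..y})) - f (Inf (K \<inter> {x..y}))\<bar> = \<bar>f (min (Sup K) y) - f (max (Inf K) x)\<bar>" by simp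
  qed
  ultimately show ?thesis using that by metis
qed

text \<open>A cell that straddles \<open>x\<close> is cut there; the triangle inequality bounds its
  increment by those of the two clipped pieces.\<close>

lemma total_variation_subadditive:
  assumes B: "\<And>\<D>. \<D> \<in> subdivisions c d \<Longrightarrow> variation_sum f \<D> \<le> B"
    and xy: "c \<le> x" "x \<le> y" "y \<le> d"
  shows "total_variation f c y \<le> total_variation f c x + total_variation f x y"
proof (rule total_variation_least)
  fix \<D> assume D: "\<D> \<in> subdivisions c y"
  then have div: "\<D> division_of \<Union>\<D>" and sub: "\<Union>\<D> \<subseteq> {c..y}" by (auto simp: subdivisions_def)
  obtain D1 where D1: "D1 \<in> subdivisions c x"
    "variation_sum f D1 = (\<Sum>K\<in>{K\<in>\<D>. K \<inter> {c..x} \<noteq> {}}. \<bar>f (min (Sup K) x) - f (max (Inf K) c)\<bar>)"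
    by (rule variation_sum_restrict[OF D xy(1), of f])
  obtain D2 where D2: "D2 \<in> subdivisions x y"
    "variation_sum f D2 = (\<Sum>K\<in>{K\<in>\<D>. K \<inter> {x..y} \<noteq> {}}. \<bar>f (min (Sup K) y) - f (max (Inf K) x)\<bar>)"
    by (rule variation_sum_restrict[OF D xy(2), of f])
  have fin: "finite \<D>" using div by auto
  have "variation_sum f \<D> \<le> (\<Sum>K\<in>\<D>. (if K \<inter> {c..x} \<noteq> {} then \<bar>f (min (Sup K) x) - f (max (Inf K) c)\<bar> else 0)
      + (if K \<inter> {x..y} \<noteq> {} then \<bar>f (min (Sup K) y) - f (max (Inf K) x)\<bar> else 0))"
    unfolding variation_sum_def
  proof (rule sum_mono)
    fix K assume K: "K \<in> \<D>"
    obtain k l where kl: "K = {k..l}" "k \<le> l" by (rule division_IccE[OF div K])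
    have "{k..l} \<subseteq> {c..y}" using kl K sub by blast
    then have "c \<le> k" "l \<le> y" using kl by auto
    then show "\<bar>f (Sup K) - f (Inf K)\<bar> \<le> (if K \<inter> {c..x} \<noteq> {} then \<bar>f (min (Sup K) x) - f (max (Inf K) c)\<bar> else 0)
      + (if K \<inter> {x..y} \<noteq> {} then \<bar>f (min (Sup K) y) - f (max (Inf K) x)\<bar> else 0)"
      using kl by (auto simp: min_def max_def)
  qed
  also have "\<dots> = variation_sum f D1 + variation_sum f D2"
    unfolding D1(2) D2(2) sum.distrib using fin by (simp add: sum.inter_filter)
  also have "\<dots> \<le> total_variation f c x + total_variation f x y"
  proof (rule add_mono)
    show "variation_sum f D1 \<le> total_variation f c x"
      by (rule total_variation_upper[where c=c and d=d and B=B, OF B _ _ D1(1)]) (use xy in auto)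
    show "variation_sum f D2 \<le> total_variation f x y"
      by (rule total_variation_upper[where c=c and d=d and B=B, OF B _ _ D2(1)]) (use xy in auto)
  qed
  finally show "variation_sum f \<D> \<le> total_variation f c x + total_variation f x y" .
qed

lemma sum_length_subdivision:
  assumes "\<D> \<in> subdivisions x y" "x \<le> y"
  shows "(\<Sum>K\<in>\<D>. Sup K - Inf K) \<le> y - x"
proof -
  have div: "\<D> division_of \<Union>\<D>" and sub: "\<Union>\<D> \<subseteq> {x..y}" using assms by (auto simp: subdivisions_def)
  have "((\<lambda>_. 1::real) has_integral (\<Sum>K\<in>\<D>. Sup K - Inf K)) (\<Union>\<D>)"
  proof (rule has_integral_combine_division[OF div])
    fix K assume K: "K \<in> \<D>"
    show "((\<lambda>_. 1::real) has_integral Sup K - Inf K) K"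
      using has_integral_const_real[of "1::real" "Inf K" "Sup K"] division_Icc[OF div K] by simp
  qed
  moreover have "((\<lambda>_. 1::real) has_integral (y - x)) {x..y}"
    using has_integral_const_real[of "1::real" x y] assms(2) by simp
  ultimately show ?thesis by (rule has_integral_subset_le[OF sub]) auto
qed

text \<open>In each cell of a short family take a subdivision that nearly attains the variation of
  that cell. Together they form a family of no larger total length, so the \<delta> that
  \<open>f\<close> has for \<epsilon>/2 serves for the variation function and \<epsilon>.\<close>

lemma abs_cont_total_variation:
  assumes ac: "abs_cont_on_Icc c d f"
    and B: "\<And>\<D>. \<D> \<in> subdivisions c d \<Longrightarrow> variation_sum f \<D> \<le> B"
  shows "abs_cont_on_Icc c d (total_variation f c)"
  unfolding abs_cont_on_Icc_def
proof (intro allI impI)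
  fix \<epsilon> :: real assume eps: "\<epsilon> > 0"
  obtain \<delta> where \<delta>: "\<delta> > 0" "\<And>\<D>. \<D> division_of \<Union>\<D> \<Longrightarrow> \<Union>\<D> \<subseteq> {c..d} \<Longrightarrow> (\<Sum>K\<in>\<D>. Sup K - Inf K) < \<delta>
        \<Longrightarrow> (\<Sum>K\<in>\<D>. norm (f (Sup K) - f (Inf K))) < \<epsilon> / 2"
    by (rule abs_cont_on_IccE[OF ac half_gt_zero[OF eps]]) blast
  show "\<exists>\<delta>>0. \<forall>\<D>. \<D> division_of \<Union>\<D> \<and> \<Union>\<D> \<subseteq> {c..d} \<and> (\<Sum>K\<in>\<D>. Sup K - Inf K) < \<delta>
        \<longrightarrow> (\<Sum>K\<in>\<D>. norm (total_variation f c (Sup K) - total_variation f c (Inf K))) < \<epsilon>"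
  proof (intro exI[of _ \<delta>] conjI allI impI \<delta>(1))
    fix \<D> assume D: "\<D> division_of \<Union>\<D> \<and> \<Union>\<D> \<subseteq> {c..d} \<and> (\<Sum>K\<in>\<D>. Sup K - Inf K) < \<delta>"
    then have div: "\<D> division_of \<Union>\<D>" by simp
    have fin: "finite \<D>" using div by auto
    note dI = division_Icc[OF div]
    have KS: "c \<le> Inf K" "Sup K \<le> d" if K: "K \<in> \<D>" for K
    proof -
      obtain k l where kl: "K = {k..l}" "k \<le> l" by (rule division_IccE[OF div K])
      have "{k..l} \<subseteq> {c..d}" using D K kl by blast
      then show "c \<le> Inf K" "Sup K \<le> d" using kl by auto
    qed
    \<comment> \<open>One error \<eta> per cell stays below \<epsilon>/2 in total; the + 1 makes
      this strict and keeps the quotient meaningful for the empty family.\<close>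
    define \<eta> where "\<eta> = \<epsilon> / (2 * (real (card \<D>) + 1))"
    have \<eta>: "\<eta> > 0" using eps by (simp add: \<eta>_def)
    have "\<exists>E. E \<in> subdivisions (Inf K) (Sup K) \<and> total_variation f (Inf K) (Sup K) - \<eta> < variation_sum f E" for K
    proof (rule ccontr)
      assume "\<not> ?thesis"
      then have "total_variation f (Inf K) (Sup K) \<le> total_variation f (Inf K) (Sup K) - \<eta>"
        by (intro total_variation_least) (auto simp: not_less)
      then show False using \<eta> by simp
    qed
    then obtain E where E: "\<And>K. E K \<in> subdivisions (Inf K) (Sup K)"
      "\<And>K. total_variation f (Inf K) (Sup K) - \<eta> < variation_sum f (E K)" by metis
    have Ediv: "E K division_of \<Union>(E K)" "\<Union>(E K) \<subseteq> {Inf K..Sup K}" for K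
      using E(1)[of K] by (auto simp: subdivisions_def)
    have EK: "L \<subseteq> K" if "L \<in> E K" "K \<in> \<D>" for L K
      using Ediv(2)[of K] that dI(1)[OF that(2)] by blast
    have finE: "finite (E K)" for K using Ediv(1)[of K] by auto
    let ?U = "\<Union>(E ` \<D>)"
    have U: "?U = snd ` (SIGMA K:\<D>. E K)" by force
    have divU: "?U division_of \<Union>?U"
    proof (rule division_ofI)
      show "finite ?U" using fin finE by auto
      fix L assume "L \<in> ?U"
      then obtain K where K: "K \<in> \<D>" "L \<in> E K" by auto
      then show "L \<noteq> {}" "\<exists>a b. L = cbox a b" using division_ofD(3,4)[OF Ediv(1)] by metis+
      fix L' assume "L' \<in> ?U" and ne: "L \<noteq> L'"
      then obtain K' where K': "K' \<in> \<D>" "L' \<in> E K'" by auto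
      show "interior L \<inter> interior L' = {}"
      proof (cases "K = K'")
        case True
        then show ?thesis using division_ofD(5)[OF Ediv(1)] K K' ne by metis
      next
        case False
        then have "interior K \<inter> interior K' = {}" using division_ofD(5)[OF div] K K' by blast
        then show ?thesis using interior_mono[OF EK[OF K(2,1)]] interior_mono[OF EK[OF K'(2,1)]] by blast
      qed
    qed auto
    \<comment> \<open>Only a degenerate cell can belong to several \<open>E K\<close>, so the double
      sum counts correctly every function that vanishes on degenerate cells.\<close>
    have reindex: "(\<Sum>L\<in>?U. g L) = (\<Sum>K\<in>\<D>. \<Sum>L\<in>E K. g L)"
      if g: "\<And>L. Sup L = Inf L \<Longrightarrow> g L = 0" for g :: "real set \<Rightarrow> real"
    proof -
      have "(\<Sum>L\<in>?U. g L) = (\<Sum>p\<in>(SIGMA K:\<D>. E K). g (snd p))"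
        unfolding U
      proof (subst sum.reindex_nontrivial)
        show "finite (SIGMA K:\<D>. E K)" using fin finE by auto
        fix p p' assume p: "p \<in> (SIGMA K:\<D>. E K)" "p' \<in> (SIGMA K:\<D>. E K)" "p \<noteq> p'" "snd p = snd p'"
        obtain K L K' where KL: "p = (K, L)" "p' = (K', L)" using p(4) by (metis prod.collapse)
        have "K \<noteq> K'" using KL p(3) by auto
        note LI = division_Icc[OF Ediv(1)[of K], of L]
        have "Inf L = Sup L"
          by (rule division_same_interval[OF div, of K K' L]) (use KL p EK LI \<open>K \<noteq> K'\<close> in auto)
        then show "g (snd p) = 0" using g KL by simp
      qed (simp add: o_def)
      also have "\<dots> = (\<Sum>K\<in>\<D>. \<Sum>L\<in>E K. g L)"
        using fin finE by (subst sum.Sigma) (auto simp: split_beta)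
      finally show ?thesis .
    qed
    have "(\<Sum>L\<in>?U. Sup L - Inf L) = (\<Sum>K\<in>\<D>. \<Sum>L\<in>E K. Sup L - Inf L)" by (rule reindex) auto
    also have "\<dots> \<le> (\<Sum>K\<in>\<D>. Sup K - Inf K)"
      using dI(2) by (intro sum_mono sum_length_subdivision E)
    also have "\<dots> < \<delta>" using D by simp
    finally have "(\<Sum>L\<in>?U. norm (f (Sup L) - f (Inf L))) < \<epsilon> / 2"
      using EK D by (intro \<delta>(2)[OF divU]) blast+
    moreover have "(\<Sum>L\<in>?U. norm (f (Sup L) - f (Inf L))) = (\<Sum>K\<in>\<D>. variation_sum f (E K))"
      unfolding variation_sum_def by (subst reindex) auto
    ultimately have 1: "(\<Sum>K\<in>\<D>. variation_sum f (E K)) < \<epsilon> / 2" by simp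
    have "(\<Sum>K\<in>\<D>. norm (total_variation f c (Sup K) - total_variation f c (Inf K))) \<le> (\<Sum>K\<in>\<D>. variation_sum f (E K) + \<eta>)"
    proof (rule sum_mono)
      fix K assume K: "K \<in> \<D>"
      have "total_variation f c (Inf K) \<le> total_variation f c (Sup K)"
        using total_variation_superadditive[where c=c and d=d and B=B, OF B KS(1)[OF K] dI(2)[OF K] KS(2)[OF K]] by auto
      moreover have "total_variation f c (Sup K) \<le> total_variation f c (Inf K) + total_variation f (Inf K) (Sup K)"
        by (rule total_variation_subadditive[where c=c and d=d and B=B, OF B KS(1)[OF K] dI(2)[OF K] KS(2)[OF K]])
      ultimately show "norm (total_variation f c (Sup K) - total_variation f c (Inf K)) \<le> variation_sum f (E K) + \<eta>"
        using E(2)[of K] by auto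
    qed
    also have "\<dots> = (\<Sum>K\<in>\<D>. variation_sum f (E K)) + card \<D> * \<eta>" by (simp add: sum.distrib)
    also have "\<dots> < \<epsilon> / 2 + \<epsilon> / 2"
    proof (intro add_strict_mono 1)
      have "card \<D> * \<eta> < (real (card \<D>) + 1) * \<eta>" using \<eta> by simp
      also have "\<dots> = \<epsilon> / 2" by (simp add: \<eta>_def field_simps)
      finally show "card \<D> * \<eta> < \<epsilon> / 2" .
    qed
    finally show "(\<Sum>K\<in>\<D>. norm (total_variation f c (Sup K) - total_variation f c (Inf K))) < \<epsilon>" by simp
  qed
qed

subsection \<open>Absolutely continuous functions are indefinite integrals\<close>

text \<open>A Lebesgue null set inside (c,d) lies in an open set of Lebesgue measure below \<delta>.
  Over finitely many nonoverlapping intervals in that open set the increments of \<open>F\<close>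
  sum to less than \<epsilon>, and exhaustion by countably many boxes carries the bound to the
  Stieltjes measure of the whole open set. Outside (c,d) the function is constant and the measure
  vanishes.\<close>

lemma absolutely_continuous_interval_measure:
  assumes mono: "mono F" and ac: "abs_cont_on_Icc c d F" and cd: "c \<le> d"
    and out: "\<And>x. x \<le> c \<Longrightarrow> F x = F c" "\<And>x. d \<le> x \<Longrightarrow> F x = F d"
    and cont: "continuous_on UNIV F"
  shows "absolutely_continuous lborel (interval_measure F)"
proof -
  let ?\<nu> = "interval_measure F"
  have Icc: "emeasure ?\<nu> {x..y} = ennreal (F y - F x)" if "x \<le> y" for x y
    using that mono cont by (intro emeasure_interval_measure_Icc) (auto simp: mono_def intro: continuous_on_subset)
  have "emeasure ?\<nu> N = 0" if N: "N \<in> null_sets lborel" for N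
  proof -
    have Ns: "N \<in> sets borel" "emeasure lborel N = 0" using N by auto
    have small: "emeasure ?\<nu> (N \<inter> {c<..<d}) \<le> ennreal \<epsilon>" if eps: "\<epsilon> > 0" for \<epsilon>
    proof -
      obtain \<delta> where \<delta>: "\<delta> > 0" "\<And>\<D>. \<D> division_of \<Union>\<D> \<Longrightarrow> \<Union>\<D> \<subseteq> {c..d} \<Longrightarrow> (\<Sum>K\<in>\<D>. Sup K - Inf K) < \<delta>
        \<Longrightarrow> (\<Sum>K\<in>\<D>. norm (F (Sup K) - F (Inf K))) < \<epsilon>"
        by (rule abs_cont_on_IccE[OF ac eps]) blast
      obtain U where U: "open U" "N \<subseteq> U" "emeasure lborel (U - N) < \<delta>"
        by (rule outer_regular_lborel[OF Ns(1) \<delta>(1)])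
      have "emeasure lborel U \<le> emeasure lborel (U - N) + emeasure lborel N"
        using U(1,2) Ns(1) by (intro order_trans[OF emeasure_mono emeasure_subadditive]) auto
      then have U\<delta>: "emeasure lborel U < \<delta>" using U(3) Ns(2) by simp
      let ?W = "U \<inter> {c<..<d}"
      obtain \<C> where C: "countable \<C>" "\<C> \<subseteq> Pow ?W" "\<And>X. X \<in> \<C> \<Longrightarrow> \<exists>a b. X = cbox a b" "\<Union>\<C> = ?W"
        using open_countable_Union_open_cbox[of ?W] U(1) by (metis open_Int open_greaterThanLessThan)
      \<comment> \<open>Finite unions of boxes are rewritten as divisions, because absolute
        continuity of \<open>F\<close> speaks about nonoverlapping cells only.\<close>
      have fin: "emeasure ?\<nu> (\<Union>\<C>') \<le> ennreal \<epsilon>" if C': "finite \<C>'" "\<C>' \<subseteq> \<C>" for \<C>'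
      proof -
        obtain p where p: "p division_of \<Union>\<C>'"
          using elementary_unions_intervals[OF C'(1)] C(3) C'(2) by (metis subsetD)
        then have pU: "\<Union>p = \<Union>\<C>'" by (rule division_ofD(6))
        have psub: "\<Union>p \<subseteq> ?W" using pU C' C(2) by auto
        have finp: "finite p" using p by auto
        have KI: "\<exists>k l. K = {k..l} \<and> k \<le> l" if "K \<in> p" for K by (rule division_IccE[OF p that]) blast
        have Kb: "K \<in> sets borel" if "K \<in> p" for K using KI[OF that] by auto
        have "ennreal (\<Sum>K\<in>p. Sup K - Inf K) = (\<Sum>K\<in>p. emeasure lborel K)"
          using KI by (subst sum_ennreal[symmetric]) (force intro!: sum.cong)+
        also have "\<dots> = emeasure lborel (\<Union>p)"
        proof -
          have "(\<Sum>K\<in>p. emeasure lborel K) = (\<Sum>K\<in>p. ennreal (measure lborel K))"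
            using KI by (intro sum.cong refl) force
          also have "\<dots> = ennreal (\<Sum>K\<in>p. measure lborel K)" by (rule sum_ennreal) simp
          also have "(\<Sum>K\<in>p. measure lborel K) = (\<Sum>K\<in>p. measure lebesgue K)"
            using Kb by (intro sum.cong refl) simp
          also have "\<dots> = measure lebesgue (\<Union>p)"
          proof (rule measure_negligible_finite_Union[symmetric, OF finp])
            show "K \<in> lmeasurable" if "K \<in> p" for K using KI[OF that] by auto
            show "pairwise (\<lambda>S T. negligible (S \<inter> T)) p"
              unfolding pairwise_def
            proof (intro ballI impI)
              fix K L assume KL: "K \<in> p" "L \<in> p" "K \<noteq> L"
              have "interior (K \<inter> L) = {}" using division_ofD(5)[OF p KL] by (simp add: interior_Int)
              moreover have "convex (K \<inter> L)" using KI[OF KL(1)] KI[OF KL(2)] by (auto intro!: convex_Int)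
              ultimately show "negligible (K \<inter> L)" by (simp add: negligible_convex_interior)
            qed
          qed
          also have "\<dots> = measure lborel (\<Union>p)" using finp Kb by (intro measure_completion sets.finite_Union) auto
          also have "ennreal \<dots> = emeasure lborel (\<Union>p)"
          proof (rule emeasure_eq_ennreal_measure[symmetric])
            have "emeasure lborel (\<Union>p) \<le> emeasure lborel U" using psub U(1) by (intro emeasure_mono) auto
            also have "\<dots> < top" by (rule less_trans[OF U\<delta> ennreal_less_top])
            finally show "emeasure lborel (\<Union>p) \<noteq> top" by simp
          qed
          finally show ?thesis .
        qed
        also have "\<dots> \<le> emeasure lborel U" using psub U(1) by (intro emeasure_mono) auto
        also have "\<dots> < \<delta>" by (rule U\<delta>)
        finally have "ennreal (\<Sum>K\<in>p. Sup K - Inf K) < ennreal \<delta>" .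
        then have "(\<Sum>K\<in>p. Sup K - Inf K) < \<delta>" by (metis ennreal_leI linorder_not_less)
        then have "(\<Sum>K\<in>p. norm (F (Sup K) - F (Inf K))) < \<epsilon>"
          using p pU psub by (intro \<delta>(2)) auto
        moreover have "emeasure ?\<nu> (\<Union>p) \<le> ennreal (\<Sum>K\<in>p. norm (F (Sup K) - F (Inf K)))"
        proof -
          have "emeasure ?\<nu> (\<Union>p) \<le> (\<Sum>K\<in>p. emeasure ?\<nu> K)"
            using emeasure_subadditive_finite[OF finp, of "\<lambda>K. K" ?\<nu>] Kb by auto
          also have "\<dots> = (\<Sum>K\<in>p. ennreal (norm (F (Sup K) - F (Inf K))))"
          proof (intro sum.cong refl)
            fix K assume "K \<in> p"
            then obtain k l where "K = {k..l}" "k \<le> l" using KI by blast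
            then show "emeasure ?\<nu> K = ennreal (norm (F (Sup K) - F (Inf K)))"
              using mono by (simp add: Icc mono_def)
          qed
          finally show ?thesis by (simp add: sum_ennreal)
        qed
        ultimately show ?thesis unfolding pU by (meson ennreal_leI less_imp_le order_trans)
      qed
      have "emeasure ?\<nu> ?W \<le> ennreal \<epsilon>"
      proof (cases "\<C> = {}")
        case True
        then have W: "?W = {}" using C(4) by (simp add: Union_empty)
        show ?thesis unfolding W by simp
      next
        case False
        define X where "X = from_nat_into \<C>"
        have X: "range X = \<C>" unfolding X_def using range_from_nat_into[OF False C(1)] .
        have bX: "X i \<in> sets borel" for i
        proof -
          have "X i \<in> \<C>" using X by blast
          then obtain k l where "X i = cbox k l" using C(3) by blast
          then show ?thesis by simp
        qed
        have "(\<lambda>n. emeasure ?\<nu> (\<Union>i\<le>n. X i)) \<longlonglongrightarrow> emeasure ?\<nu> (\<Union>n. \<Union>i\<le>n. X i)"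
        proof (rule Lim_emeasure_incseq)
          show "range (\<lambda>n. \<Union>i\<le>n. X i) \<subseteq> sets ?\<nu>" using bX by auto
          show "incseq (\<lambda>n. \<Union>i\<le>n. X i)" by (rule incseq_SucI) (auto simp: atMost_Suc)
        qed
        moreover have "emeasure ?\<nu> (\<Union>i\<le>n. X i) \<le> ennreal \<epsilon>" for n
          using X by (intro fin) auto
        ultimately have "emeasure ?\<nu> (\<Union>n. \<Union>i\<le>n. X i) \<le> ennreal \<epsilon>"
          by (intro LIMSEQ_le_const2) auto
        moreover have "(\<Union>n. \<Union>i\<le>n. X i) = ?W" using X C(4) by auto
        ultimately show ?thesis by simp
      qed
      moreover have "emeasure ?\<nu> (N \<inter> {c<..<d}) \<le> emeasure ?\<nu> ?W"
        using U(1,2) by (intro emeasure_mono) auto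
      ultimately show ?thesis by simp
    qed
    have "emeasure ?\<nu> (N \<inter> {c<..<d}) = 0"
    proof -
      have "emeasure ?\<nu> (N \<inter> {c<..<d}) \<le> 0" by (rule ennreal_le_epsilon) (use small in simp)
      then show ?thesis by simp
    qed
    moreover have "emeasure ?\<nu> (\<Union>n::nat. {c - n..c}) = 0"
    proof (rule emeasure_UN_eq_0)
      show "emeasure ?\<nu> {c - real n..c} = 0" for n using Icc[of "c - n" c] out(1)[of "c - n"] by simp
    qed auto
    moreover have "emeasure ?\<nu> (\<Union>n::nat. {d..d + n}) = 0"
    proof (rule emeasure_UN_eq_0)
      show "emeasure ?\<nu> {d..d + real n} = 0" for n using Icc[of d "d + n"] out(2)[of "d + n"] by simp
    qed auto
    moreover have "N \<subseteq> (N \<inter> {c<..<d}) \<union> ((\<Union>n::nat. {c - n..c}) \<union> (\<Union>n::nat. {d..d + n}))"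
    proof
      fix x assume "x \<in> N"
      obtain n :: nat where "c - x \<le> n" using real_arch_simple by blast
      moreover obtain m :: nat where "x - d \<le> m" using real_arch_simple by blast
      ultimately show "x \<in> (N \<inter> {c<..<d}) \<union> ((\<Union>n::nat. {c - n..c}) \<union> (\<Union>n::nat. {d..d + n}))"
        using \<open>x \<in> N\<close> by (cases "x \<le> c"; cases "d \<le> x") (auto simp: algebra_simps)
    qed
    ultimately show ?thesis
      using emeasure_Un_null_set[of _ ?\<nu>] Ns(1)
      by (intro emeasure_eq_0[of "(N \<inter> {c<..<d}) \<union> ((\<Union>n::nat. {c - n..c}) \<union> (\<Union>n::nat. {d..d + n}))" ?\<nu> N])
        (auto intro!: null_sets.Un simp: null_sets_def[symmetric] null_setsI)
  qed
  then show ?thesis by (auto simp: absolutely_continuous_def null_sets_def)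
qed

lemma abs_cont_continuous:
  assumes ac: "abs_cont_on_Icc c d f"
  shows "continuous_on {c..d} f"
  unfolding continuous_on_iff
proof (intro ballI allI impI)
  fix x \<epsilon> :: real assume x: "x \<in> {c..d}" and eps: "\<epsilon> > 0"
  obtain \<delta> where \<delta>: "\<delta> > 0" "\<And>\<D>. \<D> division_of \<Union>\<D> \<Longrightarrow> \<Union>\<D> \<subseteq> {c..d} \<Longrightarrow> (\<Sum>K\<in>\<D>. Sup K - Inf K) < \<delta>
        \<Longrightarrow> (\<Sum>K\<in>\<D>. norm (f (Sup K) - f (Inf K))) < \<epsilon>"
    by (rule abs_cont_on_IccE[OF ac eps]) blast
  have *: "norm (f v - f u) < \<epsilon>" if "u \<in> {c..d}" "v \<in> {c..d}" "u \<le> v" "v - u < \<delta>" for u v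
    using \<delta>(2)[of "{{u..v}}"] that division_of_self[of u v] by auto
  show "\<exists>\<delta>>0. \<forall>y\<in>{c..d}. dist y x < \<delta> \<longrightarrow> dist (f y) (f x) < \<epsilon>"
  proof (intro exI[of _ \<delta>] conjI ballI impI \<delta>(1))
    fix y assume "y \<in> {c..d}" "dist y x < \<delta>"
    then show "dist (f y) (f x) < \<epsilon>" using *[of x y] *[of y x] x
      by (cases "x \<le> y") (auto simp: dist_norm norm_minus_commute)
  qed
qed

text \<open>Radon-Nikodym for the Stieltjes measure of \<open>F\<close>. The density is finite a.e.
  on {c..d}, so \<open>enn2real\<close> loses nothing there.\<close>

lemma mono_abs_cont_density:
  fixes F :: "real \<Rightarrow> real"
  assumes mono: "mono F" and ac: "abs_cont_on_Icc c d F" and cd: "c \<le> d"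
    and out: "\<And>x. x \<le> c \<Longrightarrow> F x = F c" "\<And>x. d \<le> x \<Longrightarrow> F x = F d"
  obtains g where "g absolutely_integrable_on {c..d}" "\<And>x. x \<in> {c..d} \<Longrightarrow> F x - F c = integral {c..x} g"
proof -
  have Fc: "F x = F (max c (min d x))" for x using out[of x] cd by (auto simp: max_def min_def)
  have "continuous_on UNIV (\<lambda>x. F (max c (min d x)))"
    using cd by (intro continuous_on_compose2[OF abs_cont_continuous[OF ac]] continuous_intros) auto
  then have cont: "continuous_on UNIV F" using Fc by (metis (no_types, lifting) continuous_on_cong)
  have "absolutely_continuous lborel (interval_measure F)"
    by (rule absolutely_continuous_interval_measure[OF mono ac cd out cont])
  then obtain h where h[measurable]: "h \<in> borel_measurable lborel" and dens: "density lborel h = interval_measure F"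
    using sigma_finite_measure.Radon_Nikodym[OF sigma_finite_lborel, of "interval_measure F"] by auto
  have Icc: "(\<integral>\<^sup>+x. h x * indicator {c..y} x \<partial>lborel) = ennreal (F y - F c)" if "c \<le> y" for y
  proof -
    have "(\<integral>\<^sup>+x. h x * indicator {c..y} x \<partial>lborel) = emeasure (density lborel h) {c..y}"
      by (simp add: emeasure_density)
    also have "\<dots> = ennreal (F y - F c)" unfolding dens
      using that mono cont by (intro emeasure_interval_measure_Icc) (auto simp: mono_def intro: continuous_on_subset)
    finally show ?thesis .
  qed
  have AEfin: "AE x in lborel. h x * indicator {c..d} x \<noteq> \<infinity>"
    using Icc[OF cd] by (intro nn_integral_noteq_infinite) auto
  define g where "g = (\<lambda>x. enn2real (h x))"
  have hi: "((\<lambda>x. indicator {c..y} x * g x) has_integral (F y - F c)) UNIV" if y: "y \<in> {c..d}" for y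
  proof (rule nn_integral_has_integral)
    have "(\<integral>\<^sup>+x. ennreal (indicator {c..y} x * g x) \<partial>lborel) = (\<integral>\<^sup>+x. h x * indicator {c..y} x \<partial>lborel)"
      using AEfin by (intro nn_integral_cong_AE, eventually_elim)
        (use y in \<open>auto simp: g_def indicator_def top.not_eq_extremum split: if_splits\<close>)
    then show "(\<integral>\<^sup>+x. ennreal (indicator {c..y} x * g x) \<partial>lborel) = ennreal (F y - F c)"
      using Icc y by simp
  qed (use mono y in \<open>auto simp: g_def mono_def\<close>)
  have hi': "(g has_integral (F y - F c)) {c..y}" if y: "y \<in> {c..d}" for y
  proof -
    have "(\<lambda>x. indicator {c..y} x * g x) = (\<lambda>x. if x \<in> {c..y} then g x else 0)" by (auto simp: indicator_def)
    then show ?thesis using hi[OF y] has_integral_restrict_UNIV[of "{c..y}" g] by simp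
  qed
  show ?thesis
  proof (rule that)
    show "g absolutely_integrable_on {c..d}"
      using hi'[of d] cd by (intro nonnegative_absolutely_integrable_1) (auto simp: g_def integrable_on_def)
    show "F x - F c = integral {c..x} g" if "x \<in> {c..d}" for x
      using integral_unique[OF hi'[OF that]] by simp
  qed
qed

lemma abs_cont_subinterval: "abs_cont_on_Icc c d f \<Longrightarrow> {c'..d'} \<subseteq> {c..d} \<Longrightarrow> abs_cont_on_Icc c' d' f"
  unfolding abs_cont_on_Icc_def by (meson subset_trans)

text \<open>Domination of increments is all that absolute continuity needs; components, products,
  reciprocals and exponentials below are reduced to this one estimate.\<close>

lemma abs_cont_sum_bound:
  assumes f: "abs_cont_on_Icc c d f" and g: "abs_cont_on_Icc c d g"
    and h: "\<And>x y. x \<in> {c..d} \<Longrightarrow> y \<in> {c..d} \<Longrightarrow> norm (h y - h x) \<le> C * norm (f y - f x) + C * norm (g y - g x)"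
    and C: "C \<ge> 0"
  shows "abs_cont_on_Icc c d h"
  unfolding abs_cont_on_Icc_def
proof (intro allI impI)
  fix \<epsilon> :: real assume "\<epsilon> > 0"
  define e where "e = \<epsilon> / (2 * C + 1)"
  have e: "e > 0" using \<open>\<epsilon> > 0\<close> C by (simp add: e_def)
  obtain \<delta>1 where \<delta>1: "\<delta>1 > 0" "\<And>\<D>. \<D> division_of \<Union>\<D> \<Longrightarrow> \<Union>\<D> \<subseteq> {c..d} \<Longrightarrow> (\<Sum>K\<in>\<D>. Sup K - Inf K) < \<delta>1
        \<Longrightarrow> (\<Sum>K\<in>\<D>. norm (f (Sup K) - f (Inf K))) < e"
    by (rule abs_cont_on_IccE[OF f e]) blast
  obtain \<delta>2 where \<delta>2: "\<delta>2 > 0" "\<And>\<D>. \<D> division_of \<Union>\<D> \<Longrightarrow> \<Union>\<D> \<subseteq> {c..d} \<Longrightarrow> (\<Sum>K\<in>\<D>. Sup K - Inf K) < \<delta>2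
        \<Longrightarrow> (\<Sum>K\<in>\<D>. norm (g (Sup K) - g (Inf K))) < e"
    by (rule abs_cont_on_IccE[OF g e]) blast
  show "\<exists>\<delta>>0. \<forall>\<D>. \<D> division_of \<Union>\<D> \<and> \<Union>\<D> \<subseteq> {c..d} \<and> (\<Sum>K\<in>\<D>. Sup K - Inf K) < \<delta>
        \<longrightarrow> (\<Sum>K\<in>\<D>. norm (h (Sup K) - h (Inf K))) < \<epsilon>"
  proof (intro exI[of _ "min \<delta>1 \<delta>2"] conjI allI impI)
    fix \<D> assume D: "\<D> division_of \<Union>\<D> \<and> \<Union>\<D> \<subseteq> {c..d} \<and> (\<Sum>K\<in>\<D>. Sup K - Inf K) < min \<delta>1 \<delta>2"
    then have div: "\<D> division_of \<Union>\<D>" and sub: "\<Union>\<D> \<subseteq> {c..d}" by auto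
    have "(\<Sum>K\<in>\<D>. norm (h (Sup K) - h (Inf K))) \<le> (\<Sum>K\<in>\<D>. C * norm (f (Sup K) - f (Inf K)) + C * norm (g (Sup K) - g (Inf K)))"
    proof (intro sum_mono h)
      fix K assume K: "K \<in> \<D>"
      obtain k l where kl: "K = {k..l}" "k \<le> l" by (rule division_IccE[OF div K])
      have "{k..l} \<subseteq> {c..d}" using sub K kl by blast
      then show "Inf K \<in> {c..d}" "Sup K \<in> {c..d}" using kl by auto
    qed
    also have "\<dots> = C * (\<Sum>K\<in>\<D>. norm (f (Sup K) - f (Inf K))) + C * (\<Sum>K\<in>\<D>. norm (g (Sup K) - g (Inf K)))"
      by (simp add: sum.distrib sum_distrib_left)
    also have "\<dots> \<le> C * e + C * e"
      using \<delta>1(2)[OF div sub] \<delta>2(2)[OF div sub] D C by (intro add_mono mult_left_mono) auto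
    also have "\<dots> < (2 * C + 1) * e" using e by (simp add: algebra_simps)
    also have "\<dots> = \<epsilon>" using C by (simp add: e_def)
    finally show "(\<Sum>K\<in>\<D>. norm (h (Sup K) - h (Inf K))) < \<epsilon>" .
  qed (use \<delta>1 \<delta>2 in auto)
qed

lemma abs_cont_bounded:
  assumes "abs_cont_on_Icc c d f"
  obtains B where "B \<ge> 0" "\<And>x. x \<in> {c..d} \<Longrightarrow> norm (f x) \<le> B"
proof -
  have "bounded (f ` {c..d})"
    using abs_cont_continuous[OF assms] by (intro compact_imp_bounded compact_continuous_image) auto
  then obtain B where B: "\<forall>x\<in>{c..d}. norm (f x) \<le> B" by (auto simp: bounded_iff)
  show ?thesis by (rule that[of "max B 0"]) (use B in \<open>auto simp: max.coboundedI1\<close>)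
qed

text \<open>Jordan decomposition \<open>f = T - (T - f)\<close> with the variation function
  \<open>T\<close>: both terms are nondecreasing and absolutely continuous, so each has a
  density.\<close>

lemma abs_cont_density_local:
  fixes f :: "real \<Rightarrow> real"
  assumes ac: "abs_cont_on_Icc c d f" and cd: "c \<le> d"
    and B: "\<And>\<D>. \<D> \<in> subdivisions c d \<Longrightarrow> variation_sum f \<D> \<le> B"
  obtains g where "g absolutely_integrable_on {c..d}" "\<And>x. x \<in> {c..d} \<Longrightarrow> f x - f c = integral {c..x} g"
proof -
  let ?T = "total_variation f c"
  \<comment> \<open>Clamping to {c..d} extends the functions by constants to the whole line, where
    they induce Stieltjes measures.\<close>
  define cl where "cl = (\<lambda>x. max c (min d x))"
  have cl: "cl x = x" if "x \<in> {c..d}" for x using that by (auto simp: cl_def)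
  have clm: "cl x \<le> cl y" if "x \<le> y" for x y using that by (auto simp: cl_def)
  have clI: "c \<le> cl x" "cl x \<le> d" for x using cd by (auto simp: cl_def)
  note sup = total_variation_superadditive[where c=c and d=d and B=B and f=f, OF B]
  have acT: "abs_cont_on_Icc c d ?T" by (rule abs_cont_total_variation[OF ac B])
  have acTf: "abs_cont_on_Icc c d (\<lambda>x. ?T (cl x) - f (cl x))"
    by (rule abs_cont_sum_bound[OF acT ac, of _ 1])
      (use cl in \<open>auto simp: algebra_simps intro: order_trans[OF norm_triangle_ineq4]\<close>)
  have acTc: "abs_cont_on_Icc c d (\<lambda>x. ?T (cl x))"
    by (rule abs_cont_sum_bound[OF acT acT, of _ 1]) (use cl in auto)
  obtain g1 where g1: "g1 absolutely_integrable_on {c..d}"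
    "\<And>x. x \<in> {c..d} \<Longrightarrow> ?T (cl x) - ?T (cl c) = integral {c..x} g1"
  proof (rule mono_abs_cont_density[OF _ acTc cd])
    show "mono (\<lambda>x. ?T (cl x))"
    proof (rule monoI)
      fix x y :: real assume "x \<le> y"
      then show "?T (cl x) \<le> ?T (cl y)" using sup[OF _ _ clm clI(2)] clI by force
    qed
  qed (auto simp: cl_def)
  obtain g2 where g2: "g2 absolutely_integrable_on {c..d}"
    "\<And>x. x \<in> {c..d} \<Longrightarrow> (?T (cl x) - f (cl x)) - (?T (cl c) - f (cl c)) = integral {c..x} g2"
  proof (rule mono_abs_cont_density[OF _ acTf cd])
    show "mono (\<lambda>x. ?T (cl x) - f (cl x))"
    proof (rule monoI)
      fix x y :: real assume "x \<le> y"
      then show "?T (cl x) - f (cl x) \<le> ?T (cl y) - f (cl y)" using sup[OF _ _ clm clI(2), of x y] clI by force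
    qed
  qed (auto simp: cl_def)
  show ?thesis
  proof (rule that)
    show "(\<lambda>x. g1 x - g2 x) absolutely_integrable_on {c..d}" using g1 g2 by auto
    fix x assume x: "x \<in> {c..d}"
    have "g1 integrable_on {c..x}" "g2 integrable_on {c..x}"
      using x g1(1) g2(1) by (auto intro!: integrable_subinterval_real[of _ c d] simp: absolutely_integrable_on_def)
    then have "integral {c..x} (\<lambda>x. g1 x - g2 x) = integral {c..x} g1 - integral {c..x} g2"
      by (rule Henstock_Kurzweil_Integration.integral_diff)
    also have "\<dots> = f x - f c" using g1(2)[OF x] g2(2)[OF x] cl[of x] cl[of c] x by simp
    finally show "f x - f c = integral {c..x} (\<lambda>x. g1 x - g2 x)" ..
  qed
qed

lemma Icc_subset_einterval:
  assumes "c \<in> einterval a b" "d \<in> einterval a b"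
  shows "{c..d} \<subseteq> einterval a b"
proof
  fix x assume "x \<in> {c..d}"
  then show "x \<in> einterval a b"
    using assms less_le_trans[of a "ereal c" "ereal x"] le_less_trans[of "ereal x" "ereal d" b]
    by (simp add: einterval_def)
qed

lemma AC_locD: "AC_loc a b f \<Longrightarrow> {c..d} \<subseteq> einterval a b \<Longrightarrow> abs_cont_on_Icc c d f"
  by (simp add: AC_loc_def)

lemma einterval_nbhd:
  assumes "x \<in> einterval a b"
  obtains e where "e > 0" "{x - e..x + e} \<subseteq> einterval a b"
proof -
  obtain e where "e > 0" "cball x e \<subseteq> einterval a b"
    using open_contains_cball[of "einterval a b"] assms by auto
  then show ?thesis using that by (simp add: cball_eq_atLeastAtMost)
qed

lemma AC_loc_continuous:
  assumes "AC_loc a b f"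
  shows "continuous_on (einterval a b) f"
proof (intro continuous_at_imp_continuous_on ballI)
  fix x assume "x \<in> einterval a b"
  then obtain e where e: "e > 0" "{x - e..x + e} \<subseteq> einterval a b" by (rule einterval_nbhd)
  have "continuous_on {x - e..x + e} f" by (rule abs_cont_continuous[OF AC_locD[OF assms e(2)]])
  then have "continuous_on {x - e<..<x + e} f" by (rule continuous_on_subset) auto
  then show "isCont f x" using e(1) by (simp add: continuous_on_eq_continuous_at)
qed

lemma einterval_exhaustion:
  assumes "a < b"
  obtains l u :: "nat \<Rightarrow> real" where "\<And>n. l n < u n" "\<And>n. {l n..u n} \<subseteq> einterval a b"
    "einterval a b = (\<Union>n. {l n..u n})" "incseq u" "decseq l"
proof -
  obtain u l :: "nat \<Rightarrow> real" where *: "einterval a b = (\<Union>i. {l i..u i})" "incseq u" "decseq l"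
    "\<And>i. l i < u i" "\<And>i. a < l i" "\<And>i. u i < b"
    by (rule einterval_Icc_approximation[OF assms]) blast
  show ?thesis by (rule that[of l u]) (use * in auto)
qed

lemma AE_einterval:
  assumes "\<And>c d. c < d \<Longrightarrow> {c..d} \<subseteq> einterval a b \<Longrightarrow> AE x\<in>{c<..<d} in lebesgue. P x"
  shows "AE x\<in>einterval a b in lebesgue. P x"
proof (cases "a < b")
  case True
  obtain l u :: "nat \<Rightarrow> real" where lu: "\<And>n. l n < u n" "\<And>n. {l n..u n} \<subseteq> einterval a b"
    "einterval a b = (\<Union>n. {l n..u n})"
    by (rule einterval_exhaustion[OF True]) blast
  have "AE x in lebesgue. \<forall>n. x \<in> {l n<..<u n} \<longrightarrow> P x"
    unfolding AE_all_countable using assms[OF lu(1,2)] by blast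
  moreover have "AE x in lebesgue. \<forall>n. x \<noteq> l n \<and> x \<noteq> u n"
    unfolding AE_all_countable AE_conj_iff
    by (intro allI conjI AE_completion AE_lborel_singleton)
  ultimately show ?thesis
    by eventually_elim (auto simp: lu(3) less_le)
next
  case False
  then have "einterval a b = {}" by (auto simp: einterval_def)
  then show ?thesis by simp
qed

lemma abs_cont_component:
  fixes f :: "real \<Rightarrow> 'a::euclidean_space"
  assumes "abs_cont_on_Icc c d f" "i \<in> Basis"
  shows "abs_cont_on_Icc c d (\<lambda>x. f x \<bullet> i)"
  by (rule abs_cont_sum_bound[OF assms(1,1), of _ 1])
    (use assms(2) in \<open>auto simp: inner_diff_left[symmetric] intro: order_trans[OF Basis_le_norm]\<close>)

text \<open>On an interval shorter than the \<delta> belonging to \<epsilon> = 1, every variation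
  sum of a component is at most 1, so bounded variation needs no global argument.\<close>

lemma abs_cont_local_density:
  fixes f :: "real \<Rightarrow> 'a::euclidean_space"
  assumes ac: "abs_cont_on_Icc c d f"
  obtains \<delta> where "\<delta> > 0" "\<And>x y. {x..y} \<subseteq> {c..d} \<Longrightarrow> x \<le> y \<Longrightarrow> y - x < \<delta> \<Longrightarrow>
    \<exists>g. g absolutely_integrable_on {x..y} \<and> (\<forall>z\<in>{x..y}. f z - f x = integral {x..z} g)"
proof -
  obtain \<delta> where \<delta>: "\<delta> > 0" "\<And>\<D>. \<D> division_of \<Union>\<D> \<Longrightarrow> \<Union>\<D> \<subseteq> {c..d} \<Longrightarrow> (\<Sum>K\<in>\<D>. Sup K - Inf K) < \<delta>
        \<Longrightarrow> (\<Sum>K\<in>\<D>. norm (f (Sup K) - f (Inf K))) < 1"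
    by (rule abs_cont_on_IccE[OF ac zero_less_one]) blast
  show ?thesis
  proof (rule that[OF \<delta>(1)])
    fix x y assume xy: "{x..y} \<subseteq> {c..d}" "x \<le> y" "y - x < \<delta>"
    have "\<exists>g. g absolutely_integrable_on {x..y} \<and> (\<forall>z\<in>{x..y}. f z \<bullet> i - f x \<bullet> i = integral {x..z} g)" if i: "i \<in> Basis" for i
    proof -
      have ac': "abs_cont_on_Icc x y (\<lambda>x. f x \<bullet> i)"
        by (intro abs_cont_component abs_cont_subinterval[OF ac xy(1)] i)
      have "variation_sum (\<lambda>x. f x \<bullet> i) \<D> \<le> 1" if D: "\<D> \<in> subdivisions x y" for \<D>
      proof -
        have "variation_sum (\<lambda>x. f x \<bullet> i) \<D> \<le> (\<Sum>K\<in>\<D>. norm (f (Sup K) - f (Inf K)))"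
          unfolding variation_sum_def inner_diff_left[symmetric] by (intro sum_mono Basis_le_norm i)
        also have "\<dots> < 1"
        proof (rule \<delta>(2))
          show "\<D> division_of \<Union>\<D>" "\<Union>\<D> \<subseteq> {c..d}" using D xy(1) unfolding subdivisions_def by blast+
          show "(\<Sum>K\<in>\<D>. Sup K - Inf K) < \<delta>" using sum_length_subdivision[OF D xy(2)] xy(3) by simp
        qed
        finally show ?thesis by simp
      qed
      then show ?thesis using abs_cont_density_local[OF ac' xy(2)] by metis
    qed
    then have "\<forall>i\<in>Basis. \<exists>g. g absolutely_integrable_on {x..y} \<and> (\<forall>z\<in>{x..y}. f z \<bullet> i - f x \<bullet> i = integral {x..z} g)"
      by blast
    from bchoice[OF this] obtain g where g0: "\<forall>i\<in>Basis. g i absolutely_integrable_on {x..y} \<and>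
      (\<forall>z\<in>{x..y}. f z \<bullet> i - f x \<bullet> i = integral {x..z} (g i))" ..
    have g: "\<And>i. i \<in> Basis \<Longrightarrow> g i absolutely_integrable_on {x..y}"
      "\<And>i z. i \<in> Basis \<Longrightarrow> z \<in> {x..y} \<Longrightarrow> f z \<bullet> i - f x \<bullet> i = integral {x..z} (g i)"
      using g0 by blast+
    let ?g = "\<lambda>z. \<Sum>i\<in>Basis. g i z *\<^sub>R i"
    have "?g absolutely_integrable_on {x..y}"
      using g(1) by (intro absolutely_integrable_sum absolutely_integrable_scaleR_right) auto
    moreover have "f z - f x = integral {x..z} ?g" if z: "z \<in> {x..y}" for z
    proof -
      have ig: "g i integrable_on {x..z}" if "i \<in> Basis" for i
        using g(1)[OF that] z by (auto intro!: integrable_subinterval_real[of _ x y] simp: absolutely_integrable_on_def)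
      have "integral {x..z} ?g = (\<Sum>i\<in>Basis. integral {x..z} (\<lambda>u. g i u *\<^sub>R i))"
        using ig by (intro Henstock_Kurzweil_Integration.integral_sum integrable_on_scaleR_left) auto
      also have "\<dots> = (\<Sum>i\<in>Basis. integral {x..z} (g i) *\<^sub>R i)"
        using ig by (intro sum.cong refl integral_unique has_integral_scaleR_left integrable_integral) auto
      also have "\<dots> = (\<Sum>i\<in>Basis. ((f z - f x) \<bullet> i) *\<^sub>R i)"
        using g(2) z by (intro sum.cong refl) (simp add: inner_diff_left)
      also have "\<dots> = f z - f x" by (rule euclidean_representation)
      finally show ?thesis ..
    qed
    ultimately show "\<exists>g. g absolutely_integrable_on {x..y} \<and> (\<forall>z\<in>{x..y}. f z - f x = integral {x..z} g)" by blast
  qed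
qed

lemma density_imp_AE_derivative:
  fixes f :: "real \<Rightarrow> 'a::euclidean_space"
  assumes g: "g integrable_on {x..y}" and f: "\<And>z. z \<in> {x..y} \<Longrightarrow> f z - f x = integral {x..z} g"
  shows "AE z\<in>{x<..<y} in lebesgue. (f has_vector_derivative g z) (at z)"
proof -
  have *: "(f has_vector_derivative g z) (at z)"
    if z: "z \<in> {x<..<y}" and d: "((\<lambda>z. integral {x..z} g) has_vector_derivative g z) (at z)" for z
  proof (rule has_vector_derivative_transform_within_open[OF _ _ z])
    show "((\<lambda>z. f x + integral {x..z} g) has_vector_derivative g z) (at z)"
      using has_vector_derivative_add[OF has_vector_derivative_const d, of "f x"] by simp
    show "f x + integral {x..u} g = f u" if "u \<in> {x<..<y}" for u
      using f[of u] that by (simp add: algebra_simps)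
  qed auto
  show ?thesis using Lebesgue_differentiation[OF g] by eventually_elim (use * in auto)
qed

text \<open>By Lebesgue differentiation every local density agrees a.e. with
  \<open>vector_derivative\<close>. As the latter does not depend on the subinterval, the local
  statements glue by bisection.\<close>

lemma abs_cont_vector_derivative:
  fixes f :: "real \<Rightarrow> 'a::euclidean_space"
  assumes ac: "abs_cont_on_Icc c d f" and cd: "c \<le> d"
  defines "f' \<equiv> \<lambda>x. vector_derivative f (at x)"
  shows "f' absolutely_integrable_on {c..d} \<and> f d - f c = integral {c..d} f'"
proof -
  obtain \<delta> where \<delta>: "\<delta> > 0" "\<And>x y. {x..y} \<subseteq> {c..d} \<Longrightarrow> x \<le> y \<Longrightarrow> y - x < \<delta> \<Longrightarrow>
    \<exists>g. g absolutely_integrable_on {x..y} \<and> (\<forall>z\<in>{x..y}. f z - f x = integral {x..z} g)"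
    by (rule abs_cont_local_density[OF ac]) blast
  have small: "f' absolutely_integrable_on {x..y} \<and> f y - f x = integral {x..y} f'"
    if xy: "{x..y} \<subseteq> {c..d}" "x \<le> y" "y - x < \<delta>" for x y
  proof -
    obtain g where g: "g absolutely_integrable_on {x..y}" "\<And>z. z \<in> {x..y} \<Longrightarrow> f z - f x = integral {x..z} g"
      using \<delta>(2)[OF xy] by auto
    have "AE z\<in>{x<..<y} in lebesgue. (f has_vector_derivative g z) (at z)"
      using g by (intro density_imp_AE_derivative) (auto simp: absolutely_integrable_on_def)
    moreover have "AE z in lebesgue. z \<noteq> x \<and> z \<noteq> y"
      unfolding AE_conj_iff by (intro conjI AE_completion AE_lborel_singleton)
    ultimately have eq: "AE z\<in>{x..y} in lebesgue. g z = f' z"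
      by eventually_elim (auto simp: f'_def vector_derivative_at less_le)
    then show ?thesis
      using g xy(2) absolutely_integrable_cong_AE[OF eq] integral_cong_AE_set[OF eq] by auto
  qed
  have "c \<le> x \<longrightarrow> y \<le> d \<longrightarrow> f' absolutely_integrable_on {x..y} \<and> f y - f x = integral {x..y} f'" if "x \<le> y" for x y
    using that
  proof (induction rule: Bolzano)
    case (trans u v w)
    show ?case
    proof (intro impI)
      assume b: "c \<le> u" "w \<le> d"
      then have 1: "f' absolutely_integrable_on {u..v}" "f v - f u = integral {u..v} f'"
        "f' absolutely_integrable_on {v..w}" "f w - f v = integral {v..w} f'" using trans by auto
      have 2: "f' absolutely_integrable_on {u..w}"
        by (rule absolutely_integrable_on_combine[OF 1(1,3)]) (use trans in auto)
      then have "integral {u..v} f' + integral {v..w} f' = integral {u..w} f'"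
        using trans by (intro integral_combine_Icc) (auto simp: absolutely_integrable_on_def)
      then show "f' absolutely_integrable_on {u..w} \<and> f w - f u = integral {u..w} f'"
        using 1 2 by (metis add.commute diff_add_cancel add_diff_eq)
    qed
  next
    case (local u)
    show ?case
      by (intro exI[of _ \<delta>] conjI allI impI small) (use \<delta> in auto)
  qed
  then show ?thesis using cd by auto
qed

subsection \<open>Local primitives on an open interval\<close>

text \<open>The working form of local absolute continuity, with \<open>g\<close> a version of the
  a.e. derivative. Only increments of \<open>f\<close> enter, so the constant of integration stays
  free, and \<open>g\<close> may be changed on null sets.\<close>

definition primitive_on :: "ereal \<Rightarrow> ereal \<Rightarrow> (real \<Rightarrow> 'a::euclidean_space) \<Rightarrow> (real \<Rightarrow> 'a) \<Rightarrow> bool" where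
  "primitive_on a b f g \<longleftrightarrow> (\<forall>c d. c \<le> d \<longrightarrow> {c..d} \<subseteq> einterval a b \<longrightarrow>
     g absolutely_integrable_on {c..d} \<and> f d - f c = integral {c..d} g)"

lemma primitive_onD:
  assumes "primitive_on a b f g" "c \<le> d" "{c..d} \<subseteq> einterval a b"
  shows "g absolutely_integrable_on {c..d}" "f d - f c = integral {c..d} g" "(g has_integral (f d - f c)) {c..d}"
  using assms by (auto simp: primitive_on_def absolutely_integrable_on_def)

lemma abs_cont_empty: "\<not> c \<le> d \<Longrightarrow> abs_cont_on_Icc c d f"
  unfolding abs_cont_on_Icc_def
proof (intro allI impI exI[of _ 1] conjI)
  fix \<epsilon> :: real and \<D> :: "real set set"
  assume "\<not> c \<le> d" "\<epsilon> > 0" and D: "\<D> division_of \<Union>\<D> \<and> \<Union>\<D> \<subseteq> {c..d} \<and> (\<Sum>K\<in>\<D>. Sup K - Inf K) < 1"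
  then have "\<Union>\<D> = {}" by simp
  then have "\<D> = {}" using D by (metis division_of_trivial)
  then show "(\<Sum>K\<in>\<D>. norm (f (Sup K) - f (Inf K))) < \<epsilon>" using \<open>\<epsilon> > 0\<close> by simp
qed simp

lemma primitive_on_AC_loc:
  assumes "primitive_on a b f g"
  shows "AC_loc a b f"
  unfolding AC_loc_def
proof (intro allI impI)
  fix c d assume sub: "{c..d} \<subseteq> einterval a b"
  show "abs_cont_on_Icc c d f"
  proof (cases "c \<le> d")
    case True
    show ?thesis
    proof (rule abs_cont_indefinite_integral)
      show "g absolutely_integrable_on {c..d}" by (rule primitive_onD[OF assms True sub])
      fix x y assume xy: "c \<le> x" "x \<le> y" "y \<le> d"
      then have "{x..y} \<subseteq> einterval a b" using sub by auto
      then show "f y - f x = integral {x..y} g" using primitive_onD(2)[OF assms xy(2)] by blast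
    qed
  next
    case False
    then show ?thesis by (rule abs_cont_empty)
  qed
qed

lemma primitive_on_AE_derivative:
  assumes "primitive_on a b f g"
  shows "AE x\<in>einterval a b in lebesgue. (f has_vector_derivative g x) (at x)"
proof (rule AE_einterval)
  fix c d :: real assume cd: "c < d" "{c..d} \<subseteq> einterval a b"
  show "AE x\<in>{c<..<d} in lebesgue. (f has_vector_derivative g x) (at x)"
  proof (rule density_imp_AE_derivative)
    show "g integrable_on {c..d}" using primitive_onD(1)[OF assms, of c d] cd by (simp add: absolutely_integrable_on_def)
    fix z assume z: "z \<in> {c..d}"
    then have "{c..z} \<subseteq> einterval a b" using cd by auto
    then show "f z - f c = integral {c..z} g" using primitive_onD(2)[OF assms, of c z] z by simp
  qed
qed

lemma primitive_on_cong_AE: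
  assumes "primitive_on a b f g" "AE x\<in>einterval a b in lebesgue. g x = g' x"
  shows "primitive_on a b f g'"
  unfolding primitive_on_def
proof (intro allI impI)
  fix c d assume cd: "c \<le> (d::real)" "{c..d} \<subseteq> einterval a b"
  have eq: "AE x\<in>{c..d} in lebesgue. g x = g' x"
    using assms(2) by eventually_elim (use cd in auto)
  show "g' absolutely_integrable_on {c..d} \<and> f d - f c = integral {c..d} g'"
    using primitive_onD[OF assms(1) cd] absolutely_integrable_cong_AE[OF eq] integral_cong_AE_set[OF eq] by simp
qed

lemma AC_loc_primitive_vector_derivative:
  fixes f :: "real \<Rightarrow> 'a::euclidean_space"
  assumes "AC_loc a b f"
  shows "primitive_on a b f (\<lambda>x. vector_derivative f (at x))"
  unfolding primitive_on_def using abs_cont_vector_derivative[OF AC_locD[OF assms]] by blast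

lemma AC_loc_primitiveI:
  fixes f :: "real \<Rightarrow> 'a::euclidean_space"
  assumes "AC_loc a b f" "AE x\<in>einterval a b in lebesgue. (f has_vector_derivative g x) (at x)"
  shows "primitive_on a b f g"
proof (rule primitive_on_cong_AE[OF AC_loc_primitive_vector_derivative[OF assms(1)]])
  show "AE x\<in>einterval a b in lebesgue. vector_derivative f (at x) = g x"
    using assms(2) by eventually_elim (auto simp: vector_derivative_at)
qed

lemma primitive_on_subset:
  assumes "primitive_on a b f g" "einterval a' b' \<subseteq> einterval a b"
  shows "primitive_on a' b' f g"
  using assms unfolding primitive_on_def by (meson subset_trans)

lemma AC_loc_bound:
  assumes f: "AC_loc a b f" and g: "AC_loc a b g"
    and h: "\<And>c d. c \<le> d \<Longrightarrow> {c..d} \<subseteq> einterval a b \<Longrightarrow> \<exists>C\<ge>0. \<forall>x\<in>{c..d}. \<forall>y\<in>{c..d}.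
      norm (h y - h x) \<le> C * norm (f y - f x) + C * norm (g y - g x)"
  shows "AC_loc a b h"
  unfolding AC_loc_def
proof (intro allI impI)
  fix c d assume sub: "{c..d} \<subseteq> einterval a b"
  show "abs_cont_on_Icc c d h"
  proof (cases "c \<le> d")
    case True
    then obtain C where "C \<ge> 0" "\<forall>x\<in>{c..d}. \<forall>y\<in>{c..d}. norm (h y - h x) \<le> C * norm (f y - f x) + C * norm (g y - g x)"
      using h[OF True sub] by auto
    then show ?thesis by (intro abs_cont_sum_bound[OF AC_locD[OF f sub] AC_locD[OF g sub]]) auto
  next
    case False
    then show ?thesis by (rule abs_cont_empty)
  qed
qed

lemma AC_loc_bilinear:
  fixes f :: "real \<Rightarrow> 'a::euclidean_space" and g :: "real \<Rightarrow> 'b::euclidean_space"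
  assumes bl: "bounded_bilinear (pr :: _ \<Rightarrow> _ \<Rightarrow> 'c::euclidean_space)"
    and f: "AC_loc a b f" and g: "AC_loc a b g"
  shows "AC_loc a b (\<lambda>x. pr (f x) (g x))"
proof (rule AC_loc_bound[OF f g])
  interpret bounded_bilinear pr by (rule bl)
  fix c d assume cd: "c \<le> (d::real)" "{c..d} \<subseteq> einterval a b"
  obtain F where F: "F \<ge> 0" "\<And>x. x \<in> {c..d} \<Longrightarrow> norm (f x) \<le> F"
    by (rule abs_cont_bounded[OF AC_locD[OF f cd(2)]]) blast
  obtain G where G: "G \<ge> 0" "\<And>x. x \<in> {c..d} \<Longrightarrow> norm (g x) \<le> G"
    by (rule abs_cont_bounded[OF AC_locD[OF g cd(2)]]) blast
  obtain K where K: "K \<ge> 0" "\<And>u v. norm (pr u v) \<le> norm u * norm v * K" using nonneg_bounded by blast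
  show "\<exists>C\<ge>0. \<forall>x\<in>{c..d}. \<forall>y\<in>{c..d}. norm (pr (f y) (g y) - pr (f x) (g x)) \<le> C * norm (f y - f x) + C * norm (g y - g x)"
  proof (intro exI[of _ "(F + G) * K"] conjI ballI)
    fix x y assume x: "x \<in> {c..d}" and y: "y \<in> {c..d}"
    have "pr (f y) (g y) - pr (f x) (g x) = pr (f y - f x) (g y) + pr (f x) (g y - g x)"
      by (simp add: diff_left diff_right)
    then have "norm (pr (f y) (g y) - pr (f x) (g x)) \<le> norm (pr (f y - f x) (g y)) + norm (pr (f x) (g y - g x))"
      by (simp add: norm_triangle_ineq)
    also have "\<dots> \<le> norm (f y - f x) * norm (g y) * K + norm (f x) * norm (g y - g x) * K"
      by (intro add_mono K)
    also have "\<dots> \<le> norm (f y - f x) * (F + G) * K + (F + G) * norm (g y - g x) * K"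
      using F(2)[OF x] G(2)[OF y] F(1) G(1) K(1) by (intro add_mono mult_right_mono mult_left_mono) auto
    finally show "norm (pr (f y) (g y) - pr (f x) (g x)) \<le> (F + G) * K * norm (f y - f x) + (F + G) * K * norm (g y - g x)"
      by (simp add: mult_ac)
  qed (use F G K in auto)
qed

lemma primitive_on_bilinear:
  fixes f :: "real \<Rightarrow> 'a::euclidean_space" and g :: "real \<Rightarrow> 'b::euclidean_space"
  assumes bl: "bounded_bilinear (pr :: _ \<Rightarrow> _ \<Rightarrow> 'c::euclidean_space)"
    and f: "primitive_on a b f f'" and g: "primitive_on a b g g'"
  shows "primitive_on a b (\<lambda>x. pr (f x) (g x)) (\<lambda>x. pr (f x) (g' x) + pr (f' x) (g x))"
proof (rule AC_loc_primitiveI)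
  show "AC_loc a b (\<lambda>x. pr (f x) (g x))" by (rule AC_loc_bilinear[OF bl primitive_on_AC_loc[OF f] primitive_on_AC_loc[OF g]])
  show "AE x\<in>einterval a b in lebesgue. ((\<lambda>x. pr (f x) (g x)) has_vector_derivative pr (f x) (g' x) + pr (f' x) (g x)) (at x)"
    using primitive_on_AE_derivative[OF f] primitive_on_AE_derivative[OF g]
    by eventually_elim (auto intro: bounded_bilinear.has_vector_derivative[OF bl])
qed

lemma primitive_on_linear:
  fixes f :: "real \<Rightarrow> 'a::euclidean_space"
  assumes bl: "bounded_linear (T :: _ \<Rightarrow> 'c::euclidean_space)" and f: "primitive_on a b f f'"
  shows "primitive_on a b (\<lambda>x. T (f x)) (\<lambda>x. T (f' x))"
  unfolding primitive_on_def
proof (intro allI impI conjI)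
  fix c d assume cd: "c \<le> (d::real)" "{c..d} \<subseteq> einterval a b"
  show "(\<lambda>x. T (f' x)) absolutely_integrable_on {c..d}"
    using absolutely_integrable_linear[OF primitive_onD(1)[OF f cd] bl] by (simp add: o_def)
  have "T (f d) - T (f c) = T (integral {c..d} f')"
    using primitive_onD(2)[OF f cd] linear_diff[OF bounded_linear.linear[OF bl]] by metis
  also have "\<dots> = integral {c..d} (\<lambda>x. T (f' x))"
    using integral_linear[OF _ bl, of f' "{c..d}"] primitive_onD(1)[OF f cd]
    by (simp add: absolutely_integrable_on_def o_def)
  finally show "T (f d) - T (f c) = integral {c..d} (\<lambda>x. T (f' x))" .
qed

lemma primitive_on_add:
  assumes "primitive_on a b f f'" "primitive_on a b g g'"
  shows "primitive_on a b (\<lambda>x. f x + g x) (\<lambda>x. f' x + g' x)"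
  unfolding primitive_on_def
proof (intro allI impI conjI)
  fix c d assume cd: "c \<le> (d::real)" "{c..d} \<subseteq> einterval a b"
  show "(\<lambda>x. f' x + g' x) absolutely_integrable_on {c..d}"
    using primitive_onD(1)[OF assms(1) cd] primitive_onD(1)[OF assms(2) cd] by auto
  have "((\<lambda>x. f' x + g' x) has_integral (f d - f c) + (g d - g c)) {c..d}"
    by (rule has_integral_add[OF primitive_onD(3)[OF assms(1) cd] primitive_onD(3)[OF assms(2) cd]])
  then show "f d + g d - (f c + g c) = integral {c..d} (\<lambda>x. f' x + g' x)"
    by (simp add: integral_unique algebra_simps)
qed

lemma primitive_on_const: "primitive_on a b (\<lambda>_. c) (\<lambda>_. 0)"
  by (simp add: primitive_on_def)

lemma primitive_on_mult:
  fixes f g :: "real \<Rightarrow> 'a::{euclidean_space, real_normed_algebra}"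
  shows "primitive_on a b f f' \<Longrightarrow> primitive_on a b g g' \<Longrightarrow> primitive_on a b (\<lambda>x. f x * g x) (\<lambda>x. f x * g' x + f' x * g x)"
  by (rule primitive_on_bilinear[OF bounded_bilinear_mult])

text \<open>Positivity becomes uniform on each compact subinterval through the minimum of
  \<open>g\<close>, so increments of 1/g are dominated by those of \<open>g\<close>.\<close>

lemma primitive_on_inverse:
  fixes g :: "real \<Rightarrow> real"
  assumes g: "primitive_on a b g g'" and pos: "\<And>x. x \<in> einterval a b \<Longrightarrow> g x > 0"
  shows "primitive_on a b (\<lambda>x. 1 / g x) (\<lambda>x. - g' x / (g x)\<^sup>2)"
proof (rule AC_loc_primitiveI)
  note ac = primitive_on_AC_loc[OF g]
  show "AC_loc a b (\<lambda>x. 1 / g x)"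
  proof (rule AC_loc_bound[OF ac ac])
    fix c d assume cd: "c \<le> (d::real)" "{c..d} \<subseteq> einterval a b"
    obtain m where m: "m \<in> {c..d}" "\<And>x. x \<in> {c..d} \<Longrightarrow> g m \<le> g x"
      using continuous_attains_inf[of "{c..d}" g] cd continuous_on_subset[OF AC_loc_continuous[OF ac] cd(2)] by auto
    have gm: "g m > 0" using pos m cd by auto
    show "\<exists>C\<ge>0. \<forall>x\<in>{c..d}. \<forall>y\<in>{c..d}. norm (1 / g y - 1 / g x) \<le> C * norm (g y - g x) + C * norm (g y - g x)"
    proof (intro exI[of _ "1 / (g m)\<^sup>2"] conjI ballI)
      fix x y assume x: "x \<in> {c..d}" and y: "y \<in> {c..d}"
      have gx: "g x \<ge> g m" "g y \<ge> g m" using m x y by auto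
      have "norm (1 / g y - 1 / g x) = norm (g y - g x) / (g x * g y)"
        using gx gm by (simp add: field_simps abs_mult abs_minus_commute abs_divide)
      also have "\<dots> \<le> norm (g y - g x) / (g m * g m)"
        using gx gm by (intro divide_left_mono mult_mono) auto
      also have "\<dots> \<le> 1 / (g m)\<^sup>2 * norm (g y - g x) + 1 / (g m)\<^sup>2 * norm (g y - g x)"
        using gm by (simp add: power2_eq_square divide_right_mono)
      finally show "norm (1 / g y - 1 / g x) \<le> 1 / (g m)\<^sup>2 * norm (g y - g x) + 1 / (g m)\<^sup>2 * norm (g y - g x)" .
    qed auto
  qed
  show "AE x\<in>einterval a b in lebesgue. ((\<lambda>x. 1 / g x) has_vector_derivative - g' x / (g x)\<^sup>2) (at x)"
    using primitive_on_AE_derivative[OF g]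
  proof eventually_elim
    case (elim x)
    show ?case
    proof
      assume x: "x \<in> einterval a b"
      then have "(g has_real_derivative g' x) (at x)" using elim by (simp add: has_real_derivative_iff_has_vector_derivative)
      then have "((\<lambda>x. 1 / g x) has_real_derivative - g' x / (g x)\<^sup>2) (at x)"
        using pos[OF x] by (auto intro!: derivative_eq_intros simp: power2_eq_square)
      then show "((\<lambda>x. 1 / g x) has_vector_derivative - g' x / (g x)\<^sup>2) (at x)"
        by (simp add: has_real_derivative_iff_has_vector_derivative)
    qed
  qed
qed

section \<open>The Friedrichs extension of a semibounded operator\<close>

lemma cnj_mult_self: "complex_of_real c * cnj z * z = complex_of_real (c * (cmod z)\<^sup>2)"
  using complex_norm_square[of z] by (simp add: mult_ac)

lemma Re_quadratic_expansion:
  "Re (complex_of_real A + \<alpha> * z + cnj \<alpha> * (cnj z + \<alpha> * complex_of_real C)) = A + 2 * Re (\<alpha> * z) + (cmod \<alpha>)\<^sup>2 * C"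
  unfolding cmod_power2 by (simp add: power2_eq_square algebra_simps)

text \<open>The choice \<alpha> = -c cnj z turns the hypothesis into a real quadratic in c, which is
  evaluated at c = 1/C; for C = 0 a large c rules out z \<noteq> 0. The Cauchy-Schwarz inequalities
  for L2, for the form and for weighted integrals are all obtained from it.\<close>

lemma quadratic_discriminant_complex:
  fixes z :: complex
  assumes "C \<ge> 0" and pos: "\<And>\<alpha>. 0 \<le> A + 2 * Re (\<alpha> * z) + (cmod \<alpha>)\<^sup>2 * C"
  shows "(cmod z)\<^sup>2 \<le> A * C"
proof -
  have *: "0 \<le> A - 2 * c * (cmod z)\<^sup>2 + c\<^sup>2 * (cmod z)\<^sup>2 * C" for c
  proof -
    have 1: "Re (complex_of_real (- c) * cnj z * z) = - c * (cmod z)\<^sup>2" unfolding cnj_mult_self by (simp only: Re_complex_of_real)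
    have 2: "(cmod (complex_of_real (- c) * cnj z))\<^sup>2 = c\<^sup>2 * (cmod z)\<^sup>2" by (simp add: norm_mult power_mult_distrib)
    show ?thesis using pos[of "complex_of_real (- c) * cnj z"] unfolding 1 2 by simp
  qed
  show ?thesis
  proof (cases "C = 0")
    case True
    have "z = 0"
    proof (rule ccontr)
      assume "z \<noteq> 0"
      then show False using *[of "(A + 1) / (2 * (cmod z)\<^sup>2)"] True by simp
    qed
    then show ?thesis using True by simp
  next
    case False
    with assms have C: "C > 0" by simp
    have "(1 / C)\<^sup>2 * (cmod z)\<^sup>2 * C = (cmod z)\<^sup>2 / C" "2 * (1 / C) * (cmod z)\<^sup>2 = 2 * ((cmod z)\<^sup>2 / C)"
      using C by (simp_all add: power2_eq_square)
    then have "(cmod z)\<^sup>2 / C \<le> A" using *[of "1 / C"] by linarith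
    then show ?thesis using C by (simp add: field_simps)
  qed
qed

section \<open>Inner product and norm on the complex L2 space of a measure\<close>

lemma L2_mult_integrable:
  assumes "f \<in> L2 M" "g \<in> L2 M"
  shows "integrable M (\<lambda>x. cnj (f x) * g x)"
proof (rule Bochner_Integration.integrable_bound)
  have [measurable]: "f \<in> borel_measurable M" "g \<in> borel_measurable M" using assms by (auto simp: L2_def)
  show "integrable M (\<lambda>x. (cmod (f x))\<^sup>2 + (cmod (g x))\<^sup>2)" using assms by (auto simp: L2_def)
  have "(\<lambda>x. cnj (f x)) \<in> borel_measurable M"
    by (intro borel_measurable_continuous_on[where f=cnj] continuous_intros) auto
  then show "(\<lambda>x. cnj (f x) * g x) \<in> borel_measurable M" by simp
  have "cmod (cnj (f x) * g x) \<le> (cmod (f x))\<^sup>2 + (cmod (g x))\<^sup>2" for x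
  proof -
    have "0 \<le> cmod (f x) * cmod (g x)" by simp
    moreover have "2 * (cmod (f x) * cmod (g x)) \<le> (cmod (f x))\<^sup>2 + (cmod (g x))\<^sup>2"
      using sum_squares_bound[of "cmod (f x)" "cmod (g x)"] by (simp add: mult.assoc)
    ultimately show ?thesis by (simp only: norm_mult complex_mod_cnj)
  qed
  then show "AE x in M. cmod (cnj (f x) * g x) \<le> norm ((cmod (f x))\<^sup>2 + (cmod (g x))\<^sup>2)" by simp
qed

lemma L2_add_scale:
  assumes "f \<in> L2 M" "g \<in> L2 M"
  shows "(\<lambda>x. f x + \<alpha> * g x) \<in> L2 M"
proof -
  have [measurable]: "f \<in> borel_measurable M" "g \<in> borel_measurable M" using assms by (auto simp: L2_def)
  have "integrable M (\<lambda>x. (cmod (f x + \<alpha> * g x))\<^sup>2)"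
  proof (rule Bochner_Integration.integrable_bound)
    show "integrable M (\<lambda>x. 2 * (cmod (f x))\<^sup>2 + 2 * (cmod \<alpha>)\<^sup>2 * (cmod (g x))\<^sup>2)" using assms by (auto simp: L2_def)
    have "(cmod (f x + \<alpha> * g x))\<^sup>2 \<le> 2 * (cmod (f x))\<^sup>2 + 2 * (cmod \<alpha>)\<^sup>2 * (cmod (g x))\<^sup>2" for x
    proof -
      have "(cmod (f x + \<alpha> * g x))\<^sup>2 \<le> (cmod (f x) + cmod \<alpha> * cmod (g x))\<^sup>2"
        using norm_triangle_ineq[of "f x" "\<alpha> * g x"] by (intro power_mono) (auto simp: norm_mult)
      also have "\<dots> \<le> 2 * (cmod (f x))\<^sup>2 + 2 * (cmod \<alpha> * cmod (g x))\<^sup>2"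
        using sum_squares_bound[of "cmod (f x)" "cmod \<alpha> * cmod (g x)"] by (simp add: power2_sum)
      finally show ?thesis by (simp add: power_mult_distrib)
    qed
    then show "AE x in M. norm ((cmod (f x + \<alpha> * g x))\<^sup>2) \<le> norm (2 * (cmod (f x))\<^sup>2 + 2 * (cmod \<alpha>)\<^sup>2 * (cmod (g x))\<^sup>2)"
      by simp
  qed simp
  then show ?thesis by (simp add: L2_def)
qed

lemma L2_zero: "(\<lambda>_. 0) \<in> L2 M" by (simp add: L2_def)

lemma L2_diff: "f \<in> L2 M \<Longrightarrow> g \<in> L2 M \<Longrightarrow> (\<lambda>x. f x - g x) \<in> L2 M"
  using L2_add_scale[of f M g "-1"] by simp

lemma L2_cong_AE:
  assumes "f \<in> L2 M" "g \<in> borel_measurable M" "AE x in M. f x = g x"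
  shows "g \<in> L2 M"
proof -
  have "integrable M (\<lambda>x. (cmod (g x))\<^sup>2) \<longleftrightarrow> integrable M (\<lambda>x. (cmod (f x))\<^sup>2)"
    using assms by (intro integrable_cong_AE) (auto simp: L2_def)
  then show ?thesis using assms by (simp add: L2_def)
qed

lemma L2_inner_add_right:
  assumes "f \<in> L2 M" "g \<in> L2 M" "h \<in> L2 M"
  shows "L2_inner M f (\<lambda>x. g x + \<alpha> * h x) = L2_inner M f g + \<alpha> * L2_inner M f h"
proof -
  have "L2_inner M f (\<lambda>x. g x + \<alpha> * h x) = (LINT x|M. cnj (f x) * g x + \<alpha> * (cnj (f x) * h x))"
    unfolding L2_inner_def by (intro Bochner_Integration.integral_cong) (auto simp: algebra_simps)
  also have "\<dots> = L2_inner M f g + \<alpha> * L2_inner M f h"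
    unfolding L2_inner_def using L2_mult_integrable assms by (subst Bochner_Integration.integral_add) auto
  finally show ?thesis .
qed

lemma L2_inner_commute: "L2_inner M g f = cnj (L2_inner M f g)"
proof -
  have "cnj (L2_inner M f g) = (LINT x|M. cnj (cnj (f x) * g x))"
    unfolding L2_inner_def by (rule Bochner_Integration.integral_cnj[symmetric])
  then show ?thesis by (simp add: L2_inner_def mult.commute)
qed

lemma L2_inner_add_left:
  assumes "f \<in> L2 M" "g \<in> L2 M" "h \<in> L2 M"
  shows "L2_inner M (\<lambda>x. g x + \<alpha> * h x) f = L2_inner M g f + cnj \<alpha> * L2_inner M h f"
proof -
  have "L2_inner M (\<lambda>x. g x + \<alpha> * h x) f = cnj (L2_inner M f (\<lambda>x. g x + \<alpha> * h x))" by (rule L2_inner_commute)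
  also have "\<dots> = cnj (L2_inner M f g) + cnj \<alpha> * cnj (L2_inner M f h)" by (simp add: L2_inner_add_right[OF assms])
  finally show ?thesis by (simp only: L2_inner_commute[symmetric])
qed

lemma L2_inner_diff_left:
  assumes "f \<in> L2 M" "g \<in> L2 M" "h \<in> L2 M"
  shows "L2_inner M (\<lambda>x. g x - h x) f = L2_inner M g f - L2_inner M h f"
  using L2_inner_add_left[OF assms, of "-1"] by simp

lemma L2_inner_diff_right:
  assumes "f \<in> L2 M" "g \<in> L2 M" "h \<in> L2 M"
  shows "L2_inner M f (\<lambda>x. g x - h x) = L2_inner M f g - L2_inner M f h"
  using L2_inner_add_right[OF assms, of "-1"] by simp

lemma L2_inner_self: "L2_inner M f f = complex_of_real ((L2_norm M f)\<^sup>2)"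
proof -
  have "L2_inner M f f = (LINT x|M. complex_of_real ((cmod (f x))\<^sup>2))"
    unfolding L2_inner_def
    by (intro Bochner_Integration.integral_cong) (auto simp: complex_norm_square mult.commute simp del: of_real_power)
  also have "\<dots> = complex_of_real (LINT x|M. (cmod (f x))\<^sup>2)" by (rule integral_complex_of_real)
  finally show ?thesis by (simp add: L2_norm_def)
qed

lemma L2_norm_nonneg: "L2_norm M f \<ge> 0"
  by (simp add: L2_norm_def)

lemma L2_inner_cong_AE:
  assumes "f \<in> L2 M" "g \<in> L2 M" "f' \<in> L2 M" "g' \<in> L2 M" "AE x in M. f x = f' x" "AE x in M. g x = g' x"
  shows "L2_inner M f g = L2_inner M f' g'"
proof -
  have "AE x in M. cnj (f x) * g x = cnj (f' x) * g' x" using assms(5,6) by eventually_elim simp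
  then show ?thesis unfolding L2_inner_def
    using L2_mult_integrable[OF assms(1,2)] L2_mult_integrable[OF assms(3,4)] by (intro integral_cong_AE) auto
qed

lemma L2_norm_cong_AE:
  assumes "f \<in> L2 M" "g \<in> L2 M" "AE x in M. f x = g x"
  shows "L2_norm M f = L2_norm M g"
proof -
  have "complex_of_real ((L2_norm M f)\<^sup>2) = complex_of_real ((L2_norm M g)\<^sup>2)"
    unfolding L2_inner_self[symmetric] by (rule L2_inner_cong_AE) (use assms in auto)
  then show ?thesis using L2_norm_nonneg by (metis of_real_eq_iff power2_eq_iff_nonneg)
qed

lemma L2_norm_add_sq:
  assumes "f \<in> L2 M" "g \<in> L2 M"
  shows "(L2_norm M (\<lambda>x. f x + \<alpha> * g x))\<^sup>2 = (L2_norm M f)\<^sup>2 + 2 * Re (\<alpha> * L2_inner M f g) + (cmod \<alpha>)\<^sup>2 * (L2_norm M g)\<^sup>2"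
proof -
  have fg: "(\<lambda>x. f x + \<alpha> * g x) \<in> L2 M" by (rule L2_add_scale[OF assms])
  have "complex_of_real ((L2_norm M (\<lambda>x. f x + \<alpha> * g x))\<^sup>2) = L2_inner M (\<lambda>x. f x + \<alpha> * g x) (\<lambda>x. f x + \<alpha> * g x)"
    by (rule L2_inner_self[symmetric])
  also have "\<dots> = complex_of_real ((L2_norm M f)\<^sup>2) + \<alpha> * L2_inner M f g + cnj \<alpha> * (cnj (L2_inner M f g) + \<alpha> * complex_of_real ((L2_norm M g)\<^sup>2))"
    unfolding L2_inner_add_left[OF fg assms] L2_inner_add_right[OF assms(1) assms] L2_inner_add_right[OF assms(2) assms]
    unfolding L2_inner_self L2_inner_commute[of M g f] by (rule refl)
  finally have eq: "complex_of_real ((L2_norm M (\<lambda>x. f x + \<alpha> * g x))\<^sup>2) = complex_of_real ((L2_norm M f)\<^sup>2) + \<alpha> * L2_inner M f g + cnj \<alpha> * (cnj (L2_inner M f g) + \<alpha> * complex_of_real ((L2_norm M g)\<^sup>2))" .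
  show ?thesis using arg_cong[OF eq, of Re] by (simp only: Re_complex_of_real Re_quadratic_expansion)
qed

lemma L2_Cauchy_Schwarz:
  assumes "f \<in> L2 M" "g \<in> L2 M"
  shows "cmod (L2_inner M f g) \<le> L2_norm M f * L2_norm M g"
proof -
  have "(cmod (L2_inner M f g))\<^sup>2 \<le> (L2_norm M f)\<^sup>2 * (L2_norm M g)\<^sup>2"
  proof (rule quadratic_discriminant_complex)
    fix \<alpha>
    show "0 \<le> (L2_norm M f)\<^sup>2 + 2 * Re (\<alpha> * L2_inner M f g) + (cmod \<alpha>)\<^sup>2 * (L2_norm M g)\<^sup>2"
      unfolding L2_norm_add_sq[OF assms, symmetric] by simp
  qed simp
  then show ?thesis using L2_norm_nonneg[of M f] L2_norm_nonneg[of M g]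
    by (metis abs_le_square_iff abs_mult abs_norm_cancel abs_of_nonneg power_mult_distrib)
qed

lemma L2_norm_triangle:
  assumes "f \<in> L2 M" "g \<in> L2 M"
  shows "L2_norm M (\<lambda>x. f x - g x) \<le> L2_norm M f + L2_norm M g"
proof -
  have "(L2_norm M (\<lambda>x. f x + (-1) * g x))\<^sup>2 \<le> (L2_norm M f)\<^sup>2 + 2 * (L2_norm M f * L2_norm M g) + (L2_norm M g)\<^sup>2"
    unfolding L2_norm_add_sq[OF assms]
    using L2_Cauchy_Schwarz[OF assms] abs_Re_le_cmod[of "L2_inner M f g"] by simp
  also have "\<dots> = (L2_norm M f + L2_norm M g)\<^sup>2" by (simp add: power2_sum)
  finally show ?thesis using L2_norm_nonneg[of M f] L2_norm_nonneg[of M g]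
    by (simp add: power2_le_iff_abs_le abs_le_iff)
qed

lemma L2_inner_tendsto:
  assumes u: "\<And>n. u n \<in> L2 M" "f \<in> L2 M" "(\<lambda>n. L2_norm M (\<lambda>x. u n x - f x)) \<longlonglongrightarrow> 0"
    and v: "\<And>n. v n \<in> L2 M" "g \<in> L2 M" "(\<lambda>n. L2_norm M (\<lambda>x. v n x - g x)) \<longlonglongrightarrow> 0"
  shows "(\<lambda>n. L2_inner M (u n) (v n)) \<longlonglongrightarrow> L2_inner M f g"
proof (rule LIM_zero_cancel, rule Lim_null_comparison)
  let ?a = "\<lambda>n. L2_norm M (\<lambda>x. u n x - f x)" and ?b = "\<lambda>n. L2_norm M (\<lambda>x. v n x - g x)"
  have "cmod (L2_inner M (u n) (v n) - L2_inner M f g) \<le> ?a n * ?b n + ?a n * L2_norm M g + L2_norm M f * ?b n" for n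
  proof -
    note uf = L2_diff[OF u(1)[of n] u(2)] and vg = L2_diff[OF v(1)[of n] v(2)]
    have "L2_inner M (u n) (v n) - L2_inner M f g = L2_inner M (\<lambda>x. u n x - f x) (\<lambda>x. v n x - g x)
      + L2_inner M (\<lambda>x. u n x - f x) g + L2_inner M f (\<lambda>x. v n x - g x)"
      using L2_inner_diff_right[OF uf v(1)[of n] v(2)] L2_inner_diff_left[OF v(1)[of n] u(1)[of n] u(2)]
        L2_inner_diff_right[OF u(2) v(1)[of n] v(2)] L2_inner_diff_left[OF v(2) u(1)[of n] u(2)] by simp
    then show ?thesis
      using L2_Cauchy_Schwarz[OF uf vg] L2_Cauchy_Schwarz[OF uf v(2)] L2_Cauchy_Schwarz[OF u(2) vg]
      by (smt (verit) norm_triangle_ineq)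
  qed
  then show "\<forall>\<^sub>F n in sequentially. cmod (L2_inner M (u n) (v n) - L2_inner M f g) \<le> ?a n * ?b n + ?a n * L2_norm M g + L2_norm M f * ?b n"
    by simp
  show "(\<lambda>n. ?a n * ?b n + ?a n * L2_norm M g + L2_norm M f * ?b n) \<longlonglongrightarrow> 0"
    using tendsto_add[OF tendsto_add[OF tendsto_mult[OF u(3) v(3)] tendsto_mult_right[OF u(3), of "L2_norm M g"]]
      tendsto_mult_left[OF v(3), of "L2_norm M f"]] by simp
qed

section \<open>Abstract theory: the closure of a semibounded form and its operator\<close>

locale semibounded_operator =
  fixes M :: "'a measure" and D :: "('a \<Rightarrow> complex) set" and A :: "('a \<Rightarrow> complex) \<Rightarrow> ('a \<Rightarrow> complex)" and \<gamma> :: real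
  assumes D_L2: "u \<in> D \<Longrightarrow> u \<in> L2 M" and A_L2: "u \<in> D \<Longrightarrow> A u \<in> L2 M"
    and D_lin: "u \<in> D \<Longrightarrow> v \<in> D \<Longrightarrow> (\<lambda>x. u x + \<alpha> * v x) \<in> D"
    and A_lin: "u \<in> D \<Longrightarrow> v \<in> D \<Longrightarrow> AE x in M. A (\<lambda>x. u x + \<alpha> * v x) x = A u x + \<alpha> * A v x"
    and sym: "u \<in> D \<Longrightarrow> v \<in> D \<Longrightarrow> L2_inner M u (A v) = L2_inner M (A u) v"
    and lower: "u \<in> D \<Longrightarrow> Re (L2_inner M u (A u)) \<ge> \<gamma> * (L2_norm M u)\<^sup>2"
    and D_nonempty: "D \<noteq> {}"
begin

abbreviation "t \<equiv> \<lambda>f g. L2_inner M f (A g)"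

text \<open>The shift by 1 - \<gamma> makes the form dominate the square of the L2 norm
  (\<open>sf_ge\<close>), so that \<open>sn\<close> is a norm stronger than the L2 norm.\<close>

definition sf :: "('a \<Rightarrow> complex) \<Rightarrow> ('a \<Rightarrow> complex) \<Rightarrow> complex" where
  "sf u v = t u v + complex_of_real (1 - \<gamma>) * L2_inner M u v"

definition sn :: "('a \<Rightarrow> complex) \<Rightarrow> real" where
  "sn u = sqrt (Re (sf u u))"

definition form_Cauchy :: "(nat \<Rightarrow> 'a \<Rightarrow> complex) \<Rightarrow> bool" where
  "form_Cauchy u \<longleftrightarrow> (\<forall>n. u n \<in> D) \<and> (\<forall>\<epsilon>>0. \<exists>N. \<forall>m\<ge>N. \<forall>n\<ge>N. sn (\<lambda>x. u n x - u m x) < \<epsilon>)"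

lemma D_diff: "u \<in> D \<Longrightarrow> v \<in> D \<Longrightarrow> (\<lambda>x. u x - v x) \<in> D"
  using D_lin[of u v "-1"] by simp

lemma sf_add_right:
  assumes "u \<in> D" "v \<in> D" "w \<in> D"
  shows "sf u (\<lambda>x. v x + \<alpha> * w x) = sf u v + \<alpha> * sf u w"
proof -
  have "t u (\<lambda>x. v x + \<alpha> * w x) = L2_inner M u (\<lambda>x. A v x + \<alpha> * A w x)"
    by (rule L2_inner_cong_AE[OF D_L2[OF assms(1)] A_L2[OF D_lin[OF assms(2,3)]] D_L2[OF assms(1)]
      L2_add_scale[OF A_L2[OF assms(2)] A_L2[OF assms(3)]] _ A_lin[OF assms(2,3)]]) simp
  also have "\<dots> = t u v + \<alpha> * t u w" using assms by (intro L2_inner_add_right D_L2 A_L2)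
  finally show ?thesis
    using L2_inner_add_right[OF D_L2[OF assms(1)] D_L2[OF assms(2)] D_L2[OF assms(3)], of \<alpha>]
    by (simp add: sf_def algebra_simps)
qed

lemma sf_commute: "u \<in> D \<Longrightarrow> v \<in> D \<Longrightarrow> sf v u = cnj (sf u v)"
  unfolding sf_def sym[of v u] L2_inner_commute[of M "A v" u] L2_inner_commute[of M v u] by simp

lemma sf_add_left:
  assumes "u \<in> D" "v \<in> D" "w \<in> D"
  shows "sf (\<lambda>x. v x + \<alpha> * w x) u = sf v u + cnj \<alpha> * sf w u"
proof -
  have "sf (\<lambda>x. v x + \<alpha> * w x) u = cnj (sf u (\<lambda>x. v x + \<alpha> * w x))" by (intro sf_commute D_lin assms)
  also have "\<dots> = cnj (sf u v) + cnj \<alpha> * cnj (sf u w)" by (simp add: sf_add_right[OF assms])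
  finally show ?thesis by (simp only: sf_commute[OF assms(1,2)] sf_commute[OF assms(1,3)])
qed

lemma sf_diff_right: "u \<in> D \<Longrightarrow> v \<in> D \<Longrightarrow> w \<in> D \<Longrightarrow> sf u (\<lambda>x. v x - w x) = sf u v - sf u w"
  using sf_add_right[of u v w "-1"] by simp

lemma sf_diff_left: "u \<in> D \<Longrightarrow> v \<in> D \<Longrightarrow> w \<in> D \<Longrightarrow> sf (\<lambda>x. v x - w x) u = sf v u - sf w u"
  using sf_add_left[of u v w "-1"] by simp

lemma sf_ge: "u \<in> D \<Longrightarrow> (L2_norm M u)\<^sup>2 \<le> Re (sf u u)"
  using lower[of u] unfolding sf_def L2_inner_self by (simp add: algebra_simps)

lemma sn_sq: "u \<in> D \<Longrightarrow> (sn u)\<^sup>2 = Re (sf u u)"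
  unfolding sn_def using sf_ge[of u] by (simp add: order_trans[OF zero_le_power2])

lemma sf_self: "u \<in> D \<Longrightarrow> sf u u = complex_of_real ((sn u)\<^sup>2)"
  using sf_commute[of u u] by (simp add: sn_sq complex_eq_iff del: of_real_power)

lemma sn_nonneg: "u \<in> D \<Longrightarrow> sn u \<ge> 0"
  unfolding sn_def using sf_ge[of u] by (simp add: order_trans[OF zero_le_power2])

lemma L2_norm_le_sn: "u \<in> D \<Longrightarrow> L2_norm M u \<le> sn u"
  using sf_ge[of u] by (simp add: sn_def real_le_rsqrt)

lemma sn_add_sq:
  assumes "u \<in> D" "v \<in> D"
  shows "(sn (\<lambda>x. u x + \<alpha> * v x))\<^sup>2 = (sn u)\<^sup>2 + 2 * Re (\<alpha> * sf u v) + (cmod \<alpha>)\<^sup>2 * (sn v)\<^sup>2"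
proof -
  note w = D_lin[OF assms, of \<alpha>]
  have "complex_of_real ((sn (\<lambda>x. u x + \<alpha> * v x))\<^sup>2) = sf (\<lambda>x. u x + \<alpha> * v x) (\<lambda>x. u x + \<alpha> * v x)"
    by (rule sf_self[OF w, symmetric])
  also have "\<dots> = complex_of_real ((sn u)\<^sup>2) + \<alpha> * sf u v + cnj \<alpha> * (cnj (sf u v) + \<alpha> * complex_of_real ((sn v)\<^sup>2))"
    unfolding sf_add_left[OF w assms] sf_add_right[OF assms(1) assms] sf_add_right[OF assms(2) assms]
    unfolding sf_self[OF assms(1)] sf_self[OF assms(2)] sf_commute[OF assms] by (rule refl)
  finally have eq: "complex_of_real ((sn (\<lambda>x. u x + \<alpha> * v x))\<^sup>2) = complex_of_real ((sn u)\<^sup>2) + \<alpha> * sf u v + cnj \<alpha> * (cnj (sf u v) + \<alpha> * complex_of_real ((sn v)\<^sup>2))" .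
  show ?thesis using arg_cong[OF eq, of Re] by (simp only: Re_complex_of_real Re_quadratic_expansion)
qed

lemma sf_Cauchy_Schwarz:
  assumes "u \<in> D" "v \<in> D"
  shows "cmod (sf u v) \<le> sn u * sn v"
proof -
  have "(cmod (sf u v))\<^sup>2 \<le> (sn u)\<^sup>2 * (sn v)\<^sup>2"
  proof (rule quadratic_discriminant_complex)
    fix \<alpha>
    show "0 \<le> (sn u)\<^sup>2 + 2 * Re (\<alpha> * sf u v) + (cmod \<alpha>)\<^sup>2 * (sn v)\<^sup>2"
      unfolding sn_add_sq[OF assms, symmetric] by simp
  qed simp
  then show ?thesis using sn_nonneg assms
    by (metis abs_le_square_iff abs_mult abs_norm_cancel abs_of_nonneg power_mult_distrib)
qed

lemma sn_triangle:
  assumes "u \<in> D" "v \<in> D"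
  shows "sn (\<lambda>x. u x + \<alpha> * v x) \<le> sn u + cmod \<alpha> * sn v"
proof -
  have "Re (\<alpha> * sf u v) \<le> cmod (\<alpha> * sf u v)" by (rule complex_Re_le_cmod)
  also have "\<dots> = cmod \<alpha> * cmod (sf u v)" by (rule norm_mult)
  also have "\<dots> \<le> cmod \<alpha> * (sn u * sn v)" by (intro mult_left_mono sf_Cauchy_Schwarz assms norm_ge_zero)
  finally have "Re (\<alpha> * sf u v) \<le> cmod \<alpha> * (sn u * sn v)" .
  then have "(sn (\<lambda>x. u x + \<alpha> * v x))\<^sup>2 \<le> (sn u + cmod \<alpha> * sn v)\<^sup>2"
    unfolding sn_add_sq[OF assms] by (simp add: power2_sum power_mult_distrib algebra_simps)
  then show ?thesis using sn_nonneg[OF assms(1)] sn_nonneg[OF assms(2)]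
    by (auto intro: power2_le_imp_le)
qed

lemma sn_diff_le: "u \<in> D \<Longrightarrow> v \<in> D \<Longrightarrow> sn (\<lambda>x. u x - v x) \<le> sn u + sn v"
  using sn_triangle[of u v "-1"] by simp

text \<open>\<open>form_conv\<close> demands smallness of the unshifted form only; the shift term is
  small because the sequence also converges in L2.\<close>

lemma form_conv_Cauchy:
  assumes "form_conv M D t u f"
  shows "form_Cauchy u"
  unfolding form_Cauchy_def
proof (intro conjI allI impI)
  have uD: "\<And>n. u n \<in> D" and f: "f \<in> L2 M" and lim: "(\<lambda>n. L2_norm M (\<lambda>x. u n x - f x)) \<longlonglongrightarrow> 0"
    and ct: "\<And>\<epsilon>. \<epsilon> > 0 \<Longrightarrow> \<exists>N. \<forall>m\<ge>N. \<forall>n\<ge>N. cmod (t (\<lambda>x. u n x - u m x) (\<lambda>x. u n x - u m x)) < \<epsilon>"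
    using assms by (auto simp: form_conv_def)
  show "u n \<in> D" for n by (rule uD)
  fix \<epsilon> :: real assume eps: "\<epsilon> > 0"
  obtain N1 where N1: "\<forall>m\<ge>N1. \<forall>n\<ge>N1. cmod (t (\<lambda>x. u n x - u m x) (\<lambda>x. u n x - u m x)) < \<epsilon>\<^sup>2 / 2"
    using ct[of "\<epsilon>\<^sup>2 / 2"] eps by auto
  define K where "K = \<bar>1 - \<gamma>\<bar> + 1"
  have K: "K \<ge> 1" "1 - \<gamma> \<le> K" by (auto simp: K_def)
  \<comment> \<open>\<open>K\<close> is at least 1 and at least 1 - \<gamma>, so this \<eta> makes
    the shift term at most \<epsilon>^2/(4K), within the \<epsilon>^2/2 that is available.\<close>
  define \<eta> where "\<eta> = \<epsilon> / (2 * K)"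
  have \<eta>: "\<eta> > 0" using eps K by (simp add: \<eta>_def)
  have "\<forall>\<^sub>F n in sequentially. L2_norm M (\<lambda>x. u n x - f x) < \<eta> / 2"
    using order_tendstoD(2)[OF lim, of "\<eta> / 2"] \<eta> by simp
  then obtain N2 where N2: "\<And>n. n \<ge> N2 \<Longrightarrow> L2_norm M (\<lambda>x. u n x - f x) < \<eta> / 2"
    by (auto simp: eventually_sequentially)
  show "\<exists>N. \<forall>m\<ge>N. \<forall>n\<ge>N. sn (\<lambda>x. u n x - u m x) < \<epsilon>"
  proof (intro exI[of _ "max N1 N2"] allI impI)
    fix m n assume mn: "max N1 N2 \<le> m" "max N1 N2 \<le> n"
    let ?w = "\<lambda>x. u n x - u m x"
    have wD: "?w \<in> D" by (intro D_diff uD)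
    have "L2_norm M ?w = L2_norm M (\<lambda>x. (u n x - f x) - (u m x - f x))" by simp
    also have "\<dots> \<le> L2_norm M (\<lambda>x. u n x - f x) + L2_norm M (\<lambda>x. u m x - f x)"
      by (rule L2_norm_triangle[OF L2_diff[OF D_L2[OF uD] f] L2_diff[OF D_L2[OF uD] f]])
    also have "\<dots> < \<eta>" using N2[of m] N2[of n] mn by simp
    finally have w: "L2_norm M ?w < \<eta>" .
    have "(sn ?w)\<^sup>2 = Re (t ?w ?w) + (1 - \<gamma>) * (L2_norm M ?w)\<^sup>2"
      unfolding sn_sq[OF wD] sf_def L2_inner_self by simp
    also have "\<dots> < \<epsilon>\<^sup>2 / 2 + \<epsilon>\<^sup>2 / 2"
    proof (rule add_less_le_mono)
      show "Re (t ?w ?w) < \<epsilon>\<^sup>2 / 2" using mn by (intro le_less_trans[OF complex_Re_le_cmod] N1[rule_format]) auto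
      have "(1 - \<gamma>) * (L2_norm M ?w)\<^sup>2 \<le> K * \<eta>\<^sup>2"
        using w L2_norm_nonneg[of M ?w] K by (intro mult_mono power_mono) auto
      also have "\<dots> = \<epsilon>\<^sup>2 / (4 * K)" using K by (simp add: \<eta>_def power2_eq_square)
      also have "\<dots> \<le> \<epsilon>\<^sup>2 / 2" using K by (intro divide_left_mono) auto
      finally show "(1 - \<gamma>) * (L2_norm M ?w)\<^sup>2 \<le> \<epsilon>\<^sup>2 / 2" .
    qed
    finally have "(sn ?w)\<^sup>2 < \<epsilon>\<^sup>2" by simp
    then show "sn ?w < \<epsilon>" using eps by (simp add: power2_less_imp_less)
  qed
qed

lemma form_Cauchy_bounded:
  assumes "form_Cauchy u"
  obtains B where "B > 0" "\<And>n. sn (u n) \<le> B"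
proof -
  have uD: "\<And>n. u n \<in> D" using assms by (simp add: form_Cauchy_def)
  obtain N where N: "\<forall>m\<ge>N. \<forall>n\<ge>N. sn (\<lambda>x. u n x - u m x) < 1"
    using assms by (auto simp: form_Cauchy_def dest!: spec[of _ "1::real"])
  have *: "sn (u n) \<le> 1 + sn (u N)" if "n \<ge> N" for n
  proof -
    have "sn (\<lambda>x. (u n x - u N x) + 1 * u N x) \<le> sn (\<lambda>x. u n x - u N x) + cmod 1 * sn (u N)"
      by (intro sn_triangle D_diff uD)
    also have "\<dots> \<le> 1 + sn (u N)" using N that by (simp add: less_imp_le)
    finally show ?thesis by simp
  qed
  define B where "B = 1 + Max ((\<lambda>n. sn (u n)) ` {..N})"
  have "sn (u n) \<le> B" for n
  proof (cases "n \<le> N")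
    case True
    then have "sn (u n) \<le> Max ((\<lambda>n. sn (u n)) ` {..N})" by (intro Max_ge) auto
    then show ?thesis by (simp add: B_def)
  next
    case False
    have "sn (u N) \<le> Max ((\<lambda>n. sn (u n)) ` {..N})" by (intro Max_ge) auto
    then show ?thesis using *[of n] False unfolding B_def by linarith
  qed
  then have "sn (u n) \<le> \<bar>B\<bar> + 1" for n using abs_ge_self[of B] by (meson add_increasing2 order_trans zero_le_one)
  then show ?thesis by (rule that[of "\<bar>B\<bar> + 1", rotated]) simp
qed

text \<open>Closability. The form comes from an operator, so for fixed n the number
  \<open>sf (z m) (z n)\<close> is a combination of L2 inner products of \<open>z m\<close> with
  fixed functions and tends to 0 as m grows. Up to the difference of \<open>z n\<close> and
  \<open>z m\<close>, small in the form norm, it is the square of \<open>sn (z n)\<close>.\<close>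

lemma form_Cauchy_null:
  assumes z: "form_Cauchy z" and lim: "(\<lambda>n. L2_norm M (z n)) \<longlonglongrightarrow> 0"
  shows "(\<lambda>n. sn (z n)) \<longlonglongrightarrow> 0"
proof (rule LIMSEQ_I)
  fix \<epsilon> :: real assume eps: "\<epsilon> > 0"
  have zD: "\<And>n. z n \<in> D" using z by (simp add: form_Cauchy_def)
  obtain B where B: "B > 0" "\<And>n. sn (z n) \<le> B" by (rule form_Cauchy_bounded[OF z]) blast
  obtain N where N: "\<forall>m\<ge>N. \<forall>n\<ge>N. sn (\<lambda>x. z n x - z m x) < \<epsilon>\<^sup>2 / (2 * B)"
    using z eps B(1) by (auto simp: form_Cauchy_def dest!: spec[of _ "\<epsilon>\<^sup>2 / (2 * B)"])
  show "\<exists>N. \<forall>n\<ge>N. norm (sn (z n) - 0) < \<epsilon>"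
  proof (intro exI[of _ N] allI impI)
    fix n assume n: "n \<ge> N"
    have lim0: "(\<lambda>m. sf (z m) (z n)) \<longlonglongrightarrow> 0"
    proof -
      have 1: "(\<lambda>m. L2_inner M (z m) w) \<longlonglongrightarrow> 0" if w: "w \<in> L2 M" for w
      proof (rule Lim_null_comparison)
        show "\<forall>\<^sub>F m in sequentially. norm (L2_inner M (z m) w) \<le> L2_norm M (z m) * L2_norm M w"
          using L2_Cauchy_Schwarz[OF D_L2[OF zD] w] by simp
        show "(\<lambda>m. L2_norm M (z m) * L2_norm M w) \<longlonglongrightarrow> 0" using tendsto_mult_right[OF lim] by simp
      qed
      show ?thesis unfolding sf_def
        using tendsto_add[OF 1[OF A_L2[OF zD]] tendsto_mult_left[OF 1[OF D_L2[OF zD]]]] by simp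
    qed
    have "(sn (z n))\<^sup>2 - Re (sf (z m) (z n)) \<le> \<epsilon>\<^sup>2 / 2" if "m \<ge> N" for m
    proof -
      have "(sn (z n))\<^sup>2 - Re (sf (z m) (z n)) = Re (sf (\<lambda>x. z n x - z m x) (z n))"
        by (simp add: sn_sq zD sf_diff_left)
      also have "\<dots> \<le> sn (\<lambda>x. z n x - z m x) * sn (z n)"
        using complex_Re_le_cmod sf_Cauchy_Schwarz[OF D_diff[OF zD zD] zD] by (rule order_trans)
      also have "\<dots> \<le> \<epsilon>\<^sup>2 / (2 * B) * B"
        using N n that B sn_nonneg[OF zD] sn_nonneg[OF D_diff[OF zD zD]] by (intro mult_mono) (auto simp: less_imp_le)
      finally show ?thesis using B by simp
    qed
    then have ev: "\<exists>N. \<forall>m\<ge>N. (sn (z n))\<^sup>2 - Re (sf (z m) (z n)) \<le> \<epsilon>\<^sup>2 / 2" by blast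
    have lim1: "(\<lambda>m. (sn (z n))\<^sup>2 - Re (sf (z m) (z n))) \<longlonglongrightarrow> (sn (z n))\<^sup>2 - Re 0"
      by (intro tendsto_diff tendsto_const tendsto_Re lim0)
    have "(sn (z n))\<^sup>2 \<le> \<epsilon>\<^sup>2 / 2" using LIMSEQ_le_const2[OF lim1 ev] by simp
    also have "\<dots> < \<epsilon>\<^sup>2" using eps by simp
    finally show "norm (sn (z n) - 0) < \<epsilon>" using eps sn_nonneg[OF zD] by (simp add: power2_less_imp_less)
  qed
qed

lemma form_Cauchy_diff:
  assumes u: "form_Cauchy u" and v: "form_Cauchy v"
  shows "form_Cauchy (\<lambda>n x. u n x - v n x)"
  unfolding form_Cauchy_def
proof (intro conjI allI impI)
  have D: "\<And>n. u n \<in> D" "\<And>n. v n \<in> D" using u v by (auto simp: form_Cauchy_def)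
  then show "(\<lambda>x. u n x - v n x) \<in> D" for n by (intro D_diff)
  fix \<epsilon> :: real assume eps: "\<epsilon> > 0"
  obtain N1 where N1: "\<forall>m\<ge>N1. \<forall>n\<ge>N1. sn (\<lambda>x. u n x - u m x) < \<epsilon> / 2"
    using u eps by (auto simp: form_Cauchy_def dest!: spec[of _ "\<epsilon> / 2"])
  obtain N2 where N2: "\<forall>m\<ge>N2. \<forall>n\<ge>N2. sn (\<lambda>x. v n x - v m x) < \<epsilon> / 2"
    using v eps by (auto simp: form_Cauchy_def dest!: spec[of _ "\<epsilon> / 2"])
  show "\<exists>N. \<forall>m\<ge>N. \<forall>n\<ge>N. sn (\<lambda>x. u n x - v n x - (u m x - v m x)) < \<epsilon>"
  proof (intro exI[of _ "max N1 N2"] allI impI)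
    fix m n assume mn: "max N1 N2 \<le> m" "max N1 N2 \<le> n"
    have "sn (\<lambda>x. (u n x - u m x) - (v n x - v m x)) \<le> sn (\<lambda>x. u n x - u m x) + sn (\<lambda>x. v n x - v m x)"
      by (intro sn_diff_le D_diff D)
    also have "\<dots> < \<epsilon> / 2 + \<epsilon> / 2" using N1 N2 mn by (intro add_strict_mono) auto
    finally show "sn (\<lambda>x. u n x - v n x - (u m x - v m x)) < \<epsilon>" by (simp add: algebra_simps)
  qed
qed

lemma form_conv_diff_null:
  assumes "form_conv M D t u f" "form_conv M D t v f"
  shows "(\<lambda>n. sn (\<lambda>x. u n x - v n x)) \<longlonglongrightarrow> 0"
proof (rule form_Cauchy_null)
  show "form_Cauchy (\<lambda>n x. u n x - v n x)" by (intro form_Cauchy_diff form_conv_Cauchy[OF assms(1)] form_conv_Cauchy[OF assms(2)])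
  have D: "\<And>n. u n \<in> D" "\<And>n. v n \<in> D" "f \<in> L2 M"
    and l: "(\<lambda>n. L2_norm M (\<lambda>x. u n x - f x)) \<longlonglongrightarrow> 0" "(\<lambda>n. L2_norm M (\<lambda>x. v n x - f x)) \<longlonglongrightarrow> 0"
    using assms by (auto simp: form_conv_def)
  show "(\<lambda>n. L2_norm M (\<lambda>x. u n x - v n x)) \<longlonglongrightarrow> 0"
  proof (rule Lim_null_comparison)
    show "(\<lambda>n. L2_norm M (\<lambda>x. u n x - f x) + L2_norm M (\<lambda>x. v n x - f x)) \<longlonglongrightarrow> 0"
      using tendsto_add[OF l] by simp
    have "L2_norm M (\<lambda>x. (u n x - f x) - (v n x - f x)) \<le> L2_norm M (\<lambda>x. u n x - f x) + L2_norm M (\<lambda>x. v n x - f x)" for n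
      by (intro L2_norm_triangle L2_diff D_L2 D)
    then show "\<forall>\<^sub>F n in sequentially. norm (L2_norm M (\<lambda>x. u n x - v n x)) \<le> L2_norm M (\<lambda>x. u n x - f x) + L2_norm M (\<lambda>x. v n x - f x)"
      by (simp add: L2_norm_nonneg)
  qed
qed

text \<open>Independence of the approximating sequences; together with \<open>sf_Cauchy\<close> it
  gives the definite description in \<open>form_closure\<close> a meaning.\<close>

lemma sf_tendsto_unique:
  assumes u: "form_conv M D t u f" "form_conv M D t u' f" and v: "form_conv M D t v g" "form_conv M D t v' g"
  shows "(\<lambda>n. sf (u n) (v n) - sf (u' n) (v' n)) \<longlonglongrightarrow> 0"
proof -
  have D: "\<And>n. u n \<in> D" "\<And>n. u' n \<in> D" "\<And>n. v n \<in> D" "\<And>n. v' n \<in> D"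
    using u v by (auto simp: form_conv_def)
  obtain B where B: "B > 0" "\<And>n. sn (v n) \<le> B" by (rule form_Cauchy_bounded[OF form_conv_Cauchy[OF v(1)]]) blast
  obtain B' where B': "B' > 0" "\<And>n. sn (u' n) \<le> B'" by (rule form_Cauchy_bounded[OF form_conv_Cauchy[OF u(2)]]) blast
  have "cmod (sf (u n) (v n) - sf (u' n) (v' n)) \<le> sn (\<lambda>x. u n x - u' n x) * B + B' * sn (\<lambda>x. v n x - v' n x)" for n
  proof -
    have "sf (u n) (v n) - sf (u' n) (v' n) = sf (\<lambda>x. u n x - u' n x) (v n) + sf (u' n) (\<lambda>x. v n x - v' n x)"
      by (simp add: sf_diff_left sf_diff_right D)
    then have "cmod (sf (u n) (v n) - sf (u' n) (v' n)) \<le> cmod (sf (\<lambda>x. u n x - u' n x) (v n)) + cmod (sf (u' n) (\<lambda>x. v n x - v' n x))"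
      by (simp add: norm_triangle_ineq)
    also have "\<dots> \<le> sn (\<lambda>x. u n x - u' n x) * sn (v n) + sn (u' n) * sn (\<lambda>x. v n x - v' n x)"
      by (intro add_mono sf_Cauchy_Schwarz D_diff D)
    also have "\<dots> \<le> sn (\<lambda>x. u n x - u' n x) * B + B' * sn (\<lambda>x. v n x - v' n x)"
      by (intro add_mono mult_left_mono mult_right_mono B B' sn_nonneg D_diff D)
    finally show ?thesis .
  qed
  then have ev: "\<forall>\<^sub>F n in sequentially. norm (sf (u n) (v n) - sf (u' n) (v' n)) \<le> sn (\<lambda>x. u n x - u' n x) * B + B' * sn (\<lambda>x. v n x - v' n x)"
    by simp
  have "(\<lambda>n. sn (\<lambda>x. u n x - u' n x) * B + B' * sn (\<lambda>x. v n x - v' n x)) \<longlonglongrightarrow> 0"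
    using tendsto_add[OF tendsto_mult_right[OF form_conv_diff_null[OF u], of B] tendsto_mult_left[OF form_conv_diff_null[OF v], of B']]
    by simp
  with ev show ?thesis by (rule Lim_null_comparison)
qed

lemma sf_Cauchy:
  assumes u: "form_Cauchy u" and v: "form_Cauchy v"
  shows "Cauchy (\<lambda>n. sf (u n) (v n))"
proof (rule CauchyI)
  fix \<epsilon> :: real assume eps: "\<epsilon> > 0"
  have D: "\<And>n. u n \<in> D" "\<And>n. v n \<in> D" using u v by (auto simp: form_Cauchy_def)
  obtain B where B: "B > 0" "\<And>n. sn (v n) \<le> B" by (rule form_Cauchy_bounded[OF v]) blast
  obtain B' where B': "B' > 0" "\<And>n. sn (u n) \<le> B'" by (rule form_Cauchy_bounded[OF u]) blast
  obtain N1 where N1: "\<forall>m\<ge>N1. \<forall>n\<ge>N1. sn (\<lambda>x. u n x - u m x) < \<epsilon> / (2 * B)"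
    using u eps B by (auto simp: form_Cauchy_def dest!: spec[of _ "\<epsilon> / (2 * B)"])
  obtain N2 where N2: "\<forall>m\<ge>N2. \<forall>n\<ge>N2. sn (\<lambda>x. v n x - v m x) < \<epsilon> / (2 * B')"
    using v eps B' by (auto simp: form_Cauchy_def dest!: spec[of _ "\<epsilon> / (2 * B')"])
  show "\<exists>N. \<forall>m\<ge>N. \<forall>n\<ge>N. norm (sf (u m) (v m) - sf (u n) (v n)) < \<epsilon>"
  proof (intro exI[of _ "max N1 N2"] allI impI)
    fix m n assume mn: "max N1 N2 \<le> m" "max N1 N2 \<le> n"
    have "sf (u m) (v m) - sf (u n) (v n) = sf (\<lambda>x. u m x - u n x) (v m) + sf (u n) (\<lambda>x. v m x - v n x)"
      by (simp add: sf_diff_left sf_diff_right D)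
    then have "cmod (sf (u m) (v m) - sf (u n) (v n)) \<le> cmod (sf (\<lambda>x. u m x - u n x) (v m)) + cmod (sf (u n) (\<lambda>x. v m x - v n x))"
      by (simp add: norm_triangle_ineq)
    also have "\<dots> \<le> sn (\<lambda>x. u m x - u n x) * sn (v m) + sn (u n) * sn (\<lambda>x. v m x - v n x)"
      by (intro add_mono sf_Cauchy_Schwarz D_diff D)
    also have "\<dots> \<le> sn (\<lambda>x. u m x - u n x) * B + B' * sn (\<lambda>x. v m x - v n x)"
      by (intro add_mono mult_left_mono mult_right_mono B B' sn_nonneg D_diff D)
    also have "\<dots> < \<epsilon> / (2 * B) * B + B' * (\<epsilon> / (2 * B'))"
      using N1 N2 mn B B' by (intro add_strict_mono mult_strict_left_mono mult_strict_right_mono) auto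
    also have "\<dots> = \<epsilon>" using B B' by simp
    finally show "norm (sf (u m) (v m) - sf (u n) (v n)) < \<epsilon>" .
  qed
qed

lemma form_conv_inner_tendsto:
  assumes "form_conv M D t u f" "form_conv M D t v g"
  shows "(\<lambda>n. L2_inner M (u n) (v n)) \<longlonglongrightarrow> L2_inner M f g"
  using assms D_L2 by (intro L2_inner_tendsto) (auto simp: form_conv_def)

lemma form_closure_limit:
  assumes u: "form_conv M D t u f" and v: "form_conv M D t v g"
  shows "(\<lambda>n. t (u n) (v n)) \<longlonglongrightarrow> form_closure M D t f g"
proof -
  have ts: "t u v = sf u v - complex_of_real (1 - \<gamma>) * L2_inner M u v" for u v by (simp add: sf_def)
  obtain l where l: "(\<lambda>n. sf (u n) (v n)) \<longlonglongrightarrow> l"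
    using sf_Cauchy[OF form_conv_Cauchy[OF u] form_conv_Cauchy[OF v]] by (auto simp: Cauchy_convergent_iff convergent_def)
  let ?l = "l - complex_of_real (1 - \<gamma>) * L2_inner M f g"
  have lim: "(\<lambda>n. t (u n) (v n)) \<longlonglongrightarrow> ?l"
    unfolding ts by (intro tendsto_diff tendsto_mult tendsto_const l form_conv_inner_tendsto[OF u v])
  have "form_closure M D t f g = ?l"
    unfolding form_closure_def
  proof (rule the_equality)
    show "\<exists>u v. form_conv M D t u f \<and> form_conv M D t v g \<and> (\<lambda>n. t (u n) (v n)) \<longlonglongrightarrow> ?l"
      using u v lim by blast
    fix k assume "\<exists>u v. form_conv M D t u f \<and> form_conv M D t v g \<and> (\<lambda>n. t (u n) (v n)) \<longlonglongrightarrow> k"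
    then obtain u' v' where u': "form_conv M D t u' f" and v': "form_conv M D t v' g"
      and k: "(\<lambda>n. t (u' n) (v' n)) \<longlonglongrightarrow> k" by blast
    have "(\<lambda>n. sf (u' n) (v' n) + (sf (u n) (v n) - sf (u' n) (v' n)))
      \<longlonglongrightarrow> (k + complex_of_real (1 - \<gamma>) * L2_inner M f g) + 0"
      unfolding sf_def[of "u' _"]
      by (intro tendsto_add tendsto_mult tendsto_const k form_conv_inner_tendsto[OF u' v'])
        (use sf_tendsto_unique[OF u u' v v'] in \<open>simp add: sf_def\<close>)
    then have "(\<lambda>n. sf (u n) (v n)) \<longlonglongrightarrow> k + complex_of_real (1 - \<gamma>) * L2_inner M f g" by simp
    then show "k = ?l" using LIMSEQ_unique[OF l] by simp
  qed
  then show ?thesis using lim by simp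
qed

lemma form_conv_const: "\<phi> \<in> D \<Longrightarrow> form_conv M D t (\<lambda>_. \<phi>) \<phi>"
  unfolding form_conv_def by (auto simp: D_L2 L2_norm_def L2_inner_def)

text \<open>Elements of \<open>D\<close> are approximated by constant sequences. Testing with them
  places the Friedrichs extension inside the adjoint of \<open>A\<close>, which later identifies its
  elements as weak solutions.\<close>

lemma friedrichs_extD:
  assumes "(f, h) \<in> friedrichs_ext M D A"
  shows "f \<in> L2 M" "h \<in> L2 M" "\<exists>u. form_conv M D t u f" "\<phi> \<in> D \<Longrightarrow> L2_inner M (A \<phi>) f = L2_inner M \<phi> h"
proof -
  have fh: "f \<in> form_closure_dom M D t" "h \<in> L2 M" "\<And>g. g \<in> form_closure_dom M D t \<Longrightarrow> form_closure M D t g f = L2_inner M g h"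
    using assms by (auto simp: friedrichs_ext_def form_operator_def Let_def)
  then obtain u where u: "form_conv M D t u f" by (auto simp: form_closure_dom_def)
  then show "\<exists>u. form_conv M D t u f" "f \<in> L2 M" "h \<in> L2 M" using fh by (auto simp: form_conv_def)
  assume phi: "\<phi> \<in> D"
  have "\<phi> \<in> form_closure_dom M D t" using form_conv_const[OF phi] by (auto simp: form_closure_dom_def)
  then have "(\<lambda>n. t \<phi> (u n)) \<longlonglongrightarrow> L2_inner M \<phi> h"
    using form_closure_limit[OF form_conv_const[OF phi] u] fh(3) by simp
  moreover have "(\<lambda>n. t \<phi> (u n)) \<longlonglongrightarrow> L2_inner M (A \<phi>) f"
  proof -
    have uD: "\<And>n. u n \<in> D" using u by (simp add: form_conv_def)
    have "(\<lambda>n. L2_inner M (A \<phi>) (u n)) \<longlonglongrightarrow> L2_inner M (A \<phi>) f"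
      using u by (intro L2_inner_tendsto) (auto simp: form_conv_def D_L2 A_L2 phi L2_norm_def)
    then show ?thesis by (simp add: sym[OF phi uD])
  qed
  ultimately show "L2_inner M (A \<phi>) f = L2_inner M \<phi> h" by (rule LIMSEQ_unique[symmetric])
qed

lemma form_conv_cong_AE:
  assumes "form_conv M D t u f" "g \<in> L2 M" "AE x in M. f x = g x"
  shows "form_conv M D t u g"
proof -
  have "L2_norm M (\<lambda>x. u n x - g x) = L2_norm M (\<lambda>x. u n x - f x)" for n
    by (rule L2_norm_cong_AE) (use assms D_L2 in \<open>auto simp: form_conv_def intro!: L2_diff\<close>)
  then show ?thesis using assms(1,2) by (simp add: form_conv_def)
qed

lemma friedrichs_ext_cong_AE:
  assumes fh: "(f, h) \<in> friedrichs_ext M D A" and g: "g \<in> L2 M" "AE x in M. f x = g x"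
    and k: "k \<in> L2 M" "AE x in M. h x = k x"
  shows "(g, k) \<in> friedrichs_ext M D A"
proof -
  have f: "f \<in> L2 M" "h \<in> L2 M" by (rule friedrichs_extD[OF fh])+
  have eq: "form_conv M D t u f \<longleftrightarrow> form_conv M D t u g" for u
  proof
    assume "form_conv M D t u g"
    moreover have "AE x in M. g x = f x" using g(2) by eventually_elim simp
    ultimately show "form_conv M D t u f" using f(1) form_conv_cong_AE by blast
  qed (rule form_conv_cong_AE[OF _ g])
  have "g \<in> form_closure_dom M D t"
    using fh by (auto simp: friedrichs_ext_def form_operator_def form_closure_dom_def Let_def eq)
  moreover have "form_closure M D t w g = L2_inner M w k" if w: "w \<in> form_closure_dom M D t" for w
  proof -
    have wL: "w \<in> L2 M" using w by (auto simp: form_closure_dom_def form_conv_def)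
    have "form_closure M D t w g = form_closure M D t w f" by (simp add: form_closure_def eq)
    also have "\<dots> = L2_inner M w h" using fh w by (auto simp: friedrichs_ext_def form_operator_def Let_def)
    also have "\<dots> = L2_inner M w k" by (rule L2_inner_cong_AE) (use wL f k in auto)
    finally show ?thesis .
  qed
  ultimately show ?thesis using k by (auto simp: friedrichs_ext_def form_operator_def Let_def)
qed

text \<open>A minimizing sequence of \<open>u \<mapsto> sf[u] - 2 Re \<langle>u, k\<rangle>\<close> is Cauchy for the form by the parallelogram
  identity, and its limit solves the equation.\<close>

lemma friedrichs_ext_solvable:
  assumes complete: "\<And>u. form_Cauchy u \<Longrightarrow> \<exists>f\<in>L2 M. (\<lambda>n. L2_norm M (\<lambda>x. u n x - f x)) \<longlonglongrightarrow> 0"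
    and k: "k \<in> L2 M"
  obtains f where "(f, \<lambda>x. k x + complex_of_real (\<gamma> - 1) * f x) \<in> friedrichs_ext M D A"
proof -
  define J where "J u = (sn u)\<^sup>2 - 2 * Re (L2_inner M u k)" for u
  have Jge: "J u \<ge> - (L2_norm M k)\<^sup>2" if "u \<in> D" for u
  proof -
    have "Re (L2_inner M u k) \<le> L2_norm M u * L2_norm M k"
      using complex_Re_le_cmod L2_Cauchy_Schwarz[OF D_L2[OF that] k] by (rule order_trans)
    also have "\<dots> \<le> sn u * L2_norm M k" by (intro mult_right_mono L2_norm_le_sn that L2_norm_nonneg)
    finally have "Re (L2_inner M u k) \<le> sn u * L2_norm M k" .
    then have "J u + (L2_norm M k)\<^sup>2 \<ge> (sn u - L2_norm M k)\<^sup>2" by (simp add: J_def power2_diff)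
    then show ?thesis using zero_le_power2[of "sn u - L2_norm M k"] by linarith
  qed
  define m where "m = Inf (J ` D)"
  have bdd: "bdd_below (J ` D)" using Jge by (intro bdd_belowI2) auto
  have mJ: "m \<le> J u" if "u \<in> D" for u unfolding m_def using bdd that by (intro cInf_lower) auto
  have "\<exists>u\<in>D. J u < m + 1 / real (Suc n)" for n
    using cInf_lessD[of "J ` D" "m + 1 / real (Suc n)"] D_nonempty by (auto simp: m_def)
  then obtain u where u: "\<And>n. u n \<in> D" "\<And>n. J (u n) < m + 1 / real (Suc n)" by metis
  have half: "sn (\<lambda>x. u n x - u l x) \<le> sqrt (2 * (1 / real (Suc n)) + 2 * (1 / real (Suc l)))" for n l
  proof -
    define d where "d = (\<lambda>x. u n x - u l x)"
    have dD: "d \<in> D" unfolding d_def by (intro D_diff u)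
    define w where "w = (\<lambda>x. u l x + (1/2) * d x)"
    have wD: "w \<in> D" unfolding w_def by (intro D_lin u dD)
    have n: "u n = (\<lambda>x. u l x + 1 * d x)" by (simp add: d_def)
    have "(sn (u n))\<^sup>2 = (sn (u l))\<^sup>2 + 2 * Re (sf (u l) d) + (sn d)\<^sup>2"
      using sn_add_sq[OF u(1)[of l] dD, of 1] unfolding n[symmetric] by simp
    moreover have "(sn w)\<^sup>2 = (sn (u l))\<^sup>2 + Re (sf (u l) d) + (sn d)\<^sup>2 / 4"
      unfolding w_def sn_add_sq[OF u(1)[of l] dD] by (simp add: power2_eq_square norm_divide)
    moreover have "Re (L2_inner M (u n) k) = Re (L2_inner M (u l) k) + Re (L2_inner M d k)"
      using L2_inner_add_left[OF k D_L2[OF u(1)[of l]] D_L2[OF dD], of 1] unfolding n[symmetric] by simp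
    moreover have "Re (L2_inner M w k) = Re (L2_inner M (u l) k) + Re (L2_inner M d k) / 2"
      unfolding w_def L2_inner_add_left[OF k D_L2[OF u(1)[of l]] D_L2[OF dD]] by simp
    ultimately have "(sn d)\<^sup>2 = 2 * J (u n) + 2 * J (u l) - 4 * J w" by (simp add: J_def)
    also have "\<dots> \<le> 2 * (1 / real (Suc n)) + 2 * (1 / real (Suc l))"
      using u(2)[of n] u(2)[of l] mJ[OF wD] by linarith
    finally show ?thesis unfolding d_def[symmetric] by (rule real_le_rsqrt)
  qed
  have Cau: "form_Cauchy u"
    unfolding form_Cauchy_def
  proof (intro conjI allI impI u(1))
    fix \<epsilon> :: real assume eps: "\<epsilon> > 0"
    obtain N where N: "inverse (real (Suc N)) < \<epsilon>\<^sup>2 / 4" using reals_Archimedean[of "\<epsilon>\<^sup>2 / 4"] eps by auto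
    show "\<exists>N. \<forall>m\<ge>N. \<forall>n\<ge>N. sn (\<lambda>x. u n x - u m x) < \<epsilon>"
    proof (intro exI[of _ N] allI impI)
      fix l n assume ln: "N \<le> l" "N \<le> n"
      have "1 / real (Suc n) \<le> 1 / real (Suc N)" "1 / real (Suc l) \<le> 1 / real (Suc N)"
        using ln by (auto intro!: divide_left_mono)
      then have "2 * (1 / real (Suc n)) + 2 * (1 / real (Suc l)) < \<epsilon>\<^sup>2" using N unfolding inverse_eq_divide by linarith
      then have "sqrt (2 * (1 / real (Suc n)) + 2 * (1 / real (Suc l))) < sqrt (\<epsilon>\<^sup>2)" by (rule real_sqrt_less_mono)
      then show "sn (\<lambda>x. u n x - u l x) < \<epsilon>" using half[of n l] eps by simp
    qed
  qed
  then obtain f where f: "f \<in> L2 M" "(\<lambda>n. L2_norm M (\<lambda>x. u n x - f x)) \<longlonglongrightarrow> 0" using complete by blast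
  have conv: "form_conv M D t u f"
    unfolding form_conv_def
  proof (intro conjI allI impI u f)
    fix \<epsilon> :: real assume eps: "\<epsilon> > 0"
    define C where "C = 1 + \<bar>1 - \<gamma>\<bar>"
    have C: "C > 0" by (simp add: C_def add_pos_nonneg)
    obtain N where N: "\<forall>m\<ge>N. \<forall>n\<ge>N. sn (\<lambda>x. u n x - u m x) < sqrt (\<epsilon> / C)"
      using Cau eps C by (auto simp: form_Cauchy_def dest!: spec[of _ "sqrt (\<epsilon> / C)"])
    show "\<exists>N. \<forall>m\<ge>N. \<forall>n\<ge>N. cmod (t (\<lambda>x. u n x - u m x) (\<lambda>x. u n x - u m x)) < \<epsilon>"
    proof (intro exI[of _ N] allI impI)
      fix l n assume ln: "N \<le> l" "N \<le> n"
      let ?w = "\<lambda>x. u n x - u l x"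
      have wD: "?w \<in> D" by (intro D_diff u)
      have "t ?w ?w = sf ?w ?w - complex_of_real (1 - \<gamma>) * complex_of_real ((L2_norm M ?w)\<^sup>2)"
        by (simp add: sf_def L2_inner_self)
      then have "cmod (t ?w ?w) \<le> cmod (sf ?w ?w) + \<bar>1 - \<gamma>\<bar> * (L2_norm M ?w)\<^sup>2"
        by (metis (no_types, lifting) abs_of_nonneg norm_mult norm_of_real norm_triangle_ineq4 zero_le_power2)
      also have "\<dots> \<le> sn ?w * sn ?w + \<bar>1 - \<gamma>\<bar> * (sn ?w)\<^sup>2"
        by (intro add_mono mult_left_mono power_mono sf_Cauchy_Schwarz wD L2_norm_le_sn L2_norm_nonneg) auto
      also have "\<dots> = C * (sn ?w)\<^sup>2" by (simp add: C_def power2_eq_square algebra_simps)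
      also have "\<dots> < C * (sqrt (\<epsilon> / C))\<^sup>2"
        using N ln C sn_nonneg[OF wD] by (intro mult_strict_left_mono power_strict_mono) auto
      also have "\<dots> = \<epsilon>" using eps C by simp
      finally show "cmod (t ?w ?w) < \<epsilon>" .
    qed
  qed
  \<comment> \<open>Perturbing the near-minimizer \<open>u n\<close> by \<alpha> \<phi> can lower
    \<open>J\<close> by at most 1/(n+1). The discriminant of this quadratic in \<alpha> bounds the
    defect in the Euler-Lagrange equation.\<close>
  have var: "(cmod (sf (u n) \<phi> - L2_inner M k \<phi>))\<^sup>2 \<le> 1 / real (Suc n) * (sn \<phi>)\<^sup>2" if phi: "\<phi> \<in> D" for \<phi> n
  proof (rule quadratic_discriminant_complex)
    fix \<alpha>
    have "m \<le> J (\<lambda>x. u n x + \<alpha> * \<phi> x)" by (intro mJ D_lin u phi)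
    also have "\<dots> = J (u n) + 2 * Re (\<alpha> * (sf (u n) \<phi> - L2_inner M k \<phi>)) + (cmod \<alpha>)\<^sup>2 * (sn \<phi>)\<^sup>2"
      unfolding J_def sn_add_sq[OF u(1) phi] L2_inner_add_left[OF k D_L2[OF u(1)] D_L2[OF phi]] L2_inner_commute[of M \<phi> k]
      by (simp add: algebra_simps)
    finally show "0 \<le> 1 / real (Suc n) + 2 * Re (\<alpha> * (sf (u n) \<phi> - L2_inner M k \<phi>)) + (cmod \<alpha>)\<^sup>2 * (sn \<phi>)\<^sup>2"
      using u(2)[of n] by linarith
  qed simp
  \<comment> \<open>The limit equation for the shifted form has right-hand side \<open>k\<close>;
    moving the shift 1 - \<gamma> to the right gives \<open>h\<close> for the unshifted
    form.\<close>
  define h where "h = (\<lambda>x. k x + complex_of_real (\<gamma> - 1) * f x)"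
  have hL: "h \<in> L2 M" unfolding h_def by (intro L2_add_scale k f)
  have "form_closure M D t g f = L2_inner M g h" if g: "g \<in> form_closure_dom M D t" for g
  proof -
    obtain v where v: "form_conv M D t v g" using g by (auto simp: form_closure_dom_def)
    have vD: "\<And>n. v n \<in> D" and gL: "g \<in> L2 M" and gv: "(\<lambda>n. L2_norm M (\<lambda>x. v n x - g x)) \<longlonglongrightarrow> 0"
      using v by (auto simp: form_conv_def)
    obtain B where B: "B > 0" "\<And>n. sn (v n) \<le> B" by (rule form_Cauchy_bounded[OF form_conv_Cauchy[OF v]]) blast
    \<comment> \<open>The bound in \<open>var\<close> is uniform up to the form norm of the test
      function, and the form norms of the \<open>v n\<close> are bounded. So the equation also
      passes to the limit against test functions that vary with n.\<close>
    have "(\<lambda>n. sf (v n) (u n) - L2_inner M (v n) k) \<longlonglongrightarrow> 0"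
    proof (rule Lim_null_comparison)
      have "cmod (sf (v n) (u n) - L2_inner M (v n) k) \<le> sqrt (1 / real (Suc n)) * B" for n
      proof -
        have "sf (v n) (u n) - L2_inner M (v n) k = cnj (sf (u n) (v n) - L2_inner M k (v n))"
          by (simp add: sf_commute[OF u(1) vD] L2_inner_commute[of M "v n" k])
        then have "(cmod (sf (v n) (u n) - L2_inner M (v n) k))\<^sup>2 = (cmod (sf (u n) (v n) - L2_inner M k (v n)))\<^sup>2"
          by (simp only: complex_mod_cnj)
        also have "\<dots> \<le> 1 / real (Suc n) * (sn (v n))\<^sup>2" by (rule var[OF vD])
        also have "\<dots> \<le> 1 / real (Suc n) * B\<^sup>2" by (intro mult_left_mono power_mono B sn_nonneg vD) auto
        also have "\<dots> = (sqrt (1 / real (Suc n)) * B)\<^sup>2" by (simp add: power_mult_distrib)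
        finally show ?thesis by (rule power2_le_imp_le) (use B(1) in simp)
      qed
      then show "\<forall>\<^sub>F n in sequentially. norm (sf (v n) (u n) - L2_inner M (v n) k) \<le> sqrt (1 / real (Suc n)) * B" by simp
      have "(\<lambda>n. sqrt (inverse (real (Suc n))) * B) \<longlonglongrightarrow> sqrt 0 * B"
        by (intro tendsto_mult tendsto_const tendsto_real_sqrt LIMSEQ_inverse_real_of_nat)
      then show "(\<lambda>n. sqrt (1 / real (Suc n)) * B) \<longlonglongrightarrow> 0" by (simp add: inverse_eq_divide)
    qed
    moreover have "(\<lambda>n. L2_inner M (v n) k) \<longlonglongrightarrow> L2_inner M g k"
      by (intro L2_inner_tendsto vD D_L2 gL gv k) (simp add: L2_norm_def)
    ultimately have "(\<lambda>n. (sf (v n) (u n) - L2_inner M (v n) k) + L2_inner M (v n) k + complex_of_real (\<gamma> - 1) * L2_inner M (v n) (u n))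
      \<longlonglongrightarrow> 0 + L2_inner M g k + complex_of_real (\<gamma> - 1) * L2_inner M g f"
      by (intro tendsto_add tendsto_mult tendsto_const form_conv_inner_tendsto[OF v conv])
    moreover have "(\<lambda>n. (sf (v n) (u n) - L2_inner M (v n) k) + L2_inner M (v n) k + complex_of_real (\<gamma> - 1) * L2_inner M (v n) (u n))
      = (\<lambda>n. t (v n) (u n))"
      by (auto simp: sf_def algebra_simps)
    ultimately have "(\<lambda>n. t (v n) (u n)) \<longlonglongrightarrow> L2_inner M g h"
      unfolding h_def using L2_inner_add_right[OF gL k f(1)] by simp
    with form_closure_limit[OF v conv] show ?thesis by (rule LIMSEQ_unique)
  qed
  then have "(f, h) \<in> friedrichs_ext M D A"
    using conv hL by (auto simp: friedrichs_ext_def form_operator_def Let_def form_closure_dom_def)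
  then show ?thesis unfolding h_def by (rule that)
qed

end

section \<open>Sturm--Liouville expressions as first-order systems\<close>

text \<open>The set where two continuous functions differ is open, and a nonempty open set is not
  negligible.\<close>

lemma continuous_AE_eq_on_open:
  fixes f g :: "real \<Rightarrow> 'a::euclidean_space"
  assumes Z: "open Z" and f: "continuous_on Z f" and g: "continuous_on Z g"
    and eq: "AE x\<in>Z in lebesgue. f x = g x" and x: "x \<in> Z"
  shows "f x = g x"
proof (rule ccontr)
  assume ne: "f x \<noteq> g x"
  have "continuous_on Z (\<lambda>x. f x - g x)" by (intro continuous_intros f g)
  then have "open ((\<lambda>x. f x - g x) -` (- {0}) \<inter> Z)"
    using Z by (intro continuous_open_preimage[of Z _ "- {0}", unfolded Int_commute[of Z]]) auto
  moreover have "(\<lambda>x. f x - g x) -` (- {0}) \<inter> Z = {x\<in>Z. f x \<noteq> g x}" by auto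
  ultimately have "open {x\<in>Z. f x \<noteq> g x}" by simp
  moreover have "negligible {x\<in>Z. f x \<noteq> g x}" using eq by (simp add: AE_lebesgue_negligible)
  ultimately have "{x\<in>Z. f x \<noteq> g x} = {}" using open_not_negligible by blast
  then show False using x ne by blast
qed

lemma vector_derivative_zero_on_open:
  assumes "open Z" "x \<in> Z" "\<And>y. y \<in> Z \<Longrightarrow> f y = 0"
  shows "vector_derivative f (at x) = 0"
proof -
  have "(f has_vector_derivative 0) (at x)"
    by (rule has_vector_derivative_transform_within_open[OF has_vector_derivative_const[of 0] assms(1,2)])
      (use assms(3) in auto)
  then show ?thesis by (rule vector_derivative_at)
qed

lemma borel_measurable_lebesgue_on_cong_AE:
  fixes f g :: "real \<Rightarrow> 'a::euclidean_space"
  assumes f: "f \<in> borel_measurable (lebesgue_on S)" and S: "S \<in> sets lebesgue"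
    and eq: "AE x\<in>S in lebesgue. f x = g x"
  shows "g \<in> borel_measurable (lebesgue_on S)"
proof -
  have "(\<lambda>x. if x \<in> S then f x else 0) \<in> borel_measurable lebesgue" by (rule borel_measurable_if_I[OF f S])
  moreover have "AE x in lebesgue. (if x \<in> S then f x else 0) = (if x \<in> S then g x else 0)"
    using eq by eventually_elim auto
  ultimately have "(\<lambda>x. if x \<in> S then g x else 0) \<in> borel_measurable lebesgue" by (rule borel_measurable_AE)
  then show ?thesis by (rule borel_measurable_if_D)
qed

lemma absolutely_integrable_scaleR_continuous:
  fixes f :: "real \<Rightarrow> 'a::euclidean_space" and g :: "real \<Rightarrow> real"
  assumes g: "g absolutely_integrable_on {c..d}" and f: "continuous_on {c..d} f"
  shows "(\<lambda>x. g x *\<^sub>R f x) absolutely_integrable_on {c..d}"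
proof (rule absolutely_integrable_bounded_measurable_product[where h="\<lambda>f g. g *\<^sub>R f", OF _ _ _ _ g])
  show "bilinear (\<lambda>(f::'a) g. g *\<^sub>R f)"
    by (simp add: bilinear_conv_bounded_bilinear bounded_bilinear.flip[OF bounded_bilinear_scaleR])
  show "f \<in> borel_measurable (lebesgue_on {c..d})"
    using f by (intro continuous_imp_measurable_on_sets_lebesgue) auto
  show "bounded (f ` {c..d})" using f by (intro compact_imp_bounded compact_continuous_image) auto
qed auto

lemma primitive_on_continuous: "primitive_on a b f g \<Longrightarrow> continuous_on (einterval a b) f"
  by (rule AC_loc_continuous[OF primitive_on_AC_loc])

text \<open>Since \<open>f\<close> vanishes at both ends, clipping an interval to {c..d} does not
  change the increment of the function extended by zero.\<close>

lemma primitive_on_truncate: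
  fixes f :: "real \<Rightarrow> 'a::euclidean_space"
  assumes f: "primitive_on a b f g" and cd: "{c..d} \<subseteq> einterval a b" "f c = 0" "f d = 0"
  shows "primitive_on a b (\<lambda>x. if x \<in> {c..d} then f x else 0) (\<lambda>x. if x \<in> {c..d} then g x else 0)"
  unfolding primitive_on_def
proof (intro allI impI)
  fix x y :: real assume xy: "x \<le> y" "{x..y} \<subseteq> einterval a b"
  let ?G = "\<lambda>x. if x \<in> {c..d} then g x else 0" and ?F = "\<lambda>x. if x \<in> {c..d} then f x else 0"
  have "?G absolutely_integrable_on {x..y}"
  proof -
    have "(\<lambda>z. if z \<in> {x..y} then ?G z else 0) = (\<lambda>z. if z \<in> {x..y} \<inter> {c..d} then g z else 0)" by auto
    moreover have "g absolutely_integrable_on {x..y} \<inter> {c..d}"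
      by (rule set_integrable_subset[OF primitive_onD(1)[OF f xy]]) auto
    ultimately have "(\<lambda>z. if z \<in> {x..y} then ?G z else 0) absolutely_integrable_on UNIV"
      using absolutely_integrable_restrict_UNIV[of "{x..y} \<inter> {c..d}" g] by simp
    then show ?thesis by (rule absolutely_integrable_restrict_UNIV[THEN iffD1])
  qed
  moreover have "?F y - ?F x = integral {x..y} ?G"
  proof -
    have 1: "integral {x..y} ?G = integral ({x..y} \<inter> {c..d}) g"
      using integral_restrict_Int[of "{x..y}" "{c..d}" g] by (simp only: Int_commute)
    show ?thesis
    proof (cases "max x c \<le> min y d")
      case True
      have "{max x c..min y d} \<subseteq> einterval a b" using cd(1) by auto
      then have "f (min y d) - f (max x c) = integral {max x c..min y d} g" using primitive_onD(2)[OF f True] by simp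
      moreover have "x \<le> d" "c \<le> y" using True by auto
      then have "?F y = f (min y d)" "?F x = f (max x c)" using cd by (auto simp: min_def max_def)
      ultimately show ?thesis using 1 by (simp add: Int_atLeastAtMost)
    next
      case False
      then have "{x..y} \<inter> {c..d} = {}" by auto
      moreover have "?F y = 0" "?F x = 0" using False xy(1) cd by auto
      ultimately show ?thesis using 1 by simp
    qed
  qed
  ultimately show "?G absolutely_integrable_on {x..y} \<and> ?F y - ?F x = integral {x..y} ?G" by blast
qed

text \<open>Two versions agree a.e. and are continuous. This makes the choice operator in
  \<open>quasi_deriv\<close> harmless on the interval.\<close>

lemma is_quasi_deriv_unique:
  fixes f :: "real \<Rightarrow> 'a::euclidean_space"
  assumes "is_quasi_deriv a b p s f h" "is_quasi_deriv a b p s f h'" "x \<in> einterval a b"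
  shows "h x = h' x"
proof (rule continuous_AE_eq_on_open[OF _ _ _ _ assms(3)])
  show "continuous_on (einterval a b) h" "continuous_on (einterval a b) h'"
    using assms(1,2) by (auto simp: is_quasi_deriv_def intro: AC_loc_continuous)
  have "AE x\<in>einterval a b in lebesgue. h x = p x *\<^sub>R (vector_derivative f (at x) + s x *\<^sub>R f x)"
    "AE x\<in>einterval a b in lebesgue. h' x = p x *\<^sub>R (vector_derivative f (at x) + s x *\<^sub>R f x)"
    using assms(1,2) by (auto simp: is_quasi_deriv_def)
  then show "AE x\<in>einterval a b in lebesgue. h x = h' x" by eventually_elim auto
qed auto

lemma is_quasi_deriv_quasi_deriv:
  assumes "is_quasi_deriv a b p s f h"
  shows "is_quasi_deriv a b p s f (quasi_deriv a b p s f)"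
  unfolding quasi_deriv_def by (rule someI[where P="is_quasi_deriv a b p s f", OF assms])

locale sl_problem =
  fixes a b :: ereal and p q r s :: "real \<Rightarrow> real"
  assumes coeffs: "sl_coefficients a b p q r s"
    and p_pos: "AE x\<in>einterval a b in lebesgue. p x > 0"
begin

abbreviation I where "I \<equiv> einterval a b"
abbreviation M where "M \<equiv> weighted_measure a b r"
abbreviation qd :: "(real \<Rightarrow> 'c::real_normed_vector) \<Rightarrow> real \<Rightarrow> 'c" where "qd \<equiv> quasi_deriv a b p s"
abbreviation "\<tau> \<equiv> tau a b p q r s"

abbreviation "T0 \<equiv> dom_T0 a b p q r s"
abbreviation "Tmax \<equiv> dom_Tmax a b p q r s"

lemma ab: "a < b" using coeffs by (simp add: sl_coefficients_def)

lemma r_pos: "AE x\<in>I in lebesgue. r x > 0" using coeffs by (simp add: sl_coefficients_def)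

lemma r_measurable: "r \<in> borel_measurable (lebesgue_on I)"
  and q_measurable: "q \<in> borel_measurable (lebesgue_on I)"
  and p_measurable: "p \<in> borel_measurable (lebesgue_on I)"
  using coeffs by (auto simp: sl_coefficients_def)

lemma coeff_integrable:
  assumes "{c..d} \<subseteq> I"
  shows "(\<lambda>x. inverse (p x)) absolutely_integrable_on {c..d}" "q absolutely_integrable_on {c..d}"
    "r absolutely_integrable_on {c..d}" "s absolutely_integrable_on {c..d}"
  using coeffs assms by (auto simp: sl_coefficients_def L1_loc_def)

lemma M_AE: "(AE x in M. P x) \<longleftrightarrow> (AE x\<in>I in lebesgue. P x)"
proof -
  have "(AE x in M. P x) \<longleftrightarrow> (AE x in lebesgue_on I. 0 < ennreal (r x) \<longrightarrow> P x)"
    unfolding weighted_measure_def using r_measurable by (intro AE_density) measurable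
  also have "\<dots> \<longleftrightarrow> (AE x\<in>I in lebesgue. 0 < r x \<longrightarrow> P x)"
    by (subst AE_restrict_space_iff) auto
  also have "\<dots> \<longleftrightarrow> (AE x\<in>I in lebesgue. P x)"
  proof
    assume "AE x\<in>I in lebesgue. 0 < r x \<longrightarrow> P x"
    then show "AE x\<in>I in lebesgue. P x" using r_pos by eventually_elim auto
  next
    assume "AE x\<in>I in lebesgue. P x"
    then show "AE x\<in>I in lebesgue. 0 < r x \<longrightarrow> P x" by eventually_elim auto
  qed
  finally show ?thesis .
qed

lemma M_measurable: "f \<in> borel_measurable M \<longleftrightarrow> f \<in> borel_measurable (lebesgue_on I)"
  by (simp add: weighted_measure_def)

lemma r_nonneg_restrict: "AE x in lebesgue_on I. 0 \<le> r x"
  using r_pos by (subst AE_restrict_space_iff) (auto elim: eventually_mono)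

lemma lebesgue_on_integrable_iff:
  fixes F :: "real \<Rightarrow> 'c::euclidean_space"
  shows "integrable (lebesgue_on I) F \<longleftrightarrow> F absolutely_integrable_on I"
  by (subst integrable_restrict_space) (auto simp: set_integrable_def)

lemma M_integrable_iff:
  fixes F :: "real \<Rightarrow> 'c::euclidean_space"
  assumes "F \<in> borel_measurable (lebesgue_on I)"
  shows "integrable M F \<longleftrightarrow> (\<lambda>x. r x *\<^sub>R F x) absolutely_integrable_on I"
  unfolding weighted_measure_def integrable_density[OF assms r_measurable r_nonneg_restrict]
  by (rule lebesgue_on_integrable_iff)

lemma M_integral:
  fixes F :: "real \<Rightarrow> 'c::euclidean_space"
  assumes "F \<in> borel_measurable (lebesgue_on I)" "(\<lambda>x. r x *\<^sub>R F x) absolutely_integrable_on I"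
  shows "integral\<^sup>L M F = integral I (\<lambda>x. r x *\<^sub>R F x)"
  unfolding weighted_measure_def integral_density[OF assms(1) r_measurable r_nonneg_restrict]
  by (rule lebesgue_integral_eq_integral) (use assms(2) in \<open>auto simp: lebesgue_on_integrable_iff\<close>)

lemma L2_iff:
  "f \<in> L2 M \<longleftrightarrow> f \<in> borel_measurable (lebesgue_on I) \<and> (\<lambda>x. r x * (cmod (f x))\<^sup>2) absolutely_integrable_on I"
proof (cases "f \<in> borel_measurable (lebesgue_on I)")
  case True
  then have "(\<lambda>x. (cmod (f x))\<^sup>2) \<in> borel_measurable (lebesgue_on I)" by measurable
  then show ?thesis using True M_integrable_iff[of "\<lambda>x. (cmod (f x))\<^sup>2"] by (simp add: L2_def M_measurable)
qed (simp add: L2_def M_measurable)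

lemma L2_norm_sq:
  assumes "f \<in> L2 M"
  shows "(L2_norm M f)\<^sup>2 = integral I (\<lambda>x. r x * (cmod (f x))\<^sup>2)"
proof -
  have f: "f \<in> borel_measurable (lebesgue_on I)" "(\<lambda>x. r x * (cmod (f x))\<^sup>2) absolutely_integrable_on I"
    using assms by (auto simp: L2_iff)
  have "(\<lambda>x. (cmod (f x))\<^sup>2) \<in> borel_measurable (lebesgue_on I)" using f(1) by measurable
  then have "(LINT x|M. (cmod (f x))\<^sup>2) = integral I (\<lambda>x. r x * (cmod (f x))\<^sup>2)"
    using f(2) M_integral[of "\<lambda>x. (cmod (f x))\<^sup>2"] by simp
  moreover have "(L2_norm M f)\<^sup>2 = (LINT x|M. (cmod (f x))\<^sup>2)"
    unfolding L2_norm_def by (intro real_sqrt_pow2 Bochner_Integration.integral_nonneg) simp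
  ultimately show ?thesis by simp
qed

lemma L2_inner_eq:
  assumes "f \<in> L2 M" "g \<in> L2 M"
  shows "(\<lambda>x. r x *\<^sub>R (cnj (f x) * g x)) absolutely_integrable_on I"
    "L2_inner M f g = integral I (\<lambda>x. r x *\<^sub>R (cnj (f x) * g x))"
proof -
  have i: "integrable M (\<lambda>x. cnj (f x) * g x)" by (rule L2_mult_integrable[OF assms])
  then have m: "(\<lambda>x. cnj (f x) * g x) \<in> borel_measurable (lebesgue_on I)" using borel_measurable_integrable[OF i] by (simp add: M_measurable)
  show 1: "(\<lambda>x. r x *\<^sub>R (cnj (f x) * g x)) absolutely_integrable_on I" using i unfolding M_integrable_iff[OF m] .
  show "L2_inner M f g = integral I (\<lambda>x. r x *\<^sub>R (cnj (f x) * g x))"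
    unfolding L2_inner_def by (rule M_integral[OF m 1])
qed

text \<open>From |f| \<le> 1 + |f|^2 and the local integrability of \<open>r\<close>. It makes L2
  functions admissible right-hand sides for initial value problems.\<close>

lemma L2_weight_integrable:
  assumes f: "f \<in> L2 M" and cd: "{c..d} \<subseteq> I"
  shows "(\<lambda>x. r x *\<^sub>R f x) absolutely_integrable_on {c..d}"
proof (rule measurable_bounded_by_integrable_imp_absolutely_integrable)
  have fm: "f \<in> borel_measurable (lebesgue_on I)" "(\<lambda>x. r x * (cmod (f x))\<^sup>2) absolutely_integrable_on I"
    using f by (auto simp: L2_iff)
  have "(\<lambda>x. r x *\<^sub>R f x) \<in> borel_measurable (lebesgue_on I)" using fm(1) r_measurable by measurable
  then show "(\<lambda>x. r x *\<^sub>R f x) \<in> borel_measurable (lebesgue_on {c..d})" using cd by (rule measurable_restrict_mono)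
  have "(\<lambda>x. r x * (cmod (f x))\<^sup>2) absolutely_integrable_on {c..d}"
    by (rule set_integrable_subset[OF fm(2)]) (use cd in auto)
  then have "(\<lambda>x. \<bar>r x\<bar> + \<bar>r x * (cmod (f x))\<^sup>2\<bar>) absolutely_integrable_on {c..d}"
    using coeff_integrable(3)[OF cd] by (intro set_integral_add set_integrable_abs)
  then show "(\<lambda>x. \<bar>r x\<bar> + \<bar>r x * (cmod (f x))\<^sup>2\<bar>) integrable_on {c..d}"
    by (simp add: absolutely_integrable_on_def)
  show "norm (r x *\<^sub>R f x) \<le> \<bar>r x\<bar> + \<bar>r x * (cmod (f x))\<^sup>2\<bar>" for x
  proof -
    have "cmod (f x) \<le> 1 + (cmod (f x))\<^sup>2"
      using sum_squares_bound[of "cmod (f x)" 1] norm_ge_zero[of "f x"] unfolding mult_1_right power_one by linarith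
    then have "\<bar>r x\<bar> * cmod (f x) \<le> \<bar>r x\<bar> * (1 + (cmod (f x))\<^sup>2)" by (rule mult_left_mono) simp
    then show ?thesis by (simp add: algebra_simps abs_mult)
  qed
qed auto

lemma D_tau_primitive:
  fixes f :: "real \<Rightarrow> 'c::euclidean_space"
  assumes "f \<in> D_tau a b p s"
  shows "primitive_on a b f (\<lambda>x. inverse (p x) *\<^sub>R qd f x - s x *\<^sub>R f x)" "AC_loc a b (qd f)"
proof -
  have f: "AC_loc a b f" "is_quasi_deriv a b p s f (qd f)"
    using assms by (auto simp: D_tau_def intro: is_quasi_deriv_quasi_deriv)
  then show "AC_loc a b (qd f)" by (simp add: is_quasi_deriv_def)
  have "AE x\<in>I in lebesgue. qd f x = p x *\<^sub>R (vector_derivative f (at x) + s x *\<^sub>R f x)"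
    using f(2) by (simp add: is_quasi_deriv_def)
  then have "AE x\<in>I in lebesgue. vector_derivative f (at x) = inverse (p x) *\<^sub>R qd f x - s x *\<^sub>R f x"
    using p_pos by eventually_elim (auto simp: algebra_simps)
  then show "primitive_on a b f (\<lambda>x. inverse (p x) *\<^sub>R qd f x - s x *\<^sub>R f x)"
    by (rule primitive_on_cong_AE[OF AC_loc_primitive_vector_derivative[OF f(1)]])
qed

lemma D_tauI:
  fixes f :: "real \<Rightarrow> 'c::euclidean_space"
  assumes f: "primitive_on a b f (\<lambda>x. inverse (p x) *\<^sub>R h x - s x *\<^sub>R f x)" and h: "AC_loc a b h"
  shows "f \<in> D_tau a b p s" "x \<in> I \<Longrightarrow> qd f x = h x"
proof -
  have "AE x\<in>I in lebesgue. h x = p x *\<^sub>R (vector_derivative f (at x) + s x *\<^sub>R f x)"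
    using primitive_on_AE_derivative[OF f] p_pos
    by eventually_elim (auto simp: vector_derivative_at algebra_simps)
  then have qd: "is_quasi_deriv a b p s f h" using h by (simp add: is_quasi_deriv_def)
  then show "f \<in> D_tau a b p s" using primitive_on_AC_loc[OF f] by (auto simp: D_tau_def)
  have "is_quasi_deriv a b p s f (qd f)" by (rule is_quasi_deriv_quasi_deriv[OF qd])
  then show "x \<in> I \<Longrightarrow> qd f x = h x" using is_quasi_deriv_unique[OF _ qd] by blast
qed

text \<open>\<open>sol u u1 h\<close> expresses \<open>\<tau> u = h\<close> with \<open>u1\<close> the quasi-derivative of \<open>u\<close>.\<close>

definition sol :: "(real \<Rightarrow> complex) \<Rightarrow> (real \<Rightarrow> complex) \<Rightarrow> (real \<Rightarrow> complex) \<Rightarrow> bool" where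
  "sol u u1 h \<longleftrightarrow> primitive_on a b u (\<lambda>x. inverse (p x) *\<^sub>R u1 x - s x *\<^sub>R u x) \<and>
     primitive_on a b u1 (\<lambda>x. s x *\<^sub>R u1 x + q x *\<^sub>R u x - r x *\<^sub>R h x)"

lemma dom_Tmax_sol:
  assumes "g \<in> Tmax"
  shows "sol g (qd g) (\<tau> g)"
proof -
  have g: "g \<in> D_tau a b p s" using assms by (simp add: dom_Tmax_def)
  have "AE x\<in>I in lebesgue. vector_derivative (qd g) (at x) = s x *\<^sub>R qd g x + q x *\<^sub>R g x - r x *\<^sub>R \<tau> g x"
    using r_pos by eventually_elim (auto simp: tau_def)
  then show ?thesis unfolding sol_def
    by (intro conjI D_tau_primitive(1)[OF g] primitive_on_cong_AE[OF AC_loc_primitive_vector_derivative[OF D_tau_primitive(2)[OF g]]])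
qed

text \<open>Converse to \<open>dom_Tmax_sol\<close>: a solution of the first-order system is its own
  locally absolutely continuous representative, and r > 0 a.e. allows \<open>h\<close> to be
  recovered from the derivative of \<open>u1\<close>.\<close>

lemma sol_dom_Tmax:
  assumes u: "sol u u1 h" and L2: "u \<in> L2 M" "h \<in> L2 M"
  shows "u \<in> Tmax" "AE x\<in>I in lebesgue. \<tau> u x = h x" "x \<in> I \<Longrightarrow> qd u x = u1 x"
proof -
  have u12: "primitive_on a b u (\<lambda>x. inverse (p x) *\<^sub>R u1 x - s x *\<^sub>R u x)"
    "primitive_on a b u1 (\<lambda>x. s x *\<^sub>R u1 x + q x *\<^sub>R u x - r x *\<^sub>R h x)" using u by (auto simp: sol_def)
  note D = D_tauI[OF u12(1) primitive_on_AC_loc[OF u12(2)]]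
  show qd: "x \<in> I \<Longrightarrow> qd u x = u1 x" for x by (rule D(2))
  have vd: "vector_derivative (qd u) (at x) = v" if x: "x \<in> I" and v: "(u1 has_vector_derivative v) (at x)" for x v
  proof -
    have "(qd u has_vector_derivative v) (at x)"
      by (rule has_vector_derivative_transform_within_open[OF v _ x]) (auto simp: qd)
    then show ?thesis by (rule vector_derivative_at)
  qed
  show eq: "AE x\<in>I in lebesgue. \<tau> u x = h x"
    using primitive_on_AE_derivative[OF u12(2)] r_pos
  proof eventually_elim
    case (elim x)
    show ?case
    proof
      assume x: "x \<in> I"
      then have "vector_derivative (qd u) (at x) = s x *\<^sub>R u1 x + q x *\<^sub>R u x - r x *\<^sub>R h x"
        using elim vd by blast
      then show "\<tau> u x = h x" using elim x by (simp add: tau_def qd)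
    qed
  qed
  have eq': "AE x in M. h x = \<tau> u x" unfolding M_AE using eq by eventually_elim auto
  have "\<tau> u \<in> borel_measurable (lebesgue_on I)"
    by (rule borel_measurable_lebesgue_on_cong_AE[of h]) (use L2(2) eq' in \<open>auto simp: L2_iff M_AE\<close>)
  then have "\<tau> u \<in> L2 M" by (intro L2_cong_AE[OF L2(2) _ eq']) (simp add: M_measurable)
  then show "u \<in> Tmax" using D(1) L2 by (simp add: dom_Tmax_def)
qed

lemma sol_add_scale:
  assumes "sol u u1 h" "sol v v1 k"
  shows "sol (\<lambda>x. u x + \<alpha> * v x) (\<lambda>x. u1 x + \<alpha> * v1 x) (\<lambda>x. h x + \<alpha> * k x)"
proof -
  note bl = bounded_linear_mult_right[of \<alpha>]
  have u: "primitive_on a b u (\<lambda>x. inverse (p x) *\<^sub>R u1 x - s x *\<^sub>R u x)"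
    "primitive_on a b u1 (\<lambda>x. s x *\<^sub>R u1 x + q x *\<^sub>R u x - r x *\<^sub>R h x)" using assms(1) by (auto simp: sol_def)
  have v: "primitive_on a b v (\<lambda>x. inverse (p x) *\<^sub>R v1 x - s x *\<^sub>R v x)"
    "primitive_on a b v1 (\<lambda>x. s x *\<^sub>R v1 x + q x *\<^sub>R v x - r x *\<^sub>R k x)" using assms(2) by (auto simp: sol_def)
  show ?thesis unfolding sol_def
    using primitive_on_add[OF u(1) primitive_on_linear[OF bl v(1)]] primitive_on_add[OF u(2) primitive_on_linear[OF bl v(2)]]
    by (simp add: algebra_simps scaleR_conv_of_real)
qed

lemma sol_cnj:
  assumes "sol u u1 h"
  shows "sol (\<lambda>x. cnj (u x)) (\<lambda>x. cnj (u1 x)) (\<lambda>x. cnj (h x))"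
  using primitive_on_linear[OF bounded_linear_cnj] assms unfolding sol_def by fastforce

lemma sol_continuous:
  assumes "sol u u1 h"
  shows "continuous_on I u" "continuous_on I u1"
  using assms by (auto simp: sol_def intro: primitive_on_continuous)

text \<open>Lagrange's identity in bilinear form: the terms with p, q and s cancel in the product
  rule. Conjugation is left to \<open>sol_cnj\<close>, so the same lemma yields constancy of
  Wronskians and Green's formula.\<close>

lemma sol_wronskian:
  assumes "sol u u1 h" "sol v v1 k"
  shows "primitive_on a b (\<lambda>x. u x * v1 x - u1 x * v x) (\<lambda>x. r x *\<^sub>R (h x * v x - u x * k x))"
proof -
  have u: "primitive_on a b u (\<lambda>x. inverse (p x) *\<^sub>R u1 x - s x *\<^sub>R u x)"
    "primitive_on a b u1 (\<lambda>x. s x *\<^sub>R u1 x + q x *\<^sub>R u x - r x *\<^sub>R h x)" using assms(1) by (auto simp: sol_def)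
  have v: "primitive_on a b v (\<lambda>x. inverse (p x) *\<^sub>R v1 x - s x *\<^sub>R v x)"
    "primitive_on a b v1 (\<lambda>x. s x *\<^sub>R v1 x + q x *\<^sub>R v x - r x *\<^sub>R k x)" using assms(2) by (auto simp: sol_def)
  have "primitive_on a b (\<lambda>x. u x * v1 x + (-1) * (u1 x * v x))
    (\<lambda>x. (u x * (s x *\<^sub>R v1 x + q x *\<^sub>R v x - r x *\<^sub>R k x) + (inverse (p x) *\<^sub>R u1 x - s x *\<^sub>R u x) * v1 x)
      + (-1) * (u1 x * (inverse (p x) *\<^sub>R v1 x - s x *\<^sub>R v x) + (s x *\<^sub>R u1 x + q x *\<^sub>R u x - r x *\<^sub>R h x) * v x))"
    by (rule primitive_on_add[OF primitive_on_mult[OF u(1) v(2)]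
      primitive_on_linear[OF bounded_linear_mult_right primitive_on_mult[OF u(2) v(1)]]])
  then show ?thesis by (simp add: algebra_simps scaleR_conv_of_real)
qed

text \<open>Green's formula of \<open>u\<close> with itself; the two cross terms with s cancel in
  the real part.\<close>

lemma sol_energy:
  assumes "sol u u1 h"
  shows "primitive_on a b (\<lambda>x. Re (cnj (u x) * u1 x))
    (\<lambda>x. inverse (p x) * (cmod (u1 x))\<^sup>2 + q x * (cmod (u x))\<^sup>2 - r x * Re (cnj (u x) * h x))"
proof -
  have u: "primitive_on a b u (\<lambda>x. inverse (p x) *\<^sub>R u1 x - s x *\<^sub>R u x)"
    "primitive_on a b u1 (\<lambda>x. s x *\<^sub>R u1 x + q x *\<^sub>R u x - r x *\<^sub>R h x)" using assms by (auto simp: sol_def)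
  have "primitive_on a b (\<lambda>x. Re (cnj (u x) * u1 x))
    (\<lambda>x. Re (cnj (u x) * (s x *\<^sub>R u1 x + q x *\<^sub>R u x - r x *\<^sub>R h x) + cnj (inverse (p x) *\<^sub>R u1 x - s x *\<^sub>R u x) * u1 x))"
    by (rule primitive_on_linear[OF bounded_linear_Re primitive_on_mult[OF primitive_on_linear[OF bounded_linear_cnj u(1)] u(2)]])
  moreover have "(\<lambda>x. Re (cnj (u x) * (s x *\<^sub>R u1 x + q x *\<^sub>R u x - r x *\<^sub>R h x) + cnj (inverse (p x) *\<^sub>R u1 x - s x *\<^sub>R u x) * u1 x))
    = (\<lambda>x. inverse (p x) * (cmod (u1 x))\<^sup>2 + q x * (cmod (u x))\<^sup>2 - r x * Re (cnj (u x) * h x))"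
    unfolding cmod_power2 by (rule ext) (simp add: power2_eq_square algebra_simps)
  ultimately show ?thesis by simp
qed

lemma sol_truncate:
  assumes u: "sol u u1 h" and cd: "{c..d} \<subseteq> I" "u c = 0" "u1 c = 0" "u d = 0" "u1 d = 0"
  shows "sol (\<lambda>x. if x \<in> {c..d} then u x else 0) (\<lambda>x. if x \<in> {c..d} then u1 x else 0) (\<lambda>x. if x \<in> {c..d} then h x else 0)"
proof -
  have u12: "primitive_on a b u (\<lambda>x. inverse (p x) *\<^sub>R u1 x - s x *\<^sub>R u x)"
    "primitive_on a b u1 (\<lambda>x. s x *\<^sub>R u1 x + q x *\<^sub>R u x - r x *\<^sub>R h x)" using u by (auto simp: sol_def)
  have "(\<lambda>x. if x \<in> {c..d} then inverse (p x) *\<^sub>R u1 x - s x *\<^sub>R u x else 0) =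
    (\<lambda>x. inverse (p x) *\<^sub>R (if x \<in> {c..d} then u1 x else 0) - s x *\<^sub>R (if x \<in> {c..d} then u x else 0))"
    "(\<lambda>x. if x \<in> {c..d} then s x *\<^sub>R u1 x + q x *\<^sub>R u x - r x *\<^sub>R h x else 0) =
    (\<lambda>x. s x *\<^sub>R (if x \<in> {c..d} then u1 x else 0) + q x *\<^sub>R (if x \<in> {c..d} then u x else 0) - r x *\<^sub>R (if x \<in> {c..d} then h x else 0))"
    by auto
  then show ?thesis unfolding sol_def
    using primitive_on_truncate[OF u12(1) cd(1,2,4)] primitive_on_truncate[OF u12(2) cd(1,3,5)] by simp
qed

text \<open>\<open>dom_T0\<close> asks only \<phi> itself to vanish off a compact set. There its
  quasi-derivative is zero a.e., hence everywhere by continuity on an open set. The points c' and d'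
  are adjoined to the support so that the interval found also covers prescribed points.\<close>

lemma dom_T0_support:
  assumes \<phi>: "\<phi> \<in> T0" and cd': "c' \<in> I" "d' \<in> I"
  obtains c d where "c < c'" "c < d" "d' < d" "{c..d} \<subseteq> I"
    "\<And>x. x \<in> I \<Longrightarrow> x \<notin> {c<..<d} \<Longrightarrow> \<phi> x = 0 \<and> qd \<phi> x = 0 \<and> \<tau> \<phi> x = 0"
proof -
  obtain K where K: "compact K" "K \<subseteq> I" "\<And>x. x \<in> I - K \<Longrightarrow> \<phi> x = 0"
    using \<phi> by (auto simp: dom_T0_def)
  let ?K = "insert c' (insert d' K)"
  have cK: "compact ?K" "?K \<subseteq> I" "?K \<noteq> {}" using K cd' by auto
  obtain k0 where k0: "k0 \<in> ?K" "\<And>x. x \<in> ?K \<Longrightarrow> k0 \<le> x" using compact_attains_inf[OF cK(1,3)] by blast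
  obtain k1 where k1: "k1 \<in> ?K" "\<And>x. x \<in> ?K \<Longrightarrow> x \<le> k1" using compact_attains_sup[OF cK(1,3)] by blast
  have "k0 \<in> I" "k1 \<in> I" using k0 k1 cK by auto
  then obtain e0 e1 where e: "e0 > 0" "{k0 - e0..k0 + e0} \<subseteq> I" "e1 > 0" "{k1 - e1..k1 + e1} \<subseteq> I"
    using einterval_nbhd by metis
  define Z where "Z = I - {k0..k1}"
  have oZ: "open Z" unfolding Z_def by (intro open_Diff) auto
  have \<phi>0: "\<phi> x = 0" if "x \<in> Z" for x
    using K(3)[of x] that k0(2)[of x] k1(2)[of x] by (auto simp: Z_def)
  have D: "\<phi> \<in> D_tau a b p s" using \<phi> by (simp add: dom_T0_def dom_Tmax_def)
  have "AE x\<in>Z in lebesgue. qd \<phi> x = 0"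
  proof -
    have "is_quasi_deriv a b p s \<phi> (qd \<phi>)" using D by (auto simp: D_tau_def intro: is_quasi_deriv_quasi_deriv)
    then have "AE x\<in>I in lebesgue. qd \<phi> x = p x *\<^sub>R (vector_derivative \<phi> (at x) + s x *\<^sub>R \<phi> x)" by (simp add: is_quasi_deriv_def)
    moreover have "vector_derivative \<phi> (at x) = 0" if "x \<in> Z" for x
      by (rule vector_derivative_zero_on_open[OF oZ that \<phi>0])
    moreover have "Z \<subseteq> I" by (auto simp: Z_def)
    ultimately show ?thesis by (auto simp: \<phi>0 elim!: eventually_mono)
  qed
  then have qd0: "qd \<phi> x = 0" if "x \<in> Z" for x
    using AC_loc_continuous[OF D_tau_primitive(2)[OF D]] that
    by (intro continuous_AE_eq_on_open[OF oZ, of "qd \<phi>" "\<lambda>_. 0"]) (auto simp: Z_def intro: continuous_on_subset)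
  have \<tau>0: "\<tau> \<phi> x = 0" if "x \<in> Z" for x
    unfolding tau_def using that by (simp add: \<phi>0 qd0 vector_derivative_zero_on_open[OF oZ that qd0])
  show ?thesis
  proof (rule that[of "k0 - e0" "k1 + e1"])
    show "k0 - e0 < c'" "d' < k1 + e1" "k0 - e0 < k1 + e1" using k0(2)[of c'] k1(2)[of d'] k0(2)[of k1] k1(1) e by auto
    show "{k0 - e0..k1 + e1} \<subseteq> I" by (rule Icc_subset_einterval) (use e in auto)
    fix x assume "x \<in> I" "x \<notin> {k0 - e0<..<k1 + e1}"
    then have "x \<in> Z" using e by (auto simp: Z_def)
    then show "\<phi> x = 0 \<and> qd \<phi> x = 0 \<and> \<tau> \<phi> x = 0" by (simp add: \<phi>0 qd0 \<tau>0)
  qed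
qed

lemma dom_T0_subset: "T0 \<subseteq> Tmax"
  by (auto simp: dom_T0_def)

lemma dom_Tmax_L2: "g \<in> Tmax \<Longrightarrow> g \<in> L2 M \<and> \<tau> g \<in> L2 M"
  by (simp add: dom_Tmax_def)

lemma dom_Tmax_linear:
  assumes "u \<in> Tmax" "v \<in> Tmax"
  shows "(\<lambda>x. u x + \<alpha> * v x) \<in> Tmax"
    "AE x\<in>I in lebesgue. \<tau> (\<lambda>x. u x + \<alpha> * v x) x = \<tau> u x + \<alpha> * \<tau> v x"
    "x \<in> I \<Longrightarrow> qd (\<lambda>x. u x + \<alpha> * v x) x = qd u x + \<alpha> * qd v x"
  using sol_dom_Tmax[OF sol_add_scale[OF dom_Tmax_sol[OF assms(1)] dom_Tmax_sol[OF assms(2)]]]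
    dom_Tmax_L2[OF assms(1)] dom_Tmax_L2[OF assms(2)] L2_add_scale by blast+

lemma dom_T0_linear:
  assumes "u \<in> T0" "v \<in> T0"
  shows "(\<lambda>x. u x + \<alpha> * v x) \<in> T0"
proof -
  obtain K L where "compact K" "K \<subseteq> I" "\<forall>x\<in>I - K. u x = 0" "compact L" "L \<subseteq> I" "\<forall>x\<in>I - L. v x = 0"
    using assms by (auto simp: dom_T0_def)
  then have "compact (K \<union> L)" "K \<union> L \<subseteq> I" "\<forall>x\<in>I - (K \<union> L). u x + \<alpha> * v x = 0" by (auto simp: compact_Un)
  then show ?thesis using assms dom_Tmax_linear(1) by (auto simp: dom_T0_def)
qed

lemma dom_T0_zero: "(\<lambda>_. 0) \<in> T0"
proof -
  have "sol (\<lambda>_. 0) (\<lambda>_. 0) (\<lambda>_. 0)" by (simp add: sol_def primitive_on_const)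
  then have "(\<lambda>_. 0) \<in> Tmax" by (rule sol_dom_Tmax) (rule L2_zero)+
  then show ?thesis by (auto simp: dom_T0_def intro: exI[of _ "{}"])
qed

lemma integral_eq_on_support:
  fixes F :: "real \<Rightarrow> 'c::euclidean_space"
  assumes "{c..d} \<subseteq> I" "\<And>x. x \<in> I \<Longrightarrow> x \<notin> {c..d} \<Longrightarrow> F x = 0"
  shows "integral I F = integral {c..d} F"
proof -
  have "integral I F = integral I (\<lambda>x. if x \<in> {c..d} then F x else 0)" using assms by (intro integral_cong) auto
  also have "\<dots> = integral (I \<inter> {c..d}) F"
    using integral_restrict_Int[of I "{c..d}" F] by (simp only: Int_commute)
  finally show ?thesis using assms(1) by (simp add: Int_absorb1)
qed

text \<open>The compact support of \<phi> removes the boundary terms of Lagrange's identity, so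
  \<open>v\<close> needs no boundary condition.\<close>

lemma T0_symmetric:
  assumes \<phi>: "\<phi> \<in> T0" and v: "sol v v1 k" "v \<in> L2 M" "k \<in> L2 M"
  shows "L2_inner M \<phi> k = L2_inner M (\<tau> \<phi>) v"
proof -
  obtain z where z: "z \<in> I" using ab einterval_nonempty by blast
  obtain c d where cd: "c < d" "{c..d} \<subseteq> I"
    "\<And>x. x \<in> I \<Longrightarrow> x \<notin> {c<..<d} \<Longrightarrow> \<phi> x = 0 \<and> qd \<phi> x = 0 \<and> \<tau> \<phi> x = 0"
    using dom_T0_support[OF \<phi> z z] by metis
  have \<phi>m: "\<phi> \<in> Tmax" using \<phi> dom_T0_subset by blast
  note L = dom_Tmax_L2[OF \<phi>m]
  have cdI: "c \<in> I" "d \<in> I" using cd by auto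
  have W: "primitive_on a b (\<lambda>x. cnj (\<phi> x) * v1 x - cnj (qd \<phi> x) * v x) (\<lambda>x. r x *\<^sub>R (cnj (\<tau> \<phi> x) * v x - cnj (\<phi> x) * k x))"
    by (rule sol_wronskian[OF sol_cnj[OF dom_Tmax_sol[OF \<phi>m]] v(1)])
  have 0: "integral {c..d} (\<lambda>x. r x *\<^sub>R (cnj (\<tau> \<phi> x) * v x - cnj (\<phi> x) * k x)) = 0"
    using primitive_onD(2)[OF W less_imp_le[OF cd(1)] cd(2)] cd(3)[OF cdI(1)] cd(3)[OF cdI(2)] by simp
  have 1: "L2_inner M (\<tau> \<phi>) v = integral {c..d} (\<lambda>x. r x *\<^sub>R (cnj (\<tau> \<phi> x) * v x))"
    unfolding L2_inner_eq(2)[OF conjunct2[OF L] v(2)] by (intro integral_eq_on_support cd) (use cd(3) in auto)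
  have 2: "L2_inner M \<phi> k = integral {c..d} (\<lambda>x. r x *\<^sub>R (cnj (\<phi> x) * k x))"
    unfolding L2_inner_eq(2)[OF conjunct1[OF L] v(3)] by (intro integral_eq_on_support cd) (use cd(3) in auto)
  have i: "(\<lambda>x. r x *\<^sub>R (cnj (\<tau> \<phi> x) * v x)) absolutely_integrable_on {c..d}" "(\<lambda>x. r x *\<^sub>R (cnj (\<phi> x) * k x)) absolutely_integrable_on {c..d}"
    using L2_inner_eq(1)[OF conjunct2[OF L] v(2)] L2_inner_eq(1)[OF conjunct1[OF L] v(3)] cd(2)
    by (auto intro: set_integrable_subset)
  then have "integral {c..d} (\<lambda>x. r x *\<^sub>R (cnj (\<tau> \<phi> x) * v x - cnj (\<phi> x) * k x)) = L2_inner M (\<tau> \<phi>) v - L2_inner M \<phi> k"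
    unfolding 1 2 scaleR_diff_right by (intro Henstock_Kurzweil_Integration.integral_diff) (auto simp: absolutely_integrable_on_def)
  then show ?thesis using 0 by simp
qed

end

subsection \<open>Initial value problems\<close>

definition oriented_integral :: "(real \<Rightarrow> 'a::euclidean_space) \<Rightarrow> real \<Rightarrow> real \<Rightarrow> 'a" where
  "oriented_integral g x0 x = (if x0 \<le> x then integral {x0..x} g else - integral {x..x0} g)"

lemma oriented_integral_primitive:
  fixes g :: "real \<Rightarrow> 'a::euclidean_space"
  assumes x0: "x0 \<in> einterval a b" and g: "\<And>c d. {c..d} \<subseteq> einterval a b \<Longrightarrow> g absolutely_integrable_on {c..d}"
  shows "primitive_on a b (oriented_integral g x0) g"
  unfolding primitive_on_def
proof (intro allI impI conjI)
  fix c d :: real assume cd: "c \<le> d" "{c..d} \<subseteq> einterval a b"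
  show "g absolutely_integrable_on {c..d}" by (rule g[OF cd(2)])
  have I: "g integrable_on {u..v}" if "u \<in> einterval a b" "v \<in> einterval a b" for u v
    using g[OF Icc_subset_einterval[OF that]] by (simp add: absolutely_integrable_on_def)
  have cdI: "c \<in> einterval a b" "d \<in> einterval a b" using cd by auto
  have comb: "integral {u..v} g + integral {v..w} g = integral {u..w} g"
    if "u \<le> v" "v \<le> w" "u \<in> einterval a b" "w \<in> einterval a b" for u v w
    by (rule integral_combine_Icc[OF that(1,2) I[OF that(3,4)]])
  consider "x0 \<le> c" | "c < x0" "x0 \<le> d" | "d < x0" by linarith
  then show "oriented_integral g x0 d - oriented_integral g x0 c = integral {c..d} g"
  proof cases
    case 1
    then show ?thesis using comb[of x0 c d] cd x0 cdI by (simp add: oriented_integral_def algebra_simps)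
  next
    case 2
    then show ?thesis using comb[of c x0 d] cd x0 cdI by (simp add: oriented_integral_def algebra_simps)
  next
    case 3
    then show ?thesis using comb[of c d x0] cd x0 cdI by (simp add: oriented_integral_def algebra_simps)
  qed
qed

lemma oriented_integral_refl: "oriented_integral g x0 x0 = 0"
  by (simp add: oriented_integral_def)

lemma primitive_on_power:
  fixes k :: "real \<Rightarrow> real"
  assumes k: "primitive_on a b k m"
  shows "primitive_on a b (\<lambda>x. k x ^ Suc n) (\<lambda>x. real (Suc n) * m x * k x ^ n)"
proof (induction n)
  case 0
  show ?case using k by simp
next
  case (Suc n)
  have "primitive_on a b (\<lambda>x. k x * k x ^ Suc n) (\<lambda>x. k x * (real (Suc n) * m x * k x ^ n) + m x * k x ^ Suc n)"
    by (rule primitive_on_mult[OF k Suc])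
  then show ?case by (simp add: algebra_simps)
qed

text \<open>Picard iteration; the \<open>n\<close>-th increment at \<open>x\<close> is bounded by \<open>C k(x)^n / n!\<close>
  with \<open>k\<close> the integral of \<open>m\<close>.\<close>

lemma linear_system_solvable:
  fixes A :: "real \<Rightarrow> 'v::euclidean_space \<Rightarrow> 'v" and F :: "real \<Rightarrow> 'v"
  assumes x0: "x0 \<in> einterval a b"
    and m: "\<And>c d. {c..d} \<subseteq> einterval a b \<Longrightarrow> m absolutely_integrable_on {c..d}"
    and A_bound: "\<And>x y. norm (A x y) \<le> m x * norm y"
    and A_diff: "\<And>x y z. A x (y - z) = A x y - A x z"
    and A_int: "\<And>c d y. {c..d} \<subseteq> einterval a b \<Longrightarrow> continuous_on {c..d} y \<Longrightarrow> (\<lambda>x. A x (y x)) absolutely_integrable_on {c..d}"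
    and F: "\<And>c d. {c..d} \<subseteq> einterval a b \<Longrightarrow> F absolutely_integrable_on {c..d}"
  obtains y where "primitive_on a b y (\<lambda>x. A x (y x) + F x)" "y x0 = y0"
proof -
  define k where "k = oriented_integral m x0"
  have k: "primitive_on a b k m" unfolding k_def by (rule oriented_integral_primitive[OF x0 m])
  have k0: "k x0 = 0" by (simp add: k_def oriented_integral_refl)
  \<comment> \<open>The bound on \<open>A\<close>, read at a unit vector, forces \<open>m\<close> to
    be nonnegative.\<close>
  have m0: "m x \<ge> 0" for x
  proof -
    obtain v :: 'v where "norm v = 1" using vector_choose_size[of 1] by auto
    then show ?thesis using order_trans[OF norm_ge_zero A_bound[of x v]] by simp
  qed
  define step where "step y x = y0 + oriented_integral (\<lambda>t. A t (y t) + F t) x0 x" for y x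
  define Y where "Y n = (step ^^ n) (\<lambda>_. y0)" for n
  have Y0: "Y 0 = (\<lambda>_. y0)" and YS: "Y (Suc n) = step (Y n)" for n by (simp_all add: Y_def)
  have stepP: "primitive_on a b (step y) (\<lambda>t. A t (y t) + F t)" if y: "continuous_on (einterval a b) y" for y
  proof -
    have "primitive_on a b (oriented_integral (\<lambda>t. A t (y t) + F t) x0) (\<lambda>t. A t (y t) + F t)"
      by (rule oriented_integral_primitive[OF x0 set_integral_add(1)[OF A_int F]])
        (use y in \<open>auto intro: continuous_on_subset\<close>)
    then have "primitive_on a b (\<lambda>x. y0 + oriented_integral (\<lambda>t. A t (y t) + F t) x0 x) (\<lambda>t. 0 + (A t (y t) + F t))"
      by (rule primitive_on_add[OF primitive_on_const])
    then show ?thesis by (simp add: step_def[abs_def])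
  qed
  have Yc: "continuous_on (einterval a b) (Y n)" for n
  proof (induction n)
    case (Suc n)
    then show ?case unfolding YS by (rule primitive_on_continuous[OF stepP])
  qed (simp add: Y0)
  have YP: "primitive_on a b (Y (Suc n)) (\<lambda>t. A t (Y n t) + F t)" for n
    unfolding YS by (rule stepP[OF Yc])
  have Yx0: "Y n x0 = y0" for n by (cases n) (simp_all add: Y0 YS step_def oriented_integral_refl)
  have dP: "primitive_on a b (\<lambda>x. Y (Suc (Suc n)) x - Y (Suc n) x) (\<lambda>t. A t (Y (Suc n) t - Y n t))" for n
    using primitive_on_add[OF YP[of "Suc n"] primitive_on_linear[OF bounded_linear_minus[OF bounded_linear_ident] YP[of n]]]
    by (simp add: A_diff)
  have incr: "norm (Y (Suc n) x - Y n x) \<le> C * (\<bar>k x\<bar> ^ n / fact n)"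
    if cd: "{c..d} \<subseteq> einterval a b" "x0 \<in> {c..d}" and C: "\<And>x. x \<in> {c..d} \<Longrightarrow> norm (Y 1 x - Y 0 x) \<le> C" and x: "x \<in> {c..d}"
    for c d C n x
    using x
  proof (induction n arbitrary: x)
    case 0
    then show ?case using C by simp
  next
    case (Suc n)
    have xI: "x \<in> einterval a b" using Suc.prems cd by auto
    have C0: "C \<ge> 0" using C[OF cd(2)] norm_ge_zero order_trans by blast
    \<comment> \<open>A primitive of (n+1) m k^n is k^(n+1); the factor C/(n+1)! lets the integral
      of the inductive bound be read off as the next bound.\<close>
    note pw = primitive_on_linear[OF bounded_linear_mult_right[of "C / fact (Suc n)"] primitive_on_power[OF k, of n]]
    have fs: "C / fact (Suc n) * (real (Suc n) * m t * K ^ n) = m t * (C * (K ^ n / fact n))" for t K :: real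
      by (simp add: field_simps del: of_nat_Suc)
    show ?case
    proof (cases "x0 \<le> x")
      case True
      have sub: "{x0..x} \<subseteq> einterval a b" by (rule Icc_subset_einterval[OF x0 xI])
      have kp: "0 \<le> k t" if "t \<in> {x0..x}" for t
      proof -
        have "{x0..t} \<subseteq> einterval a b" using that sub by auto
        then have "k t - k x0 = integral {x0..t} m" using primitive_onD(2)[OF k, of x0 t] that by auto
        also have "\<dots> \<ge> 0" using m0 by (intro Henstock_Kurzweil_Integration.integral_nonneg) (use m \<open>{x0..t} \<subseteq> einterval a b\<close> in \<open>auto simp: absolutely_integrable_on_def\<close>)
        finally show ?thesis using k0 by simp
      qed
      have "Y (Suc (Suc n)) x - Y (Suc n) x = integral {x0..x} (\<lambda>t. A t (Y (Suc n) t - Y n t))"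
        using primitive_onD(2)[OF dP True sub] by (simp add: Yx0)
      also have "norm \<dots> \<le> integral {x0..x} (\<lambda>t. C / fact (Suc n) * (real (Suc n) * m t * k t ^ n))"
      proof (rule integral_norm_bound_integral)
        show "(\<lambda>t. A t (Y (Suc n) t - Y n t)) integrable_on {x0..x}"
          using primitive_onD(1)[OF dP True sub] by (simp add: absolutely_integrable_on_def)
        show "(\<lambda>t. C / fact (Suc n) * (real (Suc n) * m t * k t ^ n)) integrable_on {x0..x}"
          using primitive_onD(1)[OF pw True sub] by (simp only: absolutely_integrable_on_def)
        fix t assume t: "t \<in> {x0..x}"
        have "norm (A t (Y (Suc n) t - Y n t)) \<le> m t * norm (Y (Suc n) t - Y n t)" by (rule A_bound)
        also have "\<dots> \<le> m t * (C * (\<bar>k t\<bar> ^ n / fact n))"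
          using t cd(2) Suc.prems by (intro mult_left_mono Suc.IH m0) auto
        finally show "norm (A t (Y (Suc n) t - Y n t)) \<le> C / fact (Suc n) * (real (Suc n) * m t * k t ^ n)"
          unfolding fs using kp[OF t] by simp
      qed
      also have "\<dots> = C / fact (Suc n) * k x ^ Suc n"
        using primitive_onD(2)[OF pw True sub] by (simp add: k0)
      finally have "norm (Y (Suc (Suc n)) x - Y (Suc n) x) \<le> C / fact (Suc n) * k x ^ Suc n" .
      moreover have "\<bar>k x\<bar> = k x" using kp[of x] True by simp
      ultimately show ?thesis by (simp only: times_divide_eq_right times_divide_eq_left)
    next
      case False
      then have le: "x \<le> x0" by simp
      have sub: "{x..x0} \<subseteq> einterval a b" by (rule Icc_subset_einterval[OF xI x0])
      \<comment> \<open>Left of x0 the function \<open>k\<close> is nonpositive, so the same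
        computation is run with -k, whose density is -m.\<close>
      note k' = primitive_on_linear[OF bounded_linear_minus[OF bounded_linear_ident] k]
      note pw' = primitive_on_linear[OF bounded_linear_mult_right[of "- C / fact (Suc n)"] primitive_on_power[OF k', of n]]
      have fs': "- C / fact (Suc n) * (real (Suc n) * - m t * K ^ n) = m t * (C * (K ^ n / fact n))" for t K :: real
        using fs[of t K] by simp
      have kp: "k t \<le> 0" if "t \<in> {x..x0}" for t
      proof -
        have "{t..x0} \<subseteq> einterval a b" using that sub by auto
        then have "k x0 - k t = integral {t..x0} m" using primitive_onD(2)[OF k, of t x0] that by auto
        also have "\<dots> \<ge> 0" using m0 by (intro Henstock_Kurzweil_Integration.integral_nonneg) (use m \<open>{t..x0} \<subseteq> einterval a b\<close> in \<open>auto simp: absolutely_integrable_on_def\<close>)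
        finally show ?thesis using k0 by simp
      qed
      have eq: "- (Y (Suc (Suc n)) x - Y (Suc n) x) = integral {x..x0} (\<lambda>t. A t (Y (Suc n) t - Y n t))"
        using primitive_onD(2)[OF dP le sub] unfolding Yx0 diff_self diff_0 .
      have "norm (Y (Suc (Suc n)) x - Y (Suc n) x) = norm (integral {x..x0} (\<lambda>t. A t (Y (Suc n) t - Y n t)))"
        unfolding eq[symmetric] by (rule norm_minus_cancel[symmetric])
      also have "\<dots> \<le> integral {x..x0} (\<lambda>t. - C / fact (Suc n) * (real (Suc n) * - m t * (- k t) ^ n))"
      proof (rule integral_norm_bound_integral)
        show "(\<lambda>t. A t (Y (Suc n) t - Y n t)) integrable_on {x..x0}"
          using primitive_onD(1)[OF dP le sub] by (simp add: absolutely_integrable_on_def)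
        show "(\<lambda>t. - C / fact (Suc n) * (real (Suc n) * - m t * (- k t) ^ n)) integrable_on {x..x0}"
          using primitive_onD(1)[OF pw' le sub] by (simp only: absolutely_integrable_on_def)
        fix t assume t: "t \<in> {x..x0}"
        have "norm (A t (Y (Suc n) t - Y n t)) \<le> m t * norm (Y (Suc n) t - Y n t)" by (rule A_bound)
        also have "\<dots> \<le> m t * (C * (\<bar>k t\<bar> ^ n / fact n))"
          using t cd(2) Suc.prems by (intro mult_left_mono Suc.IH m0) auto
        finally show "norm (A t (Y (Suc n) t - Y n t)) \<le> - C / fact (Suc n) * (real (Suc n) * - m t * (- k t) ^ n)"
          unfolding fs' using kp[OF t] by (simp add: abs_of_nonpos)
      qed
      also have "\<dots> = C / fact (Suc n) * (- k x) ^ Suc n"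
        using primitive_onD(2)[OF pw' le sub] by (simp add: k0)
      finally show ?thesis using kp[of x] le by (simp add: abs_of_nonpos del: power_Suc fact_Suc)
    qed
  qed
  have bnd: "\<exists>C \<kappa>. C \<ge> 0 \<and> (\<forall>x\<in>{c..d}. \<forall>n. norm (Y (Suc n) x - Y n x) \<le> C * (\<kappa> ^ n / fact n))"
    if cd: "{c..d} \<subseteq> einterval a b" "x0 \<in> {c..d}" for c d
  proof -
    have "bounded ((\<lambda>x. Y 1 x - Y 0 x) ` {c..d})"
      by (intro compact_imp_bounded compact_continuous_image continuous_on_diff continuous_on_subset[OF Yc cd(1)]) auto
    then obtain C where C: "\<forall>x\<in>{c..d}. norm (Y 1 x - Y 0 x) \<le> C" by (auto simp: bounded_iff)
    have "bounded (k ` {c..d})"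
      by (intro compact_imp_bounded compact_continuous_image continuous_on_subset[OF primitive_on_continuous[OF k] cd(1)]) auto
    then obtain \<kappa> where \<kappa>: "\<forall>x\<in>{c..d}. norm (k x) \<le> \<kappa>" by (auto simp: bounded_iff)
    have C0: "C \<ge> 0" using C cd(2) norm_ge_zero order_trans by blast
    have "norm (Y (Suc n) x - Y n x) \<le> C * (\<kappa> ^ n / fact n)" if x: "x \<in> {c..d}" for x n
    proof -
      have "norm (Y (Suc n) x - Y n x) \<le> C * (\<bar>k x\<bar> ^ n / fact n)" by (rule incr[OF cd _ x]) (use C in auto)
      also have "\<dots> \<le> C * (\<kappa> ^ n / fact n)"
        using \<kappa> x C0 by (intro mult_left_mono divide_right_mono power_mono) auto
      finally show ?thesis .
    qed
    then show ?thesis using C0 by blast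
  qed
  have exps: "summable (\<lambda>n. C * (\<kappa> ^ n / fact n))" for C \<kappa> :: real
    using summable_mult[OF summable_exp[of \<kappa>], of C] by (simp add: field_simps inverse_eq_divide)
  define y where "y x = lim (\<lambda>n. Y n x)" for x
  have ybound: "\<exists>D. \<forall>x\<in>{c..d}. (\<lambda>n. Y n x) \<longlonglongrightarrow> y x \<and> (\<forall>n. norm (Y n x) \<le> D)"
    if cd: "{c..d} \<subseteq> einterval a b" "x0 \<in> {c..d}" for c d
  proof -
    obtain C \<kappa> where C: "C \<ge> 0" "\<And>x n. x \<in> {c..d} \<Longrightarrow> norm (Y (Suc n) x - Y n x) \<le> C * (\<kappa> ^ n / fact n)"
      using bnd[OF cd] by blast
    define D where "D = norm y0 + (\<Sum>n. \<bar>C * (\<kappa> ^ n / fact n)\<bar>)"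
    have abss: "summable (\<lambda>n. \<bar>C * (\<kappa> ^ n / fact n)\<bar>)"
      using summable_norm_cancel summable_mult[OF summable_norm_exp[of \<kappa>], of "\<bar>C\<bar>"]
      by (simp add: abs_mult power_abs divide_inverse mult_ac)
    have tele: "Y n x = y0 + (\<Sum>i<n. Y (Suc i) x - Y i x)" for n x
      using sum_lessThan_telescope[of "\<lambda>i. Y i x" n] by (simp add: Y0)
    show ?thesis
    proof (intro exI[of _ D] ballI conjI allI)
      fix x assume x: "x \<in> {c..d}"
      have sm: "summable (\<lambda>n. Y (Suc n) x - Y n x)"
        by (rule summable_comparison_test'[OF exps[of C \<kappa>], of 0]) (use C(2)[OF x] in auto)
      have "(\<lambda>n. y0 + (\<Sum>i<n. Y (Suc i) x - Y i x)) \<longlonglongrightarrow> y0 + (\<Sum>n. Y (Suc n) x - Y n x)"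
        by (intro tendsto_add tendsto_const summable_LIMSEQ sm)
      then have "(\<lambda>n. Y n x) \<longlonglongrightarrow> y0 + (\<Sum>n. Y (Suc n) x - Y n x)" unfolding tele[symmetric] .
      then show "(\<lambda>n. Y n x) \<longlonglongrightarrow> y x" unfolding y_def by (simp add: limI)
      fix n
      have "norm (Y n x) \<le> norm y0 + (\<Sum>i<n. norm (Y (Suc i) x - Y i x))"
        by (subst tele) (intro norm_triangle_mono order_refl norm_sum)
      also have "(\<Sum>i<n. norm (Y (Suc i) x - Y i x)) \<le> (\<Sum>i<n. \<bar>C * (\<kappa> ^ i / fact i)\<bar>)"
        using C(2)[OF x] by (intro sum_mono) (meson abs_ge_self order_trans)
      also have "\<dots> \<le> (\<Sum>n. \<bar>C * (\<kappa> ^ n / fact n)\<bar>)" by (rule sum_le_suminf[OF abss]) auto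
      finally show "norm (Y n x) \<le> D" by (simp add: D_def)
    qed
  qed
  have yP: "primitive_on a b y (\<lambda>x. A x (y x) + F x)"
    unfolding primitive_on_def
  proof (intro allI impI)
    fix c d assume cd: "c \<le> (d::real)" "{c..d} \<subseteq> einterval a b"
    have cdI: "c \<in> einterval a b" "d \<in> einterval a b" using cd by auto
    have sub: "{min c x0..max d x0} \<subseteq> einterval a b"
      by (rule Icc_subset_einterval) (use cdI x0 in \<open>auto simp: min_def max_def\<close>)
    have "x0 \<in> {min c x0..max d x0}" by auto
    from ybound[OF sub this] obtain D where "\<forall>x\<in>{min c x0..max d x0}. (\<lambda>n. Y n x) \<longlonglongrightarrow> y x \<and> (\<forall>n. norm (Y n x) \<le> D)" ..
    moreover have "x \<in> {min c x0..max d x0}" if "x \<in> {c..d}" for x using that by auto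
    ultimately have lim: "\<And>x. x \<in> {c..d} \<Longrightarrow> (\<lambda>n. Y n x) \<longlonglongrightarrow> y x" and D: "\<And>x n. x \<in> {c..d} \<Longrightarrow> norm (Y n x) \<le> D"
      by blast+
    have Alim: "(\<lambda>n. A x (Y n x) + F x) \<longlonglongrightarrow> A x (y x) + F x" if x: "x \<in> {c..d}" for x
    proof (intro tendsto_add tendsto_const LIM_zero_cancel[of "\<lambda>n. A x (Y n x)"])
      show "(\<lambda>n. A x (Y n x) - A x (y x)) \<longlonglongrightarrow> 0"
      proof (rule Lim_null_comparison)
        show "\<forall>\<^sub>F n in sequentially. norm (A x (Y n x) - A x (y x)) \<le> m x * norm (Y n x - y x)"
          using A_bound by (simp add: A_diff[symmetric])
        show "(\<lambda>n. m x * norm (Y n x - y x)) \<longlonglongrightarrow> 0"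
          using tendsto_mult_left[OF tendsto_norm_zero[OF LIM_zero[OF lim[OF x]]], of "m x"] by simp
      qed
    qed
    have AYi: "(\<lambda>x. A x (Y n x) + F x) absolutely_integrable_on {c..d}" for n
      by (intro set_integral_add(1) A_int F cd continuous_on_subset[OF Yc])
    have hi: "(\<lambda>x. m x * D + norm (F x)) absolutely_integrable_on {c..d}"
      using m[OF cd(2)] F[OF cd(2)] by (intro set_integral_add(1) set_integrable_norm) auto
    have bd: "norm (A x (Y n x) + F x) \<le> m x * D + norm (F x)" if "x \<in> {c..d}" for x n
    proof -
      have "norm (A x (Y n x)) \<le> m x * D"
        using A_bound[of x "Y n x"] mult_left_mono[OF D[OF that, of n] m0[of x]] by linarith
      then show ?thesis using norm_triangle_ineq[of "A x (Y n x)" "F x"] by linarith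
    qed
    have bg: "norm (A x (y x) + F x) \<le> m x * D + norm (F x)" if "x \<in> {c..d}" for x
      by (rule LIMSEQ_le_const2[OF tendsto_norm[OF Alim[OF that]]]) (use bd[OF that] in blast)
    have 1: "(\<lambda>x. A x (y x) + F x) absolutely_integrable_on {c..d}"
      by (rule dominated_convergence_absolutely_integrable[OF AYi _ bg Alim]) (use hi in \<open>auto simp: absolutely_integrable_on_def\<close>)
    have 2: "(\<lambda>n. integral {c..d} (\<lambda>x. A x (Y n x) + F x)) \<longlonglongrightarrow> integral {c..d} (\<lambda>x. A x (y x) + F x)"
      by (rule dominated_convergence(2)[OF _ _ bd Alim]) (use AYi hi in \<open>auto simp: absolutely_integrable_on_def\<close>)
    have "(\<lambda>n. Y (Suc n) d - Y (Suc n) c) \<longlonglongrightarrow> y d - y c"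
      using cd(1) by (intro tendsto_diff LIMSEQ_Suc lim) auto
    moreover have "Y (Suc n) d - Y (Suc n) c = integral {c..d} (\<lambda>x. A x (Y n x) + F x)" for n
      by (rule primitive_onD(2)[OF YP cd])
    ultimately have "y d - y c = integral {c..d} (\<lambda>x. A x (y x) + F x)" using LIMSEQ_unique[OF _ 2] by simp
    with 1 show "(\<lambda>x. A x (y x) + F x) absolutely_integrable_on {c..d} \<and> y d - y c = integral {c..d} (\<lambda>x. A x (y x) + F x)" ..
  qed
  show ?thesis
  proof (rule that[OF yP])
    show "y x0 = y0" by (simp add: y_def Yx0)
  qed
qed

context sl_problem
begin

text \<open>The equation is a linear system for the pair (u, u1) with locally integrable matrix;
  \<open>m\<close> is the sum of the absolute values of the four entries.\<close>

lemma sol_exists: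
  assumes x0: "x0 \<in> I" and h: "\<And>c d. {c..d} \<subseteq> I \<Longrightarrow> (\<lambda>x. r x *\<^sub>R h x) absolutely_integrable_on {c..d}"
  obtains u u1 where "sol u u1 h" "u x0 = \<alpha>" "u1 x0 = \<beta>"
proof -
  define A where "A x y = (inverse (p x) *\<^sub>R snd y - s x *\<^sub>R fst y, s x *\<^sub>R snd y + q x *\<^sub>R fst y)"
    for x and y :: "complex \<times> complex"
  define F where "F x = (0 :: complex, - (r x *\<^sub>R h x))" for x
  define m where "m x = \<bar>inverse (p x)\<bar> + \<bar>s x\<bar> + (\<bar>s x\<bar> + \<bar>q x\<bar>)" for x
  have pair: "(\<lambda>x. (f x, g x)) absolutely_integrable_on {c..d}"
    if f: "f absolutely_integrable_on {c..d}" and g: "g absolutely_integrable_on {c..d}" for f g :: "real \<Rightarrow> complex" and c d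
  proof -
    have "bounded_linear (\<lambda>z::complex. (z, 0::complex))" "bounded_linear (\<lambda>z::complex. (0::complex, z))"
      by (intro bounded_linear_Pair bounded_linear_ident bounded_linear_zero)+
    then have "(\<lambda>x. (f x, 0) + (0, g x)) absolutely_integrable_on {c..d}"
      using absolutely_integrable_linear[OF f] absolutely_integrable_linear[OF g] by (intro set_integral_add(1)) (auto simp: o_def)
    then show ?thesis by simp
  qed
  obtain y where y: "primitive_on a b y (\<lambda>x. A x (y x) + F x)" "y x0 = (\<alpha>, \<beta>)"
  proof (rule linear_system_solvable[OF x0, of m A F])
    fix c d assume cd: "{c..d} \<subseteq> I"
    note ci = coeff_integrable[OF cd]
    show "m absolutely_integrable_on {c..d}" unfolding m_def using ci by (intro set_integral_add(1) set_integrable_abs)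
    have "(\<lambda>x. (0::complex)) absolutely_integrable_on {c..d}" by simp
    moreover have "(\<lambda>x. - (r x *\<^sub>R h x)) absolutely_integrable_on {c..d}"
      using absolutely_integrable_linear[OF h[OF cd] bounded_linear_minus[OF bounded_linear_ident]]
      by (simp add: o_def)
    ultimately show "F absolutely_integrable_on {c..d}" unfolding F_def by (rule pair)
    fix y :: "real \<Rightarrow> complex \<times> complex" assume y: "continuous_on {c..d} y"
    note sc = absolutely_integrable_scaleR_continuous
    show "(\<lambda>x. A x (y x)) absolutely_integrable_on {c..d}" unfolding A_def
      by (intro pair set_integral_diff(1) set_integral_add(1) sc ci continuous_on_fst continuous_on_snd y)
  next
    fix x and y :: "complex \<times> complex"
    have f: "norm (fst y) \<le> norm y" and s: "norm (snd y) \<le> norm y"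
      using norm_fst_le[of "fst y" "snd y"] norm_snd_le[of "snd y" "fst y"] by simp_all
    have "norm (A x y) \<le> norm (inverse (p x) *\<^sub>R snd y - s x *\<^sub>R fst y) + norm (s x *\<^sub>R snd y + q x *\<^sub>R fst y)"
      unfolding A_def by (rule norm_Pair_le)
    also have "\<dots> \<le> (\<bar>inverse (p x)\<bar> * norm (snd y) + \<bar>s x\<bar> * norm (fst y)) + (\<bar>s x\<bar> * norm (snd y) + \<bar>q x\<bar> * norm (fst y))"
      by (intro add_mono order_trans[OF norm_triangle_ineq4] order_trans[OF norm_triangle_ineq]) simp_all
    also have "\<dots> \<le> (\<bar>inverse (p x)\<bar> * norm y + \<bar>s x\<bar> * norm y) + (\<bar>s x\<bar> * norm y + \<bar>q x\<bar> * norm y)"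
      by (intro add_mono mult_left_mono f s abs_ge_zero)
    finally show "norm (A x y) \<le> m x * norm y" by (simp add: m_def algebra_simps)
  next
    fix x and y z :: "complex \<times> complex"
    show "A x (y - z) = A x y - A x z" by (simp add: A_def algebra_simps)
  qed
  have "primitive_on a b (\<lambda>x. fst (y x)) (\<lambda>x. fst (A x (y x) + F x))" "primitive_on a b (\<lambda>x. snd (y x)) (\<lambda>x. snd (A x (y x) + F x))"
    by (rule primitive_on_linear[OF bounded_linear_fst y(1)], rule primitive_on_linear[OF bounded_linear_snd y(1)])
  then have "sol (\<lambda>x. fst (y x)) (\<lambda>x. snd (y x)) h" unfolding sol_def by (simp add: A_def F_def)
  then show ?thesis by (rule that) (simp_all add: y(2))
qed

end

subsection \<open>The adjoint of the preminimal operator\<close>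

lemma absolutely_integrable_zero_AE:
  fixes g :: "real \<Rightarrow> real"
  assumes g: "g absolutely_integrable_on S" and pos: "AE x\<in>S in lebesgue. 0 \<le> g x" and int: "integral S g = 0"
  shows "AE x\<in>S in lebesgue. g x = 0"
proof -
  have "(LINT x|lebesgue. indicator S x *\<^sub>R g x) = 0"
    using set_lebesgue_integral_eq_integral(2)[OF g] int by (simp add: set_lebesgue_integral_def)
  moreover have "AE x in lebesgue. 0 \<le> indicator S x *\<^sub>R g x"
    using pos by eventually_elim (auto simp: indicator_def)
  ultimately have "AE x in lebesgue. indicator S x *\<^sub>R g x = 0"
    using g integral_nonneg_eq_0_iff_AE unfolding set_integrable_def by blast
  then show ?thesis by eventually_elim auto
qed

context sl_problem
begin

text \<open>Restriction to a compact subinterval makes the problem regular: all solutions are in L2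
  there, which allows orthogonal projection onto them in \<open>T0_adjoint_local\<close>.\<close>

lemma subproblem:
  assumes "ereal c < ereal d" "{c..d} \<subseteq> I"
  shows "sl_problem (ereal c) (ereal d) p q r s"
proof -
  have "einterval (ereal c) (ereal d) \<subseteq> {c..d}" by (auto simp: einterval_def)
  with assms(2) have sub: "einterval (ereal c) (ereal d) \<subseteq> I" by blast
  have AE: "AE x\<in>einterval (ereal c) (ereal d) in lebesgue. P x" if "AE x\<in>I in lebesgue. P x" for P
    using that by eventually_elim (use sub in auto)
  have p0: "AE x\<in>I in lebesgue. p x \<noteq> 0" using coeffs by (simp add: sl_coefficients_def)
  have sm: "s \<in> borel_measurable (lebesgue_on I)" using coeffs by (auto simp: sl_coefficients_def)
  note meas = measurable_restrict_mono[OF _ sub]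
  have L1: "L1_loc (ereal c) (ereal d) f" if "L1_loc a b f" for f
    using that sub unfolding L1_loc_def by blast
  have "sl_coefficients (ereal c) (ereal d) p q r s"
    unfolding sl_coefficients_def
    using assms(1) AE[OF r_pos] AE[OF p0] L1 coeffs meas[OF p_measurable] meas[OF q_measurable] meas[OF r_measurable] meas[OF sm]
    by (auto simp: sl_coefficients_def)
  then show ?thesis using AE[OF p_pos] by (simp add: sl_problem_def)
qed

lemma subproblem_inner:
  assumes cd: "c < d" "{c..d} \<subseteq> I" and fg: "f \<in> L2 (weighted_measure (ereal c) (ereal d) r)" "g \<in> L2 (weighted_measure (ereal c) (ereal d) r)"
  shows "L2_inner (weighted_measure (ereal c) (ereal d) r) f g = integral {c..d} (\<lambda>x. r x *\<^sub>R (cnj (f x) * g x))"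
proof -
  interpret N: sl_problem "ereal c" "ereal d" p q r s by (rule subproblem) (use cd in auto)
  have "einterval (ereal c) (ereal d) = {c<..<d}" by (auto simp: einterval_def)
  then show ?thesis using N.L2_inner_eq(2)[OF fg] by (simp add: integral_open_interval_real)
qed

lemma subproblem_L2:
  assumes cd: "c < d" "{c..d} \<subseteq> I"
  shows "f \<in> L2 M \<Longrightarrow> f \<in> L2 (weighted_measure (ereal c) (ereal d) r)"
    "continuous_on {c..d} f \<Longrightarrow> f \<in> L2 (weighted_measure (ereal c) (ereal d) r)"
proof -
  interpret N: sl_problem "ereal c" "ereal d" p q r s by (rule subproblem) (use cd in auto)
  have e: "einterval (ereal c) (ereal d) = {c<..<d}" by (auto simp: einterval_def)
  have sub: "{c<..<d} \<subseteq> I" "{c<..<d} \<subseteq> {c..d}" using cd by (auto intro: less_imp_le)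
  {
    assume "f \<in> L2 M"
    then have f: "f \<in> borel_measurable (lebesgue_on I)" "(\<lambda>x. r x * (cmod (f x))\<^sup>2) absolutely_integrable_on I"
      by (auto simp: L2_iff)
    show "f \<in> L2 (weighted_measure (ereal c) (ereal d) r)"
      unfolding N.L2_iff e using measurable_restrict_mono[OF f(1) sub(1)] set_integrable_subset[OF f(2) _ sub(1)] by auto
  next
    assume f: "continuous_on {c..d} f"
    have "f \<in> borel_measurable (lebesgue_on {c<..<d})"
      by (intro continuous_imp_measurable_on_sets_lebesgue continuous_on_subset[OF f]) auto
    moreover have "(\<lambda>x. r x *\<^sub>R (cmod (f x))\<^sup>2) absolutely_integrable_on {c..d}"
      by (intro absolutely_integrable_scaleR_continuous coeff_integrable(3) cd continuous_intros f)
    then have "(\<lambda>x. r x * (cmod (f x))\<^sup>2) absolutely_integrable_on {c<..<d}"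
      using sub(2) by (auto intro: set_integrable_subset)
    ultimately show "f \<in> L2 (weighted_measure (ereal c) (ereal d) r)" unfolding N.L2_iff e by blast
  }
qed

lemma sol_wronskian_const:
  assumes "sol u u1 (\<lambda>_. 0)" "sol v v1 (\<lambda>_. 0)" "x \<in> I" "y \<in> I"
  shows "u x * v1 x - u1 x * v x = u y * v1 y - u1 y * v y"
proof -
  note W = sol_wronskian[OF assms(1,2)]
  have "u y * v1 y - u1 y * v y = u x * v1 x - u1 x * v x" if "x \<in> I" "y \<in> I" "x \<le> y" for x y
    using primitive_onD(2)[OF W that(3) Icc_subset_einterval[OF that(1,2)]] by simp
  then show ?thesis using assms(3,4) by (metis linear)
qed

lemma sol_zero_on_interval:
  assumes u: "sol u u1 h" and cd: "{c<..<d} \<subseteq> I" and z: "\<And>x. x \<in> {c<..<d} \<Longrightarrow> u x = 0" and x: "x \<in> {c<..<d}"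
  shows "u1 x = 0"
proof (rule continuous_AE_eq_on_open[OF _ _ _ _ x, of u1 "\<lambda>_. 0"])
  show "continuous_on {c<..<d} u1" by (rule continuous_on_subset[OF sol_continuous(2)[OF u] cd])
  have pu: "primitive_on a b u (\<lambda>x. inverse (p x) *\<^sub>R u1 x - s x *\<^sub>R u x)" using u by (simp add: sol_def)
  have key: "u1 y = 0" if y: "y \<in> {c<..<d}" and py: "p y > 0"
    and d: "(u has_vector_derivative inverse (p y) *\<^sub>R u1 y - s y *\<^sub>R u y) (at y)" for y
  proof -
    have "vector_derivative u (at y) = 0" by (rule vector_derivative_zero_on_open[OF _ y z]) auto
    then show ?thesis using vector_derivative_at[OF d] z[OF y] py by simp
  qed
  show "AE x\<in>{c<..<d} in lebesgue. u1 x = 0"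
    using primitive_on_AE_derivative[OF pu] p_pos by eventually_elim (use key cd in auto)
qed auto

lemma fundamental_system:
  assumes x0: "x0 \<in> I"
  obtains y y' z z' where "sol y y' (\<lambda>_. 0)" "sol z z' (\<lambda>_. 0)" "\<And>x. x \<in> I \<Longrightarrow> y x * z' x - y' x * z x = 1"
proof -
  have i: "(\<lambda>x. r x *\<^sub>R (0::complex)) absolutely_integrable_on {c..d}" for c d by simp
  obtain y y' where y: "sol y y' (\<lambda>_. 0)" "y x0 = 1" "y' x0 = 0" by (rule sol_exists[OF x0 i])
  obtain z z' where z: "sol z z' (\<lambda>_. 0)" "z x0 = 0" "z' x0 = 1" by (rule sol_exists[OF x0 i])
  show ?thesis
  proof (rule that[OF y(1) z(1)])
    fix x assume "x \<in> I"
    then show "y x * z' x - y' x * z x = 1" using sol_wronskian_const[OF y(1) z(1) _ x0, of x] y z by simp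
  qed
qed

text \<open>A solution with zero data has zero Wronskian with both members of a fundamental system,
  and Cramer's rule then returns the value 0 at every point.\<close>

lemma sol_unique:
  assumes u: "sol u u1 (\<lambda>_. 0)" and x0: "x0 \<in> I" "u x0 = 0" "u1 x0 = 0" and x: "x \<in> I"
  shows "u x = 0"
proof -
  obtain y y' z z' where y: "sol y y' (\<lambda>_. 0)" and z: "sol z z' (\<lambda>_. 0)" and W: "\<And>x. x \<in> I \<Longrightarrow> y x * z' x - y' x * z x = 1"
    using fundamental_system[OF x0(1)] by metis
  have 1: "u x * y' x - u1 x * y x = 0" "u x * z' x - u1 x * z x = 0"
    using sol_wronskian_const[OF u y x x0(1)] sol_wronskian_const[OF u z x x0(1)] x0 by auto
  have "u x = u x * (y x * z' x - y' x * z x)" using W[OF x] by simp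
  also have "\<dots> = y x * (u x * z' x - u1 x * z x) - z x * (u x * y' x - u1 x * y x)" by (simp add: algebra_simps)
  finally show ?thesis using 1 by simp
qed

lemma L2_norm_zero_AE:
  assumes "f \<in> L2 M" "L2_norm M f = 0"
  shows "AE x\<in>I in lebesgue. f x = 0"
proof -
  have f: "(\<lambda>x. r x * (cmod (f x))\<^sup>2) absolutely_integrable_on I" using assms(1) by (simp add: L2_iff)
  have "AE x\<in>I in lebesgue. r x * (cmod (f x))\<^sup>2 = 0"
  proof (rule absolutely_integrable_zero_AE[OF f])
    show "AE x\<in>I in lebesgue. 0 \<le> r x * (cmod (f x))\<^sup>2" using r_pos by eventually_elim auto
    show "integral I (\<lambda>x. r x * (cmod (f x))\<^sup>2) = 0" using L2_norm_sq[OF assms(1)] assms(2) by simp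
  qed
  then show ?thesis using r_pos by eventually_elim auto
qed

lemma L2_restrict_Icc:
  assumes f: "f \<in> borel_measurable (lebesgue_on I)" "(\<lambda>x. r x * (cmod (f x))\<^sup>2) absolutely_integrable_on {c..d}"
    and cd: "{c..d} \<subseteq> I"
  shows "(\<lambda>x. if x \<in> {c..d} then f x else 0) \<in> L2 M"
  unfolding L2_iff
proof
  have ms: "{c..d} \<in> sets (lebesgue_on I)" using cd by (auto simp: sets_restrict_space_iff)
  show "(\<lambda>x. if x \<in> {c..d} then f x else 0) \<in> borel_measurable (lebesgue_on I)"
    using f(1) ms by (intro measurable_If_set) (auto simp: Int_absorb2 cd)
  have eq: "(\<lambda>x. if x \<in> I then r x * (cmod (if x \<in> {c..d} then f x else 0))\<^sup>2 else 0) = (\<lambda>x. if x \<in> {c..d} then r x * (cmod (f x))\<^sup>2 else 0)"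
    using cd by (auto simp: fun_eq_iff)
  show "(\<lambda>x. r x * (cmod (if x \<in> {c..d} then f x else 0))\<^sup>2) absolutely_integrable_on I"
    by (rule absolutely_integrable_restrict_UNIV[THEN iffD1])
      (unfold eq, rule absolutely_integrable_restrict_UNIV[THEN iffD2, OF f(2)])
qed

text \<open>For the solution with zero data at \<open>c\<close>, the Wronskians with
  \<open>y\<close> and \<open>z\<close> at \<open>d\<close> are, up to sign, the pairings of
  \<open>k\<close> with \<open>y\<close> and \<open>z\<close>. When these vanish, so do the data at
  \<open>d\<close>, and extension by zero gives a member of the domain of T0.\<close>

lemma T0_range:
  assumes cd: "c < d" "{c..d} \<subseteq> I" and k: "k \<in> L2 M" "\<And>x. x \<notin> {c..d} \<Longrightarrow> k x = 0"
    and y: "sol y y' (\<lambda>_. 0)" and z: "sol z z' (\<lambda>_. 0)" and W: "\<And>x. x \<in> I \<Longrightarrow> y x * z' x - y' x * z x = 1"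
    and orth: "integral {c..d} (\<lambda>x. r x *\<^sub>R (y x * k x)) = 0" "integral {c..d} (\<lambda>x. r x *\<^sub>R (z x * k x)) = 0"
  obtains \<phi> \<phi>1 where "\<phi> \<in> T0" "AE x\<in>I in lebesgue. \<tau> \<phi> x = k x" "sol \<phi> \<phi>1 k"
    "\<phi> c = 0" "\<phi>1 c = 0" "\<phi> d = 0" "\<phi>1 d = 0" "\<And>x. x \<notin> {c..d} \<Longrightarrow> \<phi> x = 0"
proof -
  have cI: "c \<in> I" "d \<in> I" using cd by auto
  obtain \<phi> \<phi>1 where \<phi>: "sol \<phi> \<phi>1 k" "\<phi> c = 0" "\<phi>1 c = 0"
    by (rule sol_exists[OF cI(1) L2_weight_integrable[OF k(1)]])
  have Wd: "v d * \<phi>1 d - v' d * \<phi> d = 0" if v: "sol v v' (\<lambda>_. 0)" and o: "integral {c..d} (\<lambda>x. r x *\<^sub>R (v x * k x)) = 0" for v v'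
  proof -
    have "integral {c..d} (\<lambda>x. r x *\<^sub>R (0 * \<phi> x - v x * k x)) = 0" using o by simp
    then show ?thesis
      using primitive_onD(2)[OF sol_wronskian[OF v \<phi>(1)] less_imp_le[OF cd(1)] cd(2)] \<phi>(2,3) by simp
  qed
  note 1 = Wd[OF y orth(1)] and 2 = Wd[OF z orth(2)]
  have "\<phi> d = \<phi> d * (y d * z' d - y' d * z d)" using W[OF cI(2)] by simp
  also have "\<dots> = z d * (y d * \<phi>1 d - y' d * \<phi> d) - y d * (z d * \<phi>1 d - z' d * \<phi> d)" by (simp add: algebra_simps)
  finally have d0: "\<phi> d = 0" using 1 2 by simp
  have "\<phi>1 d = \<phi>1 d * (y d * z' d - y' d * z d)" using W[OF cI(2)] by simp
  also have "\<dots> = z' d * (y d * \<phi>1 d - y' d * \<phi> d) - y' d * (z d * \<phi>1 d - z' d * \<phi> d)" by (simp add: algebra_simps)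
  finally have d1: "\<phi>1 d = 0" using 1 2 by simp
  define \<psi> \<psi>1 where "\<psi> = (\<lambda>x. if x \<in> {c..d} then \<phi> x else 0)" and "\<psi>1 = (\<lambda>x. if x \<in> {c..d} then \<phi>1 x else 0)"
  have "(\<lambda>x. if x \<in> {c..d} then k x else 0) = k" using k(2) by auto
  then have \<psi>: "sol \<psi> \<psi>1 k" unfolding \<psi>_def \<psi>1_def using sol_truncate[OF \<phi>(1) cd(2) \<phi>(2,3) d0 d1] by simp
  have \<psi>c: "continuous_on I \<psi>" by (rule sol_continuous(1)[OF \<psi>])
  have "\<psi> \<in> L2 M"
  proof -
    have "(\<lambda>x. r x *\<^sub>R (cmod (\<psi> x))\<^sup>2) absolutely_integrable_on {c..d}"
      by (intro absolutely_integrable_scaleR_continuous coeff_integrable(3) cd continuous_intros continuous_on_subset[OF \<psi>c])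
    moreover have "\<psi> \<in> borel_measurable (lebesgue_on I)" by (rule continuous_imp_measurable_on_sets_lebesgue[OF \<psi>c]) auto
    ultimately have "(\<lambda>x. if x \<in> {c..d} then \<psi> x else 0) \<in> L2 M" by (intro L2_restrict_Icc cd) auto
    moreover have "(\<lambda>x. if x \<in> {c..d} then \<psi> x else 0) = \<psi>" by (auto simp: \<psi>_def)
    ultimately show ?thesis by simp
  qed
  note T = sol_dom_Tmax[OF \<psi> this k(1)]
  have "\<psi> \<in> T0"
    unfolding dom_T0_def using T(1) cd(2) by (auto simp: \<psi>_def intro!: exI[of _ "{c..d}"])
  then show ?thesis by (rule that[OF _ T(2) \<psi>]) (use \<phi> d0 d1 in \<open>auto simp: \<psi>_def \<psi>1_def\<close>)
qed

text \<open>A du Bois-Reymond argument. Subtract from \<open>f\<close> a solution \<open>w\<close>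
  with right-hand side \<open>h\<close>, and split off the projection onto the conjugates of a
  fundamental system. The remainder \<open>k0\<close> satisfies the solvability conditions of
  \<open>T0_range\<close>, so it is \<tau> \<phi> for some \<phi> in \<open>T0\<close>; then it is
  orthogonal to f - w and therefore to itself.\<close>

lemma T0_adjoint_local:
  assumes f: "f \<in> L2 M" and h: "h \<in> L2 M"
    and adj: "\<And>\<phi>. \<phi> \<in> T0 \<Longrightarrow> L2_inner M (\<tau> \<phi>) f = L2_inner M \<phi> h"
    and cd: "c < d" "{c..d} \<subseteq> I"
  obtains g g1 where "sol g g1 h" "AE x\<in>{c..d} in lebesgue. f x = g x"
proof -
  let ?N = "weighted_measure (ereal c) (ereal d) r"
  interpret N: sl_problem "ereal c" "ereal d" p q r s by (rule subproblem) (use cd in auto)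
  have cI: "c \<in> I" "d \<in> I" using cd by auto
  have eN: "einterval (ereal c) (ereal d) = {c<..<d}" by (auto simp: einterval_def)
  have oI: "{c<..<d} \<subseteq> I" using cd by (auto intro: less_imp_le)
  note NL2 = subproblem_L2[OF cd] and Ninner = subproblem_inner[OF cd]
  obtain y y' z0 z0' where y: "sol y y' (\<lambda>_. 0)" and z0: "sol z0 z0' (\<lambda>_. 0)" and W0: "\<And>x. x \<in> I \<Longrightarrow> y x * z0' x - y' x * z0 x = 1"
    using fundamental_system[OF cI(1)] by metis
  have solN: "v \<in> L2 ?N" "(\<lambda>x. cnj (v x)) \<in> L2 ?N" if "sol v v' k" for v v' k
    using sol_continuous(1)[OF that] cd(2) by (auto intro!: NL2(2) continuous_intros intro: continuous_on_subset)
  \<comment> \<open>If such a solution vanished a.e. on (c,d), so would its quasi-derivative, and a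
    Wronskian there could not be 1.\<close>
  have pos: "L2_norm ?N (\<lambda>x. cnj (v x)) \<noteq> 0" if v: "sol v v' (\<lambda>_. 0)" and ne: "\<exists>w w'. \<forall>x\<in>I. v x * w' x - v' x * w x = (1::complex) \<or> w x * v' x - w' x * v x = (1::complex)" for v v'
  proof
    assume "L2_norm ?N (\<lambda>x. cnj (v x)) = 0"
    then have "AE x\<in>{c<..<d} in lebesgue. cnj (v x) = 0" using N.L2_norm_zero_AE[OF solN(2)[OF v]] by (simp add: eN)
    then have "AE x\<in>{c<..<d} in lebesgue. v x = 0" by simp
    then have v0: "v x = 0" if "x \<in> {c<..<d}" for x
      by (rule continuous_AE_eq_on_open[OF _ continuous_on_subset[OF sol_continuous(1)[OF v] oI] continuous_on_const _ that, rotated]) auto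
    have mid: "(c + d) / 2 \<in> {c<..<d}" using cd by auto
    have "v' ((c + d) / 2) = 0" by (rule sol_zero_on_interval[OF v oI v0 mid])
    moreover obtain w w' where "\<forall>x\<in>I. v x * w' x - v' x * w x = (1::complex) \<or> w x * v' x - w' x * v x = (1::complex)"
      using ne by blast
    then have "v ((c + d) / 2) * w' ((c + d) / 2) - v' ((c + d) / 2) * w ((c + d) / 2) = 1 \<or>
      w ((c + d) / 2) * v' ((c + d) / 2) - w' ((c + d) / 2) * v ((c + d) / 2) = 1"
      by (rule bspec) (use oI mid in blast)
    ultimately show False using v0[OF mid] by simp
  qed
  \<comment> \<open>Gram-Schmidt: subtracting a multiple of \<open>y\<close> makes the conjugates of
    \<open>y\<close> and \<open>z\<close> orthogonal on (c,d) and leaves the Wronskian equal to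
    1.\<close>
  define \<kappa> where "\<kappa> = L2_inner ?N (\<lambda>x. cnj (y x)) (\<lambda>x. cnj (z0 x)) / L2_inner ?N (\<lambda>x. cnj (y x)) (\<lambda>x. cnj (y x))"
  define z z' where "z = (\<lambda>x. z0 x + (- cnj \<kappa>) * y x)" and "z' = (\<lambda>x. z0' x + (- cnj \<kappa>) * y' x)"
  have z: "sol z z' (\<lambda>_. 0)" unfolding z_def z'_def using sol_add_scale[OF z0 y, of "- cnj \<kappa>"] by simp
  have W: "y x * z' x - y' x * z x = 1" if "x \<in> I" for x
    using W0[OF that] by (simp add: z_def z'_def algebra_simps)
  have yn: "L2_inner ?N (\<lambda>x. cnj (y x)) (\<lambda>x. cnj (y x)) \<noteq> 0"
    using pos[OF y] W0 by (auto simp: L2_inner_self)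
  have zn: "L2_inner ?N (\<lambda>x. cnj (z x)) (\<lambda>x. cnj (z x)) \<noteq> 0"
    using pos[OF z] W by (auto simp: L2_inner_self)
  have zc: "(\<lambda>x. cnj (z x)) = (\<lambda>x. cnj (z0 x) + (- \<kappa>) * cnj (y x))" by (simp add: z_def)
  have yz: "L2_inner ?N (\<lambda>x. cnj (y x)) (\<lambda>x. cnj (z x)) = 0"
    unfolding zc L2_inner_add_right[OF solN(2)[OF y] solN(2)[OF z0] solN(2)[OF y]] using yn by (simp add: \<kappa>_def)
  then have zy: "L2_inner ?N (\<lambda>x. cnj (z x)) (\<lambda>x. cnj (y x)) = 0" using L2_inner_commute by (metis complex_cnj_zero)
  obtain w w1 where w: "sol w w1 h" by (rule sol_exists[OF cI(1) L2_weight_integrable[OF h]])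
  define F where "F = (\<lambda>x. f x - w x)"
  have FN: "F \<in> L2 ?N" unfolding F_def by (intro L2_diff NL2(1) f solN(1)[OF w])
  define \<alpha> where "\<alpha> = L2_inner ?N (\<lambda>x. cnj (y x)) F / L2_inner ?N (\<lambda>x. cnj (y x)) (\<lambda>x. cnj (y x))"
  define \<beta> where "\<beta> = L2_inner ?N (\<lambda>x. cnj (z x)) F / L2_inner ?N (\<lambda>x. cnj (z x)) (\<lambda>x. cnj (z x))"
  define k0 where "k0 = (\<lambda>x. (F x + (- \<alpha>) * cnj (y x)) + (- \<beta>) * cnj (z x))"
  have k1N: "(\<lambda>x. F x + (- \<alpha>) * cnj (y x)) \<in> L2 ?N" by (intro L2_add_scale FN solN(2)[OF y])
  have k0N: "k0 \<in> L2 ?N" unfolding k0_def by (intro L2_add_scale[OF k1N] solN(2)[OF z])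
  have oy: "L2_inner ?N (\<lambda>x. cnj (y x)) k0 = 0"
    unfolding k0_def L2_inner_add_right[OF solN(2)[OF y] k1N solN(2)[OF z]] L2_inner_add_right[OF solN(2)[OF y] FN solN(2)[OF y]] yz
    using yn by (simp add: \<alpha>_def)
  have oz: "L2_inner ?N (\<lambda>x. cnj (z x)) k0 = 0"
    unfolding k0_def L2_inner_add_right[OF solN(2)[OF z] k1N solN(2)[OF z]] L2_inner_add_right[OF solN(2)[OF z] FN solN(2)[OF y]] zy
    using zn by (simp add: \<beta>_def)
  define k where "k = (\<lambda>x. if x \<in> {c..d} then k0 x else 0)"
  have k0': "k x = 0" if "x \<notin> {c..d}" for x using that by (auto simp: k_def)
  have kM: "k \<in> L2 M"
  proof -
    let ?g = "\<lambda>x. if x \<in> {c..d} then w x + (\<alpha> * cnj (y x) + \<beta> * cnj (z x)) else 0" and ?f = "\<lambda>x. if x \<in> {c..d} then f x else 0"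
    have fM: "f \<in> borel_measurable (lebesgue_on I)" "(\<lambda>x. r x * (cmod (f x))\<^sup>2) absolutely_integrable_on I" using f by (auto simp: L2_iff)
    have cont: "continuous_on I (\<lambda>x. w x + (\<alpha> * cnj (y x) + \<beta> * cnj (z x)))"
      by (intro continuous_intros sol_continuous(1)[OF w] sol_continuous(1)[OF y] sol_continuous(1)[OF z])
    note rest = L2_restrict_Icc[OF _ _ cd(2)]
    have "?g \<in> L2 M"
    proof (rule rest)
      show "(\<lambda>x. w x + (\<alpha> * cnj (y x) + \<beta> * cnj (z x))) \<in> borel_measurable (lebesgue_on I)"
        by (rule continuous_imp_measurable_on_sets_lebesgue[OF cont]) auto
      have "(\<lambda>x. r x *\<^sub>R (cmod (w x + (\<alpha> * cnj (y x) + \<beta> * cnj (z x))))\<^sup>2) absolutely_integrable_on {c..d}"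
        by (intro absolutely_integrable_scaleR_continuous coeff_integrable(3) cd continuous_on_power continuous_on_norm continuous_on_subset[OF cont])
      then show "(\<lambda>x. r x * (cmod (w x + (\<alpha> * cnj (y x) + \<beta> * cnj (z x))))\<^sup>2) absolutely_integrable_on {c..d}" by simp
    qed
    moreover have "?f \<in> L2 M" using fM(1) set_integrable_subset[OF fM(2) _ cd(2)] by (intro rest) auto
    ultimately have "(\<lambda>x. ?f x - ?g x) \<in> L2 M" by (intro L2_diff)
    moreover have "(\<lambda>x. ?f x - ?g x) = k" by (auto simp: k_def k0_def F_def)
    ultimately show ?thesis by simp
  qed
  have orth: "integral {c..d} (\<lambda>x. r x *\<^sub>R (v x * k x)) = 0" if "sol v v' (\<lambda>_. 0)" "L2_inner ?N (\<lambda>x. cnj (v x)) k0 = 0" for v v'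
  proof -
    have "integral {c..d} (\<lambda>x. r x *\<^sub>R (v x * k x)) = integral {c..d} (\<lambda>x. r x *\<^sub>R (cnj (cnj (v x)) * k0 x))"
      by (intro integral_cong) (auto simp: k_def)
    also have "\<dots> = 0" using Ninner[OF solN(2)[OF that(1)] k0N] that(2) by simp
    finally show ?thesis .
  qed
  obtain \<phi> \<phi>1 where \<phi>: "\<phi> \<in> T0" "AE x\<in>I in lebesgue. \<tau> \<phi> x = k x" "sol \<phi> \<phi>1 k"
    "\<phi> c = 0" "\<phi>1 c = 0" "\<phi> d = 0" "\<phi>1 d = 0" "\<And>x. x \<notin> {c..d} \<Longrightarrow> \<phi> x = 0"
    by (rule T0_range[OF cd kM _ y z W orth[OF y oy] orth[OF z oz]]) (auto simp: k_def)
  have \<phi>M: "\<phi> \<in> L2 M" "\<tau> \<phi> \<in> L2 M" using \<phi>(1) dom_T0_subset dom_Tmax_L2 by blast+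
  \<comment> \<open>The pairing of \<open>k0\<close> with \<open>f\<close> equals that of \<phi>
    with \<open>h\<close> by the adjoint relation. The pairing with \<open>w\<close> has the same
    value by Green's formula, since \<phi> and its quasi-derivative vanish at c and d.\<close>
  have "L2_inner ?N k0 F = 0"
  proof -
    have A: "(\<lambda>x. r x *\<^sub>R (cnj (k x) * f x)) absolutely_integrable_on {c..d}" "(\<lambda>x. r x *\<^sub>R (cnj (\<phi> x) * h x)) absolutely_integrable_on {c..d}"
      using L2_inner_eq(1)[OF kM f] L2_inner_eq(1)[OF \<phi>M(1) h] cd(2) by (auto intro: set_integrable_subset)
    have "L2_inner M k f = L2_inner M (\<tau> \<phi>) f"
      by (rule L2_inner_cong_AE[OF kM f \<phi>M(2) f]) (use \<phi>(2) in \<open>auto simp: M_AE elim!: eventually_mono\<close>)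
    also have "\<dots> = L2_inner M \<phi> h" by (rule adj[OF \<phi>(1)])
    finally have "integral I (\<lambda>x. r x *\<^sub>R (cnj (k x) * f x)) = integral I (\<lambda>x. r x *\<^sub>R (cnj (\<phi> x) * h x))"
      by (simp only: L2_inner_eq(2)[OF kM f] L2_inner_eq(2)[OF \<phi>M(1) h])
    moreover have "integral I (\<lambda>x. r x *\<^sub>R (cnj (k x) * f x)) = integral {c..d} (\<lambda>x. r x *\<^sub>R (cnj (k x) * f x))"
      by (rule integral_eq_on_support[OF cd(2)]) (subst k0', assumption, simp)
    moreover have "integral I (\<lambda>x. r x *\<^sub>R (cnj (\<phi> x) * h x)) = integral {c..d} (\<lambda>x. r x *\<^sub>R (cnj (\<phi> x) * h x))"
      by (rule integral_eq_on_support[OF cd(2)]) (subst \<phi>(8), assumption, simp)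
    ultimately have 1: "integral {c..d} (\<lambda>x. r x *\<^sub>R (cnj (k x) * f x)) = integral {c..d} (\<lambda>x. r x *\<^sub>R (cnj (\<phi> x) * h x))" by simp
    note P = primitive_onD[OF sol_wronskian[OF sol_cnj[OF \<phi>(3)] w] less_imp_le[OF cd(1)] cd(2)]
    have 2: "integral {c..d} (\<lambda>x. r x *\<^sub>R (cnj (k x) * w x - cnj (\<phi> x) * h x)) = 0"
      using P(2) \<phi>(4-7) by simp
    have "L2_inner ?N k0 F = integral {c..d} (\<lambda>x. r x *\<^sub>R (cnj (k0 x) * F x))" by (rule Ninner[OF k0N FN])
    also have "\<dots> = integral {c..d} (\<lambda>x. (r x *\<^sub>R (cnj (k x) * f x) - r x *\<^sub>R (cnj (\<phi> x) * h x)) - r x *\<^sub>R (cnj (k x) * w x - cnj (\<phi> x) * h x))"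
    proof (intro integral_cong)
      fix x assume x: "x \<in> {c..d}"
      have "r x *\<^sub>R (cnj (k0 x) * (f x - w x)) = (r x *\<^sub>R (cnj (k0 x) * f x) - r x *\<^sub>R (cnj (\<phi> x) * h x)) - r x *\<^sub>R (cnj (k0 x) * w x - cnj (\<phi> x) * h x)"
        unfolding scaleR_diff_right[symmetric] by (simp add: right_diff_distrib)
      moreover have "k x = k0 x" using x by (simp add: k_def)
      ultimately show "r x *\<^sub>R (cnj (k0 x) * F x) = (r x *\<^sub>R (cnj (k x) * f x) - r x *\<^sub>R (cnj (\<phi> x) * h x)) - r x *\<^sub>R (cnj (k x) * w x - cnj (\<phi> x) * h x)"
        unfolding F_def by (simp only:)
    qed
    also have "\<dots> = (integral {c..d} (\<lambda>x. r x *\<^sub>R (cnj (k x) * f x)) - integral {c..d} (\<lambda>x. r x *\<^sub>R (cnj (\<phi> x) * h x))) - 0"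
    proof (rule integral_unique[OF has_integral_diff[OF has_integral_diff]])
      show "((\<lambda>x. r x *\<^sub>R (cnj (k x) * f x)) has_integral integral {c..d} (\<lambda>x. r x *\<^sub>R (cnj (k x) * f x))) {c..d}"
        "((\<lambda>x. r x *\<^sub>R (cnj (\<phi> x) * h x)) has_integral integral {c..d} (\<lambda>x. r x *\<^sub>R (cnj (\<phi> x) * h x))) {c..d}"
        by (rule integrable_integral[OF absolutely_integrable_imp_integrable[OF A(1)]],
            rule integrable_integral[OF absolutely_integrable_imp_integrable[OF A(2)]])
      show "((\<lambda>x. r x *\<^sub>R (cnj (k x) * w x - cnj (\<phi> x) * h x)) has_integral 0) {c..d}"
        using P(1) unfolding 2[symmetric] by (intro integrable_integral) (simp add: absolutely_integrable_on_def)
    qed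
    finally show ?thesis using 1 by simp
  qed
  moreover have "L2_inner ?N k0 k0 = (L2_inner ?N k0 F + (- \<alpha>) * L2_inner ?N k0 (\<lambda>x. cnj (y x))) + (- \<beta>) * L2_inner ?N k0 (\<lambda>x. cnj (z x))"
    using L2_inner_add_right[OF k0N k1N solN(2)[OF z], of "- \<beta>"] L2_inner_add_right[OF k0N FN solN(2)[OF y], of "- \<alpha>"]
    unfolding k0_def[symmetric] by simp
  moreover have "L2_inner ?N k0 (\<lambda>x. cnj (y x)) = 0" "L2_inner ?N k0 (\<lambda>x. cnj (z x)) = 0"
    using oy oz L2_inner_commute[of ?N k0] by (metis complex_cnj_zero)+
  ultimately have "L2_norm ?N k0 = 0" by (simp add: L2_inner_self)
  then have "AE x\<in>{c<..<d} in lebesgue. k0 x = 0" using N.L2_norm_zero_AE[OF k0N] by (simp add: eN)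
  moreover have "AE x in lebesgue. x \<noteq> c \<and> x \<noteq> d"
    unfolding AE_conj_iff by (intro conjI AE_completion AE_lborel_singleton)
  ultimately have "AE x\<in>{c..d} in lebesgue. f x = (w x + \<alpha> * cnj (y x)) + \<beta> * cnj (z x)"
    by eventually_elim (auto simp: k0_def F_def algebra_simps less_le)
  moreover have "sol (\<lambda>x. (w x + \<alpha> * cnj (y x)) + \<beta> * cnj (z x)) (\<lambda>x. (w1 x + \<alpha> * cnj (y' x)) + \<beta> * cnj (z' x)) h"
    using sol_add_scale[OF sol_add_scale[OF w sol_cnj[OF y]] sol_cnj[OF z]] by simp
  ultimately show ?thesis using that by blast
qed

text \<open>The local solutions on an exhausting sequence have the same right-hand side and agree on
  the first interval, so their differences vanish everywhere by \<open>sol_unique\<close>.\<close>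

lemma T0_adjoint:
  assumes f: "f \<in> L2 M" and h: "h \<in> L2 M"
    and adj: "\<And>\<phi>. \<phi> \<in> T0 \<Longrightarrow> L2_inner M (\<tau> \<phi>) f = L2_inner M \<phi> h"
  obtains g where "g \<in> Tmax" "AE x\<in>I in lebesgue. f x = g x" "AE x\<in>I in lebesgue. h x = \<tau> g x"
proof -
  obtain l u :: "nat \<Rightarrow> real" where lu: "\<And>n. l n < u n" "\<And>n. {l n..u n} \<subseteq> I" "I = (\<Union>n. {l n..u n})" "incseq u" "decseq l"
    by (rule einterval_exhaustion[OF ab]) blast
  have "\<exists>g g1. sol g g1 h \<and> (AE x\<in>{l n..u n} in lebesgue. f x = g x)" for n
    using T0_adjoint_local[OF f h adj lu(1,2)] by blast
  then obtain g g1 where g: "\<And>n. sol (g n) (g1 n) h" "\<And>n. AE x\<in>{l n..u n} in lebesgue. f x = g n x" by metis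
  have eq: "g n x = g 0 x" if x: "x \<in> I" for n x
  proof -
    let ?d = "\<lambda>x. g n x + (-1) * g 0 x" and ?d1 = "\<lambda>x. g1 n x + (-1) * g1 0 x"
    have d: "sol ?d ?d1 (\<lambda>_. 0)" using sol_add_scale[OF g(1)[of n] g(1)[of 0], of "-1"] by simp
    have sub: "{l 0<..<u 0} \<subseteq> {l n..u n}" using incseqD[OF lu(4), of 0 n] decseqD[OF lu(5), of 0 n] by auto
    have subI: "{l 0<..<u 0} \<subseteq> I" using sub lu(2) by blast
    have "AE x\<in>{l 0<..<u 0} in lebesgue. ?d x = 0"
      using g(2)[of n] g(2)[of 0] by eventually_elim (use sub in auto)
    then have d0: "?d x = 0" if "x \<in> {l 0<..<u 0}" for x
      by (rule continuous_AE_eq_on_open[OF _ continuous_on_subset[OF sol_continuous(1)[OF d] subI] continuous_on_const _ that, rotated]) auto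
    have mid: "(l 0 + u 0) / 2 \<in> {l 0<..<u 0}" using lu(1)[of 0] by auto
    have "?d x = 0"
      using subI mid by (intro sol_unique[OF d _ d0[OF mid] sol_zero_on_interval[OF d subI d0 mid] x]) auto
    then show ?thesis by simp
  qed
  have "AE x in lebesgue. \<forall>n. x \<in> {l n..u n} \<longrightarrow> f x = g n x" using g(2) by (simp add: AE_all_countable)
  then have fg: "AE x\<in>I in lebesgue. f x = g 0 x"
    by eventually_elim (metis UN_iff eq lu(3))
  have fm: "f \<in> borel_measurable (lebesgue_on I)" using f by (simp add: L2_iff)
  have "g 0 \<in> L2 M"
    by (rule L2_cong_AE[OF f]) (use fg borel_measurable_lebesgue_on_cong_AE[OF fm _ fg] in \<open>auto simp: M_AE M_measurable\<close>)
  note T = sol_dom_Tmax[OF g(1)[of 0] this h]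
  show ?thesis by (rule that[OF T(1) fg]) (use T(2) in \<open>auto elim!: eventually_mono\<close>)
qed

end

subsection \<open>Integral inequalities\<close>

lemma integral_nonneg_AE:
  fixes f :: "real \<Rightarrow> real"
  assumes "f absolutely_integrable_on S" "AE x\<in>S in lebesgue. 0 \<le> f x"
  shows "0 \<le> integral S f"
  using integral_mono_AE_Icc[OF _ assms(1), of "\<lambda>_. 0"] assms(2) by simp

lemma integral_Icc_subset_le_AE:
  fixes f :: "real \<Rightarrow> real"
  assumes f: "f absolutely_integrable_on T" and sub: "{x..y} \<subseteq> T" and pos: "AE x\<in>T in lebesgue. 0 \<le> f x"
  shows "integral {x..y} f \<le> integral T f"
proof -
  have fxy: "f absolutely_integrable_on {x..y}" by (rule set_integrable_subset[OF f _ sub]) simp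
  let ?g = "\<lambda>t. if t \<in> {x..y} then f t else 0"
  have "(\<lambda>t. if t \<in> T then ?g t else 0) = ?g" by (rule ext) (use subsetD[OF sub] in auto)
  then have g: "?g absolutely_integrable_on T"
    using absolutely_integrable_restrict_UNIV[of "T" ?g] absolutely_integrable_restrict_UNIV[of "{x..y}" f] fxy by simp
  have "integral {x..y} f = integral T ?g"
    using integral_restrict_Int[of "T" "{x..y}" f] sub by (simp only: Int_absorb2 Int_absorb1)
  also have "\<dots> \<le> integral T f"
    by (rule integral_mono_AE_Icc[OF g f]) (use pos in \<open>auto elim!: eventually_mono\<close>)
  finally show ?thesis .
qed

lemma integral_Icc_pos_AE:
  fixes f :: "real \<Rightarrow> real"
  assumes f: "f absolutely_integrable_on {c..d}" and cd: "c < d" and pos: "AE x\<in>{c..d} in lebesgue. 0 < f x"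
  shows "integral {c..d} f > 0"
proof -
  have pos': "AE x\<in>{c..d} in lebesgue. 0 \<le> f x" using pos by eventually_elim auto
  have "integral {c..d} f \<noteq> 0"
  proof
    assume "integral {c..d} f = 0"
    from absolutely_integrable_zero_AE[OF f pos' this] pos have "AE x\<in>{c..d} in lebesgue. False"
      by eventually_elim auto
    then have "negligible {x \<in> {c..d}. \<not> False}" unfolding AE_lebesgue_negligible .
    then have "negligible {c..d}" by (simp only: simp_thms not_False_eq_True Collect_mem_eq)
    then show False using cd by (simp add: negligible_interval(1)[of c d, unfolded box_real])
  qed
  then show ?thesis using integral_nonneg_AE[OF f pos'] by simp
qed

lemma integral_Cauchy_Schwarz_weighted:
  fixes w f g :: "real \<Rightarrow> real"
  assumes w: "(\<lambda>x. w x * (f x)\<^sup>2) absolutely_integrable_on S" "(\<lambda>x. w x * (f x * g x)) absolutely_integrable_on S"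
      "(\<lambda>x. w x * (g x)\<^sup>2) absolutely_integrable_on S"
    and pos: "AE x\<in>S in lebesgue. 0 \<le> w x"
  shows "(integral S (\<lambda>x. w x * (f x * g x)))\<^sup>2 \<le> integral S (\<lambda>x. w x * (f x)\<^sup>2) * integral S (\<lambda>x. w x * (g x)\<^sup>2)"
proof -
  let ?A = "integral S (\<lambda>x. w x * (f x)\<^sup>2)" and ?B = "integral S (\<lambda>x. w x * (f x * g x))" and ?C = "integral S (\<lambda>x. w x * (g x)\<^sup>2)"
  have hi: "((\<lambda>x. w x * (f x)\<^sup>2) has_integral ?A) S" "((\<lambda>x. w x * (f x * g x)) has_integral ?B) S" "((\<lambda>x. w x * (g x)\<^sup>2) has_integral ?C) S"
    using w by (auto simp: absolutely_integrable_on_def)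
  have C: "?C \<ge> 0" by (rule integral_nonneg_AE[OF w(3)]) (use pos in \<open>auto elim!: eventually_mono\<close>)
  have t: "0 \<le> ?A + 2 * t * ?B + t\<^sup>2 * ?C" for t
  proof -
    have "((\<lambda>x. w x * (f x)\<^sup>2 + 2 * t * (w x * (f x * g x)) + t\<^sup>2 * (w x * (g x)\<^sup>2)) has_integral ?A + 2 * t * ?B + t\<^sup>2 * ?C) S"
      by (intro has_integral_add has_integral_mult_right hi)
    moreover have "(\<lambda>x. w x * (f x)\<^sup>2 + 2 * t * (w x * (f x * g x)) + t\<^sup>2 * (w x * (g x)\<^sup>2)) = (\<lambda>x. w x * (f x + t * g x)\<^sup>2)"
      by (auto simp: power2_eq_square algebra_simps)
    ultimately have i: "((\<lambda>x. w x * (f x + t * g x)\<^sup>2) has_integral ?A + 2 * t * ?B + t\<^sup>2 * ?C) S" by simp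
    have "(\<lambda>x. w x * (f x)\<^sup>2 + 2 * t * (w x * (f x * g x)) + t\<^sup>2 * (w x * (g x)\<^sup>2)) absolutely_integrable_on S"
      using w by (intro set_integral_add(1) set_integrable_mult_right)
    then have a: "(\<lambda>x. w x * (f x + t * g x)\<^sup>2) absolutely_integrable_on S"
      by (rule back_subst[where P="\<lambda>F. F absolutely_integrable_on S"]) (auto simp: power2_eq_square algebra_simps)
    have "0 \<le> integral S (\<lambda>x. w x * (f x + t * g x)\<^sup>2)"
      by (rule integral_nonneg_AE[OF a]) (use pos in \<open>auto elim!: eventually_mono\<close>)
    then show ?thesis using integral_unique[OF i] by simp
  qed
  have "(cmod (of_real ?B))\<^sup>2 \<le> ?A * ?C"
  proof (rule quadratic_discriminant_complex[OF C])
    fix \<alpha> :: complex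
    have "0 \<le> ?A + 2 * Re \<alpha> * ?B + (Re \<alpha>)\<^sup>2 * ?C" by (rule t)
    also have "\<dots> \<le> ?A + 2 * Re \<alpha> * ?B + (cmod \<alpha>)\<^sup>2 * ?C"
      using C by (intro add_left_mono mult_right_mono) (auto simp: cmod_power2)
    finally show "0 \<le> ?A + 2 * Re (\<alpha> * of_real ?B) + (cmod \<alpha>)\<^sup>2 * ?C" by simp
  qed
  then show ?thesis by simp
qed

lemma primitive_on_exp:
  fixes S :: "real \<Rightarrow> real"
  assumes S: "primitive_on a b S s"
  shows "primitive_on a b (\<lambda>x. exp (S x)) (\<lambda>x. s x * exp (S x))"
proof (rule AC_loc_primitiveI)
  note ac = primitive_on_AC_loc[OF S]
  show "AC_loc a b (\<lambda>x. exp (S x))"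
  proof (rule AC_loc_bound[OF ac ac])
    fix c d assume cd: "c \<le> (d::real)" "{c..d} \<subseteq> einterval a b"
    obtain B where B: "B \<ge> 0" "\<And>x. x \<in> {c..d} \<Longrightarrow> norm (S x) \<le> B"
      by (rule abs_cont_bounded[OF AC_locD[OF ac cd(2)]]) blast
    have e: "exp v - exp u \<le> exp B * (v - u)" if "u \<le> v" "v \<le> B" for u v :: real
    proof -
      have "exp u \<ge> exp v * (1 + (u - v))"
        using mult_left_mono[OF exp_ge_add_one_self[of "u - v"], of "exp v"] by (simp add: exp_add[symmetric])
      then have "exp v - exp u \<le> exp v * (v - u)" by (simp add: algebra_simps)
      also have "\<dots> \<le> exp B * (v - u)" using that by (intro mult_right_mono) auto
      finally show ?thesis .
    qed
    show "\<exists>C\<ge>0. \<forall>x\<in>{c..d}. \<forall>y\<in>{c..d}. norm (exp (S y) - exp (S x)) \<le> C * norm (S y - S x) + C * norm (S y - S x)"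
    proof (intro exI[of _ "exp B"] conjI ballI)
      fix x y assume x: "x \<in> {c..d}" and y: "y \<in> {c..d}"
      have bx: "S x \<le> B" "S y \<le> B" using B(2)[OF x] B(2)[OF y] by auto
      have "norm (exp (S y) - exp (S x)) \<le> exp B * norm (S y - S x)"
      proof (cases "S x \<le> S y")
        case True
        then show ?thesis using e[OF True bx(2)] by simp
      next
        case False
        then show ?thesis using e[of "S y" "S x"] bx by simp
      qed
      then show "norm (exp (S y) - exp (S x)) \<le> exp B * norm (S y - S x) + exp B * norm (S y - S x)"
        by (rule order_trans) simp
    qed simp
  qed
  show "AE x\<in>einterval a b in lebesgue. ((\<lambda>x. exp (S x)) has_vector_derivative s x * exp (S x)) (at x)"
    using primitive_on_AE_derivative[OF S]
    by eventually_elim (auto simp: has_real_derivative_iff_has_vector_derivative[symmetric] intro!: derivative_eq_intros)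
qed

context sl_problem
begin

lemma inverse_p_nonneg: "{c..d} \<subseteq> I \<Longrightarrow> AE x\<in>{c..d} in lebesgue. 0 \<le> inverse (p x)"
  using p_pos by (auto elim!: eventually_mono)

lemma r_pos_Icc: "{c..d} \<subseteq> I \<Longrightarrow> AE x\<in>{c..d} in lebesgue. 0 < r x"
  using r_pos by (auto elim!: eventually_mono)

lemma coeff_times_continuous:
  fixes f :: "real \<Rightarrow> real"
  assumes "{c..d} \<subseteq> I" "continuous_on {c..d} f"
  shows "(\<lambda>x. inverse (p x) * f x) absolutely_integrable_on {c..d}" "(\<lambda>x. q x * f x) absolutely_integrable_on {c..d}"
    "(\<lambda>x. r x * f x) absolutely_integrable_on {c..d}" "(\<lambda>x. s x * f x) absolutely_integrable_on {c..d}"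
  using absolutely_integrable_scaleR_continuous[OF coeff_integrable(1)[OF assms(1)] assms(2)]
    absolutely_integrable_scaleR_continuous[OF coeff_integrable(2)[OF assms(1)] assms(2)]
    absolutely_integrable_scaleR_continuous[OF coeff_integrable(3)[OF assms(1)] assms(2)]
    absolutely_integrable_scaleR_continuous[OF coeff_integrable(4)[OF assms(1)] assms(2)] by simp_all

text \<open>Multiplication by the exponential \<open>E\<close> of a primitive of s removes s: (E u)'
  = E u1 / p. On a window of length \<eta> around \<open>x\<close>, the least value of |u|^2 is
  controlled by the integral of r |u|^2. By Cauchy-Schwarz, moving from there to \<open>x\<close>
  costs the integral of 1/p over the window times the energy, and this factor is small for small
  \<eta>.\<close>

lemma sobolev:
  assumes cd: "c < d" "{c..d} \<subseteq> I" and eps: "\<epsilon> > 0"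
  obtains C where "C \<ge> 0" "\<And>u u1 h x. sol u u1 h \<Longrightarrow> x \<in> {c..d} \<Longrightarrow>
    (cmod (u x))\<^sup>2 \<le> \<epsilon> * integral {c..d} (\<lambda>x. inverse (p x) * (cmod (u1 x))\<^sup>2) + C * integral {c..d} (\<lambda>x. r x * (cmod (u x))\<^sup>2)"
proof -
  have cI: "c \<in> I" using cd by auto
  define S where "S = oriented_integral s c"
  have S: "primitive_on a b S s" unfolding S_def by (rule oriented_integral_primitive[OF cI coeff_integrable(4)])
  obtain B where B: "B \<ge> 0" "\<And>x. x \<in> {c..d} \<Longrightarrow> norm (S x) \<le> B"
    by (rule abs_cont_bounded[OF AC_locD[OF primitive_on_AC_loc[OF S] cd(2)]]) blast
  define E where "E x = exp (S x)" for x
  have E: "primitive_on a b E (\<lambda>x. s x * E x)" unfolding E_def by (rule primitive_on_exp[OF S])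
  define L where "L = exp B"
  have L: "L \<ge> 1" using B by (simp add: L_def)
  have EL: "0 < E x" "E x \<le> L" "1 \<le> L * E x" if "x \<in> {c..d}" for x
    using B(2)[OF that] by (auto simp: E_def L_def exp_add[symmetric])
  \<comment> \<open>\<open>E\<close> and 1/E are at most \<open>L\<close> on {c..d}. Passing from u
    to E u and back, and squaring a sum of two terms, costs the factor 2 L^4, so exactly \<epsilon>
    is left.\<close>
  define \<delta> where "\<delta> = \<epsilon> / (2 * L^4)"
  have \<delta>: "\<delta> > 0" using eps L by (simp add: \<delta>_def)
  define P where "P = oriented_integral (\<lambda>x. inverse (p x)) c"
  have P: "primitive_on a b P (\<lambda>x. inverse (p x))" unfolding P_def by (rule oriented_integral_primitive[OF cI coeff_integrable(1)])
  have "uniformly_continuous_on {c..d} P"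
    using continuous_on_subset[OF primitive_on_continuous[OF P] cd(2)] by (rule compact_uniformly_continuous) auto
  then obtain \<eta>0 where \<eta>0: "\<eta>0 > 0" "\<And>x y. x \<in> {c..d} \<Longrightarrow> y \<in> {c..d} \<Longrightarrow> dist y x < \<eta>0 \<Longrightarrow> dist (P y) (P x) < \<delta>"
    using \<delta> unfolding uniformly_continuous_on_def by metis
  define \<eta> where "\<eta> = min (\<eta>0 / 2) ((d - c) / 2)"
  have \<eta>: "0 < \<eta>" "\<eta> < \<eta>0" "\<eta> \<le> (d - c) / 2" using \<eta>0 cd by (auto simp: \<eta>_def min_def)
  define R where "R = oriented_integral r c"
  have R: "primitive_on a b R r" unfolding R_def by (rule oriented_integral_primitive[OF cI coeff_integrable(3)])
  have Rint: "integral {x..x + \<eta>} r = R (x + \<eta>) - R x" if "x \<in> {c..d - \<eta>}" for x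
  proof -
    have "{x..x + \<eta>} \<subseteq> {c..d}" using that by auto
    then have "{x..x + \<eta>} \<subseteq> I" using cd(2) by (rule subset_trans)
    then show ?thesis using primitive_onD(2)[OF R, of x "x + \<eta>"] \<eta> by simp
  qed
  have "continuous_on {c..d - \<eta>} (\<lambda>x. R (x + \<eta>) - R x)"
  proof -
    have "continuous_on {c..d} R" by (rule continuous_on_subset[OF primitive_on_continuous[OF R] cd(2)])
    then have "continuous_on {c..d - \<eta>} R" "continuous_on {c..d - \<eta>} (\<lambda>x. R (x + \<eta>))"
      using \<eta> by (auto intro: continuous_on_subset intro!: continuous_on_compose2[of "{c..d}" R _ "\<lambda>x. x + \<eta>"] continuous_intros)
    then show ?thesis by (rule continuous_on_diff[rotated])
  qed
  moreover have "{c..d - \<eta>} \<noteq> {}" using \<eta> cd by auto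
  ultimately obtain x0 where x0: "x0 \<in> {c..d - \<eta>}" "\<And>x. x \<in> {c..d - \<eta>} \<Longrightarrow> R (x0 + \<eta>) - R x0 \<le> R (x + \<eta>) - R x"
    using continuous_attains_inf[of "{c..d - \<eta>}" "\<lambda>x. R (x + \<eta>) - R x"] by auto
  \<comment> \<open>The least mass of \<open>r\<close> in a window of length \<eta> inside {c..d}.
    It is attained by compactness, hence positive.\<close>
  define \<rho> where "\<rho> = R (x0 + \<eta>) - R x0"
  have "{x0..x0 + \<eta>} \<subseteq> {c..d}" using x0(1) by auto
  then have sub0: "{x0..x0 + \<eta>} \<subseteq> I" using cd(2) by (rule subset_trans)
  have \<rho>: "\<rho> > 0"
    using integral_Icc_pos_AE[OF coeff_integrable(3)[OF sub0] _ r_pos_Icc[OF sub0]] \<eta> Rint[OF x0(1)] by (simp add: \<rho>_def)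
  define C where "C = 2 * L^4 / \<rho>"
  show ?thesis
  proof (rule that[of C])
    show "C \<ge> 0" using L \<rho> by (simp add: C_def)
    fix u u1 h x assume u: "sol u u1 h" and x: "x \<in> {c..d}"
    let ?E1 = "integral {c..d} (\<lambda>x. inverse (p x) * (cmod (u1 x))\<^sup>2)" and ?U = "integral {c..d} (\<lambda>x. r x * (cmod (u x))\<^sup>2)"
    have uc: "continuous_on {c..d} u" "continuous_on {c..d} u1" using sol_continuous[OF u] cd(2) by (auto intro: continuous_on_subset)
    have u12: "primitive_on a b u (\<lambda>x. inverse (p x) *\<^sub>R u1 x - s x *\<^sub>R u x)" using u by (simp add: sol_def)
    define z where "z x = E x *\<^sub>R u x" for x
    have z: "primitive_on a b z (\<lambda>x. inverse (p x) *\<^sub>R (E x *\<^sub>R u1 x))"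
      using primitive_on_bilinear[OF bounded_bilinear_scaleR E u12] unfolding z_def[abs_def]
      by (simp add: scaleR_diff_right mult.commute)
    \<comment> \<open>The window starting at \<open>l\<close> contains \<open>x\<close> and stays
      inside {c..d}, also when \<open>x\<close> is close to the right end.\<close>
    define l where "l = (if x \<le> d - \<eta> then x else x - \<eta>)"
    have l: "l \<in> {c..d - \<eta>}" "x \<in> {l..l + \<eta>}" using x \<eta> by (auto simp: l_def)
    have Jsub: "{l..l + \<eta>} \<subseteq> {c..d}" using l(1) \<eta> by auto
    have "continuous_on {l..l + \<eta>} (\<lambda>x. (cmod (u x))\<^sup>2)" using continuous_on_subset[OF uc(1) Jsub] by (intro continuous_intros)
    then obtain y where y: "y \<in> {l..l + \<eta>}" "\<And>t. t \<in> {l..l + \<eta>} \<Longrightarrow> (cmod (u y))\<^sup>2 \<le> (cmod (u t))\<^sup>2"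
      using continuous_attains_inf[of "{l..l + \<eta>}" "\<lambda>x. (cmod (u x))\<^sup>2"] \<eta> by auto
    have rU: "(\<lambda>x. r x * (cmod (u x))\<^sup>2) absolutely_integrable_on {c..d}"
      by (intro coeff_times_continuous cd continuous_intros uc)
    have uy: "(cmod (u y))\<^sup>2 * \<rho> \<le> ?U"
    proof -
      have lI: "{l..l + \<eta>} \<subseteq> I" using Jsub cd(2) by blast
      have rJ: "(\<lambda>x. r x * (cmod (u x))\<^sup>2) absolutely_integrable_on {l..l + \<eta>}" by (rule set_integrable_subset[OF rU _ Jsub]) auto
      have "(cmod (u y))\<^sup>2 * \<rho> \<le> (cmod (u y))\<^sup>2 * integral {l..l + \<eta>} r"
        using x0(2)[OF l(1)] Rint[OF l(1)] by (intro mult_left_mono) (auto simp: \<rho>_def)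
      also have "\<dots> = integral {l..l + \<eta>} (\<lambda>t. r t * (cmod (u y))\<^sup>2)" by (simp add: mult.commute)
      also have "\<dots> \<le> integral {l..l + \<eta>} (\<lambda>t. r t * (cmod (u t))\<^sup>2)"
        by (rule integral_mono_AE_Icc[OF _ rJ])
          (use coeff_integrable(3)[OF lI] r_pos_Icc[OF lI] y(2) in \<open>auto elim!: eventually_mono intro!: mult_left_mono\<close>)
      also have "\<dots> \<le> ?U"
        by (rule integral_Icc_subset_le_AE[OF rU Jsub]) (use r_pos_Icc[OF cd(2)] in \<open>auto elim!: eventually_mono\<close>)
      finally show ?thesis .
    qed
    define x1 x2 where "x1 = min x y" and "x2 = max x y"
    have x12: "x1 \<le> x2" "x1 \<in> {c..d}" "x2 \<in> {c..d}" "x2 - x1 \<le> \<eta>" "{x1..x2} \<subseteq> {c..d}"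
      using l y(1) Jsub x by (auto simp: x1_def x2_def min_def max_def)
    have x12I: "{x1..x2} \<subseteq> I" using x12(5) cd(2) by blast
    have zd: "cmod (z x - z y) = cmod (z x2 - z x1)" by (auto simp: x1_def x2_def min_def max_def norm_minus_commute)
    have cE: "continuous_on {x1..x2} E" by (rule continuous_on_subset[OF primitive_on_continuous[OF E] x12I])
    have cu1: "continuous_on {x1..x2} u1" by (rule continuous_on_subset[OF uc(2) x12(5)])
    have pI: "(\<lambda>x. inverse (p x) * (1 * cmod (u1 x))) absolutely_integrable_on {x1..x2}"
      "(\<lambda>x. inverse (p x) * (1::real)\<^sup>2) absolutely_integrable_on {x1..x2}"
      "(\<lambda>x. inverse (p x) * (cmod (u1 x))\<^sup>2) absolutely_integrable_on {x1..x2}"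
      by (intro coeff_times_continuous x12I continuous_intros cu1)+
    have "cmod (z x2 - z x1) \<le> L * integral {x1..x2} (\<lambda>x. inverse (p x) * (1 * cmod (u1 x)))"
    proof -
      have ai: "(\<lambda>x. inverse (p x) *\<^sub>R (E x *\<^sub>R u1 x)) absolutely_integrable_on {x1..x2}" by (rule primitive_onD(1)[OF z x12(1) x12I])
      have "z x2 - z x1 = integral {x1..x2} (\<lambda>x. inverse (p x) *\<^sub>R (E x *\<^sub>R u1 x))" by (rule primitive_onD(2)[OF z x12(1) x12I])
      also have "cmod \<dots> \<le> integral {x1..x2} (\<lambda>x. norm (inverse (p x) *\<^sub>R (E x *\<^sub>R u1 x)))"
        using ai by (intro integral_norm_bound_integral) (auto simp: absolutely_integrable_on_def)
      also have "\<dots> \<le> integral {x1..x2} (\<lambda>x. L * (inverse (p x) * (1 * cmod (u1 x))))"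
      proof (rule integral_mono_AE_Icc[OF set_integrable_norm[OF ai] set_integrable_mult_right[OF pI(1)]])
        show "AE x\<in>{x1..x2} in lebesgue. norm (inverse (p x) *\<^sub>R (E x *\<^sub>R u1 x)) \<le> L * (inverse (p x) * (1 * cmod (u1 x)))"
          using inverse_p_nonneg[OF x12I]
        proof eventually_elim
          case (elim t)
          show ?case
          proof
            assume t: "t \<in> {x1..x2}"
            then have "0 < E t" "E t \<le> L" using EL[of t] x12(5) by auto
            moreover have "0 \<le> inverse (p t) * cmod (u1 t)" using elim t by simp
            ultimately have "E t * (inverse (p t) * cmod (u1 t)) \<le> L * (inverse (p t) * cmod (u1 t))" by (intro mult_right_mono)
            then show "norm (inverse (p t) *\<^sub>R (E t *\<^sub>R u1 t)) \<le> L * (inverse (p t) * (1 * cmod (u1 t)))"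
              using elim t \<open>0 < E t\<close> by (simp add: mult_ac)
          qed
        qed
      qed
      finally show ?thesis by simp
    qed
    moreover have "(integral {x1..x2} (\<lambda>x. inverse (p x) * (1 * cmod (u1 x))))\<^sup>2 \<le> \<delta> * ?E1"
    proof -
      have "(integral {x1..x2} (\<lambda>x. inverse (p x) * (1 * cmod (u1 x))))\<^sup>2 \<le>
        integral {x1..x2} (\<lambda>x. inverse (p x) * (1::real)\<^sup>2) * integral {x1..x2} (\<lambda>x. inverse (p x) * (cmod (u1 x))\<^sup>2)"
        by (rule integral_Cauchy_Schwarz_weighted[OF pI(2,1,3) inverse_p_nonneg[OF x12I]])
      also have "\<dots> \<le> \<delta> * ?E1"
      proof (rule mult_mono)
        have "dist x2 x1 < \<eta>0" using x12 \<eta> by (simp add: dist_real_def)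
        then have "P x2 - P x1 < \<delta>" using \<eta>0(2)[OF x12(2,3)] by (simp add: dist_real_def)
        then show "integral {x1..x2} (\<lambda>x. inverse (p x) * (1::real)\<^sup>2) \<le> \<delta>"
          using primitive_onD(2)[OF P x12(1) x12I] by simp
        show "integral {x1..x2} (\<lambda>x. inverse (p x) * (cmod (u1 x))\<^sup>2) \<le> ?E1"
        proof (rule integral_Icc_subset_le_AE[OF _ x12(5)])
          show "(\<lambda>x. inverse (p x) * (cmod (u1 x))\<^sup>2) absolutely_integrable_on {c..d}"
            by (intro coeff_times_continuous cd continuous_intros uc)
          show "AE x\<in>{c..d} in lebesgue. 0 \<le> inverse (p x) * (cmod (u1 x))\<^sup>2"
            using inverse_p_nonneg[OF cd(2)] by eventually_elim auto
        qed
        show "0 \<le> integral {x1..x2} (\<lambda>x. inverse (p x) * (cmod (u1 x))\<^sup>2)"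
          by (rule integral_nonneg_AE[OF pI(3)]) (use inverse_p_nonneg[OF x12I] in \<open>auto elim!: eventually_mono\<close>)
      qed (use \<delta> in simp)
      finally show ?thesis .
    qed
    ultimately have zz: "(cmod (z x - z y))\<^sup>2 \<le> L\<^sup>2 * (\<delta> * ?E1)"
    proof -
      assume 1: "cmod (z x2 - z x1) \<le> L * integral {x1..x2} (\<lambda>x. inverse (p x) * (1 * cmod (u1 x)))"
        and 2: "(integral {x1..x2} (\<lambda>x. inverse (p x) * (1 * cmod (u1 x))))\<^sup>2 \<le> \<delta> * ?E1"
      have "(cmod (z x - z y))\<^sup>2 \<le> (L * integral {x1..x2} (\<lambda>x. inverse (p x) * (1 * cmod (u1 x))))\<^sup>2"
        unfolding zd by (rule power_mono[OF 1]) simp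
      also have "\<dots> \<le> L\<^sup>2 * (\<delta> * ?E1)" unfolding power_mult_distrib by (intro mult_left_mono 2) simp
      finally show ?thesis .
    qed
    have yd: "y \<in> {c..d}" using y(1) Jsub by blast
    have "cmod (u x) \<le> L * cmod (z x)"
      using mult_right_mono[OF EL(3)[OF x], of "cmod (u x)"] EL(1)[OF x] by (simp add: z_def mult_ac)
    then have "(cmod (u x))\<^sup>2 \<le> L\<^sup>2 * (cmod (z x))\<^sup>2"
      using power_mono[of "cmod (u x)" "L * cmod (z x)" 2] by (simp add: power_mult_distrib)
    also have "\<dots> \<le> L\<^sup>2 * (2 * (L\<^sup>2 * (\<delta> * ?E1)) + 2 * (L\<^sup>2 * (cmod (u y))\<^sup>2))"
    proof (rule mult_left_mono)
      have "cmod (z x) \<le> cmod (z x - z y) + cmod (z y)" by (metis diff_add_cancel norm_triangle_ineq)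
      then have "(cmod (z x))\<^sup>2 \<le> (cmod (z x - z y) + cmod (z y))\<^sup>2" by (rule power_mono) simp
      also have "\<dots> \<le> 2 * (cmod (z x - z y))\<^sup>2 + 2 * (cmod (z y))\<^sup>2"
        using sum_squares_bound[of "cmod (z x - z y)" "cmod (z y)"] by (simp add: power2_sum)
      finally have "(cmod (z x))\<^sup>2 \<le> 2 * (cmod (z x - z y))\<^sup>2 + 2 * (cmod (z y))\<^sup>2" .
      moreover have "(cmod (z y))\<^sup>2 \<le> L\<^sup>2 * (cmod (u y))\<^sup>2"
      proof -
        have "cmod (z y) \<le> L * cmod (u y)" using EL[OF yd] by (simp add: z_def mult_right_mono)
        then show ?thesis using power_mono[of "cmod (z y)" "L * cmod (u y)" 2] by (simp add: power_mult_distrib)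
      qed
      ultimately show "(cmod (z x))\<^sup>2 \<le> 2 * (L\<^sup>2 * (\<delta> * ?E1)) + 2 * (L\<^sup>2 * (cmod (u y))\<^sup>2)" using zz by linarith
    qed simp
    also have "\<dots> = \<epsilon> * ?E1 + 2 * L^4 * (cmod (u y))\<^sup>2"
      using L by (simp add: \<delta>_def power2_eq_square power4_eq_xxxx algebra_simps)
    also have "\<dots> \<le> \<epsilon> * ?E1 + C * ?U"
    proof -
      have "2 * L^4 * (cmod (u y))\<^sup>2 = C * ((cmod (u y))\<^sup>2 * \<rho>)" using \<rho> by (simp add: C_def)
      also have "\<dots> \<le> C * ?U" using uy \<open>C \<ge> 0\<close> by (rule mult_left_mono)
      finally show ?thesis by simp
    qed
    finally show "(cmod (u x))\<^sup>2 \<le> \<epsilon> * ?E1 + C * ?U" .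
  qed
qed

end

subsection \<open>Jacobi factorization near an endpoint\<close>

lemma primitive_on_AE_eq:
  assumes "primitive_on a b f g" "\<And>x. x \<in> einterval a b \<Longrightarrow> f x = f' x" "AE x\<in>einterval a b in lebesgue. g x = g' x"
  shows "primitive_on a b f' g'"
proof -
  have "primitive_on a b f g'" by (rule primitive_on_cong_AE[OF assms(1,3)])
  moreover have "f d - f c = f' d - f' c" if "c \<le> d" "{c..d} \<subseteq> einterval a b" for c d
    using that assms(2) by (metis atLeastAtMost_iff order_refl subsetD)
  ultimately show ?thesis unfolding primitive_on_def by simp
qed

text \<open>One locale for both ends: it is instantiated with (a, c0) and \<open>ga\<close>, and
  with (d0, b) and \<open>gb\<close>.\<close>

locale sl_jacobi = sl_problem +
  fixes \<alpha> \<beta> :: ereal and g :: "real \<Rightarrow> real" and \<mu> :: real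
  assumes J_sub: "einterval \<alpha> \<beta> \<subseteq> einterval a b"
    and g_D: "g \<in> D_tau a b p s"
    and g_pos: "x \<in> einterval \<alpha> \<beta> \<Longrightarrow> g x > 0"
    and q_ge: "AE x\<in>einterval \<alpha> \<beta> in lebesgue. q x \<ge> \<mu> * r x - s x * (quasi_deriv a b p s g x / g x)
               + vector_derivative (quasi_deriv a b p s g) (at x) / g x"
begin

abbreviation J where "J \<equiv> einterval \<alpha> \<beta>"
definition \<omega> :: "real \<Rightarrow> real" where "\<omega> x = 1 / (p x * (g x)\<^sup>2)"
definition V :: "(real \<Rightarrow> complex) \<Rightarrow> (real \<Rightarrow> complex) \<Rightarrow> real \<Rightarrow> complex" where
  "V w w1 x = g x *\<^sub>R w1 x - qd g x *\<^sub>R w x"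
definition Q :: "real \<Rightarrow> real" where
  "Q x = q x - vector_derivative (qd g) (at x) / g x + s x * (qd g x / g x)"
text \<open>On \<open>J\<close> this is the real part of cnj (w/g) V (\<open>bf_eq\<close>), the
  boundary term of Jacobi's factorization. The form chosen here shows its difference from Re (cnj w
  w1), needed when the end pieces are joined to the middle, and that it vanishes where
  \<open>w\<close> does.\<close>

definition bf :: "(real \<Rightarrow> complex) \<Rightarrow> (real \<Rightarrow> complex) \<Rightarrow> real \<Rightarrow> real" where
  "bf w w1 x = Re (cnj (w x) * w1 x) - qd g x / g x * (cmod (w x))\<^sup>2"
text \<open>The part of the energy density that is nonnegative a.e. on \<open>J\<close>; the
  separated term \<mu> r |w|^2 is absorbed by the L2 norm.\<close>

definition en :: "(real \<Rightarrow> complex) \<Rightarrow> (real \<Rightarrow> complex) \<Rightarrow> real \<Rightarrow> real" where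
  "en w w1 x = \<omega> x * (cmod (V w w1 x))\<^sup>2 + (Q x - \<mu> * r x) * (cmod (w x))\<^sup>2"

lemma g_prim:
  "primitive_on a b g (\<lambda>x. inverse (p x) * qd g x - s x * g x)"
  "primitive_on a b (qd g) (\<lambda>x. vector_derivative (qd g) (at x))"
  using D_tau_primitive(1)[OF g_D] AC_loc_primitive_vector_derivative[OF D_tau_primitive(2)[OF g_D]] by simp_all

lemma sol_prim:
  assumes "sol w w1 h"
  shows "primitive_on a b w (\<lambda>x. inverse (p x) *\<^sub>R w1 x - s x *\<^sub>R w x)"
    "primitive_on a b w1 (\<lambda>x. s x *\<^sub>R w1 x + q x *\<^sub>R w x - r x *\<^sub>R h x)"
  using assms by (auto simp: sol_def)

lemma continuous_J: "continuous_on J g" "continuous_on J (qd g)"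
  using primitive_on_continuous[OF g_prim(1)] primitive_on_continuous[OF g_prim(2)] J_sub
  by (auto intro: continuous_on_subset)

lemma sol_continuous_J:
  assumes "sol w w1 h"
  shows "continuous_on J w" "continuous_on J w1" "continuous_on J (V w w1)" "continuous_on J (\<lambda>x. w x / of_real (g x))"
proof -
  show *: "continuous_on J w" "continuous_on J w1" using sol_continuous[OF assms] J_sub by (auto intro: continuous_on_subset)
  show "continuous_on J (V w w1)" unfolding V_def[abs_def] by (intro continuous_intros continuous_J *)
  show "continuous_on J (\<lambda>x. w x / of_real (g x))"
    by (intro continuous_intros continuous_J *) (use g_pos in force)
qed

lemma sub_I: "{x..y} \<subseteq> J \<Longrightarrow> {x..y} \<subseteq> I" using J_sub by blast

lemma scaled_integrable:
  fixes f :: "real \<Rightarrow> 'c::euclidean_space"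
  assumes xy: "{x..y} \<subseteq> J" and f: "continuous_on {x..y} f"
  shows "(\<lambda>x. \<omega> x *\<^sub>R f x) absolutely_integrable_on {x..y}" "(\<lambda>x. Q x *\<^sub>R f x) absolutely_integrable_on {x..y}"
    "(\<lambda>x. r x *\<^sub>R f x) absolutely_integrable_on {x..y}"
proof -
  note xI = sub_I[OF xy]
  have cg: "continuous_on {x..y} g" "continuous_on {x..y} (qd g)"
    using continuous_J xy by (auto intro: continuous_on_subset)
  have g0: "g t \<noteq> 0" if "t \<in> {x..y}" for t using g_pos[of t] that xy by auto
  have "(\<lambda>x. inverse (p x) *\<^sub>R ((1 / (g x)\<^sup>2) *\<^sub>R f x)) absolutely_integrable_on {x..y}"
    by (intro absolutely_integrable_scaleR_continuous coeff_integrable xI continuous_intros cg f) (use g0 in auto)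
  then show "(\<lambda>x. \<omega> x *\<^sub>R f x) absolutely_integrable_on {x..y}"
    by (simp add: \<omega>_def divide_inverse mult.commute)
  show "(\<lambda>x. r x *\<^sub>R f x) absolutely_integrable_on {x..y}"
    by (rule absolutely_integrable_scaleR_continuous[OF coeff_integrable(3)[OF xI] f])
  have Q: "Q absolutely_integrable_on {x..y}"
  proof (cases "x \<le> y")
    case True
    have "(\<lambda>x. vector_derivative (qd g) (at x) *\<^sub>R (1 / g x)) absolutely_integrable_on {x..y}"
      "(\<lambda>x. s x *\<^sub>R (qd g x / g x)) absolutely_integrable_on {x..y}"
      by (intro absolutely_integrable_scaleR_continuous coeff_integrable xI continuous_intros cg
          primitive_onD(1)[OF g_prim(2) True xI]; use g0 in auto)+
    then show ?thesis unfolding Q_def[abs_def] using coeff_integrable(2)[OF xI]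
      by (intro set_integral_add(1) set_integral_diff(1)) simp_all
  qed simp
  show "(\<lambda>x. Q x *\<^sub>R f x) absolutely_integrable_on {x..y}"
    by (rule absolutely_integrable_scaleR_continuous[OF Q f])
qed

lemma quotient_primitive:
  assumes w: "sol w w1 h"
  shows "primitive_on \<alpha> \<beta> (\<lambda>x. w x / of_real (g x)) (\<lambda>x. \<omega> x *\<^sub>R V w w1 x)"
proof (rule primitive_on_AE_eq)
  note P = primitive_on_subset[OF g_prim(1) J_sub] primitive_on_subset[OF sol_prim(1)[OF w] J_sub]
  show "primitive_on \<alpha> \<beta> (\<lambda>x. (1 / g x) *\<^sub>R w x) (\<lambda>x. (1 / g x) *\<^sub>R (inverse (p x) *\<^sub>R w1 x - s x *\<^sub>R w x)
      + (- (inverse (p x) * qd g x - s x * g x) / (g x)\<^sup>2) *\<^sub>R w x)"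
    by (rule primitive_on_bilinear[OF bounded_bilinear_scaleR primitive_on_inverse[OF P(1) g_pos] P(2)])
  show "(1 / g x) *\<^sub>R w x = w x / of_real (g x)" for x by (simp add: scaleR_conv_of_real)
  have "(1 / G) *\<^sub>R (P *\<^sub>R w1 - S *\<^sub>R w) + (- (P * G1 - S * G) / G\<^sup>2) *\<^sub>R w = (P / G\<^sup>2) *\<^sub>R (G *\<^sub>R w1 - G1 *\<^sub>R w)"
    if "G > 0" for G G1 P S :: real and w w1 :: complex
  proof -
    have 1: "- (P * G1 - S * G) / G\<^sup>2 = S / G - P * G1 / G\<^sup>2" "P / G\<^sup>2 * G = P / G"
      using that by (simp_all add: field_simps power2_eq_square)
    show ?thesis unfolding 1 scaleR_diff_left scaleR_diff_right scaleR_scaleR by (simp add: 1)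
  qed
  then have "(1 / g x) *\<^sub>R (inverse (p x) *\<^sub>R w1 x - s x *\<^sub>R w x) + (- (inverse (p x) * qd g x - s x * g x) / (g x)\<^sup>2) *\<^sub>R w x
    = \<omega> x *\<^sub>R V w w1 x" if "x \<in> J" for x
    using g_pos[OF that] by (simp add: \<omega>_def V_def divide_inverse)
  then show "AE x\<in>J in lebesgue. (1 / g x) *\<^sub>R (inverse (p x) *\<^sub>R w1 x - s x *\<^sub>R w x)
      + (- (inverse (p x) * qd g x - s x * g x) / (g x)\<^sup>2) *\<^sub>R w x = \<omega> x *\<^sub>R V w w1 x" by simp
qed

text \<open>The terms with 1/p cancel, and so do those with s w1. The coefficient of
  \<open>w\<close> that remains is g Q, which is the origin of \<open>Q\<close>.\<close>

lemma V_primitive: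
  assumes w: "sol w w1 h"
  shows "primitive_on \<alpha> \<beta> (V w w1) (\<lambda>x. g x *\<^sub>R (Q x *\<^sub>R w x - r x *\<^sub>R h x))"
proof (rule primitive_on_AE_eq)
  note P = primitive_on_subset[OF g_prim(1) J_sub] primitive_on_subset[OF g_prim(2) J_sub]
    primitive_on_subset[OF sol_prim(1)[OF w] J_sub] primitive_on_subset[OF sol_prim(2)[OF w] J_sub]
  show "primitive_on \<alpha> \<beta> (\<lambda>x. g x *\<^sub>R w1 x + (- 1) *\<^sub>R (qd g x *\<^sub>R w x))
    (\<lambda>x. (g x *\<^sub>R (s x *\<^sub>R w1 x + q x *\<^sub>R w x - r x *\<^sub>R h x) + (inverse (p x) * qd g x - s x * g x) *\<^sub>R w1 x)
      + (- 1) *\<^sub>R (qd g x *\<^sub>R (inverse (p x) *\<^sub>R w1 x - s x *\<^sub>R w x) + vector_derivative (qd g) (at x) *\<^sub>R w x))"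
    by (rule primitive_on_add[OF primitive_on_bilinear[OF bounded_bilinear_scaleR P(1,4)]
          primitive_on_linear[OF bounded_linear_scaleR_right primitive_on_bilinear[OF bounded_bilinear_scaleR P(2,3)]]])
  show "g x *\<^sub>R w1 x + (- 1) *\<^sub>R (qd g x *\<^sub>R w x) = V w w1 x" for x by (simp add: V_def)
  have "(g x *\<^sub>R (s x *\<^sub>R w1 x + q x *\<^sub>R w x - r x *\<^sub>R h x) + (inverse (p x) * qd g x - s x * g x) *\<^sub>R w1 x)
      + (- 1) *\<^sub>R (qd g x *\<^sub>R (inverse (p x) *\<^sub>R w1 x - s x *\<^sub>R w x) + vector_derivative (qd g) (at x) *\<^sub>R w x)
      = g x *\<^sub>R (Q x *\<^sub>R w x - r x *\<^sub>R h x)" if "x \<in> J" for x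
  proof -
    have "g x * Q x = g x * q x - vector_derivative (qd g) (at x) + s x * qd g x"
      using g_pos[OF that] by (simp add: Q_def field_simps)
    then show ?thesis by (simp add: scaleR_diff_right scaleR_add_right scaleR_diff_left scaleR_add_left mult.commute)
  qed
  then show "AE x\<in>J in lebesgue. (g x *\<^sub>R (s x *\<^sub>R w1 x + q x *\<^sub>R w x - r x *\<^sub>R h x) + (inverse (p x) * qd g x - s x * g x) *\<^sub>R w1 x)
      + (- 1) *\<^sub>R (qd g x *\<^sub>R (inverse (p x) *\<^sub>R w1 x - s x *\<^sub>R w x) + vector_derivative (qd g) (at x) *\<^sub>R w x)
      = g x *\<^sub>R (Q x *\<^sub>R w x - r x *\<^sub>R h x)" by simp
qed

lemma bf_eq:
  assumes "x \<in> J"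
  shows "bf w w1 x = Re (cnj (w x / of_real (g x)) * V w w1 x)"
proof -
  have "g x \<noteq> 0" using g_pos[OF assms] by simp
  then show ?thesis
    unfolding bf_def V_def cmod_power2 by (simp add: field_simps power2_eq_square)
qed

lemma bf_primitive:
  assumes w: "sol w w1 h"
  shows "primitive_on \<alpha> \<beta> (bf w w1) (\<lambda>x. \<omega> x * (cmod (V w w1 x))\<^sup>2 + Q x * (cmod (w x))\<^sup>2 - r x * Re (cnj (w x) * h x))"
proof (rule primitive_on_AE_eq)
  show "primitive_on \<alpha> \<beta> (\<lambda>x. Re (cnj (w x / of_real (g x)) * V w w1 x))
    (\<lambda>x. Re (cnj (w x / of_real (g x)) * (g x *\<^sub>R (Q x *\<^sub>R w x - r x *\<^sub>R h x)) + cnj (\<omega> x *\<^sub>R V w w1 x) * V w w1 x))"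
    by (rule primitive_on_linear[OF bounded_linear_Re primitive_on_mult[OF
        primitive_on_linear[OF bounded_linear_cnj quotient_primitive[OF w]] V_primitive[OF w]]])
  show "Re (cnj (w x / of_real (g x)) * V w w1 x) = bf w w1 x" if "x \<in> J" for x by (rule bf_eq[OF that, symmetric])
  have "Re (cnj (w x / of_real (g x)) * (g x *\<^sub>R (Q x *\<^sub>R w x - r x *\<^sub>R h x)) + cnj (\<omega> x *\<^sub>R V w w1 x) * V w w1 x)
    = \<omega> x * (cmod (V w w1 x))\<^sup>2 + Q x * (cmod (w x))\<^sup>2 - r x * Re (cnj (w x) * h x)" if "x \<in> J" for x
  proof -
    have *: "cnj (w x / of_real (g x)) * (g x *\<^sub>R (Q x *\<^sub>R w x - r x *\<^sub>R h x)) = cnj (w x) * (Q x *\<^sub>R w x - r x *\<^sub>R h x)"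
      using g_pos[OF that] by (simp add: scaleR_conv_of_real)
    show ?thesis unfolding * cmod_power2 by (simp add: power2_eq_square algebra_simps)
  qed
  then show "AE x\<in>J in lebesgue. Re (cnj (w x / of_real (g x)) * (g x *\<^sub>R (Q x *\<^sub>R w x - r x *\<^sub>R h x)) + cnj (\<omega> x *\<^sub>R V w w1 x) * V w w1 x)
    = \<omega> x * (cmod (V w w1 x))\<^sup>2 + Q x * (cmod (w x))\<^sup>2 - r x * Re (cnj (w x) * h x)" by simp
qed

lemma sol_source_integrable:
  assumes w: "sol w w1 h" and xy: "{x..y} \<subseteq> I"
  shows "(\<lambda>x. r x *\<^sub>R h x) absolutely_integrable_on {x..y}" "(\<lambda>x. r x * Re (cnj (w x) * h x)) absolutely_integrable_on {x..y}"
proof -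
  have c: "continuous_on {x..y} w" "continuous_on {x..y} w1" using sol_continuous[OF w] xy by (auto intro: continuous_on_subset)
  show 1: "(\<lambda>x. r x *\<^sub>R h x) absolutely_integrable_on {x..y}"
  proof (cases "x \<le> y")
    case True
    have "(\<lambda>x. s x *\<^sub>R w1 x + q x *\<^sub>R w x - (s x *\<^sub>R w1 x + q x *\<^sub>R w x - r x *\<^sub>R h x)) absolutely_integrable_on {x..y}"
      by (intro set_integral_add(1) set_integral_diff(1) absolutely_integrable_scaleR_continuous coeff_integrable xy c
          primitive_onD(1)[OF sol_prim(2)[OF w] True xy])
    then show ?thesis by simp
  qed simp
  have bil: "bilinear ((*) :: complex \<Rightarrow> complex \<Rightarrow> complex)"
    by (simp add: bilinear_conv_bounded_bilinear bounded_bilinear_mult)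
  have "(\<lambda>x. cnj (w x) * (r x *\<^sub>R h x)) absolutely_integrable_on {x..y}"
  proof (rule absolutely_integrable_bounded_measurable_product[OF bil _ _ _ 1])
    have cc: "continuous_on {x..y} (\<lambda>x. cnj (w x))" by (intro continuous_intros c)
    show "(\<lambda>x. cnj (w x)) \<in> borel_measurable (lebesgue_on {x..y})"
      by (rule continuous_imp_measurable_on_sets_lebesgue[OF cc]) simp
    show "bounded ((\<lambda>x. cnj (w x)) ` {x..y})" by (intro compact_imp_bounded compact_continuous_image cc) simp
  qed simp
  then have "(\<lambda>x. Re (cnj (w x) * (r x *\<^sub>R h x))) absolutely_integrable_on {x..y}"
    using absolutely_integrable_linear[OF _ bounded_linear_Re] by (simp only: o_def)
  moreover have "Re (z * (c *\<^sub>R y)) = c * Re (z * y)" for z y c by (simp add: algebra_simps)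
  ultimately show "(\<lambda>x. r x * Re (cnj (w x) * h x)) absolutely_integrable_on {x..y}" by (simp only:)
qed

lemma omega_pos: "AE x\<in>J in lebesgue. 0 < \<omega> x"
  using p_pos by eventually_elim (use J_sub g_pos in \<open>auto simp: \<omega>_def intro!: mult_pos_pos zero_less_power\<close>)

lemma Q_ge: "AE x\<in>J in lebesgue. 0 \<le> Q x - \<mu> * r x"
  using q_ge by eventually_elim (auto simp: Q_def)

lemma V_sq_integrable:
  assumes w: "sol w w1 h" and xy: "{x..y} \<subseteq> J"
  shows "(\<lambda>x. \<omega> x * (cmod (V w w1 x))\<^sup>2) absolutely_integrable_on {x..y}"
    "(\<lambda>x. (Q x - \<mu> * r x) * (cmod (w x))\<^sup>2) absolutely_integrable_on {x..y}"
    "(\<lambda>x. r x * (cmod (w x))\<^sup>2) absolutely_integrable_on {x..y}"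
    "en w w1 absolutely_integrable_on {x..y}" "\<omega> absolutely_integrable_on {x..y}"
proof -
  have c: "continuous_on {x..y} (V w w1)" "continuous_on {x..y} w"
    using sol_continuous_J[OF w] xy by (auto intro: continuous_on_subset)
  have c2: "continuous_on {x..y} (\<lambda>x. (cmod (V w w1 x))\<^sup>2)" "continuous_on {x..y} (\<lambda>x. (cmod (w x))\<^sup>2)"
    by (intro continuous_intros c)+
  show 1: "(\<lambda>x. \<omega> x * (cmod (V w w1 x))\<^sup>2) absolutely_integrable_on {x..y}"
    using scaled_integrable(1)[OF xy c2(1)] by simp
  show r: "(\<lambda>x. r x * (cmod (w x))\<^sup>2) absolutely_integrable_on {x..y}"
    using scaled_integrable(3)[OF xy c2(2)] by simp
  have "(\<lambda>x. Q x * (cmod (w x))\<^sup>2 - \<mu> * (r x * (cmod (w x))\<^sup>2)) absolutely_integrable_on {x..y}"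
    using scaled_integrable(2)[OF xy c2(2)] r by (intro set_integral_diff(1) set_integrable_mult_right) simp_all
  then show 2: "(\<lambda>x. (Q x - \<mu> * r x) * (cmod (w x))\<^sup>2) absolutely_integrable_on {x..y}"
    by (simp add: left_diff_distrib mult.assoc)
  show "en w w1 absolutely_integrable_on {x..y}"
    unfolding en_def[abs_def] by (intro set_integral_add(1) 1 2)
  show "\<omega> absolutely_integrable_on {x..y}"
    using scaled_integrable(1)[OF xy, of "\<lambda>_. 1::real"] by simp
qed

lemma en_ge:
  assumes "{x..y} \<subseteq> J"
  shows "AE t\<in>{x..y} in lebesgue. \<omega> t * (cmod (V w w1 t))\<^sup>2 \<le> en w w1 t"
    "AE t\<in>{x..y} in lebesgue. (Q t - \<mu> * r t) * (cmod (w t))\<^sup>2 \<le> en w w1 t"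
    "AE t\<in>{x..y} in lebesgue. 0 \<le> en w w1 t"
    "AE t\<in>{x..y} in lebesgue. 0 \<le> \<omega> t"
    "AE t\<in>{x..y} in lebesgue. 0 < \<omega> t"
    "AE t\<in>{x..y} in lebesgue. 0 \<le> (Q t - \<mu> * r t) * (cmod (w t))\<^sup>2"
    "AE t\<in>{x..y} in lebesgue. 0 \<le> \<omega> t * (cmod (V w w1 t))\<^sup>2"
proof -
  have *: "AE t\<in>{x..y} in lebesgue. 0 < \<omega> t \<and> 0 \<le> Q t - \<mu> * r t"
    using omega_pos Q_ge by eventually_elim (use assms in auto)
  show "AE t\<in>{x..y} in lebesgue. \<omega> t * (cmod (V w w1 t))\<^sup>2 \<le> en w w1 t"
    "AE t\<in>{x..y} in lebesgue. (Q t - \<mu> * r t) * (cmod (w t))\<^sup>2 \<le> en w w1 t"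
    "AE t\<in>{x..y} in lebesgue. 0 \<le> en w w1 t"
    "AE t\<in>{x..y} in lebesgue. 0 \<le> \<omega> t"
    "AE t\<in>{x..y} in lebesgue. 0 < \<omega> t"
    "AE t\<in>{x..y} in lebesgue. 0 \<le> (Q t - \<mu> * r t) * (cmod (w t))\<^sup>2"
    "AE t\<in>{x..y} in lebesgue. 0 \<le> \<omega> t * (cmod (V w w1 t))\<^sup>2"
    using * by (eventually_elim, force simp: en_def)+
qed

lemma energy_identity:
  assumes w: "sol w w1 h" and xy: "x \<le> y" "{x..y} \<subseteq> J"
  shows "integral {x..y} (en w w1) = bf w w1 y - bf w w1 x + integral {x..y} (\<lambda>x. r x * Re (cnj (w x) * h x))
    - \<mu> * integral {x..y} (\<lambda>x. r x * (cmod (w x))\<^sup>2)"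
proof -
  have 1: "((\<lambda>x. \<omega> x * (cmod (V w w1 x))\<^sup>2 + Q x * (cmod (w x))\<^sup>2 - r x * Re (cnj (w x) * h x)) has_integral bf w w1 y - bf w w1 x) {x..y}"
    by (rule primitive_onD(3)[OF bf_primitive[OF w] xy])
  have 2: "((\<lambda>x. r x * Re (cnj (w x) * h x)) has_integral integral {x..y} (\<lambda>x. r x * Re (cnj (w x) * h x))) {x..y}"
    "((\<lambda>x. r x * (cmod (w x))\<^sup>2) has_integral integral {x..y} (\<lambda>x. r x * (cmod (w x))\<^sup>2)) {x..y}"
    by (rule integrable_integral[OF absolutely_integrable_imp_integrable[OF sol_source_integrable(2)[OF w sub_I[OF xy(2)]]]]
        integrable_integral[OF absolutely_integrable_imp_integrable[OF V_sq_integrable(3)[OF w xy(2)]]])+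
  have "((\<lambda>x. (\<omega> x * (cmod (V w w1 x))\<^sup>2 + Q x * (cmod (w x))\<^sup>2 - r x * Re (cnj (w x) * h x)) + r x * Re (cnj (w x) * h x) - \<mu> * (r x * (cmod (w x))\<^sup>2))
    has_integral (bf w w1 y - bf w w1 x) + integral {x..y} (\<lambda>x. r x * Re (cnj (w x) * h x))
    - \<mu> * integral {x..y} (\<lambda>x. r x * (cmod (w x))\<^sup>2)) {x..y}"
    by (intro has_integral_diff has_integral_add has_integral_mult_right 1 2)
  also have "(\<lambda>x. (\<omega> x * (cmod (V w w1 x))\<^sup>2 + Q x * (cmod (w x))\<^sup>2 - r x * Re (cnj (w x) * h x)) + r x * Re (cnj (w x) * h x) - \<mu> * (r x * (cmod (w x))\<^sup>2)) = en w w1"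
    by (rule ext) (simp add: en_def left_diff_distrib mult.assoc)
  finally show ?thesis by (rule integral_unique)
qed

lemma quotient_sq_diff:
  assumes w: "sol w w1 h" and xy: "x \<le> y" "{x..y} \<subseteq> J"
  shows "(\<lambda>x. \<omega> x * bf w w1 x) absolutely_integrable_on {x..y}"
   "(cmod (w y / of_real (g y)))\<^sup>2 - (cmod (w x / of_real (g x)))\<^sup>2 = 2 * integral {x..y} (\<lambda>x. \<omega> x * bf w w1 x)"
proof -
  let ?v = "\<lambda>x. w x / of_real (g x)"
  note v = quotient_primitive[OF w]
  have "primitive_on \<alpha> \<beta> (\<lambda>x. Re (cnj (?v x) * ?v x)) (\<lambda>x. Re (cnj (?v x) * (\<omega> x *\<^sub>R V w w1 x) + cnj (\<omega> x *\<^sub>R V w w1 x) * ?v x))"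
    by (rule primitive_on_linear[OF bounded_linear_Re primitive_on_mult[OF primitive_on_linear[OF bounded_linear_cnj v] v]])
  then have "primitive_on \<alpha> \<beta> (\<lambda>x. (cmod (?v x))\<^sup>2) (\<lambda>x. 2 * (\<omega> x * bf w w1 x))"
  proof (rule primitive_on_AE_eq)
    show "Re (cnj (?v x) * ?v x) = (cmod (?v x))\<^sup>2" for x
      unfolding cmod_power2 by (simp only: complex_cnj complex.sel times_complex.sel power2_eq_square cnj.sel)
    have *: "Re (cnj z * (c *\<^sub>R y) + cnj (c *\<^sub>R y) * z) = 2 * (c * Re (cnj z * y))" for z y c
      by (simp add: algebra_simps)
    have "Re (cnj (?v x) * (\<omega> x *\<^sub>R V w w1 x) + cnj (\<omega> x *\<^sub>R V w w1 x) * ?v x) = 2 * (\<omega> x * bf w w1 x)" if "x \<in> J" for x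
      unfolding * bf_eq[OF that] ..
    then show "AE x\<in>J in lebesgue. Re (cnj (?v x) * (\<omega> x *\<^sub>R V w w1 x) + cnj (\<omega> x *\<^sub>R V w w1 x) * ?v x) = 2 * (\<omega> x * bf w w1 x)" by simp
  qed
  note P = primitive_onD[OF this xy]
  show "(\<lambda>x. \<omega> x * bf w w1 x) absolutely_integrable_on {x..y}"
    using set_integrable_mult_right[OF P(1), of "1/2"] by simp
  show "(cmod (?v y))\<^sup>2 - (cmod (?v x))\<^sup>2 = 2 * integral {x..y} (\<lambda>x. \<omega> x * bf w w1 x)"
    using P(2) by simp
qed

text \<open>Cauchy-Schwarz with weight \<omega>, applied to (w/g)' = \<omega> V.\<close>

lemma quotient_diff_le:
  assumes w: "sol w w1 h" and xy: "x \<le> y" "{x..y} \<subseteq> J"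
  shows "(cmod (w y / of_real (g y) - w x / of_real (g x)))\<^sup>2
    \<le> integral {x..y} \<omega> * integral {x..y} (\<lambda>x. \<omega> x * (cmod (V w w1 x))\<^sup>2)"
proof -
  note P = primitive_onD[OF quotient_primitive[OF w] xy]
  have c: "continuous_on {x..y} (\<lambda>x. cmod (V w w1 x))"
    using sol_continuous_J(3)[OF w] xy(2) by (intro continuous_intros) (auto intro: continuous_on_subset)
  have i: "(\<lambda>x. \<omega> x * (1 * cmod (V w w1 x))) absolutely_integrable_on {x..y}"
    using scaled_integrable(1)[OF xy(2) c] by simp
  have "cmod (w y / of_real (g y) - w x / of_real (g x)) \<le> integral {x..y} (\<lambda>x. norm (\<omega> x *\<^sub>R V w w1 x))"
    unfolding P(2) using P(1) by (intro integral_norm_bound_integral) (auto simp: absolutely_integrable_on_def)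
  also have "\<dots> = integral {x..y} (\<lambda>x. \<omega> x * (1 * cmod (V w w1 x)))"
    by (rule integral_cong_AE_set) (use en_ge(4)[OF xy(2)] in \<open>auto elim!: eventually_mono\<close>)
  finally have "(cmod (w y / of_real (g y) - w x / of_real (g x)))\<^sup>2 \<le> (integral {x..y} (\<lambda>x. \<omega> x * (1 * cmod (V w w1 x))))\<^sup>2"
    by (rule power_mono) simp
  also have "\<dots> \<le> integral {x..y} (\<lambda>x. \<omega> x * 1\<^sup>2) * integral {x..y} (\<lambda>x. \<omega> x * (cmod (V w w1 x))\<^sup>2)"
    by (rule integral_Cauchy_Schwarz_weighted[OF _ i V_sq_integrable(1)[OF w xy(2)] en_ge(4)[OF xy(2)]])
      (use V_sq_integrable(5)[OF w xy(2)] in simp)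
  finally show ?thesis by simp
qed

end

lemma integral_Icc_combine3:
  fixes F :: "real \<Rightarrow> real"
  assumes F: "F absolutely_integrable_on {x..y}" and "x \<le> c" "c \<le> d" "d \<le> y"
  shows "integral {x..y} F = integral {x..c} F + integral {c..d} F + integral {d..y} F"
proof -
  have i: "F integrable_on {x..y}" using F by (rule absolutely_integrable_imp_integrable)
  have "F integrable_on {c..y}" by (rule integrable_on_subinterval[OF i]) (use assms in auto)
  then show ?thesis
    using integral_combine_Icc[of x c y F] integral_combine_Icc[of c d y F] i assms by simp
qed

context sl_jacobi
begin

text \<open>\<open>V\<close> of the limit is controlled by integrating by parts against the quotients \<open>u n / g\<close>, which
  converge pointwise, since no convergence of \<open>V (u n)\<close> itself is available.\<close>

lemma energy_limit:
  assumes w: "sol w w1 h" and u: "\<And>n. sol (u n) (u1 n) (k n)" and xy: "x \<le> y" "{x..y} \<subseteq> J"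
    and lim: "\<And>t. t \<in> {x..y} \<Longrightarrow> (\<lambda>n. u n t) \<longlonglongrightarrow> w t" and B: "\<And>n t. t \<in> {x..y} \<Longrightarrow> cmod (u n t) \<le> B"
    and K: "\<And>n. integral {x..y} (en (u n) (u1 n)) \<le> K"
  shows "integral {x..y} (en w w1) \<le> 2 * K"
proof -
  have Vn: "integral {x..y} (\<lambda>t. \<omega> t * (cmod (V (u n) (u1 n) t))\<^sup>2) \<le> K" for n
    by (rule order_trans[OF integral_mono_AE_Icc[OF V_sq_integrable(1)[OF u xy(2)] V_sq_integrable(4)[OF u xy(2)] en_ge(1)[OF xy(2)]] K])
  have Qn: "integral {x..y} (\<lambda>t. (Q t - \<mu> * r t) * (cmod (u n t))\<^sup>2) \<le> K" for n
    by (rule order_trans[OF integral_mono_AE_Icc[OF V_sq_integrable(2)[OF u xy(2)] V_sq_integrable(4)[OF u xy(2)] en_ge(2)[OF xy(2)]] K])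
  have Qr: "(\<lambda>t. Q t - \<mu> * r t) absolutely_integrable_on {x..y}"
    using scaled_integrable(2,3)[OF xy(2), of "\<lambda>_. 1::real"] by (intro set_integral_diff(1) set_integrable_mult_right) simp_all
  have "(\<lambda>n. integral {x..y} (\<lambda>t. (Q t - \<mu> * r t) * (cmod (u n t))\<^sup>2)) \<longlonglongrightarrow> integral {x..y} (\<lambda>t. (Q t - \<mu> * r t) * (cmod (w t))\<^sup>2)"
  proof (rule dominated_convergence(2))
    show "(\<lambda>t. (Q t - \<mu> * r t) * (cmod (u n t))\<^sup>2) integrable_on {x..y}" for n
      by (rule absolutely_integrable_imp_integrable[OF V_sq_integrable(2)[OF u xy(2)]])
    show "(\<lambda>t. norm (Q t - \<mu> * r t) * B\<^sup>2) integrable_on {x..y}"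
      by (rule absolutely_integrable_imp_integrable[OF set_integrable_mult_left[OF set_integrable_norm[OF Qr]]])
    show "norm ((Q t - \<mu> * r t) * (cmod (u n t))\<^sup>2) \<le> norm (Q t - \<mu> * r t) * B\<^sup>2" if "t \<in> {x..y}" for n t
      unfolding norm_mult using power_mono[OF B[OF that, of n] norm_ge_zero, of 2] by (intro mult_left_mono) auto
    show "(\<lambda>n. (Q t - \<mu> * r t) * (cmod (u n t))\<^sup>2) \<longlonglongrightarrow> (Q t - \<mu> * r t) * (cmod (w t))\<^sup>2" if "t \<in> {x..y}" for t
      by (intro tendsto_intros lim[OF that])
  qed
  then have 1: "integral {x..y} (\<lambda>t. (Q t - \<mu> * r t) * (cmod (w t))\<^sup>2) \<le> K"
    by (rule LIMSEQ_le_const2) (use Qn in auto)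
  define E where "E = integral {x..y} (\<lambda>t. \<omega> t * (cmod (V w w1 t))\<^sup>2)"
  have E0: "E \<ge> 0" unfolding E_def by (rule integral_nonneg_AE[OF V_sq_integrable(1)[OF w xy(2)] en_ge(7)[OF xy(2)]])
  have K0: "K \<ge> 0"
    using integral_nonneg_AE[OF V_sq_integrable(1)[OF u xy(2)] en_ge(7)[OF xy(2)]] Vn[of 0] by (rule order_trans)
  define D where "D t = g t *\<^sub>R (Q t *\<^sub>R w t - r t *\<^sub>R h t)" for t
  have D: "primitive_on \<alpha> \<beta> (V w w1) D" unfolding D_def[abs_def] by (rule V_primitive[OF w])
  have cV: "continuous_on {x..y} (V w w1)" by (rule continuous_on_subset[OF sol_continuous_J(3)[OF w] xy(2)])
  have cVn: "continuous_on {x..y} (V (u n) (u1 n))" for n by (rule continuous_on_subset[OF sol_continuous_J(3)[OF u] xy(2)])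
  \<comment> \<open>\<open>P\<close> pairs V of the limit with V of z under the weight \<omega>. As
    \<omega> V is the derivative of z/g, integration by parts leaves boundary values and an integral
    in which only z itself occurs.\<close>
  define P where "P z z1 = integral {x..y} (\<lambda>t. \<omega> t *\<^sub>R (cnj (V w w1 t) * V z z1 t))" for z z1
  define R where "R z = integral {x..y} (\<lambda>t. cnj (D t) * (z t / of_real (g t)))" for z
  define bd where "bd z = cnj (V w w1 y) * (z y / of_real (g y)) - cnj (V w w1 x) * (z x / of_real (g x))" for z
  have parts: "P z z1 = bd z - R z" "(\<lambda>t. cnj (D t) * (z t / of_real (g t))) integrable_on {x..y}" if z: "sol z z1 l" for z z1 l
  proof -
    have cz: "continuous_on {x..y} (V z z1)" by (rule continuous_on_subset[OF sol_continuous_J(3)[OF z] xy(2)])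
    have p: "primitive_on \<alpha> \<beta> (\<lambda>t. cnj (V w w1 t) * (z t / of_real (g t)))
      (\<lambda>t. cnj (V w w1 t) * (\<omega> t *\<^sub>R V z z1 t) + cnj (D t) * (z t / of_real (g t)))"
      by (rule primitive_on_mult[OF primitive_on_linear[OF bounded_linear_cnj D] quotient_primitive[OF z]])
    have i: "(\<lambda>t. \<omega> t *\<^sub>R (cnj (V w w1 t) * V z z1 t)) integrable_on {x..y}"
      by (rule absolutely_integrable_imp_integrable[OF scaled_integrable(1)[OF xy(2)]]) (intro continuous_intros cz cV)
    have "((\<lambda>t. (cnj (V w w1 t) * (\<omega> t *\<^sub>R V z z1 t) + cnj (D t) * (z t / of_real (g t))) - \<omega> t *\<^sub>R (cnj (V w w1 t) * V z z1 t))
       has_integral bd z - P z z1) {x..y}"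
      using has_integral_diff[OF primitive_onD(3)[OF p xy] integrable_integral[OF i]] unfolding bd_def P_def .
    then have "((\<lambda>t. cnj (D t) * (z t / of_real (g t))) has_integral bd z - P z z1) {x..y}"
      by (simp only: mult_scaleR_right add_diff_cancel_left')
    from this integral_unique[OF this]
    show "P z z1 = bd z - R z" "(\<lambda>t. cnj (D t) * (z t / of_real (g t))) integrable_on {x..y}"
      unfolding R_def by (simp_all only: has_integral_integrable) simp
  qed
  have cg: "continuous_on {x..y} (\<lambda>t. 1 / g t)"
    using continuous_on_subset[OF continuous_J(1) xy(2)] by (intro continuous_intros) (use g_pos xy(2) in force)+
  have "bounded ((\<lambda>t. 1 / g t) ` {x..y})" by (intro compact_imp_bounded compact_continuous_image cg) simp
  then obtain G where G: "G > 0" "\<And>t. t \<in> {x..y} \<Longrightarrow> \<bar>1 / g t\<bar> \<le> G" by (auto simp: bounded_pos)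
  have "(\<lambda>n. R (u n)) \<longlonglongrightarrow> R w"
    unfolding R_def
  proof (rule dominated_convergence(2))
    show "(\<lambda>t. cnj (D t) * (u n t / of_real (g t))) integrable_on {x..y}" for n by (rule parts(2)[OF u])
    show "(\<lambda>t. norm (D t) * (B * G)) integrable_on {x..y}"
      by (rule absolutely_integrable_imp_integrable[OF set_integrable_mult_left[OF set_integrable_norm[OF primitive_onD(1)[OF D xy]]]])
    show "norm (cnj (D t) * (u n t / of_real (g t))) \<le> norm (D t) * (B * G)" if t: "t \<in> {x..y}" for n t
    proof -
      have "B \<ge> 0" by (rule order_trans[OF norm_ge_zero B[OF t]])
      then have "cmod (u n t) * \<bar>1 / g t\<bar> \<le> B * G" using B[OF t] G(2)[OF t] by (intro mult_mono) auto
      then show ?thesis unfolding norm_mult complex_mod_cnj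
        by (intro mult_left_mono) (auto simp: norm_divide)
    qed
    have "(\<lambda>n. cnj (D t) * (u n t / of_real (g t))) \<longlonglongrightarrow> cnj (D t) * (w t / of_real (g t))" if t: "t \<in> {x..y}" for t
      using g_pos[of t] xy(2) t by (intro tendsto_intros lim) auto
    then show "\<And>t. t \<in> {x..y} \<Longrightarrow> (\<lambda>n. cnj (D t) * (u n t / of_real (g t))) \<longlonglongrightarrow> cnj (D t) * (w t / of_real (g t))" .
  qed
  moreover have "(\<lambda>n. bd (u n)) \<longlonglongrightarrow> bd w"
    unfolding bd_def using g_pos[of x] g_pos[of y] xy by (intro tendsto_intros lim) auto
  ultimately have "(\<lambda>n. P (u n) (u1 n)) \<longlonglongrightarrow> P w w1"
    using tendsto_diff unfolding parts(1)[OF w] parts(1)[OF u] by blast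
  then have lim2: "(\<lambda>n. (cmod (P (u n) (u1 n)))\<^sup>2) \<longlonglongrightarrow> (cmod (P w w1))\<^sup>2" by (intro tendsto_intros)
  have bnd: "(cmod (P (u n) (u1 n)))\<^sup>2 \<le> E * K" for n
  proof -
    have ai: "(\<lambda>t. \<omega> t *\<^sub>R (cnj (V w w1 t) * V (u n) (u1 n) t)) absolutely_integrable_on {x..y}"
      by (rule scaled_integrable(1)[OF xy(2)]) (intro continuous_intros cVn cV)
    have i: "(\<lambda>t. \<omega> t * (cmod (V w w1 t) * cmod (V (u n) (u1 n) t))) absolutely_integrable_on {x..y}"
    proof -
      have "continuous_on {x..y} (\<lambda>t. cmod (V w w1 t) * cmod (V (u n) (u1 n) t))" by (intro continuous_intros cV cVn)
      from scaled_integrable(1)[OF xy(2) this] show ?thesis by simp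
    qed
    have "cmod (P (u n) (u1 n)) \<le> integral {x..y} (\<lambda>t. norm (\<omega> t *\<^sub>R (cnj (V w w1 t) * V (u n) (u1 n) t)))"
      unfolding P_def using ai by (intro integral_norm_bound_integral) (auto simp: absolutely_integrable_on_def)
    also have "\<dots> = integral {x..y} (\<lambda>t. \<omega> t * (cmod (V w w1 t) * cmod (V (u n) (u1 n) t)))"
      by (rule integral_cong_AE_set) (use en_ge(4)[OF xy(2)] in \<open>auto elim!: eventually_mono simp: norm_mult\<close>)
    finally have "(cmod (P (u n) (u1 n)))\<^sup>2 \<le> (integral {x..y} (\<lambda>t. \<omega> t * (cmod (V w w1 t) * cmod (V (u n) (u1 n) t))))\<^sup>2"
      by (rule power_mono) simp
    also have "\<dots> \<le> E * integral {x..y} (\<lambda>t. \<omega> t * (cmod (V (u n) (u1 n) t))\<^sup>2)"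
      unfolding E_def
      by (rule integral_Cauchy_Schwarz_weighted[OF V_sq_integrable(1)[OF w xy(2)] i V_sq_integrable(1)[OF u xy(2)] en_ge(4)[OF xy(2)]])
    also have "\<dots> \<le> E * K" by (intro mult_left_mono Vn E0)
    finally show ?thesis .
  qed
  have "P w w1 = of_real E"
  proof -
    have "P w w1 = integral {x..y} (\<lambda>t. of_real (\<omega> t * (cmod (V w w1 t))\<^sup>2))"
      unfolding P_def by (intro Henstock_Kurzweil_Integration.integral_cong)
        (simp add: scaleR_conv_of_real complex_norm_square mult.commute del: of_real_power)
    also have "\<dots> = of_real E"
      unfolding E_def using absolutely_integrable_imp_integrable[OF V_sq_integrable(1)[OF w xy(2)]]
      by (rule integral_linear[OF _ bounded_linear_of_real, unfolded o_def])
    finally show ?thesis .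
  qed
  \<comment> \<open>At the limit P equals E, so the Cauchy-Schwarz bound reads E^2 \<le> E K. The
    part with Q - \<mu> r is bounded by K separately, whence the factor 2 in the conclusion.\<close>
  then have "E\<^sup>2 \<le> E * K"
    using LIMSEQ_le_const2[OF lim2, of "E * K"] bnd by auto
  then have "E \<le> K" using E0 K0 by (cases "E = 0") (auto simp: power2_eq_square)
  moreover have "integral {x..y} (en w w1) = E + integral {x..y} (\<lambda>t. (Q t - \<mu> * r t) * (cmod (w t))\<^sup>2)"
    unfolding en_def[abs_def] E_def
    by (intro Henstock_Kurzweil_Integration.integral_add absolutely_integrable_imp_integrable V_sq_integrable[OF w xy(2)])
  ultimately show ?thesis using 1 by simp
qed

end

section \<open>Both endpoints together: the energy estimate on the whole interval\<close>

locale sl_endpoints = sl_problem a b p q r s + A: sl_jacobi a b p q r s a c0 ga \<mu> + B: sl_jacobi a b p q r s d0 b gb \<mu>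
  for a b :: ereal and p q r s :: "real \<Rightarrow> real" and c0 d0 :: ereal and ga gb :: "real \<Rightarrow> real" and \<mu> :: real
begin

lemma left_sub: "c \<in> A.J \<Longrightarrow> x \<in> I \<Longrightarrow> x \<le> c \<Longrightarrow> {x..c} \<subseteq> A.J"
  by (rule Icc_subset_einterval) (auto simp: einterval_def intro: le_less_trans[of "ereal x" "ereal c"])

lemma right_sub: "d \<in> B.J \<Longrightarrow> y \<in> I \<Longrightarrow> d \<le> y \<Longrightarrow> {d..y} \<subseteq> B.J"
  by (rule Icc_subset_einterval) (auto simp: einterval_def intro: less_le_trans[of _ "ereal d" "ereal y"])

text \<open>The Jacobi energy identities on the end pieces and the plain Green identity in the
  middle are added. At c and d the boundary terms cancel only up to multiples of |w|^2. These and
  the potential term in the middle are absorbed by half of the kinetic energy through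
  \<open>sobolev\<close>, which leaves the other half on the left.\<close>

lemma coercive:
  assumes c: "c \<in> A.J" and d: "d \<in> B.J" and cd: "c < d"
  obtains C where "C \<ge> 0" "\<And>w w1 h x y. sol w w1 h \<Longrightarrow> x \<in> I \<Longrightarrow> y \<in> I \<Longrightarrow> x \<le> c \<Longrightarrow> d \<le> y \<Longrightarrow>
    integral {x..c} (A.en w w1) + integral {d..y} (B.en w w1) + 1/2 * integral {c..d} (\<lambda>t. inverse (p t) * (cmod (w1 t))\<^sup>2)
    \<le> integral {x..y} (\<lambda>t. r t * Re (cnj (w t) * h t)) + C * integral {x..y} (\<lambda>t. r t * (cmod (w t))\<^sup>2)
      - A.bf w w1 x + B.bf w w1 y"
proof -
  have cI: "c \<in> I" and dI: "d \<in> I" using c d A.J_sub B.J_sub by auto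
  have cdI: "{c..d} \<subseteq> I" by (rule Icc_subset_einterval[OF cI dI])
  define \<kappa>a \<kappa>b where "\<kappa>a = qd ga c / ga c" and "\<kappa>b = qd gb d / gb d"
  \<comment> \<open>Collects the coefficients of everything bounded by the supremum of |w|^2 on
    {c..d}: the defects at c and d and the integral of q |w|^2.\<close>
  define K where "K = \<bar>\<kappa>a\<bar> + \<bar>\<kappa>b\<bar> + integral {c..d} (\<lambda>t. \<bar>q t\<bar>)"
  have qi: "(\<lambda>t. \<bar>q t\<bar>) absolutely_integrable_on {c..d}"
    using set_integrable_norm[OF coeff_integrable(2)[OF cdI]] by simp
  have K: "K \<ge> 0" using integral_nonneg_AE[OF qi] by (simp add: K_def)
  \<comment> \<open>With this \<epsilon>, K times the Sobolev bound contains at most half of the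
    kinetic energy, because K/(K+1) \<le> 1.\<close>
  obtain C' where C': "C' \<ge> 0" "\<And>u u1 h x. sol u u1 h \<Longrightarrow> x \<in> {c..d} \<Longrightarrow>
    (cmod (u x))\<^sup>2 \<le> 1 / (2 * (K + 1)) * integral {c..d} (\<lambda>x. inverse (p x) * (cmod (u1 x))\<^sup>2) + C' * integral {c..d} (\<lambda>x. r x * (cmod (u x))\<^sup>2)"
    by (rule sobolev[OF cd cdI, of "1 / (2 * (K + 1))"]) (use K in auto)
  show ?thesis
  proof (rule that[of "K * C' + \<bar>\<mu>\<bar>"])
    show "K * C' + \<bar>\<mu>\<bar> \<ge> 0" using K C' by simp
    fix w w1 h x y assume w: "sol w w1 h" and x: "x \<in> I" "x \<le> c" and y: "y \<in> I" "d \<le> y"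
    note L = left_sub[OF c x] and Rr = right_sub[OF d y]
    have xyI: "{x..y} \<subseteq> I" by (rule Icc_subset_einterval[OF x(1) y(1)])
    define S where "S a b = integral {a..b} (\<lambda>t. r t * Re (cnj (w t) * h t))" for a b
    define N where "N a b = integral {a..b} (\<lambda>t. r t * (cmod (w t))\<^sup>2)" for a b
    define E where "E = integral {c..d} (\<lambda>t. inverse (p t) * (cmod (w1 t))\<^sup>2)"
    define Z where "Z = integral {c..d} (\<lambda>t. q t * (cmod (w t))\<^sup>2)"
    have wc: "continuous_on {x..y} w" "continuous_on {x..y} w1" using sol_continuous[OF w] xyI by (auto intro: continuous_on_subset)
    have wcd: "continuous_on {c..d} w" "continuous_on {c..d} w1" using sol_continuous[OF w] cdI by (auto intro: continuous_on_subset)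
    have iN: "(\<lambda>t. r t * (cmod (w t))\<^sup>2) absolutely_integrable_on {x..y}"
      by (intro coeff_times_continuous xyI continuous_intros wc)
    have iE: "(\<lambda>t. inverse (p t) * (cmod (w1 t))\<^sup>2) absolutely_integrable_on {c..d}"
      by (intro coeff_times_continuous cdI continuous_intros wcd)
    have iZ: "(\<lambda>t. q t * (cmod (w t))\<^sup>2) absolutely_integrable_on {c..d}"
      by (intro coeff_times_continuous cdI continuous_intros wcd)
    have S3: "S x y = S x c + S c d + S d y" unfolding S_def
      by (rule integral_Icc_combine3[OF A.sol_source_integrable(2)[OF w xyI]]) (use x y cd in auto)
    have N3: "N x y = N x c + N c d + N d y" unfolding N_def
      by (rule integral_Icc_combine3[OF iN]) (use x y cd in auto)
    have Npos: "N a b \<ge> 0" if "{a..b} \<subseteq> {x..y}" for a b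
      unfolding N_def by (rule integral_nonneg_AE[OF set_integrable_subset[OF iN _ that]])
        (use r_pos_Icc[OF xyI] that in \<open>auto elim!: eventually_mono\<close>)
    have N0: "N x c \<ge> 0" "N c d \<ge> 0" "N d y \<ge> 0" by (rule Npos; use x y cd in auto)+
    have eA: "integral {x..c} (A.en w w1) = A.bf w w1 c - A.bf w w1 x + S x c - \<mu> * N x c"
      unfolding S_def N_def by (rule A.energy_identity[OF w x(2) L])
    have eB: "integral {d..y} (B.en w w1) = B.bf w w1 y - B.bf w w1 d + S d y - \<mu> * N d y"
      unfolding S_def N_def by (rule B.energy_identity[OF w y(2) Rr])
    have eM: "E + Z - S c d = Re (cnj (w d) * w1 d) - Re (cnj (w c) * w1 c)"
    proof -
      have cd': "c \<le> d" using cd by simp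
      have "((\<lambda>t. inverse (p t) * (cmod (w1 t))\<^sup>2 + q t * (cmod (w t))\<^sup>2 - r t * Re (cnj (w t) * h t)) has_integral E + Z - S c d) {c..d}"
        unfolding E_def Z_def S_def
        by (intro has_integral_diff has_integral_add)
          (rule integrable_integral[OF absolutely_integrable_imp_integrable[OF iE]]
            integrable_integral[OF absolutely_integrable_imp_integrable[OF iZ]]
            integrable_integral[OF absolutely_integrable_imp_integrable[OF A.sol_source_integrable(2)[OF w cdI]]])+
      from has_integral_unique[OF this primitive_onD(3)[OF sol_energy[OF w] cd' cdI]] show ?thesis .
    qed
    define m where "m = 1 / (2 * (K + 1)) * E + C' * N c d"
    have m: "(cmod (w t))\<^sup>2 \<le> m" if "t \<in> {c..d}" for t
      unfolding m_def E_def N_def by (rule C'(2)[OF w that])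
    have Z: "- Z \<le> integral {c..d} (\<lambda>t. \<bar>q t\<bar>) * m"
    proof -
      have "- Z = integral {c..d} (\<lambda>t. - (q t * (cmod (w t))\<^sup>2))" unfolding Z_def by simp
      also have "\<dots> \<le> integral {c..d} (\<lambda>t. \<bar>q t\<bar> * m)"
      proof (rule integral_mono_AE_Icc[OF _ set_integrable_mult_left[OF qi]])
        show "(\<lambda>t. - (q t * (cmod (w t))\<^sup>2)) absolutely_integrable_on {c..d}" using set_integrable_mult_right[OF iZ, of "-1"] by simp
        have "- (q t * (cmod (w t))\<^sup>2) \<le> \<bar>q t\<bar> * m" if t: "t \<in> {c..d}" for t
        proof -
          have "- (q t * (cmod (w t))\<^sup>2) \<le> \<bar>q t\<bar> * (cmod (w t))\<^sup>2" using mult_right_mono[of "- q t" "\<bar>q t\<bar>" "(cmod (w t))\<^sup>2"] by simp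
          also have "\<dots> \<le> \<bar>q t\<bar> * m" by (intro mult_left_mono m t) simp
          finally show ?thesis .
        qed
        then show "AE t\<in>{c..d} in lebesgue. - (q t * (cmod (w t))\<^sup>2) \<le> \<bar>q t\<bar> * m" by simp
      qed
      finally show ?thesis by simp
    qed
    have ab: "- \<kappa>a * (cmod (w c))\<^sup>2 \<le> \<bar>\<kappa>a\<bar> * m" "\<kappa>b * (cmod (w d))\<^sup>2 \<le> \<bar>\<kappa>b\<bar> * m"
      using cd by (intro mult_mono m; simp)+
    have E0: "E \<ge> 0" unfolding E_def
      by (rule integral_nonneg_AE[OF iE]) (use inverse_p_nonneg[OF cdI] in \<open>auto elim!: eventually_mono\<close>)
    have "K * m = K / (K + 1) * (1/2 * E) + K * C' * N c d" using K by (simp add: m_def field_simps)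
    also have "K / (K + 1) * (1/2 * E) \<le> 1 * (1/2 * E)" using K E0 by (intro mult_right_mono) auto
    finally have Km: "K * m \<le> 1/2 * E + K * C' * N c d" by simp
    have Kd: "K * m = \<bar>\<kappa>a\<bar> * m + \<bar>\<kappa>b\<bar> * m + integral {c..d} (\<lambda>t. \<bar>q t\<bar>) * m" by (simp add: K_def distrib_right)
    have mu: "- \<mu> * N x c \<le> \<bar>\<mu>\<bar> * N x c" "- \<mu> * N d y \<le> \<bar>\<mu>\<bar> * N d y" using N0 by (intro mult_right_mono; simp)+
    have KC: "0 \<le> K * C' * N x c" "0 \<le> K * C' * N d y" "0 \<le> \<bar>\<mu>\<bar> * N c d" using N0 K C'(1) by simp_all
    have CN: "(K * C' + \<bar>\<mu>\<bar>) * N x y = K * C' * N x c + K * C' * N c d + K * C' * N d y + \<bar>\<mu>\<bar> * N x c + \<bar>\<mu>\<bar> * N c d + \<bar>\<mu>\<bar> * N d y"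
      unfolding N3 by (simp only: distrib_left distrib_right add.assoc)
    have bfc: "A.bf w w1 c = Re (cnj (w c) * w1 c) - \<kappa>a * (cmod (w c))\<^sup>2" "B.bf w w1 d = Re (cnj (w d) * w1 d) - \<kappa>b * (cmod (w d))\<^sup>2"
      by (simp_all only: A.bf_def B.bf_def \<kappa>a_def \<kappa>b_def)
    show "integral {x..c} (A.en w w1) + integral {d..y} (B.en w w1) + 1/2 * integral {c..d} (\<lambda>t. inverse (p t) * (cmod (w1 t))\<^sup>2)
      \<le> integral {x..y} (\<lambda>t. r t * Re (cnj (w t) * h t)) + (K * C' + \<bar>\<mu>\<bar>) * integral {x..y} (\<lambda>t. r t * (cmod (w t))\<^sup>2)
      - A.bf w w1 x + B.bf w w1 y"
      unfolding eA eB E_def[symmetric] S_def[symmetric] N_def[symmetric]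
      using S3 eM Z ab Km Kd mu KC CN bfc by linarith
  qed
qed

lemma T0_inner_support:
  assumes u: "u \<in> T0" and xy: "{x..y} \<subseteq> I" and z: "\<And>t. t \<in> I \<Longrightarrow> t \<notin> {x<..<y} \<Longrightarrow> u t = 0"
  shows "(L2_norm M u)\<^sup>2 = integral {x..y} (\<lambda>t. r t * (cmod (u t))\<^sup>2)"
    "Re (L2_inner M u (\<tau> u)) = integral {x..y} (\<lambda>t. r t * Re (cnj (u t) * \<tau> u t))"
proof -
  have L: "u \<in> L2 M" "\<tau> u \<in> L2 M" using dom_Tmax_L2 u dom_T0_subset by auto
  have z': "u t = 0" if "t \<in> I" "t \<notin> {x..y}" for t using z[OF that(1)] that(2) by auto
  show "(L2_norm M u)\<^sup>2 = integral {x..y} (\<lambda>t. r t * (cmod (u t))\<^sup>2)"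
    unfolding L2_norm_sq[OF L(1)] by (rule integral_eq_on_support[OF xy]) (use z' in auto)
  have "Re (L2_inner M u (\<tau> u)) = integral I (\<lambda>t. Re (r t *\<^sub>R (cnj (u t) * \<tau> u t)))"
    unfolding L2_inner_eq(2)[OF L]
    by (rule integral_linear[OF absolutely_integrable_imp_integrable[OF L2_inner_eq(1)[OF L]] bounded_linear_Re, unfolded o_def, symmetric])
  also have "\<dots> = integral I (\<lambda>t. r t * Re (cnj (u t) * \<tau> u t))" by (simp only: scaleR_complex.sel)
  also have "\<dots> = integral {x..y} (\<lambda>t. r t * Re (cnj (u t) * \<tau> u t))"
    by (rule integral_eq_on_support[OF xy]) (use z' in auto)
  finally show "Re (L2_inner M u (\<tau> u)) = integral {x..y} (\<lambda>t. r t * Re (cnj (u t) * \<tau> u t))" .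
qed

text \<open>The interval is enlarged beyond the support of \<open>u\<close>: there the boundary
  forms vanish, the integrals become L2 inner products, and the energies of the end pieces have only
  grown.\<close>

lemma T0_energy:
  assumes c: "c \<in> A.J" and d: "d \<in> B.J" and cd: "c < d"
  obtains C where "C \<ge> 0" "\<And>u x y. u \<in> T0 \<Longrightarrow> x \<in> I \<Longrightarrow> y \<in> I \<Longrightarrow> x \<le> c \<Longrightarrow> d \<le> y \<Longrightarrow>
    integral {x..c} (A.en u (qd u)) + integral {d..y} (B.en u (qd u)) + 1/2 * integral {c..d} (\<lambda>t. inverse (p t) * (cmod (qd u t))\<^sup>2)
    \<le> Re (L2_inner M u (\<tau> u)) + C * (L2_norm M u)\<^sup>2"
proof -
  obtain C where C: "C \<ge> 0" "\<And>w w1 h x y. sol w w1 h \<Longrightarrow> x \<in> I \<Longrightarrow> y \<in> I \<Longrightarrow> x \<le> c \<Longrightarrow> d \<le> y \<Longrightarrow>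
    integral {x..c} (A.en w w1) + integral {d..y} (B.en w w1) + 1/2 * integral {c..d} (\<lambda>t. inverse (p t) * (cmod (w1 t))\<^sup>2)
    \<le> integral {x..y} (\<lambda>t. r t * Re (cnj (w t) * h t)) + C * integral {x..y} (\<lambda>t. r t * (cmod (w t))\<^sup>2)
      - A.bf w w1 x + B.bf w w1 y"
    by (rule coercive[OF c d cd]) blast
  show ?thesis
  proof (rule that[OF C(1)])
    fix u x y assume u: "u \<in> T0" and x: "x \<in> I" "x \<le> c" and y: "y \<in> I" "d \<le> y"
    obtain x' y' where xy': "x' < x" "x' < y'" "y < y'" "{x'..y'} \<subseteq> I"
      and z: "\<And>t. t \<in> I \<Longrightarrow> t \<notin> {x'<..<y'} \<Longrightarrow> u t = 0 \<and> qd u t = 0 \<and> \<tau> u t = 0"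
      by (rule dom_T0_support[OF u x(1) y(1)]) blast
    have I': "x' \<in> I" "y' \<in> I" using xy'(2,4) by auto
    have z0: "u x' = 0" "u y' = 0" using z[OF I'(1)] z[OF I'(2)] by auto
    have w: "sol u (qd u) (\<tau> u)" using u dom_T0_subset dom_Tmax_sol by blast
    have x'c: "x' \<le> c" "d \<le> y'" using xy' x y by auto
    have "integral {x..c} (A.en u (qd u)) \<le> integral {x'..c} (A.en u (qd u))"
      by (rule integral_Icc_subset_le_AE[OF A.V_sq_integrable(4)[OF w] _ A.en_ge(3)])
        (use left_sub[OF c I'(1) x'c(1)] xy' in auto)
    moreover have "integral {d..y} (B.en u (qd u)) \<le> integral {d..y'} (B.en u (qd u))"
      by (rule integral_Icc_subset_le_AE[OF B.V_sq_integrable(4)[OF w] _ B.en_ge(3)])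
        (use right_sub[OF d I'(2) x'c(2)] xy' in auto)
    moreover have "A.bf u (qd u) x' = 0" "B.bf u (qd u) y' = 0" using z0 by (simp_all add: A.bf_def B.bf_def)
    moreover have N: "(L2_norm M u)\<^sup>2 = integral {x'..y'} (\<lambda>t. r t * (cmod (u t))\<^sup>2)"
      "Re (L2_inner M u (\<tau> u)) = integral {x'..y'} (\<lambda>t. r t * Re (cnj (u t) * \<tau> u t))"
      by (rule T0_inner_support[OF u xy'(4)]; use z in blast)+
    ultimately show "integral {x..c} (A.en u (qd u)) + integral {d..y} (B.en u (qd u)) + 1/2 * integral {c..d} (\<lambda>t. inverse (p t) * (cmod (qd u t))\<^sup>2)
      \<le> Re (L2_inner M u (\<tau> u)) + C * (L2_norm M u)\<^sup>2"
      using C(2)[OF w I' x'c] unfolding N by linarith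
  qed
qed

end

section \<open>Boundary behaviour in the domain of the Friedrichs extension\<close>

lemma L2_norm_sq_nn:
  assumes "f \<in> L2 M"
  shows "(\<integral>\<^sup>+x. ennreal ((cmod (f x))\<^sup>2) \<partial>M) = ennreal ((L2_norm M f)\<^sup>2)"
proof -
  have i: "integrable M (\<lambda>x. (cmod (f x))\<^sup>2)" using assms by (simp add: L2_def)
  have "(LINT x|M. (cmod (f x))\<^sup>2) \<ge> 0" by (intro Bochner_Integration.integral_nonneg) simp
  then show ?thesis using nn_integral_eq_integral[OF i] by (simp add: L2_norm_def)
qed

text \<open>Fatou's lemma for |u n - u m|^2 as m grows: the pointwise limit inherits the Cauchy
  bound.\<close>

lemma L2_limit_of_Cauchy:
  assumes u: "\<And>n. u n \<in> L2 M" and f: "f \<in> borel_measurable M" "AE x in M. (\<lambda>n. u n x) \<longlonglongrightarrow> f x"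
    and cauchy: "\<And>\<epsilon>. \<epsilon> > 0 \<Longrightarrow> \<exists>N. \<forall>m\<ge>N. \<forall>n\<ge>N. L2_norm M (\<lambda>x. u n x - u m x) < \<epsilon>"
  shows "f \<in> L2 M" "(\<lambda>n. L2_norm M (\<lambda>x. u n x - f x)) \<longlonglongrightarrow> 0"
proof -
  have um: "u n \<in> borel_measurable M" for n using u by (simp add: L2_def)
  have key: "(\<lambda>x. u n x - f x) \<in> L2 M \<and> L2_norm M (\<lambda>x. u n x - f x) \<le> \<epsilon>"
    if eps: "\<epsilon> > 0" and N: "\<forall>m\<ge>N. L2_norm M (\<lambda>x. u n x - u m x) < \<epsilon>" for n \<epsilon> N
  proof -
    have "(\<integral>\<^sup>+x. ennreal ((cmod (u n x - f x))\<^sup>2) \<partial>M) = (\<integral>\<^sup>+x. liminf (\<lambda>m. ennreal ((cmod (u n x - u m x))\<^sup>2)) \<partial>M)"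
    proof (rule nn_integral_cong_AE)
      show "AE x in M. ennreal ((cmod (u n x - f x))\<^sup>2) = liminf (\<lambda>m. ennreal ((cmod (u n x - u m x))\<^sup>2))"
        using f(2)
      proof eventually_elim
        case (elim x)
        have "(\<lambda>m. ennreal ((cmod (u n x - u m x))\<^sup>2)) \<longlonglongrightarrow> ennreal ((cmod (u n x - f x))\<^sup>2)"
          by (intro tendsto_ennrealI tendsto_intros elim)
        then show ?case by (rule lim_imp_Liminf[OF trivial_limit_sequentially, symmetric])
      qed
    qed
    also have "\<dots> \<le> liminf (\<lambda>m. \<integral>\<^sup>+x. ennreal ((cmod (u n x - u m x))\<^sup>2) \<partial>M)"
      by (rule nn_integral_liminf) (use um in measurable)
    also have "\<dots> \<le> liminf (\<lambda>m. ennreal (\<epsilon>\<^sup>2))"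
    proof (rule Liminf_mono, rule eventually_sequentiallyI[of N])
      fix m assume "N \<le> m"
      then have "L2_norm M (\<lambda>x. u n x - u m x) \<le> \<epsilon>" using N by (simp add: less_imp_le)
      then have "(L2_norm M (\<lambda>x. u n x - u m x))\<^sup>2 \<le> \<epsilon>\<^sup>2" by (rule power_mono[OF _ L2_norm_nonneg])
      then show "(\<integral>\<^sup>+x. ennreal ((cmod (u n x - u m x))\<^sup>2) \<partial>M) \<le> ennreal (\<epsilon>\<^sup>2)"
        unfolding L2_norm_sq_nn[OF L2_diff[OF u u]] by (rule ennreal_leI)
    qed
    also have "\<dots> = ennreal (\<epsilon>\<^sup>2)" by (rule Liminf_const) simp
    finally have le: "(\<integral>\<^sup>+x. ennreal ((cmod (u n x - f x))\<^sup>2) \<partial>M) \<le> ennreal (\<epsilon>\<^sup>2)" .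
    have mu: "(\<lambda>x. u n x - f x) \<in> borel_measurable M" using um f(1) by measurable
    have "integrable M (\<lambda>x. (cmod (u n x - f x))\<^sup>2)"
    proof (rule integrableI_bounded)
      show "(\<lambda>x. (cmod (u n x - f x))\<^sup>2) \<in> borel_measurable M" using mu by measurable
      show "(\<integral>\<^sup>+x. ennreal (norm ((cmod (u n x - f x))\<^sup>2)) \<partial>M) < \<infinity>"
        using le by (simp add: le_less_trans[OF _ ennreal_less_top])
    qed
    then have L: "(\<lambda>x. u n x - f x) \<in> L2 M" using mu by (simp add: L2_def)
    have "(L2_norm M (\<lambda>x. u n x - f x))\<^sup>2 \<le> \<epsilon>\<^sup>2"
      using le unfolding L2_norm_sq_nn[OF L] by (simp del: power_mono_iff)
    then show ?thesis using L eps by (auto intro: power2_le_imp_le)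
  qed
  obtain N1 where "\<forall>m\<ge>N1. \<forall>n\<ge>N1. L2_norm M (\<lambda>x. u n x - u m x) < 1" using cauchy[of 1] by auto
  then have "(\<lambda>x. u N1 x - f x) \<in> L2 M" using key[of 1 N1 N1] by auto
  from L2_diff[OF u[of N1] this] show "f \<in> L2 M" by simp
  show "(\<lambda>n. L2_norm M (\<lambda>x. u n x - f x)) \<longlonglongrightarrow> 0"
  proof (rule LIMSEQ_I)
    fix \<epsilon> :: real assume eps: "\<epsilon> > 0"
    obtain N where N: "\<forall>m\<ge>N. \<forall>n\<ge>N. L2_norm M (\<lambda>x. u n x - u m x) < \<epsilon> / 2" using cauchy[of "\<epsilon> / 2"] eps by auto
    have "norm (L2_norm M (\<lambda>x. u n x - f x) - 0) < \<epsilon>" if "n \<ge> N" for n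
    proof -
      have "L2_norm M (\<lambda>x. u n x - f x) \<le> \<epsilon> / 2" using key[of "\<epsilon> / 2" N n] N that eps by auto
      then show ?thesis using eps L2_norm_nonneg[of M "\<lambda>x. u n x - f x"] by simp
    qed
    then show "\<exists>no. \<forall>n\<ge>no. norm (L2_norm M (\<lambda>x. u n x - f x) - 0) < \<epsilon>" by blast
  qed
qed

text \<open>The lower bound is stated for every solution, with its boundary forms. For compactly
  supported functions these vanish and it reduces to semiboundedness (\<open>T0_lower\<close>); in
  \<open>kernel_trivial\<close> it is applied to a function whose membership in the form domain is
  not known.\<close>

locale sl_friedrichs = sl_endpoints +
  fixes \<gamma> c1 d1 :: real
  assumes c1: "c1 \<in> einterval a c0" and d1: "d1 \<in> einterval d0 b" and c1_d1: "c1 < d1"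
    and lower_form: "sol w w1 h \<Longrightarrow> x \<in> I \<Longrightarrow> y \<in> I \<Longrightarrow> x \<le> c1 \<Longrightarrow> d1 \<le> y \<Longrightarrow>
      0 \<le> integral {x..y} (\<lambda>t. r t * Re (cnj (w t) * h t)) - \<gamma> * integral {x..y} (\<lambda>t. r t * (cmod (w t))\<^sup>2)
      - A.bf w w1 x + B.bf w w1 y"
begin

lemma c1_I: "c1 \<in> I" and d1_I: "d1 \<in> I" using c1 d1 A.J_sub B.J_sub by auto

lemma left_mem: "x \<in> I \<Longrightarrow> x \<le> c1 \<Longrightarrow> x \<in> A.J" using left_sub[OF c1, of x] by auto
lemma right_mem: "y \<in> I \<Longrightarrow> d1 \<le> y \<Longrightarrow> y \<in> B.J" using right_sub[OF d1, of y] by auto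

lemma T0_lower:
  assumes u: "u \<in> T0"
  shows "Re (L2_inner M u (\<tau> u)) \<ge> \<gamma> * (L2_norm M u)\<^sup>2"
proof -
  obtain x y where xy: "x < c1" "x < y" "d1 < y" "{x..y} \<subseteq> I"
    and z: "\<And>t. t \<in> I \<Longrightarrow> t \<notin> {x<..<y} \<Longrightarrow> u t = 0 \<and> qd u t = 0 \<and> \<tau> u t = 0"
    by (rule dom_T0_support[OF u c1_I d1_I]) blast
  have I': "x \<in> I" "y \<in> I" using xy(2,4) by auto
  have z0: "u x = 0" "u y = 0" using z[OF I'(1)] z[OF I'(2)] by auto
  have w: "sol u (qd u) (\<tau> u)" using u dom_T0_subset dom_Tmax_sol by blast
  have "A.bf u (qd u) x = 0" "B.bf u (qd u) y = 0" using z0 by (simp_all add: A.bf_def B.bf_def)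
  moreover have N: "(L2_norm M u)\<^sup>2 = integral {x..y} (\<lambda>t. r t * (cmod (u t))\<^sup>2)"
    "Re (L2_inner M u (\<tau> u)) = integral {x..y} (\<lambda>t. r t * Re (cnj (u t) * \<tau> u t))"
    by (rule T0_inner_support[OF u xy(4)]; use z in blast)+
  ultimately show ?thesis using lower_form[OF w I'] xy unfolding N by simp
qed

sublocale F: semibounded_operator M "T0" \<tau> \<gamma>
proof
  fix u v \<alpha> assume u: "u \<in> T0"
  show "u \<in> L2 M" "\<tau> u \<in> L2 M" using dom_Tmax_L2 u dom_T0_subset by auto
  show "Re (L2_inner M u (\<tau> u)) \<ge> \<gamma> * (L2_norm M u)\<^sup>2" by (rule T0_lower[OF u])
  assume v: "v \<in> T0"
  show "(\<lambda>x. u x + \<alpha> * v x) \<in> T0" by (rule dom_T0_linear[OF u v])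
  have uv: "u \<in> Tmax" "v \<in> Tmax" using u v dom_T0_subset by auto
  show "AE x in M. \<tau> (\<lambda>x. u x + \<alpha> * v x) x = \<tau> u x + \<alpha> * \<tau> v x"
    unfolding M_AE by (rule dom_Tmax_linear(2)[OF uv])
  show "L2_inner M u (\<tau> v) = L2_inner M (\<tau> u) v"
    by (rule T0_symmetric[OF u dom_Tmax_sol[OF uv(2)]]) (use dom_Tmax_L2[OF uv(2)] in auto)
next
  show "T0 \<noteq> {}" using dom_T0_zero by auto
qed

lemma local_norm_le:
  assumes f: "f \<in> L2 M" and cd: "{c..d} \<subseteq> I"
  shows "integral {c..d} (\<lambda>t. r t * (cmod (f t))\<^sup>2) \<le> (L2_norm M f)\<^sup>2"
  unfolding L2_norm_sq[OF f]
  by (rule integral_Icc_subset_le_AE[OF _ cd]) (use f L2_iff r_pos in \<open>auto elim!: eventually_mono\<close>)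

text \<open>Replacing the shift 1 - \<gamma> of \<open>sn\<close> by the constant of
  \<open>T0_energy\<close> costs a multiple of the L2 norm, which \<open>sn\<close> dominates; this
  gives \<open>K0\<close>. The point values then follow from \<open>sobolev\<close> with \<epsilon>
  = 1.\<close>

lemma T0_bounds:
  assumes c: "c \<in> A.J" and d: "d \<in> B.J" and cd: "c < d"
  obtains K where "K \<ge> 0"
    "\<And>u x. u \<in> T0 \<Longrightarrow> x \<in> I \<Longrightarrow> x \<le> c \<Longrightarrow> integral {x..c} (A.en u (qd u)) \<le> K * (F.sn u)\<^sup>2"
    "\<And>u y. u \<in> T0 \<Longrightarrow> y \<in> I \<Longrightarrow> d \<le> y \<Longrightarrow> integral {d..y} (B.en u (qd u)) \<le> K * (F.sn u)\<^sup>2"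
    "\<And>u. u \<in> T0 \<Longrightarrow> integral {c..d} (\<lambda>t. inverse (p t) * (cmod (qd u t))\<^sup>2) \<le> K * (F.sn u)\<^sup>2"
    "\<And>u t. u \<in> T0 \<Longrightarrow> t \<in> {c..d} \<Longrightarrow> (cmod (u t))\<^sup>2 \<le> K * (F.sn u)\<^sup>2"
proof -
  have cI: "c \<in> I" "d \<in> I" using c d A.J_sub B.J_sub by auto
  have cdI: "{c..d} \<subseteq> I" by (rule Icc_subset_einterval[OF cI])
  obtain C where C: "C \<ge> 0" "\<And>u x y. u \<in> T0 \<Longrightarrow> x \<in> I \<Longrightarrow> y \<in> I \<Longrightarrow> x \<le> c \<Longrightarrow> d \<le> y \<Longrightarrow>
    integral {x..c} (A.en u (qd u)) + integral {d..y} (B.en u (qd u)) + 1/2 * integral {c..d} (\<lambda>t. inverse (p t) * (cmod (qd u t))\<^sup>2)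
    \<le> Re (L2_inner M u (\<tau> u)) + C * (L2_norm M u)\<^sup>2"
    by (rule T0_energy[OF c d cd]) blast
  obtain C' where C': "C' \<ge> 0" "\<And>u u1 h x. sol u u1 h \<Longrightarrow> x \<in> {c..d} \<Longrightarrow>
    (cmod (u x))\<^sup>2 \<le> 1 * integral {c..d} (\<lambda>x. inverse (p x) * (cmod (u1 x))\<^sup>2) + C' * integral {c..d} (\<lambda>x. r x * (cmod (u x))\<^sup>2)"
    by (rule sobolev[OF cd cdI zero_less_one]) blast
  define K0 where "K0 = 1 + \<bar>C + \<gamma> - 1\<bar>"
  define K where "K = 2 * K0 + C'"
  have K0: "K0 \<ge> 0" "K0 \<le> K" "2 * K0 \<le> K" using C'(1) by (simp_all add: K0_def K_def)
  {
    fix u assume u: "u \<in> T0"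
    have uL: "u \<in> L2 M" and w: "sol u (qd u) (\<tau> u)" using u dom_T0_subset dom_Tmax_sol F.D_L2 by blast+
    have ns: "(L2_norm M u)\<^sup>2 \<le> (F.sn u)\<^sup>2" by (rule power_mono[OF F.L2_norm_le_sn[OF u] L2_norm_nonneg])
    have "Re (L2_inner M u (\<tau> u)) + C * (L2_norm M u)\<^sup>2 = (F.sn u)\<^sup>2 + (C + \<gamma> - 1) * (L2_norm M u)\<^sup>2"
      unfolding F.sn_sq[OF u] F.sf_def L2_inner_self by (simp add: algebra_simps del: of_real_power)
    also have "\<dots> \<le> (F.sn u)\<^sup>2 + \<bar>C + \<gamma> - 1\<bar> * (F.sn u)\<^sup>2"
      using ns by (intro add_left_mono mult_mono) auto
    finally have E: "Re (L2_inner M u (\<tau> u)) + C * (L2_norm M u)\<^sup>2 \<le> K0 * (F.sn u)\<^sup>2"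
      by (simp add: K0_def distrib_right)
    have KK: "K0 * (F.sn u)\<^sup>2 \<le> K * (F.sn u)\<^sup>2" "2 * K0 * (F.sn u)\<^sup>2 \<le> K * (F.sn u)\<^sup>2"
      using K0 by (intro mult_right_mono; simp)+
    have p0: "integral {c..d} (\<lambda>t. inverse (p t) * (cmod (qd u t))\<^sup>2) \<ge> 0"
    proof (rule integral_nonneg_AE)
      show "(\<lambda>t. inverse (p t) * (cmod (qd u t))\<^sup>2) absolutely_integrable_on {c..d}"
        using sol_continuous(2)[OF w] by (intro coeff_times_continuous cdI continuous_intros) (rule continuous_on_subset[OF _ cdI])
    qed (use inverse_p_nonneg[OF cdI] in \<open>auto elim!: eventually_mono\<close>)
    have a0: "integral {x..c} (A.en u (qd u)) \<ge> 0" if "x \<in> I" "x \<le> c" for x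
      by (rule integral_nonneg_AE[OF A.V_sq_integrable(4)[OF w] A.en_ge(3)]) (use left_sub[OF c that] in auto)
    have b0: "integral {d..y} (B.en u (qd u)) \<ge> 0" if "y \<in> I" "d \<le> y" for y
      by (rule integral_nonneg_AE[OF B.V_sq_integrable(4)[OF w] B.en_ge(3)]) (use right_sub[OF d that] in auto)
    have 1: "integral {x..c} (A.en u (qd u)) \<le> K * (F.sn u)\<^sup>2" if "x \<in> I" "x \<le> c" for x
      using C(2)[OF u that(1) cI(2) that(2) order_refl] E KK p0 b0[OF cI(2) order_refl] by linarith
    have 2: "integral {d..y} (B.en u (qd u)) \<le> K * (F.sn u)\<^sup>2" if "y \<in> I" "d \<le> y" for y
      using C(2)[OF u cI(1) that(1) order_refl that(2)] E KK p0 a0[OF cI(1) order_refl] by linarith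
    have 3: "integral {c..d} (\<lambda>t. inverse (p t) * (cmod (qd u t))\<^sup>2) \<le> 2 * K0 * (F.sn u)\<^sup>2"
      using C(2)[OF u cI order_refl order_refl] E a0[OF cI(1) order_refl] b0[OF cI(2) order_refl] by linarith
    have 4: "(cmod (u t))\<^sup>2 \<le> K * (F.sn u)\<^sup>2" if "t \<in> {c..d}" for t
    proof -
      have "(cmod (u t))\<^sup>2 \<le> 2 * K0 * (F.sn u)\<^sup>2 + C' * (F.sn u)\<^sup>2"
        using C'(2)[OF w that] 3 mult_left_mono[OF order_trans[OF local_norm_le[OF uL cdI] ns] C'(1)] by linarith
      then show ?thesis by (simp add: K_def distrib_right)
    qed
    note 1 2 order_trans[OF 3 KK(2)] 4
  }
  note * = this
  show ?thesis by (rule that[of K]) (use K0 * in auto)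
qed

lemma cover_point:
  assumes "t \<in> I" "t' \<in> I"
  obtains c d where "c \<in> A.J" "d \<in> B.J" "c < d" "t \<in> {c..d}" "t' \<in> {c..d}"
proof (rule that[of "min c1 (min t t')" "max d1 (max t t')"])
  show "min c1 (min t t') \<in> A.J" using assms c1_I by (intro left_mem) (auto simp: min_def)
  show "max d1 (max t t') \<in> B.J" using assms d1_I by (intro right_mem) (auto simp: max_def)
qed (use c1_d1 in auto)

text \<open>Point evaluations are continuous in the form norm, so the sequence converges pointwise,
  and the pointwise limit is its L2 limit.\<close>

lemma form_Cauchy_convergent:
  assumes u: "F.form_Cauchy u"
  shows "\<exists>f\<in>L2 M. (\<lambda>n. L2_norm M (\<lambda>x. u n x - f x)) \<longlonglongrightarrow> 0"
proof -
  have uD: "u n \<in> T0" for n using u by (simp add: F.form_Cauchy_def)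
  have uc: "\<exists>N. \<forall>m\<ge>N. \<forall>n\<ge>N. F.sn (\<lambda>x. u n x - u m x) < \<epsilon>" if "\<epsilon> > 0" for \<epsilon> using u that by (auto simp: F.form_Cauchy_def)
  have conv: "(\<lambda>n. u n t) \<longlonglongrightarrow> lim (\<lambda>n. u n t)" if t: "t \<in> I" for t
  proof -
    obtain c d where cd: "c \<in> A.J" "d \<in> B.J" "c < d" "t \<in> {c..d}" by (rule cover_point[OF t t]) blast
    obtain K where K: "K \<ge> 0" "\<And>u t. u \<in> T0 \<Longrightarrow> t \<in> {c..d} \<Longrightarrow> (cmod (u t))\<^sup>2 \<le> K * (F.sn u)\<^sup>2"
      by (rule T0_bounds[OF cd(1-3)]) blast
    have "Cauchy (\<lambda>n. u n t)"
    proof (rule CauchyI)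
      fix \<epsilon> :: real assume eps: "\<epsilon> > 0"
      obtain N where N: "\<forall>m\<ge>N. \<forall>n\<ge>N. F.sn (\<lambda>x. u n x - u m x) < \<epsilon> / sqrt (K + 1)"
        using uc[of "\<epsilon> / sqrt (K + 1)"] eps K(1) by auto
      have "norm (u m t - u n t) < \<epsilon>" if "m \<ge> N" "n \<ge> N" for m n
      proof -
        have D: "(\<lambda>x. u m x - u n x) \<in> T0" by (rule F.D_diff[OF uD uD])
        have "F.sn (\<lambda>x. u m x - u n x) < \<epsilon> / sqrt (K + 1)" using N that by blast
        then have "sqrt (K + 1) * F.sn (\<lambda>x. u m x - u n x) < \<epsilon>" using K(1) by (simp add: field_simps)
        moreover have "norm (u m t - u n t) \<le> sqrt (K + 1) * F.sn (\<lambda>x. u m x - u n x)"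
        proof (rule power2_le_imp_le)
          have "(norm (u m t - u n t))\<^sup>2 \<le> K * (F.sn (\<lambda>x. u m x - u n x))\<^sup>2" by (rule K(2)[OF D cd(4)])
          also have "\<dots> \<le> (K + 1) * (F.sn (\<lambda>x. u m x - u n x))\<^sup>2" by (intro mult_right_mono) auto
          also have "\<dots> = (sqrt (K + 1) * F.sn (\<lambda>x. u m x - u n x))\<^sup>2" using K(1) by (simp add: power_mult_distrib)
          finally show "(norm (u m t - u n t))\<^sup>2 \<le> (sqrt (K + 1) * F.sn (\<lambda>x. u m x - u n x))\<^sup>2" .
          show "0 \<le> sqrt (K + 1) * F.sn (\<lambda>x. u m x - u n x)" using K(1) F.sn_nonneg[OF D] by simp
        qed
        ultimately show ?thesis by simp
      qed
      then show "\<exists>M. \<forall>m\<ge>M. \<forall>n\<ge>M. norm (u m t - u n t) < \<epsilon>" by blast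
    qed
    then show ?thesis by (simp add: Cauchy_convergent_iff convergent_LIMSEQ_iff)
  qed
  have m: "(\<lambda>x. lim (\<lambda>n. u n x)) \<in> borel_measurable M"
    by (rule borel_measurable_lim_metric) (use F.D_L2[OF uD] in \<open>simp add: L2_def\<close>)
  have ae: "AE x in M. (\<lambda>n. u n x) \<longlonglongrightarrow> lim (\<lambda>n. u n x)" unfolding M_AE using conv by simp
  have cau: "\<exists>N. \<forall>m\<ge>N. \<forall>n\<ge>N. L2_norm M (\<lambda>x. u n x - u m x) < \<epsilon>" if "\<epsilon> > 0" for \<epsilon>
    using uc[OF that] F.L2_norm_le_sn[OF F.D_diff[OF uD uD]] by (meson le_less_trans)
  have "(\<lambda>x. lim (\<lambda>n. u n x)) \<in> L2 M" "(\<lambda>n. L2_norm M (\<lambda>x. u n x - lim (\<lambda>n. u n x))) \<longlonglongrightarrow> 0"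
    by (rule L2_limit_of_Cauchy[OF F.D_L2[OF uD] m ae cau]; assumption)+
  then show ?thesis by (intro bexI[where x="\<lambda>x. lim (\<lambda>n. u n x)"])
qed

text \<open>The kinetic energy of u n - g is only known to be bounded. Using \<open>sobolev\<close>
  with a small \<epsilon> makes its contribution uniformly small, while the L2 term tends to
  0.\<close>

lemma form_limit_pointwise:
  assumes u: "form_conv M T0 F.t u f" and g: "g \<in> Tmax" "AE x\<in>I in lebesgue. f x = g x" and t: "t \<in> I"
  shows "(\<lambda>n. u n t) \<longlonglongrightarrow> g t"
proof -
  have uD: "u n \<in> T0" for n using u by (simp add: form_conv_def)
  have fL: "f \<in> L2 M" and lim: "(\<lambda>n. L2_norm M (\<lambda>x. u n x - f x)) \<longlonglongrightarrow> 0" using u by (auto simp: form_conv_def)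
  have gL: "g \<in> L2 M" using dom_Tmax_L2[OF g(1)] by simp
  obtain Bd where Bd: "Bd > 0" "\<And>n. F.sn (u n) \<le> Bd" by (rule F.form_Cauchy_bounded[OF F.form_conv_Cauchy[OF u]]) blast
  obtain c d where cd: "c \<in> A.J" "d \<in> B.J" "c < d" "t \<in> {c..d}" by (rule cover_point[OF t t]) blast
  have cdI: "{c..d} \<subseteq> I" by (rule Icc_subset_einterval) (use cd A.J_sub B.J_sub in auto)
  obtain K where K: "K \<ge> 0" "\<And>u. u \<in> T0 \<Longrightarrow> integral {c..d} (\<lambda>t. inverse (p t) * (cmod (qd u t))\<^sup>2) \<le> K * (F.sn u)\<^sup>2"
    by (rule T0_bounds[OF cd(1-3)]) blast
  define Eg where "Eg = integral {c..d} (\<lambda>t. inverse (p t) * (cmod (qd g t))\<^sup>2)"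
  define K2 where "K2 = 2 * (K * Bd\<^sup>2) + 2 * Eg"
  note sg = dom_Tmax_sol[OF g(1)]
  have su: "sol (u n) (qd (u n)) (\<tau> (u n))" for n using uD dom_T0_subset dom_Tmax_sol by blast
  have sz: "sol (\<lambda>x. u n x - g x) (\<lambda>x. qd (u n) x - qd g x) (\<lambda>x. \<tau> (u n) x - \<tau> g x)" for n
    using sol_add_scale[OF su[of n] sg, of "-1"] by simp
  have pc: "(\<lambda>x. inverse (p x) * (cmod (z x))\<^sup>2) absolutely_integrable_on {c..d}" if "continuous_on I z" for z
    using that by (intro coeff_times_continuous cdI continuous_intros) (rule continuous_on_subset[OF _ cdI])
  have pn: "0 \<le> integral {c..d} (\<lambda>x. inverse (p x) * (cmod (z x))\<^sup>2)" if "continuous_on I z" for z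
    by (rule integral_nonneg_AE[OF pc[OF that]]) (use inverse_p_nonneg[OF cdI] in \<open>auto elim!: eventually_mono\<close>)
  have Ez: "integral {c..d} (\<lambda>x. inverse (p x) * (cmod (qd (u n) x - qd g x))\<^sup>2) \<le> K2" for n
  proof -
    note c = sol_continuous(2)[OF su] sol_continuous(2)[OF sg]
    have "integral {c..d} (\<lambda>x. inverse (p x) * (cmod (qd (u n) x - qd g x))\<^sup>2)
       \<le> integral {c..d} (\<lambda>x. 2 * (inverse (p x) * (cmod (qd (u n) x))\<^sup>2) + 2 * (inverse (p x) * (cmod (qd g x))\<^sup>2))"
    proof (rule integral_mono_AE_Icc)
      show "(\<lambda>x. inverse (p x) * (cmod (qd (u n) x - qd g x))\<^sup>2) absolutely_integrable_on {c..d}"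
        by (rule pc[OF sol_continuous(2)[OF sz]])
      show "(\<lambda>x. 2 * (inverse (p x) * (cmod (qd (u n) x))\<^sup>2) + 2 * (inverse (p x) * (cmod (qd g x))\<^sup>2)) absolutely_integrable_on {c..d}"
        by (intro set_integral_add(1) set_integrable_mult_right pc c)
      have *: "P * (cmod (y - z))\<^sup>2 \<le> 2 * (P * (cmod y)\<^sup>2) + 2 * (P * (cmod z)\<^sup>2)" if "P \<ge> 0" for P y z
      proof -
        have "(cmod (y - z))\<^sup>2 \<le> 2 * (cmod y)\<^sup>2 + 2 * (cmod z)\<^sup>2"
          using power_mono[OF norm_triangle_ineq4[of y z] norm_ge_zero, of 2] sum_squares_bound[of "cmod y" "cmod z"]
          by (simp add: power2_sum)
        from mult_left_mono[OF this that] show ?thesis by (simp add: distrib_left)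
      qed
      show "AE x\<in>{c..d} in lebesgue. inverse (p x) * (cmod (qd (u n) x - qd g x))\<^sup>2
         \<le> 2 * (inverse (p x) * (cmod (qd (u n) x))\<^sup>2) + 2 * (inverse (p x) * (cmod (qd g x))\<^sup>2)"
        using inverse_p_nonneg[OF cdI] by eventually_elim (blast intro: *)
    qed
    also have "\<dots> = 2 * integral {c..d} (\<lambda>x. inverse (p x) * (cmod (qd (u n) x))\<^sup>2) + 2 * Eg"
      unfolding Eg_def using absolutely_integrable_imp_integrable[OF pc[OF c(1)[of n]]] absolutely_integrable_imp_integrable[OF pc[OF c(2)]]
      by (subst Henstock_Kurzweil_Integration.integral_add) auto
    also have "integral {c..d} (\<lambda>x. inverse (p x) * (cmod (qd (u n) x))\<^sup>2) \<le> K * Bd\<^sup>2"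
      by (rule order_trans[OF K(2)[OF uD] mult_left_mono[OF power_mono[OF Bd(2) F.sn_nonneg[OF uD]] K(1)]])
    finally show ?thesis by (simp add: K2_def)
  qed
  have K2: "K2 \<ge> 0" using pn[OF sol_continuous(2)[OF sg]] K(1) by (simp add: K2_def Eg_def)
  have nz: "L2_norm M (\<lambda>x. u n x - g x) = L2_norm M (\<lambda>x. u n x - f x)" for n
    by (rule L2_norm_cong_AE[OF L2_diff[OF F.D_L2[OF uD] gL] L2_diff[OF F.D_L2[OF uD] fL]])
      (use g(2) in \<open>auto simp: M_AE elim!: eventually_mono\<close>)
  show ?thesis
  proof (rule LIMSEQ_I)
    fix \<epsilon> :: real assume eps: "\<epsilon> > 0"
    define e where "e = \<epsilon>\<^sup>2 / (2 * (K2 + 1))"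
    have e: "e > 0" using eps K2 by (simp add: e_def)
    obtain C where C: "C \<ge> 0" "\<And>u u1 h x. sol u u1 h \<Longrightarrow> x \<in> {c..d} \<Longrightarrow>
      (cmod (u x))\<^sup>2 \<le> e * integral {c..d} (\<lambda>x. inverse (p x) * (cmod (u1 x))\<^sup>2) + C * integral {c..d} (\<lambda>x. r x * (cmod (u x))\<^sup>2)"
      by (rule sobolev[OF cd(3) cdI e]) blast
    have l2: "(\<lambda>n. (L2_norm M (\<lambda>x. u n x - f x))\<^sup>2) \<longlonglongrightarrow> 0" using tendsto_power[OF lim, of 2] by simp
    have "\<epsilon>\<^sup>2 / (2 * (C + 1)) > 0" using eps C(1) by simp
    from LIMSEQ_D[OF l2 this] obtain N where N: "\<And>n. n \<ge> N \<Longrightarrow> (L2_norm M (\<lambda>x. u n x - f x))\<^sup>2 < \<epsilon>\<^sup>2 / (2 * (C + 1))"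
      by auto
    have "norm (u n t - g t) < \<epsilon>" if n: "n \<ge> N" for n
    proof (rule power2_less_imp_less)
      have "(cmod (u n t - g t))\<^sup>2 \<le> e * K2 + C * (L2_norm M (\<lambda>x. u n x - f x))\<^sup>2"
        using C(2)[OF sz[of n] cd(4)] mult_left_mono[OF Ez[of n], of e] e
          mult_left_mono[OF local_norm_le[OF L2_diff[OF F.D_L2[OF uD[of n]] gL] cdI, unfolded nz] C(1)] by linarith
      moreover have "e * K2 < \<epsilon>\<^sup>2 / 2" using K2 eps by (simp add: e_def field_simps)
      moreover have "C * (L2_norm M (\<lambda>x. u n x - f x))\<^sup>2 \<le> \<epsilon>\<^sup>2 / 2"
      proof -
        have "C * (L2_norm M (\<lambda>x. u n x - f x))\<^sup>2 \<le> (C + 1) * (\<epsilon>\<^sup>2 / (2 * (C + 1)))"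
          using N[OF n] C(1) by (intro mult_mono) auto
        also have "\<dots> = \<epsilon>\<^sup>2 / 2" using C(1) by (simp add: field_simps)
        finally show ?thesis .
      qed
      ultimately show "(norm (u n t - g t))\<^sup>2 < \<epsilon>\<^sup>2" by linarith
    qed (use eps in simp)
    then show "\<exists>no. \<forall>n\<ge>no. norm (u n t - g t) < \<epsilon>" by blast
  qed
qed

end

context sl_jacobi
begin

text \<open>The derivative of |w/g|^2 is 2 \<omega> \<open>bf\<close>. For \<delta> > 0 the boundary
  form therefore forces growth at least like the integral of \<omega>, to the right in the first
  case and to the left in the second.\<close>

lemma bf_bound_growth:
  assumes w: "sol w w1 h" and xy: "x \<le> y" "{x..y} \<subseteq> J"
  shows "(\<And>t. t \<in> {x..y} \<Longrightarrow> \<delta> \<le> bf w w1 t) \<Longrightarrow>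
      (cmod (w x / of_real (g x)))\<^sup>2 + 2 * \<delta> * integral {x..y} \<omega> \<le> (cmod (w y / of_real (g y)))\<^sup>2"
    and "(\<And>t. t \<in> {x..y} \<Longrightarrow> bf w w1 t \<le> - \<delta>) \<Longrightarrow>
      (cmod (w y / of_real (g y)))\<^sup>2 + 2 * \<delta> * integral {x..y} \<omega> \<le> (cmod (w x / of_real (g x)))\<^sup>2"
proof -
  note D = quotient_sq_diff[OF w xy]
  note om = V_sq_integrable(5)[OF w xy(2)]
  {
    assume a: "\<And>t. t \<in> {x..y} \<Longrightarrow> \<delta> \<le> bf w w1 t"
    have "integral {x..y} (\<lambda>t. \<omega> t * \<delta>) \<le> integral {x..y} (\<lambda>t. \<omega> t * bf w w1 t)"
      by (rule integral_mono_AE_Icc[OF set_integrable_mult_left[OF om] D(1)])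
        (use en_ge(4)[OF xy(2)] a in \<open>auto elim!: eventually_mono intro!: mult_left_mono\<close>)
    then show "(cmod (w x / of_real (g x)))\<^sup>2 + 2 * \<delta> * integral {x..y} \<omega> \<le> (cmod (w y / of_real (g y)))\<^sup>2"
      using D(2) by (simp add: algebra_simps)
  next
    assume a: "\<And>t. t \<in> {x..y} \<Longrightarrow> bf w w1 t \<le> - \<delta>"
    have "integral {x..y} (\<lambda>t. \<omega> t * bf w w1 t) \<le> integral {x..y} (\<lambda>t. \<omega> t * (- \<delta>))"
    proof (rule integral_mono_AE_Icc[OF D(1) set_integrable_mult_left[OF om]])
      show "AE t\<in>{x..y} in lebesgue. \<omega> t * bf w w1 t \<le> \<omega> t * (- \<delta>)"
        using en_ge(4)[OF xy(2)]
      proof eventually_elim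
        case (elim t)
        then show ?case using a[of t] mult_left_mono[of "bf w w1 t" "- \<delta>" "\<omega> t"] by blast
      qed
    qed
    then show "(cmod (w y / of_real (g y)))\<^sup>2 + 2 * \<delta> * integral {x..y} \<omega> \<le> (cmod (w x / of_real (g x)))\<^sup>2"
      using D(2) by (simp add: algebra_simps)
  }
qed

lemma quotient_diff_le_energy:
  assumes w: "sol w w1 h" and xy: "x \<le> y" "{x..y} \<subseteq> J"
  shows "(cmod (w y / of_real (g y) - w x / of_real (g x)))\<^sup>2 \<le> integral {x..y} \<omega> * integral {x..y} (en w w1)"
  by (rule order_trans[OF quotient_diff_le[OF w xy] mult_left_mono[OF integral_mono_AE_Icc[OF V_sq_integrable(1)[OF w xy(2)]
    V_sq_integrable(4)[OF w xy(2)] en_ge(1)[OF xy(2)]] integral_nonneg_AE[OF V_sq_integrable(5)[OF w xy(2)] en_ge(4)[OF xy(2)]]]])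

lemma omega_integrable: "{x..y} \<subseteq> J \<Longrightarrow> \<omega> absolutely_integrable_on {x..y}"
  using scaled_integrable(1)[of x y "\<lambda>_. 1::real"] by simp

end

lemma einterval_extend:
  assumes "x \<in> einterval a b"
  obtains y z where "y \<in> einterval a b" "y < x" "z \<in> einterval a b" "x < z"
proof -
  obtain e where "e > 0" "ball x e \<subseteq> einterval a b"
    using open_contains_ball[of "einterval a b"] assms by auto
  then have "x - e / 2 \<in> einterval a b" "x - e / 2 < x" "x + e / 2 \<in> einterval a b" "x < x + e / 2"
    by (auto simp: dist_real_def subset_iff)
  then show ?thesis by (rule that)
qed

context sl_friedrichs
begin

text \<open>This and the next three notions replace extended-real endpoints and filters by real
  intervals ending at c1 or starting at d1. The translations are \<open>finite_int_left_iff\<close>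
  and \<open>vanish_left_iff\<close> with their right-hand counterparts.\<close>

definition bounded_left :: "(real \<Rightarrow> real) \<Rightarrow> bool" where
  "bounded_left F \<longleftrightarrow> (\<exists>K. \<forall>x\<in>I. x \<le> c1 \<longrightarrow> integral {x..c1} F \<le> K)"
definition bounded_right :: "(real \<Rightarrow> real) \<Rightarrow> bool" where
  "bounded_right F \<longleftrightarrow> (\<exists>K. \<forall>y\<in>I. d1 \<le> y \<longrightarrow> integral {d1..y} F \<le> K)"
definition vanish_left :: "(real \<Rightarrow> complex) \<Rightarrow> bool" where
  "vanish_left u \<longleftrightarrow> (\<forall>\<epsilon>>0. \<exists>y\<in>I. y \<le> c1 \<and> (\<forall>x\<in>I. x \<le> y \<longrightarrow> cmod (u x / of_real (ga x)) \<le> \<epsilon>))"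
definition vanish_right :: "(real \<Rightarrow> complex) \<Rightarrow> bool" where
  "vanish_right u \<longleftrightarrow> (\<forall>\<epsilon>>0. \<exists>y\<in>I. d1 \<le> y \<and> (\<forall>x\<in>I. y \<le> x \<longrightarrow> cmod (u x / of_real (gb x)) \<le> \<epsilon>))"

text \<open>Choose y such that the integral over {y..c1} comes within \<epsilon> of the supremum;
  whatever lies further left can then add at most \<epsilon>.\<close>

lemma tail_left:
  assumes F: "\<And>x. x \<in> I \<Longrightarrow> x \<le> c1 \<Longrightarrow> F absolutely_integrable_on {x..c1}" and bd: "bounded_left F" and eps: "\<epsilon> > 0"
  obtains y where "y \<in> I" "y \<le> c1" "\<And>x. x \<in> I \<Longrightarrow> x \<le> y \<Longrightarrow> integral {x..y} F \<le> \<epsilon>"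
proof -
  define X where "X = (\<lambda>x. integral {x..c1} F) ` {x \<in> I. x \<le> c1}"
  have ne: "X \<noteq> {}" using c1_I by (auto simp: X_def)
  have bdd: "bdd_above X" using bd by (auto simp: X_def bounded_left_def bdd_above_def)
  have "Sup X - \<epsilon> < Sup X" using eps by simp
  from less_cSupD[OF ne this] obtain v where v: "v \<in> X" "Sup X - \<epsilon> < v" by blast
  then obtain y where y: "y \<in> I" "y \<le> c1" "Sup X - \<epsilon> < integral {y..c1} F"
    unfolding X_def by blast
  show ?thesis
  proof (rule that[OF y(1,2)])
    fix x assume x: "x \<in> I" "x \<le> y"
    have xc: "x \<le> c1" using x y by simp
    have "integral {x..y} F + integral {y..c1} F = integral {x..c1} F"
      by (rule integral_combine_Icc[OF x(2) y(2) absolutely_integrable_imp_integrable[OF F[OF x(1) xc]]])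
    moreover have "integral {x..c1} F \<le> Sup X" by (rule cSup_upper[OF _ bdd]) (use x xc in \<open>auto simp: X_def\<close>)
    ultimately show "integral {x..y} F \<le> \<epsilon>" using y(3) by linarith
  qed
qed

lemma tail_right:
  assumes F: "\<And>y. y \<in> I \<Longrightarrow> d1 \<le> y \<Longrightarrow> F absolutely_integrable_on {d1..y}" and bd: "bounded_right F" and eps: "\<epsilon> > 0"
  obtains y where "y \<in> I" "d1 \<le> y" "\<And>x. x \<in> I \<Longrightarrow> y \<le> x \<Longrightarrow> integral {y..x} F \<le> \<epsilon>"
proof -
  define X where "X = (\<lambda>y. integral {d1..y} F) ` {y \<in> I. d1 \<le> y}"
  have ne: "X \<noteq> {}" using d1_I by (auto simp: X_def)
  have bdd: "bdd_above X" using bd by (auto simp: X_def bounded_right_def bdd_above_def)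
  have "Sup X - \<epsilon> < Sup X" using eps by simp
  from less_cSupD[OF ne this] obtain v where v: "v \<in> X" "Sup X - \<epsilon> < v" by blast
  then obtain y where y: "y \<in> I" "d1 \<le> y" "Sup X - \<epsilon> < integral {d1..y} F"
    unfolding X_def by blast
  show ?thesis
  proof (rule that[OF y(1,2)])
    fix x assume x: "x \<in> I" "y \<le> x"
    have xc: "d1 \<le> x" using x y by simp
    have "integral {d1..y} F + integral {y..x} F = integral {d1..x} F"
      by (rule integral_combine_Icc[OF y(2) x(2) absolutely_integrable_imp_integrable[OF F[OF x(1) xc]]])
    moreover have "integral {d1..x} F \<le> Sup X" by (rule cSup_upper[OF _ bdd]) (use x xc in \<open>auto simp: X_def\<close>)
    ultimately show "integral {y..x} F \<le> \<epsilon>" using y(3) by linarith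
  qed
qed

lemma vanish_left_iff: "vanish_left u \<longleftrightarrow> (((\<lambda>x. u x / of_real (ga x)) \<circ> real_of_ereal) \<longlongrightarrow> 0) (at_right a)"
proof -
  have ac: "a < ereal c1" "ereal c1 < b" using c1_I by (auto simp: einterval_def)
  show ?thesis
    unfolding tendsto_iff eventually_at_right[OF ac(1)]
  proof (intro iffI allI impI)
    fix e :: real assume v: "vanish_left u" and e: "e > 0"
    then have "e / 2 > 0" by simp
    then obtain y where y: "y \<in> I" "y \<le> c1" "\<And>x. x \<in> I \<Longrightarrow> x \<le> y \<Longrightarrow> cmod (u x / of_real (ga x)) \<le> e / 2"
      using v unfolding vanish_left_def by blast
    have "dist (((\<lambda>x. u x / of_real (ga x)) \<circ> real_of_ereal) z) 0 < e" if z: "a < z" "z < ereal y" for z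
    proof -
      obtain x where x: "z = ereal x" using z by (cases z) auto
      have "x \<in> I" "x \<le> y" using z y(1) less_trans[of "ereal x" "ereal y" b] by (auto simp: x einterval_def)
      from y(3)[OF this] e show ?thesis by (simp add: x)
    qed
    then show "\<exists>b>a. \<forall>z>a. z < b \<longrightarrow> dist (((\<lambda>x. u x / of_real (ga x)) \<circ> real_of_ereal) z) 0 < e"
      using y(1) by (intro exI[of _ "ereal y"]) (auto simp: einterval_def)
  next
    assume H: "\<forall>e>0. \<exists>b>a. \<forall>z>a. z < b \<longrightarrow> dist (((\<lambda>x. u x / of_real (ga x)) \<circ> real_of_ereal) z) 0 < e"
    show "vanish_left u"
      unfolding vanish_left_def
    proof (intro allI impI)
      fix e :: real assume "e > 0"
      then obtain b' where b': "b' > a" "\<And>z. a < z \<Longrightarrow> z < b' \<Longrightarrow> dist (((\<lambda>x. u x / of_real (ga x)) \<circ> real_of_ereal) z) 0 < e"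
        using H by blast
      obtain y where y: "a < ereal y" "ereal y < min b' (ereal c1)" using ereal_dense2[of a "min b' (ereal c1)"] b'(1) ac(1) by auto
      have yI: "y \<in> I" "y \<le> c1" using y ac(2) less_trans[of "ereal y" "ereal c1" b] by (auto simp: einterval_def)
      have "cmod (u x / of_real (ga x)) \<le> e" if x: "x \<in> I" "x \<le> y" for x
      proof -
        have "ereal x < b'" using x(2) y(2) le_less_trans[of "ereal x" "ereal y" b'] by simp
        from b'(2)[OF _ this] x(1) show ?thesis by (simp add: einterval_def)
      qed
      then show "\<exists>y\<in>I. y \<le> c1 \<and> (\<forall>x\<in>I. x \<le> y \<longrightarrow> cmod (u x / of_real (ga x)) \<le> e)" using yI by blast
    qed
  qed
qed

lemma vanish_left_diff: "vanish_left u \<Longrightarrow> vanish_left v \<Longrightarrow> vanish_left (\<lambda>x. u x - v x)"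
  unfolding vanish_left_iff by (drule (1) tendsto_diff) (simp add: o_def diff_divide_distrib)

lemma vanish_right_iff: "vanish_right u \<longleftrightarrow> (((\<lambda>x. u x / of_real (gb x)) \<circ> real_of_ereal) \<longlongrightarrow> 0) (at_left b)"
proof -
  have db: "ereal d1 < b" "a < ereal d1" using d1_I by (auto simp: einterval_def)
  show ?thesis
    unfolding tendsto_iff eventually_at_left[OF db(1)]
  proof (intro iffI allI impI)
    fix e :: real assume v: "vanish_right u" and e: "e > 0"
    then have "e / 2 > 0" by simp
    then obtain y where y: "y \<in> I" "d1 \<le> y" "\<And>x. x \<in> I \<Longrightarrow> y \<le> x \<Longrightarrow> cmod (u x / of_real (gb x)) \<le> e / 2"
      using v unfolding vanish_right_def by blast
    have "dist (((\<lambda>x. u x / of_real (gb x)) \<circ> real_of_ereal) z) 0 < e" if z: "ereal y < z" "z < b" for z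
    proof -
      obtain x where x: "z = ereal x" using z by (cases z) auto
      have "x \<in> I" "y \<le> x" using z y(1) less_trans[of a "ereal y" "ereal x"] by (auto simp: x einterval_def)
      from y(3)[OF this] e show ?thesis by (simp add: x)
    qed
    then show "\<exists>a'<b. \<forall>z>a'. z < b \<longrightarrow> dist (((\<lambda>x. u x / of_real (gb x)) \<circ> real_of_ereal) z) 0 < e"
      using y(1) by (intro exI[of _ "ereal y"]) (auto simp: einterval_def)
  next
    assume H: "\<forall>e>0. \<exists>a'<b. \<forall>z>a'. z < b \<longrightarrow> dist (((\<lambda>x. u x / of_real (gb x)) \<circ> real_of_ereal) z) 0 < e"
    show "vanish_right u"
      unfolding vanish_right_def
    proof (intro allI impI)
      fix e :: real assume "e > 0"
      then obtain a' where a': "a' < b" "\<And>z. a' < z \<Longrightarrow> z < b \<Longrightarrow> dist (((\<lambda>x. u x / of_real (gb x)) \<circ> real_of_ereal) z) 0 < e"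
        using H by blast
      obtain y where y: "max a' (ereal d1) < ereal y" "ereal y < b" using ereal_dense2[of "max a' (ereal d1)" b] a'(1) db(1) by auto
      have yI: "y \<in> I" "d1 \<le> y" using y db(2) less_trans[of a "ereal d1" "ereal y"] by (auto simp: einterval_def)
      have "cmod (u x / of_real (gb x)) \<le> e" if x: "x \<in> I" "y \<le> x" for x
      proof -
        have "a' < ereal x" using x(2) y(1) less_le_trans[of a' "ereal y" "ereal x"] by simp
        from a'(2)[OF this] x(1) show ?thesis by (simp add: einterval_def)
      qed
      then show "\<exists>y\<in>I. d1 \<le> y \<and> (\<forall>x\<in>I. y \<le> x \<longrightarrow> cmod (u x / of_real (gb x)) \<le> e)" using yI by blast
    qed
  qed
qed

lemma vanish_right_diff: "vanish_right u \<Longrightarrow> vanish_right v \<Longrightarrow> vanish_right (\<lambda>x. u x - v x)"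
  unfolding vanish_right_iff by (drule (1) tendsto_diff) (simp add: o_def diff_divide_distrib)

text \<open>The element is a weak solution by \<open>T0_adjoint\<close> and inherits the energy
  bound of its approximating sequence by \<open>energy_limit\<close>. For the vanishing of the
  quotient: each \<open>u n\<close> is zero close to the endpoint, so |u n / g|^2 at x is at most
  the tail integral of \<omega> times the common energy bound. This is uniform in n and survives the
  pointwise limit.\<close>

lemma friedrichs_behaviour:
  assumes fh: "(f, h) \<in> friedrichs_ext M T0 \<tau>"
  obtains g where "g \<in> Tmax" "AE x\<in>I in lebesgue. f x = g x" "AE x\<in>I in lebesgue. h x = \<tau> g x"
    "bounded_left (A.en g (qd g))" "bounded_right (B.en g (qd g))"
    "bounded_left A.\<omega> \<Longrightarrow> vanish_left g" "bounded_right B.\<omega> \<Longrightarrow> vanish_right g"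
proof -
  note FD = F.friedrichs_extD[OF fh]
  obtain u where u: "form_conv M T0 F.t u f" using FD(3) by blast
  obtain g where g: "g \<in> Tmax" "AE x\<in>I in lebesgue. f x = g x" "AE x\<in>I in lebesgue. h x = \<tau> g x"
    by (rule T0_adjoint[OF FD(1,2,4)]) blast
  have uD: "u n \<in> T0" for n using u by (simp add: form_conv_def)
  have su: "sol (u n) (qd (u n)) (\<tau> (u n))" for n using uD dom_T0_subset dom_Tmax_sol by blast
  note sg = dom_Tmax_sol[OF g(1)]
  note lim = form_limit_pointwise[OF u g(1,2)]
  obtain Bd where Bd: "Bd > 0" "\<And>n. F.sn (u n) \<le> Bd" by (rule F.form_Cauchy_bounded[OF F.form_conv_Cauchy[OF u]]) blast
  have Bd2: "(F.sn (u n))\<^sup>2 \<le> Bd\<^sup>2" for n by (rule power_mono[OF Bd(2) F.sn_nonneg[OF uD]])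
  obtain K where K: "K \<ge> 0"
    "\<And>u x. u \<in> T0 \<Longrightarrow> x \<in> I \<Longrightarrow> x \<le> c1 \<Longrightarrow> integral {x..c1} (A.en u (qd u)) \<le> K * (F.sn u)\<^sup>2"
    "\<And>u y. u \<in> T0 \<Longrightarrow> y \<in> I \<Longrightarrow> d1 \<le> y \<Longrightarrow> integral {d1..y} (B.en u (qd u)) \<le> K * (F.sn u)\<^sup>2"
    by (rule T0_bounds[OF c1 d1 c1_d1]) blast
  define K' where "K' = K * Bd\<^sup>2"
  have K': "K' \<ge> 0" using K(1) by (simp add: K'_def)
  have KA: "integral {x..c1} (A.en (u n) (qd (u n))) \<le> K'" if "x \<in> I" "x \<le> c1" for x n
    unfolding K'_def by (rule order_trans[OF K(2)[OF uD that] mult_left_mono[OF Bd2 K(1)]])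
  have KB: "integral {d1..y} (B.en (u n) (qd (u n))) \<le> K'" if "y \<in> I" "d1 \<le> y" for y n
    unfolding K'_def by (rule order_trans[OF K(3)[OF uD that] mult_left_mono[OF Bd2 K(1)]])
  have unif: "\<exists>C. \<forall>n. \<forall>t\<in>{x..y}. cmod (u n t) \<le> C" if xy: "x \<in> I" "y \<in> I" for x y
  proof -
    obtain c d where cd: "c \<in> A.J" "d \<in> B.J" "c < d" "x \<in> {c..d}" "y \<in> {c..d}" by (rule cover_point[OF xy]) blast
    obtain L where L: "L \<ge> 0" "\<And>u t. u \<in> T0 \<Longrightarrow> t \<in> {c..d} \<Longrightarrow> (cmod (u t))\<^sup>2 \<le> L * (F.sn u)\<^sup>2"
      by (rule T0_bounds[OF cd(1-3)]) blast
    have "cmod (u n t) \<le> sqrt (L * Bd\<^sup>2)" if "t \<in> {x..y}" for n t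
      by (rule real_le_rsqrt, rule order_trans[OF L(2)[OF uD] mult_left_mono[OF Bd2 L(1)]]) (use that cd in auto)
    then show ?thesis by blast
  qed
  have bA: "bounded_left (A.en g (qd g))"
    unfolding bounded_left_def
  proof (intro exI[of _ "2 * K'"] ballI impI)
    fix x assume x: "x \<in> I" "x \<le> c1"
    obtain C where C: "\<And>n t. t \<in> {x..c1} \<Longrightarrow> cmod (u n t) \<le> C" using unif[OF x(1) c1_I] by blast
    show "integral {x..c1} (A.en g (qd g)) \<le> 2 * K'"
      by (rule A.energy_limit[OF sg su x(2) left_sub[OF c1 x] lim C KA[OF x]])
        (use left_sub[OF c1 x] A.J_sub in auto)
  qed
  have bB: "bounded_right (B.en g (qd g))"
    unfolding bounded_right_def
  proof (intro exI[of _ "2 * K'"] ballI impI)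
    fix y assume y: "y \<in> I" "d1 \<le> y"
    obtain C where C: "\<And>n t. t \<in> {d1..y} \<Longrightarrow> cmod (u n t) \<le> C" using unif[OF d1_I y(1)] by blast
    show "integral {d1..y} (B.en g (qd g)) \<le> 2 * K'"
      by (rule B.energy_limit[OF sg su y(2) right_sub[OF d1 y] lim C KB[OF y]])
        (use right_sub[OF d1 y] B.J_sub in auto)
  qed
  \<comment> \<open>K'/(K'+1) is at most 1; the + 1 avoids a division by zero when K' = 0.\<close>
  have small: "z \<le> \<epsilon>" if "z\<^sup>2 \<le> \<epsilon>\<^sup>2 / (K' + 1) * K'" "\<epsilon> > 0" for z \<epsilon> :: real
  proof (rule power2_le_imp_le)
    have "\<epsilon>\<^sup>2 / (K' + 1) * K' \<le> \<epsilon>\<^sup>2" using K' by (simp add: field_simps)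
    then show "z\<^sup>2 \<le> \<epsilon>\<^sup>2" using that(1) by linarith
  qed (use that in simp)
  have vA: "vanish_left g" if om: "bounded_left A.\<omega>"
    unfolding vanish_left_def
  proof (intro allI impI)
    fix \<epsilon> :: real assume eps: "\<epsilon> > 0"
    then have e: "\<epsilon>\<^sup>2 / (K' + 1) > 0" using K' by simp
    obtain y where y: "y \<in> I" "y \<le> c1" "\<And>x. x \<in> I \<Longrightarrow> x \<le> y \<Longrightarrow> integral {x..y} A.\<omega> \<le> \<epsilon>\<^sup>2 / (K' + 1)"
      by (rule tail_left[OF A.omega_integrable[OF left_sub[OF c1]] om e]; blast)
    have "cmod (g x / of_real (ga x)) \<le> \<epsilon>" if x: "x \<in> I" "x \<le> y" for x
    proof -
      have "cmod (u n x / of_real (ga x)) \<le> \<epsilon>" for n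
      proof (rule small[OF _ eps])
        obtain x' d' where x': "x' < x" "x' < d'" "x < d'" "{x'..d'} \<subseteq> I"
          and z: "\<And>t. t \<in> I \<Longrightarrow> t \<notin> {x'<..<d'} \<Longrightarrow> u n t = 0 \<and> qd (u n) t = 0 \<and> \<tau> (u n) t = 0"
          by (rule dom_T0_support[OF uD[of n] x(1) x(1)]) blast
        have x'I: "x' \<in> I" using x' by auto
        have z0: "u n x' = 0" using z[OF x'I] by auto
        have x'c: "x' \<le> c1" and xc: "x \<le> c1" using x' x y(2) by auto
        note L = left_sub[OF c1 x'I x'c]
        have sub: "{x'..x} \<subseteq> {x'..c1}" using xc by auto
        have subJ: "{x'..x} \<subseteq> A.J" using sub L by blast
        have "(cmod (u n x / of_real (ga x)))\<^sup>2 = (cmod (u n x / of_real (ga x) - u n x' / of_real (ga x')))\<^sup>2"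
          by (simp add: z0)
        also have "\<dots> \<le> integral {x'..x} A.\<omega> * integral {x'..x} (A.en (u n) (qd (u n)))"
          by (rule A.quotient_diff_le_energy[OF su less_imp_le[OF x'(1)] subJ])
        also have "\<dots> \<le> \<epsilon>\<^sup>2 / (K' + 1) * K'"
        proof (rule mult_mono)
          have "integral {x'..x} A.\<omega> \<le> integral {x'..y} A.\<omega>"
            by (rule integral_Icc_subset_le_AE[OF A.omega_integrable _ A.en_ge(4)])
              (use L y(2) x in \<open>auto simp: subset_iff\<close>)
          also have "\<dots> \<le> \<epsilon>\<^sup>2 / (K' + 1)" by (rule y(3)[OF x'I]) (use x' x in simp)
          finally show "integral {x'..x} A.\<omega> \<le> \<epsilon>\<^sup>2 / (K' + 1)" .
          have "integral {x'..x} (A.en (u n) (qd (u n))) \<le> integral {x'..c1} (A.en (u n) (qd (u n)))"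
            by (rule integral_Icc_subset_le_AE[OF A.V_sq_integrable(4)[OF su L] sub A.en_ge(3)[OF L]])
          also have "\<dots> \<le> K'" by (rule KA[OF x'I x'c])
          finally show "integral {x'..x} (A.en (u n) (qd (u n))) \<le> K'" .
          show "0 \<le> integral {x'..x} (A.en (u n) (qd (u n)))"
            by (rule integral_nonneg_AE[OF A.V_sq_integrable(4)[OF su subJ] A.en_ge(3)[OF subJ]])
        qed (use e in simp)
        finally show "(cmod (u n x / of_real (ga x)))\<^sup>2 \<le> \<epsilon>\<^sup>2 / (K' + 1) * K'" .
      qed
      moreover have "(\<lambda>n. cmod (u n x / of_real (ga x))) \<longlonglongrightarrow> cmod (g x / of_real (ga x))"
        using A.g_pos[OF left_mem[OF x(1) order_trans[OF x(2) y(2)]]] by (intro tendsto_intros lim[OF x(1)]) simp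
      ultimately show ?thesis by (intro LIMSEQ_le_const2) auto
    qed
    then show "\<exists>y\<in>I. y \<le> c1 \<and> (\<forall>x\<in>I. x \<le> y \<longrightarrow> cmod (g x / of_real (ga x)) \<le> \<epsilon>)" using y(1,2) by blast
  qed
  have vB: "vanish_right g" if om: "bounded_right B.\<omega>"
    unfolding vanish_right_def
  proof (intro allI impI)
    fix \<epsilon> :: real assume eps: "\<epsilon> > 0"
    then have e: "\<epsilon>\<^sup>2 / (K' + 1) > 0" using K' by simp
    obtain y where y: "y \<in> I" "d1 \<le> y" "\<And>x. x \<in> I \<Longrightarrow> y \<le> x \<Longrightarrow> integral {y..x} B.\<omega> \<le> \<epsilon>\<^sup>2 / (K' + 1)"
      by (rule tail_right[OF B.omega_integrable[OF right_sub[OF d1]] om e]; blast)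
    have "cmod (g x / of_real (gb x)) \<le> \<epsilon>" if x: "x \<in> I" "y \<le> x" for x
    proof -
      have "cmod (u n x / of_real (gb x)) \<le> \<epsilon>" for n
      proof (rule small[OF _ eps])
        obtain c' x' where x': "c' < x" "c' < x'" "x < x'" "{c'..x'} \<subseteq> I"
          and z: "\<And>t. t \<in> I \<Longrightarrow> t \<notin> {c'<..<x'} \<Longrightarrow> u n t = 0 \<and> qd (u n) t = 0 \<and> \<tau> (u n) t = 0"
          by (rule dom_T0_support[OF uD[of n] x(1) x(1)]) blast
        have x'I: "x' \<in> I" using x' by auto
        have z0: "u n x' = 0" using z[OF x'I] by auto
        have x'c: "d1 \<le> x'" and xc: "d1 \<le> x" using x' x y(2) by auto
        note L = right_sub[OF d1 x'I x'c]
        have sub: "{x..x'} \<subseteq> {d1..x'}" using xc by auto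
        have subJ: "{x..x'} \<subseteq> B.J" using sub L by blast
        have "(cmod (u n x / of_real (gb x)))\<^sup>2 = (cmod (u n x' / of_real (gb x') - u n x / of_real (gb x)))\<^sup>2"
          by (simp add: z0)
        also have "\<dots> \<le> integral {x..x'} B.\<omega> * integral {x..x'} (B.en (u n) (qd (u n)))"
          by (rule B.quotient_diff_le_energy[OF su less_imp_le[OF x'(3)] subJ])
        also have "\<dots> \<le> \<epsilon>\<^sup>2 / (K' + 1) * K'"
        proof (rule mult_mono)
          have "integral {x..x'} B.\<omega> \<le> integral {y..x'} B.\<omega>"
            by (rule integral_Icc_subset_le_AE[OF B.omega_integrable _ B.en_ge(4)])
              (use L y(2) x in \<open>auto simp: subset_iff\<close>)
          also have "\<dots> \<le> \<epsilon>\<^sup>2 / (K' + 1)" by (rule y(3)[OF x'I]) (use x' x in simp)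
          finally show "integral {x..x'} B.\<omega> \<le> \<epsilon>\<^sup>2 / (K' + 1)" .
          have "integral {x..x'} (B.en (u n) (qd (u n))) \<le> integral {d1..x'} (B.en (u n) (qd (u n)))"
            by (rule integral_Icc_subset_le_AE[OF B.V_sq_integrable(4)[OF su L] sub B.en_ge(3)[OF L]])
          also have "\<dots> \<le> K'" by (rule KB[OF x'I x'c])
          finally show "integral {x..x'} (B.en (u n) (qd (u n))) \<le> K'" .
          show "0 \<le> integral {x..x'} (B.en (u n) (qd (u n)))"
            by (rule integral_nonneg_AE[OF B.V_sq_integrable(4)[OF su subJ] B.en_ge(3)[OF subJ]])
        qed (use e in simp)
        finally show "(cmod (u n x / of_real (gb x)))\<^sup>2 \<le> \<epsilon>\<^sup>2 / (K' + 1) * K'" .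
      qed
      moreover have "(\<lambda>n. cmod (u n x / of_real (gb x))) \<longlonglongrightarrow> cmod (g x / of_real (gb x))"
        using B.g_pos[OF right_mem[OF x(1) order_trans[OF y(2) x(2)]]] by (intro tendsto_intros lim[OF x(1)]) simp
      ultimately show ?thesis by (intro LIMSEQ_le_const2) auto
    qed
    then show "\<exists>y\<in>I. d1 \<le> y \<and> (\<forall>x\<in>I. y \<le> x \<longrightarrow> cmod (g x / of_real (gb x)) \<le> \<epsilon>)" using y(1,2) by blast
  qed
  show ?thesis by (rule that[OF g bA bB vA vB])
qed

end

section \<open>Uniqueness: the kernel of \<tau> - \<gamma> + 1 under the boundary conditions\<close>

context sl_problem
begin

lemma sol_cong_AE:
  assumes w: "sol w w1 h" and eq: "AE x\<in>I in lebesgue. h x = h' x"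
  shows "sol w w1 h'"
proof -
  have "primitive_on a b w1 (\<lambda>x. s x *\<^sub>R w1 x + q x *\<^sub>R w x - r x *\<^sub>R h' x)"
    using w unfolding sol_def by (elim conjE primitive_on_cong_AE) (use eq in \<open>auto elim!: eventually_mono\<close>)
  then show ?thesis using w by (simp add: sol_def)
qed

end

context sl_friedrichs
begin

text \<open>Towards \<open>a\<close>, |w/ga|^2 stays above 2 \<delta> times the integral of \<omega>
  over a fixed interval. That integral is positive, which excludes convergence to 0.\<close>

lemma kernel_left_contradiction:
  assumes w: "sol w w1 h" and v: "vanish_left w" and x0: "x0 \<in> I" "x0 \<le> c1" and \<delta>: "\<delta> > 0"
    and bf: "\<And>x. x \<in> I \<Longrightarrow> x \<le> x0 \<Longrightarrow> A.bf w w1 x \<le> - \<delta>"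
  shows False
proof -
  let ?v = "\<lambda>x. cmod (w x / of_real (ga x))"
  obtain x1 where x1: "x1 \<in> I" "x1 < x0" using einterval_extend[OF x0(1)] by blast
  have sub: "{x..x0} \<subseteq> A.J" if "x \<in> I" "x \<le> x0" for x using left_sub[OF left_mem[OF x0] that] .
  have J1: "{x1..x0} \<subseteq> A.J" by (rule sub) (use x1 in auto)
  define \<eta> where "\<eta> = integral {x1..x0} A.\<omega>"
  have \<eta>: "\<eta> > 0" unfolding \<eta>_def by (rule integral_Icc_pos_AE[OF A.omega_integrable[OF J1] x1(2) A.en_ge(5)[OF J1]])
  have low: "2 * \<delta> * \<eta> \<le> (?v x)\<^sup>2" if x: "x \<in> I" "x \<le> x1" for x
  proof -
    have xx: "x \<le> x0" using x x1 by simp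
    note J = sub[OF x(1) xx]
    have "(?v x0)\<^sup>2 + 2 * \<delta> * integral {x..x0} A.\<omega> \<le> (?v x)\<^sup>2"
    proof (rule A.bf_bound_growth(2)[OF w xx J])
      show "A.bf w w1 t \<le> - \<delta>" if "t \<in> {x..x0}" for t using bf[of t] that subsetD[OF J that] A.J_sub by auto
    qed
    moreover have "\<eta> \<le> integral {x..x0} A.\<omega>" unfolding \<eta>_def
      by (rule integral_Icc_subset_le_AE[OF A.omega_integrable[OF J] _ A.en_ge(4)[OF J]]) (use x in auto)
    then have "2 * \<delta> * \<eta> \<le> 2 * \<delta> * integral {x..x0} A.\<omega>" using \<delta> by simp
    ultimately show ?thesis using zero_le_power2[of "?v x0"] by linarith
  qed
  have "sqrt (\<delta> * \<eta>) > 0" using \<delta> \<eta> by simp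
  then obtain y where y: "y \<in> I" "\<And>x. x \<in> I \<Longrightarrow> x \<le> y \<Longrightarrow> ?v x \<le> sqrt (\<delta> * \<eta>)"
    using v unfolding vanish_left_def by blast
  have m: "min x1 y \<in> I" using x1 y by (auto simp: min_def)
  have "(?v (min x1 y))\<^sup>2 \<le> (sqrt (\<delta> * \<eta>))\<^sup>2" by (rule power_mono[OF y(2)[OF m]]) auto
  moreover have "\<delta> * \<eta> > 0" using \<delta> \<eta> by simp
  ultimately show False using low[OF m] by simp
qed

text \<open>If w/gb vanishes at b, this is the mirror image of the argument at a. In the other case
  |w/gb|^2 must grow by 2 \<delta> times the integral of \<omega>, while a small tail of the
  Dirichlet integral permits, by Cauchy-Schwarz, only a small multiple of that integral plus a
  constant. So the integral of \<omega> would be bounded.\<close>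

lemma kernel_right_contradiction:
  assumes w: "sol w w1 h" and y0: "y0 \<in> I" "d1 \<le> y0" and \<delta>: "\<delta> > 0"
    and v: "vanish_right w \<or> (bounded_right (\<lambda>x. B.\<omega> x * (cmod (B.V w w1 x))\<^sup>2) \<and> \<not> bounded_right B.\<omega>)"
    and bf: "\<And>x. x \<in> I \<Longrightarrow> y0 \<le> x \<Longrightarrow> \<delta> \<le> B.bf w w1 x"
  shows False
  using v
proof
  let ?v = "\<lambda>x. cmod (w x / of_real (gb x))"
  have sub: "{y0..x} \<subseteq> B.J" if "x \<in> I" "y0 \<le> x" for x using right_sub[OF right_mem[OF y0] that] .
  assume v: "vanish_right w"
  obtain x1 where x1: "x1 \<in> I" "y0 < x1" using einterval_extend[OF y0(1)] by blast
  have J1: "{y0..x1} \<subseteq> B.J" by (rule sub) (use x1 in auto)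
  define \<eta> where "\<eta> = integral {y0..x1} B.\<omega>"
  have \<eta>: "\<eta> > 0" unfolding \<eta>_def by (rule integral_Icc_pos_AE[OF B.omega_integrable[OF J1] x1(2) B.en_ge(5)[OF J1]])
  have low: "2 * \<delta> * \<eta> \<le> (?v x)\<^sup>2" if x: "x \<in> I" "x1 \<le> x" for x
  proof -
    have xx: "y0 \<le> x" using x x1 by simp
    note J = sub[OF x(1) xx]
    have "(?v y0)\<^sup>2 + 2 * \<delta> * integral {y0..x} B.\<omega> \<le> (?v x)\<^sup>2"
    proof (rule B.bf_bound_growth(1)[OF w xx J])
      show "\<delta> \<le> B.bf w w1 t" if "t \<in> {y0..x}" for t using bf[of t] that subsetD[OF J that] B.J_sub by auto
    qed
    moreover have "\<eta> \<le> integral {y0..x} B.\<omega>" unfolding \<eta>_def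
      by (rule integral_Icc_subset_le_AE[OF B.omega_integrable[OF J] _ B.en_ge(4)[OF J]]) (use x in auto)
    then have "2 * \<delta> * \<eta> \<le> 2 * \<delta> * integral {y0..x} B.\<omega>" using \<delta> by simp
    ultimately show ?thesis using zero_le_power2[of "?v y0"] by linarith
  qed
  have "sqrt (\<delta> * \<eta>) > 0" using \<delta> \<eta> by simp
  then obtain y where y: "y \<in> I" "\<And>x. x \<in> I \<Longrightarrow> y \<le> x \<Longrightarrow> ?v x \<le> sqrt (\<delta> * \<eta>)"
    using v unfolding vanish_right_def by blast
  have m: "max x1 y \<in> I" using x1 y by (auto simp: max_def)
  have "(?v (max x1 y))\<^sup>2 \<le> (sqrt (\<delta> * \<eta>))\<^sup>2" by (rule power_mono[OF y(2)[OF m]]) auto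
  moreover have "\<delta> * \<eta> > 0" using \<delta> \<eta> by simp
  ultimately show False using low[OF m] by simp
next
  let ?v = "\<lambda>x. cmod (w x / of_real (gb x))"
  let ?F = "\<lambda>x. B.\<omega> x * (cmod (B.V w w1 x))\<^sup>2"
  assume "bounded_right ?F \<and> \<not> bounded_right B.\<omega>"
  then have fin: "bounded_right ?F" and inf: "\<not> bounded_right B.\<omega>" by auto
  \<comment> \<open>With a Dirichlet tail of at most \<delta>/8, the growth 2 \<delta> O is bounded
    by \<delta> O / 4 plus a constant, where O is the integral of \<omega>; this bounds O.\<close>
  have d8: "\<delta> / 8 > 0" using \<delta> by simp
  obtain d2 where d2: "d2 \<in> I" "d1 \<le> d2" "\<And>x. x \<in> I \<Longrightarrow> d2 \<le> x \<Longrightarrow> integral {d2..x} ?F \<le> \<delta> / 8"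
    by (rule tail_right[OF B.V_sq_integrable(1)[OF w right_sub[OF d1]] fin d8]; blast)
  define z where "z = max d2 y0"
  have z: "z \<in> I" "d1 \<le> z" "d2 \<le> z" "y0 \<le> z" using d2 y0 by (auto simp: z_def max_def)
  have bound: "integral {z..y} B.\<omega> \<le> 2 * (?v z)\<^sup>2 / \<delta>" if y: "y \<in> I" "z \<le> y" for y
  proof -
    have J: "{z..y} \<subseteq> B.J" by (rule right_sub[OF right_mem[OF z(1,2)] y])
    have Jd: "{d2..y} \<subseteq> B.J" by (rule right_sub[OF right_mem[OF d2(1,2)] y(1)]) (use z y in simp)
    let ?O = "integral {z..y} B.\<omega>"
    have O: "?O \<ge> 0" by (rule integral_nonneg_AE[OF B.omega_integrable[OF J] B.en_ge(4)[OF J]])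
    have "(?v z)\<^sup>2 + 2 * \<delta> * ?O \<le> (?v y)\<^sup>2"
    proof (rule B.bf_bound_growth(1)[OF w y(2) J])
      show "\<delta> \<le> B.bf w w1 t" if "t \<in> {z..y}" for t using bf[of t] z(4) that subsetD[OF J that] B.J_sub by auto
    qed
    moreover have "(?v y)\<^sup>2 \<le> 2 * (cmod (w y / of_real (gb y) - w z / of_real (gb z)))\<^sup>2 + 2 * (?v z)\<^sup>2"
    proof -
      have "?v y \<le> cmod (w y / of_real (gb y) - w z / of_real (gb z)) + ?v z"
        using norm_triangle_ineq[of "w y / of_real (gb y) - w z / of_real (gb z)" "w z / of_real (gb z)"] by simp
      from power_mono[OF this norm_ge_zero, of 2] show ?thesis
        using sum_squares_bound[of "cmod (w y / of_real (gb y) - w z / of_real (gb z))" "?v z"] by (simp add: power2_sum)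
    qed
    moreover have "(cmod (w y / of_real (gb y) - w z / of_real (gb z)))\<^sup>2 \<le> ?O * (\<delta> / 8)"
    proof (rule order_trans[OF B.quotient_diff_le[OF w y(2) J] mult_left_mono[OF _ O]])
      have "integral {z..y} ?F \<le> integral {d2..y} ?F"
        by (rule integral_Icc_subset_le_AE[OF B.V_sq_integrable(1)[OF w Jd] _ B.en_ge(7)[OF Jd]]) (use z in auto)
      also have "\<dots> \<le> \<delta> / 8" by (rule d2(3)[OF y(1)]) (use z y in simp)
      finally show "integral {z..y} ?F \<le> \<delta> / 8" .
    qed
    ultimately have "2 * \<delta> * ?O \<le> 2 * (?O * (\<delta> / 8)) + (?v z)\<^sup>2" by linarith
    then have "\<delta> * ?O \<le> 2 * (?v z)\<^sup>2" using mult_nonneg_nonneg[OF less_imp_le[OF \<delta>] O] zero_le_power2[of "?v z"]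
      by (simp only: mult.commute[of ?O] mult.assoc times_divide_eq_right times_divide_eq_left)
    then show ?thesis using \<delta> by (simp add: field_simps)
  qed
  have "bounded_right B.\<omega>"
    unfolding bounded_right_def
  proof (intro exI ballI impI)
    fix y assume y: "y \<in> I" "d1 \<le> y"
    define m where "m = max y z"
    have m: "m \<in> I" "d1 \<le> m" "z \<le> m" "y \<le> m" using y z by (auto simp: m_def max_def)
    note J = right_sub[OF d1 m(1,2)]
    have "integral {d1..y} B.\<omega> \<le> integral {d1..m} B.\<omega>"
      by (rule integral_Icc_subset_le_AE[OF B.omega_integrable[OF J] _ B.en_ge(4)[OF J]]) (use m in auto)
    also have "\<dots> = integral {d1..z} B.\<omega> + integral {z..m} B.\<omega>"
      by (rule integral_combine_Icc[symmetric, OF z(2) m(3) absolutely_integrable_imp_integrable[OF B.omega_integrable[OF J]]])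
    also have "\<dots> \<le> integral {d1..z} B.\<omega> + 2 * (?v z)\<^sup>2 / \<delta>" using bound[OF m(1,3)] by simp
    finally show "integral {d1..y} B.\<omega> \<le> integral {d1..z} B.\<omega> + 2 * (?v z)\<^sup>2 / \<delta>" .
  qed
  with inf show False by contradiction
qed

text \<open>If \<open>w \<noteq> 0\<close>, the difference of the boundary forms at the two ends is bounded away from \<open>0\<close>, so one of
  them has a fixed sign near its endpoint.\<close>

lemma kernel_trivial:
  assumes w: "sol w w1 (\<lambda>x. of_real (\<gamma> - 1) * w x)" and left: "vanish_left w"
    and right: "vanish_right w \<or> (bounded_right (\<lambda>x. B.\<omega> x * (cmod (B.V w w1 x))\<^sup>2) \<and> \<not> bounded_right B.\<omega>)"
  shows "AE x\<in>I in lebesgue. w x = 0"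
proof (rule AE_einterval)
  let ?N = "\<lambda>x y. integral {x..y} (\<lambda>t. r t * (cmod (w t))\<^sup>2)"
  have iN: "(\<lambda>t. r t * (cmod (w t))\<^sup>2) absolutely_integrable_on {x..y}" if "{x..y} \<subseteq> I" for x y
    using sol_continuous(1)[OF w] by (intro coeff_times_continuous that continuous_intros) (rule continuous_on_subset[OF _ that])
  have rpos: "AE t\<in>{x..y} in lebesgue. 0 \<le> r t * (cmod (w t))\<^sup>2" if "{x..y} \<subseteq> I" for x y
    using r_pos_Icc[OF that] by eventually_elim auto
  \<comment> \<open>For \<tau> w = (\<gamma> - 1) w the lower bound \<gamma> leaves exactly one copy
    of the integral of r |w|^2 between the two boundary forms; this is the purpose of the shift by
    1.\<close>
  have step: "A.bf w w1 x + ?N x y \<le> B.bf w w1 y" if xy: "x \<in> I" "y \<in> I" "x \<le> c1" "d1 \<le> y" for x y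
  proof -
    have "integral {x..y} (\<lambda>t. r t * Re (cnj (w t) * (of_real (\<gamma> - 1) * w t))) = integral {x..y} (\<lambda>t. (\<gamma> - 1) * (r t * (cmod (w t))\<^sup>2))"
    proof (rule Henstock_Kurzweil_Integration.integral_cong)
      fix t
      have "Re (cnj (w t) * (of_real (\<gamma> - 1) * w t)) = (\<gamma> - 1) * (cmod (w t))\<^sup>2"
        unfolding cmod_power2 by (simp add: power2_eq_square algebra_simps)
      then show "r t * Re (cnj (w t) * (of_real (\<gamma> - 1) * w t)) = (\<gamma> - 1) * (r t * (cmod (w t))\<^sup>2)" by (simp only: mult_ac)
    qed
    then have "integral {x..y} (\<lambda>t. r t * Re (cnj (w t) * (of_real (\<gamma> - 1) * w t))) = (\<gamma> - 1) * ?N x y" by (simp only: integral_mult_right)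
    with lower_form[OF w xy] show ?thesis by (simp add: left_diff_distrib)
  qed
  fix c d :: real assume cd: "c < d" "{c..d} \<subseteq> I"
  define x0 y0 where "x0 = min c c1" and "y0 = max d d1"
  have cdI: "c \<in> I" "d \<in> I" using cd by auto
  have x0: "x0 \<in> I" "x0 \<le> c1" "x0 \<le> c" and y0: "y0 \<in> I" "d1 \<le> y0" "d \<le> y0"
    using c1_I d1_I cdI by (auto simp: x0_def y0_def min_def max_def)
  have sub: "{x0..y0} \<subseteq> I" by (rule Icc_subset_einterval[OF x0(1) y0(1)])
  have "?N x0 y0 = 0"
  proof (rule ccontr)
    assume "?N x0 y0 \<noteq> 0"
    then have pos: "?N x0 y0 > 0" using integral_nonneg_AE[OF iN[OF sub] rpos[OF sub]] by simp
    \<comment> \<open>Half of the gap. Either the left form is at most -\<delta> at all points up to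
      x0, or it exceeds -\<delta> at one of them, and then the right form is at least \<delta> from
      y0 on.\<close>
    define \<delta> where "\<delta> = ?N x0 y0 / 2"
    have \<delta>: "\<delta> > 0" using pos by (simp add: \<delta>_def)
    have both: "A.bf w w1 x + 2 * \<delta> \<le> B.bf w w1 y" if "x \<in> I" "x \<le> x0" "y \<in> I" "y0 \<le> y" for x y
    proof -
      have s: "{x..y} \<subseteq> I" by (rule Icc_subset_einterval[OF that(1,3)])
      have "?N x0 y0 \<le> ?N x y"
        by (rule integral_Icc_subset_le_AE[OF iN[OF s] _ rpos[OF s]]) (use that in auto)
      then show ?thesis using step[of x y] that x0 y0 by (simp add: \<delta>_def)
    qed
    show False
    proof (cases "\<forall>x\<in>I. x \<le> x0 \<longrightarrow> A.bf w w1 x \<le> - \<delta>")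
      case True
      show False by (rule kernel_left_contradiction[OF w left x0(1,2) \<delta>]) (use True in auto)
    next
      case False
      then obtain x where x: "x \<in> I" "x \<le> x0" "- \<delta> < A.bf w w1 x" by auto
      show False
      proof (rule kernel_right_contradiction[OF w y0(1,2) \<delta> right])
        fix y assume "y \<in> I" "y0 \<le> y"
        from both[OF x(1,2) this] x(3) show "\<delta> \<le> B.bf w w1 y" by linarith
      qed
    qed
  qed
  from absolutely_integrable_zero_AE[OF iN[OF sub] rpos[OF sub] this] r_pos_Icc[OF sub]
  show "AE x\<in>{c<..<d} in lebesgue. w x = 0"
    by eventually_elim (use x0 y0 in auto)
qed

text \<open>V is linear in the solution, so |V|^2 of a difference is at most twice the sum of the
  squares; for \<open>z\<close> the energy density serves as a majorant.\<close>

lemma bounded_right_V_diff: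
  assumes w: "sol w w1 h" "sol z z1 k"
    and fin: "bounded_right (\<lambda>x. B.\<omega> x * (cmod (B.V w w1 x))\<^sup>2)" "bounded_right (B.en z z1)"
  shows "bounded_right (\<lambda>x. B.\<omega> x * (cmod (B.V (\<lambda>x. w x - z x) (\<lambda>x. w1 x - z1 x) x))\<^sup>2)"
proof -
  let ?F = "\<lambda>w w1 x. B.\<omega> x * (cmod (B.V w w1 x))\<^sup>2"
  obtain K1 where K1: "\<And>y. y \<in> I \<Longrightarrow> d1 \<le> y \<Longrightarrow> integral {d1..y} (?F w w1) \<le> K1" using fin(1) unfolding bounded_right_def by blast
  obtain K2 where K2: "\<And>y. y \<in> I \<Longrightarrow> d1 \<le> y \<Longrightarrow> integral {d1..y} (B.en z z1) \<le> K2" using fin(2) unfolding bounded_right_def by blast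
  have s: "sol (\<lambda>x. w x - z x) (\<lambda>x. w1 x - z1 x) (\<lambda>x. h x - k x)" using sol_add_scale[OF w, of "-1"] by simp
  have "integral {d1..y} (?F (\<lambda>x. w x - z x) (\<lambda>x. w1 x - z1 x)) \<le> 2 * K1 + 2 * K2" if y: "y \<in> I" "d1 \<le> y" for y
  proof -
    note J = right_sub[OF d1 y]
    note i = B.V_sq_integrable(1)[OF w(1) J] B.V_sq_integrable(4)[OF w(2) J]
    have "integral {d1..y} (?F (\<lambda>x. w x - z x) (\<lambda>x. w1 x - z1 x)) \<le> integral {d1..y} (\<lambda>t. 2 * ?F w w1 t + 2 * B.en z z1 t)"
    proof (rule integral_mono_AE_Icc[OF B.V_sq_integrable(1)[OF s J]])
      show "(\<lambda>t. 2 * ?F w w1 t + 2 * B.en z z1 t) absolutely_integrable_on {d1..y}"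
        by (intro set_integral_add(1) set_integrable_mult_right i)
      show "AE t\<in>{d1..y} in lebesgue. ?F (\<lambda>x. w x - z x) (\<lambda>x. w1 x - z1 x) t \<le> 2 * ?F w w1 t + 2 * B.en z z1 t"
        using B.en_ge(1)[OF J, of z z1] B.en_ge(4)[OF J]
      proof eventually_elim
        case (elim t)
        show ?case
        proof
          assume t: "t \<in> {d1..y}"
          have "B.V (\<lambda>x. w x - z x) (\<lambda>x. w1 x - z1 x) t = B.V w w1 t - B.V z z1 t"
            by (simp add: B.V_def scaleR_diff_right)
          moreover have "(cmod (B.V w w1 t - B.V z z1 t))\<^sup>2 \<le> 2 * (cmod (B.V w w1 t))\<^sup>2 + 2 * (cmod (B.V z z1 t))\<^sup>2"
            using power_mono[OF norm_triangle_ineq4[of "B.V w w1 t" "B.V z z1 t"] norm_ge_zero, of 2]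
              sum_squares_bound[of "cmod (B.V w w1 t)" "cmod (B.V z z1 t)"] by (simp add: power2_sum)
          ultimately have "?F (\<lambda>x. w x - z x) (\<lambda>x. w1 x - z1 x) t \<le> B.\<omega> t * (2 * (cmod (B.V w w1 t))\<^sup>2 + 2 * (cmod (B.V z z1 t))\<^sup>2)"
            using elim t by (auto intro!: mult_left_mono)
          also have "\<dots> = 2 * ?F w w1 t + 2 * ?F z z1 t" by (simp add: distrib_left)
          also have "\<dots> \<le> 2 * ?F w w1 t + 2 * B.en z z1 t" using elim t by auto
          finally show "?F (\<lambda>x. w x - z x) (\<lambda>x. w1 x - z1 x) t \<le> 2 * ?F w w1 t + 2 * B.en z z1 t" .
        qed
      qed
    qed
    also have "\<dots> = 2 * integral {d1..y} (?F w w1) + 2 * integral {d1..y} (B.en z z1)"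
      using absolutely_integrable_imp_integrable[OF i(1)] absolutely_integrable_imp_integrable[OF i(2)]
      by (subst Henstock_Kurzweil_Integration.integral_add) auto
    also have "\<dots> \<le> 2 * K1 + 2 * K2" using K1[OF y] K2[OF y] by linarith
    finally show ?thesis .
  qed
  then show ?thesis unfolding bounded_right_def by blast
qed

text \<open>The condition at b matches what \<open>friedrichs_behaviour\<close> supplies for the
  comparison function. If the integral of \<omega> is finite, both quotients vanish; otherwise both
  Dirichlet integrals are finite. Either property passes to the difference, as
  \<open>kernel_trivial\<close> requires.\<close>

lemma friedrichs_member:
  assumes g: "g \<in> Tmax" and om: "bounded_left A.\<omega>" and left: "vanish_left g"
    and right: "(bounded_right B.\<omega> \<and> vanish_right g) \<or> (\<not> bounded_right B.\<omega> \<and> bounded_right (\<lambda>x. B.\<omega> x * (cmod (B.V g (qd g) x))\<^sup>2))"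
  shows "(g, \<tau> g) \<in> friedrichs_ext M T0 \<tau>"
proof -
  let ?l = "of_real (\<gamma> - 1)"
  have L: "g \<in> L2 M" "\<tau> g \<in> L2 M" using dom_Tmax_L2[OF g] by auto
  have kL: "(\<lambda>x. \<tau> g x + (- ?l) * g x) \<in> L2 M" by (rule L2_add_scale[OF L(2,1)])
  obtain f where f: "(f, \<lambda>x. (\<tau> g x + (- ?l) * g x) + ?l * f x) \<in> friedrichs_ext M T0 \<tau>"
    by (rule F.friedrichs_ext_solvable[OF form_Cauchy_convergent kL])
  obtain z where z: "z \<in> Tmax" "AE x\<in>I in lebesgue. f x = z x"
    "AE x\<in>I in lebesgue. (\<tau> g x + (- ?l) * g x) + ?l * f x = \<tau> z x"
    "bounded_right (B.en z (qd z))" "bounded_left A.\<omega> \<Longrightarrow> vanish_left z" "bounded_right B.\<omega> \<Longrightarrow> vanish_right z"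
    by (rule friedrichs_behaviour[OF f]) blast
  note sg = dom_Tmax_sol[OF g] and sz = dom_Tmax_sol[OF z(1)]
  define w where "w x = g x - z x" for x
  have "sol w (\<lambda>x. qd g x - qd z x) (\<lambda>x. \<tau> g x - \<tau> z x)"
    using sol_add_scale[OF sg sz, of "-1"] by (simp add: w_def[abs_def])
  then have sw: "sol w (\<lambda>x. qd g x - qd z x) (\<lambda>x. ?l * w x)"
  proof (rule sol_cong_AE)
    show "AE x\<in>I in lebesgue. \<tau> g x - \<tau> z x = ?l * w x"
      using z(2,3)
    proof eventually_elim
      case (elim x)
      show ?case
      proof
        assume "x \<in> I"
        then have "\<tau> z x = (\<tau> g x + (- ?l) * g x) + ?l * z x" using elim by simp
        then show "\<tau> g x - \<tau> z x = ?l * w x" by (simp add: w_def algebra_simps)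
      qed
    qed
  qed
  have "AE x\<in>I in lebesgue. w x = 0"
  proof (rule kernel_trivial[OF sw])
    show "vanish_left w" unfolding w_def[abs_def] by (rule vanish_left_diff[OF left z(5)[OF om]])
    show "vanish_right w \<or> (bounded_right (\<lambda>x. B.\<omega> x * (cmod (B.V w (\<lambda>x. qd g x - qd z x) x))\<^sup>2) \<and> \<not> bounded_right B.\<omega>)"
      using right
    proof
      assume "bounded_right B.\<omega> \<and> vanish_right g"
      then show ?thesis unfolding w_def[abs_def] using vanish_right_diff[of g z] z(6) by blast
    next
      assume "\<not> bounded_right B.\<omega> \<and> bounded_right (\<lambda>x. B.\<omega> x * (cmod (B.V g (qd g) x))\<^sup>2)"
      then show ?thesis unfolding w_def[abs_def] using bounded_right_V_diff[OF sg sz _ z(4)] by blast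
    qed
  qed
  then have gz: "AE x\<in>I in lebesgue. f x = g x \<and> z x = g x"
    using z(2) by eventually_elim (auto simp: w_def)
  show ?thesis
  proof (rule F.friedrichs_ext_cong_AE[OF f L(1) _ L(2)])
    show "AE x in M. f x = g x" unfolding M_AE using gz by eventually_elim auto
    show "AE x in M. (\<tau> g x + (- ?l) * g x) + ?l * f x = \<tau> g x" unfolding M_AE using gz by eventually_elim (auto simp: algebra_simps)
  qed
qed

end

subsection \<open>Integrals near the endpoints\<close>

lemma nn_integral_Icc_eq:
  fixes F :: "real \<Rightarrow> real"
  assumes F: "F absolutely_integrable_on {x..y}" and pos: "AE t\<in>{x..y} in lebesgue. 0 \<le> F t"
  shows "(\<integral>\<^sup>+t\<in>{x..y}. ennreal (F t) \<partial>lebesgue) = ennreal (integral {x..y} F)"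
proof -
  have i: "integrable lebesgue (\<lambda>t. indicator {x..y} t *\<^sub>R F t)" using F by (simp add: set_integrable_def)
  have "(\<integral>\<^sup>+t\<in>{x..y}. ennreal (F t) \<partial>lebesgue) = (\<integral>\<^sup>+t. ennreal (indicator {x..y} t *\<^sub>R F t) \<partial>lebesgue)"
    by (intro nn_integral_cong) (auto simp: indicator_def)
  also have "\<dots> = ennreal (LINT t|lebesgue. indicator {x..y} t *\<^sub>R F t)"
    by (rule nn_integral_eq_integral[OF i]) (use pos in \<open>auto elim!: eventually_mono simp: indicator_def\<close>)
  also have "(LINT t|lebesgue. indicator {x..y} t *\<^sub>R F t) = integral {x..y} F"
    using set_lebesgue_integral_eq_integral(2)[OF F] by (simp add: set_lebesgue_integral_def)
  finally show ?thesis .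
qed

text \<open>Monotone convergence along an exhaustion by compact intervals, on which the nonnegative
  integral and the gauge integral agree.\<close>

lemma nn_int_le:
  assumes "\<alpha> < \<beta>" and F: "\<And>x y. x < y \<Longrightarrow> {x..y} \<subseteq> einterval \<alpha> \<beta> \<Longrightarrow> F absolutely_integrable_on {x..y}"
    and pos: "AE t\<in>einterval \<alpha> \<beta> in lebesgue. 0 \<le> F t"
    and K: "\<And>x y. x < y \<Longrightarrow> {x..y} \<subseteq> einterval \<alpha> \<beta> \<Longrightarrow> integral {x..y} F \<le> K"
  shows "nn_int \<alpha> \<beta> F \<le> ennreal K"
proof -
  obtain l u :: "nat \<Rightarrow> real" where lu: "\<And>n. l n < u n" "\<And>n. {l n..u n} \<subseteq> einterval \<alpha> \<beta>"
    "einterval \<alpha> \<beta> = (\<Union>n. {l n..u n})" "incseq u" "decseq l"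
    by (rule einterval_exhaustion[OF assms(1)]) blast
  have ind: "(SUP n. ennreal (F t) * indicator {l n..u n} t) = ennreal (F t) * indicator (einterval \<alpha> \<beta>) t" for t
  proof (cases "t \<in> einterval \<alpha> \<beta>")
    case True
    then obtain n0 where n0: "t \<in> {l n0..u n0}" unfolding lu(3) by blast
    show ?thesis
    proof (rule antisym)
      show "(SUP n. ennreal (F t) * indicator {l n..u n} t) \<le> ennreal (F t) * indicator (einterval \<alpha> \<beta>) t"
        using True by (intro SUP_least) (auto simp: indicator_def)
      show "ennreal (F t) * indicator (einterval \<alpha> \<beta>) t \<le> (SUP n. ennreal (F t) * indicator {l n..u n} t)"
        by (rule SUP_upper2[of n0]) (use n0 True in auto)
    qed
  next
    case False
    then have "t \<notin> {l n..u n}" for n using lu(2) by blast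
    then show ?thesis using False by simp
  qed
  have pos': "AE t\<in>{l n..u n} in lebesgue. 0 \<le> F t" for n
    using pos by eventually_elim (use lu(2) in blast)
  have "nn_int \<alpha> \<beta> F = (\<integral>\<^sup>+t. (SUP n. ennreal (F t) * indicator {l n..u n} t) \<partial>lebesgue)"
    unfolding nn_int_def ind ..
  also have "\<dots> = (SUP n. \<integral>\<^sup>+t\<in>{l n..u n}. ennreal (F t) \<partial>lebesgue)"
  proof (rule nn_integral_monotone_convergence_SUP)
    show "incseq (\<lambda>n t. ennreal (F t) * indicator {l n..u n} t)"
    proof (rule incseq_SucI, rule le_funI)
      fix n t
      have "l (Suc n) \<le> l n" "u n \<le> u (Suc n)" using lu(4,5) by (auto simp: decseq_SucD incseq_SucD)
      then show "ennreal (F t) * indicator {l n..u n} t \<le> ennreal (F t) * indicator {l (Suc n)..u (Suc n)} t"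
        by (auto simp: indicator_def)
    qed
    fix n
    have "(\<lambda>t. indicator {l n..u n} t *\<^sub>R F t) \<in> borel_measurable lebesgue"
      using F[OF lu(1,2)] unfolding set_integrable_def by (rule borel_measurable_integrable)
    then have "(\<lambda>t. ennreal (indicator {l n..u n} t *\<^sub>R F t)) \<in> borel_measurable lebesgue" by measurable
    also have "(\<lambda>t. ennreal (indicator {l n..u n} t *\<^sub>R F t)) = (\<lambda>t. ennreal (F t) * indicator {l n..u n} t)"
      by (auto simp: indicator_def)
    finally show "(\<lambda>t. ennreal (F t) * indicator {l n..u n} t) \<in> borel_measurable lebesgue" .
  qed
  also have "\<dots> \<le> ennreal K"
    by (rule SUP_least) (use nn_integral_Icc_eq[OF F[OF lu(1,2)] pos'] K[OF lu(1,2)] in \<open>simp add: ennreal_leI\<close>)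
  finally show ?thesis .
qed

lemma integral_le_nn_int:
  fixes F :: "real \<Rightarrow> real"
  assumes F: "F absolutely_integrable_on {x..y}" and pos: "AE t\<in>{x..y} in lebesgue. 0 \<le> F t" and sub: "{x<..<y} \<subseteq> einterval \<alpha> \<beta>"
  shows "ennreal (integral {x..y} F) \<le> nn_int \<alpha> \<beta> F"
proof -
  have "AE t in lebesgue. t \<noteq> x" "AE t in lebesgue. t \<noteq> y"
    by (rule AE_I'[of "{_}"]; force)+
  then have "(\<integral>\<^sup>+t\<in>{x..y}. ennreal (F t) \<partial>lebesgue) \<le> (\<integral>\<^sup>+t\<in>einterval \<alpha> \<beta>. ennreal (F t) \<partial>lebesgue)"
    by (intro nn_integral_mono_AE, eventually_elim) (use sub in \<open>auto simp: indicator_def subset_iff\<close>)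
  then show ?thesis unfolding nn_integral_Icc_eq[OF F pos] nn_int_def .
qed

lemma nn_int_mono:
  assumes "AE t\<in>einterval \<alpha> \<beta> in lebesgue. F t \<le> G t" "einterval \<alpha> \<beta> \<subseteq> einterval \<alpha>' \<beta>'"
  shows "nn_int \<alpha> \<beta> F \<le> nn_int \<alpha>' \<beta>' G"
  unfolding nn_int_def
proof (rule nn_integral_mono_AE)
  show "AE t in lebesgue. ennreal (F t) * indicator (einterval \<alpha> \<beta>) t \<le> ennreal (G t) * indicator (einterval \<alpha>' \<beta>') t"
    using assms(1) by eventually_elim (use assms(2) in \<open>auto simp: indicator_def ennreal_leI subset_iff\<close>)
qed

lemma einterval_mono: "\<alpha>' \<le> \<alpha> \<Longrightarrow> \<beta> \<le> \<beta>' \<Longrightarrow> einterval \<alpha> \<beta> \<subseteq> einterval \<alpha>' \<beta>'"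
  by (auto simp: einterval_def intro: le_less_trans less_le_trans)

lemma finite_int_left_mono:
  assumes "a < c0" and le: "AE t\<in>einterval a c0 in lebesgue. F t \<le> G t" and G: "finite_int_left a G"
  shows "finite_int_left a F"
proof -
  have "\<forall>\<^sub>F c in at_right a. c < c0" using eventually_at_right[OF assms(1)] assms(1) by blast
  with G show ?thesis unfolding finite_int_left_def
  proof eventually_elim
    case (elim c)
    have sub: "einterval a c \<subseteq> einterval a c0" by (rule einterval_mono) (use elim in auto)
    have "AE t\<in>einterval a c in lebesgue. F t \<le> G t" using le by eventually_elim (use sub in auto)
    from nn_int_mono[OF this order_refl] elim(1) show ?case by (rule le_less_trans)
  qed
qed

lemma finite_int_right_mono:
  assumes "d0 < b" and le: "AE t\<in>einterval d0 b in lebesgue. F t \<le> G t" and G: "finite_int_right b G"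
  shows "finite_int_right b F"
proof -
  have "\<forall>\<^sub>F c in at_left b. d0 < c" using eventually_at_left[OF assms(1)] assms(1) by blast
  with G show ?thesis unfolding finite_int_right_def
  proof eventually_elim
    case (elim c)
    have sub: "einterval c b \<subseteq> einterval d0 b" by (rule einterval_mono) (use elim in auto)
    have "AE t\<in>einterval c b in lebesgue. F t \<le> G t" using le by eventually_elim (use sub in auto)
    from nn_int_mono[OF this order_refl] elim(1) show ?case by (rule le_less_trans)
  qed
qed

lemma finite_int_left_cong:
  assumes "a < c0" "AE t\<in>einterval a c0 in lebesgue. F t = G t"
  shows "finite_int_left a F \<longleftrightarrow> finite_int_left a G"
  using assms(2) by (intro iffI; elim finite_int_left_mono[OF assms(1), rotated]) (auto elim!: eventually_mono)

lemma finite_int_right_cong: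
  assumes "d0 < b" "AE t\<in>einterval d0 b in lebesgue. F t = G t"
  shows "finite_int_right b F \<longleftrightarrow> finite_int_right b G"
  using assms(2) by (intro iffI; elim finite_int_right_mono[OF assms(1), rotated]) (auto elim!: eventually_mono)

text \<open>From (w/g)' = \<omega> V and p g^2 \<omega> = 1.\<close>

lemma (in sl_jacobi) quotient_derivative_sq:
  assumes w: "sol w w1 h"
  shows "AE x\<in>J in lebesgue. p x * (g x)\<^sup>2 * (cmod (vector_derivative (\<lambda>y. w y / of_real (g y)) (at x)))\<^sup>2 = \<omega> x * (cmod (V w w1 x))\<^sup>2"
  using primitive_on_AE_derivative[OF quotient_primitive[OF w]] p_pos
proof eventually_elim
  case (elim x)
  show ?case
  proof
    assume x: "x \<in> J"
    have v: "vector_derivative (\<lambda>y. w y / of_real (g y)) (at x) = \<omega> x *\<^sub>R V w w1 x"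
      by (rule vector_derivative_at) (use elim x in auto)
    have "p x > 0" "g x > 0" using elim x J_sub g_pos by auto
    then have "p x * (g x)\<^sup>2 * \<omega> x = 1" by (simp add: \<omega>_def)
    then have "p x * (g x)\<^sup>2 * (\<omega> x)\<^sup>2 = \<omega> x" by (metis mult.assoc mult_1 power2_eq_square)
    then show "p x * (g x)\<^sup>2 * (cmod (vector_derivative (\<lambda>y. w y / of_real (g y)) (at x)))\<^sup>2 = \<omega> x * (cmod (V w w1 x))\<^sup>2"
      unfolding v by (simp add: power_mult_distrib flip: mult.assoc)
  qed
qed

context sl_friedrichs
begin

lemma a_c0: "a < c0" and d0_b: "d0 < b"
  using c1 d1 by (auto simp: einterval_def intro: less_trans)

text \<open>An integral over a small neighbourhood of a and the integrals ending at c1 differ by the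
  contribution of a compact interval, on which \<open>F\<close> is integrable.\<close>

lemma finite_int_left_iff:
  assumes F: "\<And>x. x \<in> I \<Longrightarrow> x \<le> c1 \<Longrightarrow> F absolutely_integrable_on {x..c1}" and pos: "AE t\<in>A.J in lebesgue. 0 \<le> F t"
  shows "finite_int_left a F \<longleftrightarrow> bounded_left F"
proof -
  have ac: "a < ereal c1" "ereal c1 < c0" "ereal c1 < b" using c1 c1_I by (auto simp: einterval_def)
  have posI: "AE t\<in>{x..y} in lebesgue. 0 \<le> F t" if "x \<in> I" "y \<le> c1" for x y
  proof -
    have "{x..y} \<subseteq> A.J" if "x \<le> c1" using left_sub[OF c1 \<open>x \<in> I\<close> that] \<open>y \<le> c1\<close> by auto
    then have "{x..y} \<subseteq> A.J" using \<open>y \<le> c1\<close> by (cases "x \<le> c1") auto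
    then show ?thesis using pos by (auto elim!: eventually_mono)
  qed
  show ?thesis
  proof
    assume "finite_int_left a F"
    then obtain b' where b': "a < b'" "\<And>c. a < c \<Longrightarrow> c < b' \<Longrightarrow> nn_int a c F < \<infinity>"
      unfolding finite_int_left_def eventually_at_right[OF ac(1)] by blast
    obtain c where c: "a < ereal c" "ereal c < min b' (ereal c1)" using ereal_dense2[of a "min b' (ereal c1)"] b'(1) ac(1) by auto
    have cI: "c \<in> I" "c \<le> c1" using c ac(3) less_trans[of "ereal c" "ereal c1" b] by (auto simp: einterval_def)
    have nf: "nn_int a c F < \<infinity>" using b'(2)[OF c(1)] c(2) by simp
    then obtain N where N: "N \<ge> 0" "nn_int a c F = ennreal N" by (cases "nn_int a c F" rule: ennreal_cases) auto
    have lt: "integral {x..c} F \<le> N" if x: "x \<in> I" "x \<le> c" for x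
    proof -
      have Fi: "F absolutely_integrable_on {x..c}"
        by (rule set_integrable_subset[OF F[OF x(1)]]) (use x cI in auto)
      have "{x<..<c} \<subseteq> einterval a (ereal c)"
        using x(1) less_trans[of a "ereal x"] by (auto simp: einterval_def)
      from integral_le_nn_int[OF Fi posI[OF x(1) cI(2)] this] show ?thesis unfolding N(2) using N(1) by simp
    qed
    show "bounded_left F"
      unfolding bounded_left_def
    proof (intro exI[of _ "N + integral {c..c1} F"] ballI impI)
      fix x assume x: "x \<in> I" "x \<le> c1"
      show "integral {x..c1} F \<le> N + integral {c..c1} F"
      proof (cases "x \<le> c")
        case True
        have "integral {x..c1} F = integral {x..c} F + integral {c..c1} F"
          by (rule integral_combine_Icc[symmetric, OF True cI(2) absolutely_integrable_imp_integrable[OF F[OF x]]])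
        then show ?thesis using lt[OF x(1) True] by simp
      next
        case False
        have "integral {x..c1} F \<le> integral {c..c1} F"
          by (rule integral_Icc_subset_le_AE[OF F[OF cI] _ posI[OF cI(1) order_refl]]) (use False in auto)
        then show ?thesis using N(1) by simp
      qed
    qed
  next
    assume "bounded_left F"
    then obtain K where K: "\<And>x. x \<in> I \<Longrightarrow> x \<le> c1 \<Longrightarrow> integral {x..c1} F \<le> K" unfolding bounded_left_def by blast
    have sub: "x \<in> I \<and> y \<le> c1 \<and> x \<le> c1" if "x < y" "{x..y} \<subseteq> einterval a (ereal c1)" for x y
    proof -
      have "x \<in> einterval a (ereal c1)" "y \<in> einterval a (ereal c1)" using that by auto
      then show ?thesis using less_trans[of "ereal x" "ereal c1" b] ac(3) by (auto simp: einterval_def)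
    qed
    have "nn_int a (ereal c1) F \<le> ennreal K"
    proof (rule nn_int_le[OF ac(1)])
      fix x y :: real assume xy: "x < y" "{x..y} \<subseteq> einterval a (ereal c1)"
      note s = sub[OF xy]
      show "F absolutely_integrable_on {x..y}" by (rule set_integrable_subset[OF F]) (use s in auto)
      have "integral {x..y} F \<le> integral {x..c1} F"
        by (rule integral_Icc_subset_le_AE[OF F _ posI]) (use s in auto)
      also have "\<dots> \<le> K" by (rule K) (use s in auto)
      finally show "integral {x..y} F \<le> K" .
    next
      have "einterval a (ereal c1) \<subseteq> A.J" by (rule einterval_mono) (use ac in auto)
      then show "AE t\<in>einterval a (ereal c1) in lebesgue. 0 \<le> F t" using pos by (auto elim!: eventually_mono)
    qed
    then have fin: "nn_int a (ereal c1) F < \<infinity>" by (rule le_less_trans) simp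
    have "nn_int a c F < \<infinity>" if "c < ereal c1" for c
      using nn_int_mono[of a c F F a "ereal c1"] einterval_mono[of a a c "ereal c1"] that fin by (auto intro: le_less_trans)
    then show "finite_int_left a F"
      unfolding finite_int_left_def eventually_at_right[OF ac(1)] using ac(1) by blast
  qed
qed

lemma finite_int_right_iff:
  assumes F: "\<And>y. y \<in> I \<Longrightarrow> d1 \<le> y \<Longrightarrow> F absolutely_integrable_on {d1..y}" and pos: "AE t\<in>B.J in lebesgue. 0 \<le> F t"
  shows "finite_int_right b F \<longleftrightarrow> bounded_right F"
proof -
  have db: "ereal d1 < b" "d0 < ereal d1" "a < ereal d1" using d1 d1_I by (auto simp: einterval_def)
  have posI: "AE t\<in>{x..y} in lebesgue. 0 \<le> F t" if "y \<in> I" "d1 \<le> x" for x y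
  proof -
    have "{x..y} \<subseteq> B.J" if "d1 \<le> y" using right_sub[OF d1 \<open>y \<in> I\<close> that] \<open>d1 \<le> x\<close> by auto
    then have "{x..y} \<subseteq> B.J" using \<open>d1 \<le> x\<close> by (cases "d1 \<le> y") auto
    then show ?thesis using pos by (auto elim!: eventually_mono)
  qed
  show ?thesis
  proof
    assume "finite_int_right b F"
    then obtain a' where a': "a' < b" "\<And>c. a' < c \<Longrightarrow> c < b \<Longrightarrow> nn_int c b F < \<infinity>"
      unfolding finite_int_right_def eventually_at_left[OF db(1)] by blast
    obtain c where c: "max a' (ereal d1) < ereal c" "ereal c < b" using ereal_dense2[of "max a' (ereal d1)" b] a'(1) db(1) by auto
    have cI: "c \<in> I" "d1 \<le> c" using c db(3) less_trans[of a "ereal d1" "ereal c"] by (auto simp: einterval_def)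
    have nf: "nn_int c b F < \<infinity>" using a'(2)[OF _ c(2)] c(1) by simp
    then obtain N where N: "N \<ge> 0" "nn_int c b F = ennreal N" by (cases "nn_int c b F" rule: ennreal_cases) auto
    have lt: "integral {c..y} F \<le> N" if y: "y \<in> I" "c \<le> y" for y
    proof -
      have Fi: "F absolutely_integrable_on {c..y}"
        by (rule set_integrable_subset[OF F[OF y(1)]]) (use y cI in auto)
      have "{c<..<y} \<subseteq> einterval (ereal c) b"
        using y(1) less_trans[of _ "ereal y" b] by (auto simp: einterval_def)
      from integral_le_nn_int[OF Fi posI[OF y(1) cI(2)] this] show ?thesis unfolding N(2) using N(1) by simp
    qed
    show "bounded_right F"
      unfolding bounded_right_def
    proof (intro exI[of _ "N + integral {d1..c} F"] ballI impI)
      fix y assume y: "y \<in> I" "d1 \<le> y"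
      show "integral {d1..y} F \<le> N + integral {d1..c} F"
      proof (cases "c \<le> y")
        case True
        have "integral {d1..y} F = integral {d1..c} F + integral {c..y} F"
          by (rule integral_combine_Icc[symmetric, OF cI(2) True absolutely_integrable_imp_integrable[OF F[OF y]]])
        then show ?thesis using lt[OF y(1) True] by simp
      next
        case False
        have "integral {d1..y} F \<le> integral {d1..c} F"
          by (rule integral_Icc_subset_le_AE[OF F[OF cI] _ posI[OF cI(1) order_refl]]) (use False in auto)
        then show ?thesis using N(1) by simp
      qed
    qed
  next
    assume "bounded_right F"
    then obtain K where K: "\<And>y. y \<in> I \<Longrightarrow> d1 \<le> y \<Longrightarrow> integral {d1..y} F \<le> K" unfolding bounded_right_def by blast
    have sub: "y \<in> I \<and> d1 \<le> x \<and> d1 \<le> y" if "x < y" "{x..y} \<subseteq> einterval (ereal d1) b" for x y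
    proof -
      have "x \<in> einterval (ereal d1) b" "y \<in> einterval (ereal d1) b" using that by auto
      then show ?thesis using less_trans[of a "ereal d1" "ereal y"] db(3) by (auto simp: einterval_def)
    qed
    have "nn_int (ereal d1) b F \<le> ennreal K"
    proof (rule nn_int_le[OF db(1)])
      fix x y :: real assume xy: "x < y" "{x..y} \<subseteq> einterval (ereal d1) b"
      note s = sub[OF xy]
      show "F absolutely_integrable_on {x..y}" by (rule set_integrable_subset[OF F]) (use s in auto)
      have "integral {x..y} F \<le> integral {d1..y} F"
        by (rule integral_Icc_subset_le_AE[OF F _ posI]) (use s in auto)
      also have "\<dots> \<le> K" by (rule K) (use s in auto)
      finally show "integral {x..y} F \<le> K" .
    next
      have "einterval (ereal d1) b \<subseteq> B.J" by (rule einterval_mono) (use db in auto)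
      then show "AE t\<in>einterval (ereal d1) b in lebesgue. 0 \<le> F t" using pos by (auto elim!: eventually_mono)
    qed
    then have fin: "nn_int (ereal d1) b F < \<infinity>" by (rule le_less_trans) simp
    have "nn_int c b F < \<infinity>" if "ereal d1 < c" for c
      using nn_int_mono[of c b F F "ereal d1" b] einterval_mono[of "ereal d1" c b b] that fin by (auto intro: le_less_trans)
    then show "finite_int_right b F"
      unfolding finite_int_right_def eventually_at_left[OF db(1)] using db(1) by blast
  qed
qed

lemma infinite_int_right_imp:
  assumes "infinite_int_right b F"
  shows "\<not> finite_int_right b F"
proof
  assume "finite_int_right b F"
  then have "\<forall>\<^sub>F d in at_left b. False"
    using assms unfolding finite_int_right_def infinite_int_right_def by eventually_elim simp
  then obtain a' where "a' < b" "\<And>c. a' < c \<Longrightarrow> c < b \<Longrightarrow> False" unfolding eventually_at_left[OF ab] by blast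
  then show False using dense[of a' b] by blast
qed

lemma finite_omega_iff:
  "finite_int_left a (\<lambda>x. 1 / (p x * (ga x)\<^sup>2)) \<longleftrightarrow> bounded_left A.\<omega>"
  "finite_int_right b (\<lambda>x. 1 / (p x * (gb x)\<^sup>2)) \<longleftrightarrow> bounded_right B.\<omega>"
proof -
  have *: "(\<lambda>x. 1 / (p x * (ga x)\<^sup>2)) = A.\<omega>" "(\<lambda>x. 1 / (p x * (gb x)\<^sup>2)) = B.\<omega>" by (simp_all add: fun_eq_iff A.\<omega>_def B.\<omega>_def)
  show "finite_int_left a (\<lambda>x. 1 / (p x * (ga x)\<^sup>2)) \<longleftrightarrow> bounded_left A.\<omega>"
    unfolding * by (rule finite_int_left_iff[OF A.omega_integrable[OF left_sub[OF c1]]])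
      (use A.omega_pos in \<open>auto elim!: eventually_mono\<close>)
  show "finite_int_right b (\<lambda>x. 1 / (p x * (gb x)\<^sup>2)) \<longleftrightarrow> bounded_right B.\<omega>"
    unfolding * by (rule finite_int_right_iff[OF B.omega_integrable[OF right_sub[OF d1]]])
      (use B.omega_pos in \<open>auto elim!: eventually_mono\<close>)
qed

lemma finite_quotient_iff:
  assumes w: "sol w w1 h"
  shows "finite_int_left a (\<lambda>x. p x * (ga x)\<^sup>2 * (cmod (vector_derivative (\<lambda>y. w y / of_real (ga y)) (at x)))\<^sup>2)
     \<longleftrightarrow> bounded_left (\<lambda>x. A.\<omega> x * (cmod (A.V w w1 x))\<^sup>2)"
    "finite_int_right b (\<lambda>x. p x * (gb x)\<^sup>2 * (cmod (vector_derivative (\<lambda>y. w y / of_real (gb y)) (at x)))\<^sup>2)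
     \<longleftrightarrow> bounded_right (\<lambda>x. B.\<omega> x * (cmod (B.V w w1 x))\<^sup>2)"
  unfolding finite_int_left_cong[OF a_c0 A.quotient_derivative_sq[OF w]] finite_int_right_cong[OF d0_b B.quotient_derivative_sq[OF w]]
proof -
  show "finite_int_left a (\<lambda>x. A.\<omega> x * (cmod (A.V w w1 x))\<^sup>2) \<longleftrightarrow> bounded_left (\<lambda>x. A.\<omega> x * (cmod (A.V w w1 x))\<^sup>2)"
    by (rule finite_int_left_iff[OF A.V_sq_integrable(1)[OF w left_sub[OF c1]]])
      (use A.omega_pos in \<open>auto elim!: eventually_mono\<close>)
  show "finite_int_right b (\<lambda>x. B.\<omega> x * (cmod (B.V w w1 x))\<^sup>2) \<longleftrightarrow> bounded_right (\<lambda>x. B.\<omega> x * (cmod (B.V w w1 x))\<^sup>2)"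
    by (rule finite_int_right_iff[OF B.V_sq_integrable(1)[OF w right_sub[OF d1]]])
      (use B.omega_pos in \<open>auto elim!: eventually_mono\<close>)
qed

lemma bounded_en_imp:
  assumes w: "sol w w1 h"
  shows "bounded_left (A.en w w1) \<Longrightarrow> bounded_left (\<lambda>x. A.\<omega> x * (cmod (A.V w w1 x))\<^sup>2)"
    "bounded_right (B.en w w1) \<Longrightarrow> bounded_right (\<lambda>x. B.\<omega> x * (cmod (B.V w w1 x))\<^sup>2)"
proof -
  have 1: "integral {x..c1} (\<lambda>x. A.\<omega> x * (cmod (A.V w w1 x))\<^sup>2) \<le> integral {x..c1} (A.en w w1)" if "x \<in> I" "x \<le> c1" for x
    by (rule integral_mono_AE_Icc[OF A.V_sq_integrable(1,4)[OF w] A.en_ge(1)]; rule left_sub[OF c1 that])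
  have 2: "integral {d1..y} (\<lambda>x. B.\<omega> x * (cmod (B.V w w1 x))\<^sup>2) \<le> integral {d1..y} (B.en w w1)" if "y \<in> I" "d1 \<le> y" for y
    by (rule integral_mono_AE_Icc[OF B.V_sq_integrable(1,4)[OF w] B.en_ge(1)]; rule right_sub[OF d1 that])
  show "bounded_left (A.en w w1) \<Longrightarrow> bounded_left (\<lambda>x. A.\<omega> x * (cmod (A.V w w1 x))\<^sup>2)"
    unfolding bounded_left_def using 1 by (meson order_trans)
  show "bounded_right (B.en w w1) \<Longrightarrow> bounded_right (\<lambda>x. B.\<omega> x * (cmod (B.V w w1 x))\<^sup>2)"
    unfolding bounded_right_def using 2 by (meson order_trans)
qed

text \<open>Both cases at b in one statement: a vanishing quotient is imposed there only when the
  integral of \<omega> is finite. One inclusion is \<open>friedrichs_behaviour\<close>, the other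
  \<open>friedrichs_member\<close>.\<close>

theorem friedrichs_ext_eq:
  assumes om: "bounded_left A.\<omega>"
  shows "friedrichs_ext M T0 \<tau> = L2_graph M {g \<in> Tmax.
    bounded_left (\<lambda>x. A.\<omega> x * (cmod (A.V g (qd g) x))\<^sup>2) \<and> bounded_right (\<lambda>x. B.\<omega> x * (cmod (B.V g (qd g) x))\<^sup>2) \<and>
    vanish_left g \<and> (bounded_right B.\<omega> \<longrightarrow> vanish_right g)} \<tau>" (is "_ = L2_graph M ?D \<tau>")
proof (intro set_eqI iffI)
  fix z assume z: "z \<in> friedrichs_ext M T0 \<tau>"
  obtain f h where fh: "z = (f, h)" by (cases z)
  have fh': "(f, h) \<in> friedrichs_ext M T0 \<tau>" using z fh by simp
  obtain g where g: "g \<in> Tmax" "AE x\<in>I in lebesgue. f x = g x" "AE x\<in>I in lebesgue. h x = \<tau> g x"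
    "bounded_left (A.en g (qd g))" "bounded_right (B.en g (qd g))"
    "bounded_left A.\<omega> \<Longrightarrow> vanish_left g" "bounded_right B.\<omega> \<Longrightarrow> vanish_right g"
    by (rule friedrichs_behaviour[OF fh']) blast
  have "g \<in> ?D" using g(1,6,7) om bounded_en_imp[OF dom_Tmax_sol[OF g(1)]] g(4,5) by simp
  then show "z \<in> L2_graph M ?D \<tau>"
    unfolding L2_graph_def fh M_AE using F.friedrichs_extD(1,2)[OF fh'] g(2,3) by blast
next
  fix z assume "z \<in> L2_graph M ?D \<tau>"
  then obtain f h g where z: "z = (f, h)" "f \<in> L2 M" "h \<in> L2 M" "g \<in> ?D" "AE x in M. f x = g x" "AE x in M. h x = \<tau> g x"
    unfolding L2_graph_def by blast
  have "(g, \<tau> g) \<in> friedrichs_ext M T0 \<tau>"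
    by (rule friedrichs_member[OF _ om]) (use z(4) in auto)
  then show "z \<in> friedrichs_ext M T0 \<tau>"
    unfolding z(1)
  proof (rule F.friedrichs_ext_cong_AE[OF _ z(2) _ z(3)])
    show "AE x in M. g x = f x" using z(5) by eventually_elim simp
    show "AE x in M. \<tau> g x = h x" using z(6) by eventually_elim simp
  qed
qed

text \<open>By |Q| \<le> (Q - \<mu> r) + |\<mu>| r: the first summand is part of the energy density,
  the second is controlled by the L2 norm. The estimate is made for the representative
  \<open>g\<close> and carried to \<open>f\<close> by a.e. equality.\<close>

lemma friedrichs_domain_potential:
  assumes f: "f \<in> Domain (friedrichs_ext M T0 \<tau>)"
  shows "finite_int_left a (\<lambda>x. \<bar>A.Q x\<bar> * (cmod (f x))\<^sup>2)" "finite_int_right b (\<lambda>x. \<bar>B.Q x\<bar> * (cmod (f x))\<^sup>2)"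
proof -
  obtain h where fh: "(f, h) \<in> friedrichs_ext M T0 \<tau>" using f by blast
  obtain g where g: "g \<in> Tmax" "AE x\<in>I in lebesgue. f x = g x"
    "bounded_left (A.en g (qd g))" "bounded_right (B.en g (qd g))"
    by (rule friedrichs_behaviour[OF fh]) blast
  note w = dom_Tmax_sol[OF g(1)]
  have gL: "g \<in> L2 M" using dom_Tmax_L2[OF g(1)] by simp
  let ?N = "\<lambda>x. \<bar>\<mu>\<bar> * (r x * (cmod (g x))\<^sup>2)"
  have le: "\<bar>Q\<bar> * m \<le> (om * v + (Q - \<mu> * R) * m) + \<bar>\<mu>\<bar> * (R * m)" if "0 \<le> Q - \<mu> * R" "0 \<le> R" "0 \<le> m" "0 \<le> om * v" for Q R m om v :: real
  proof -
    have "\<bar>Q\<bar> \<le> (Q - \<mu> * R) + \<bar>\<mu>\<bar> * R" using that(1,2) abs_triangle_ineq[of "Q - \<mu> * R" "\<mu> * R"] by (simp add: abs_mult)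
    from mult_right_mono[OF this that(3)] that(4) show ?thesis by (simp add: algebra_simps)
  qed
  have N: "integral {x..y} ?N \<le> \<bar>\<mu>\<bar> * (L2_norm M g)\<^sup>2" if "{x..y} \<subseteq> I" for x y
    using local_norm_le[OF gL that] by (simp add: mult_left_mono)
  show "finite_int_left a (\<lambda>x. \<bar>A.Q x\<bar> * (cmod (f x))\<^sup>2)"
  proof (rule finite_int_left_mono[OF a_c0])
    show "AE t\<in>A.J in lebesgue. \<bar>A.Q t\<bar> * (cmod (f t))\<^sup>2 \<le> A.en g (qd g) t + ?N t"
      using A.Q_ge r_pos A.omega_pos g(2)
    proof eventually_elim
      case (elim t)
      show ?case
      proof
        assume t: "t \<in> A.J"
        then have "t \<in> I" using A.J_sub by blast
        then show "\<bar>A.Q t\<bar> * (cmod (f t))\<^sup>2 \<le> A.en g (qd g) t + ?N t"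
          unfolding A.en_def using elim t by (auto intro!: le)
      qed
    qed
    have i: "(\<lambda>t. A.en g (qd g) t + ?N t) absolutely_integrable_on {x..c1}" if "x \<in> I" "x \<le> c1" for x
      by (intro set_integral_add(1) set_integrable_mult_right A.V_sq_integrable[OF w left_sub[OF c1 that]])
    obtain K where K: "\<And>x. x \<in> I \<Longrightarrow> x \<le> c1 \<Longrightarrow> integral {x..c1} (A.en g (qd g)) \<le> K" using g(3) unfolding bounded_left_def by blast
    have "integral {x..c1} (\<lambda>t. A.en g (qd g) t + ?N t) \<le> K + \<bar>\<mu>\<bar> * (L2_norm M g)\<^sup>2" if x: "x \<in> I" "x \<le> c1" for x
    proof -
      note J = left_sub[OF c1 x]
      have "integral {x..c1} (\<lambda>t. A.en g (qd g) t + ?N t) = integral {x..c1} (A.en g (qd g)) + integral {x..c1} ?N"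
        by (intro Henstock_Kurzweil_Integration.integral_add absolutely_integrable_imp_integrable set_integrable_mult_right A.V_sq_integrable[OF w J])
      then show ?thesis using K[OF x] N[OF A.sub_I[OF J]] by linarith
    qed
    then have "bounded_left (\<lambda>t. A.en g (qd g) t + ?N t)" unfolding bounded_left_def by blast
    moreover have "AE t\<in>A.J in lebesgue. 0 \<le> A.en g (qd g) t + ?N t"
      using A.Q_ge r_pos A.omega_pos by eventually_elim (use A.J_sub in \<open>auto simp: A.en_def\<close>)
    ultimately show "finite_int_left a (\<lambda>t. A.en g (qd g) t + ?N t)" using finite_int_left_iff[OF i] by blast
  qed
  show "finite_int_right b (\<lambda>x. \<bar>B.Q x\<bar> * (cmod (f x))\<^sup>2)"
  proof (rule finite_int_right_mono[OF d0_b])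
    show "AE t\<in>B.J in lebesgue. \<bar>B.Q t\<bar> * (cmod (f t))\<^sup>2 \<le> B.en g (qd g) t + ?N t"
      using B.Q_ge r_pos B.omega_pos g(2)
    proof eventually_elim
      case (elim t)
      show ?case
      proof
        assume t: "t \<in> B.J"
        then have "t \<in> I" using B.J_sub by blast
        then show "\<bar>B.Q t\<bar> * (cmod (f t))\<^sup>2 \<le> B.en g (qd g) t + ?N t"
          unfolding B.en_def using elim t by (auto intro!: le)
      qed
    qed
    have i: "(\<lambda>t. B.en g (qd g) t + ?N t) absolutely_integrable_on {d1..y}" if "y \<in> I" "d1 \<le> y" for y
      by (intro set_integral_add(1) set_integrable_mult_right B.V_sq_integrable[OF w right_sub[OF d1 that]])
    obtain K where K: "\<And>y. y \<in> I \<Longrightarrow> d1 \<le> y \<Longrightarrow> integral {d1..y} (B.en g (qd g)) \<le> K" using g(4) unfolding bounded_right_def by blast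
    have "integral {d1..y} (\<lambda>t. B.en g (qd g) t + ?N t) \<le> K + \<bar>\<mu>\<bar> * (L2_norm M g)\<^sup>2" if y: "y \<in> I" "d1 \<le> y" for y
    proof -
      note J = right_sub[OF d1 y]
      have "integral {d1..y} (\<lambda>t. B.en g (qd g) t + ?N t) = integral {d1..y} (B.en g (qd g)) + integral {d1..y} ?N"
        by (intro Henstock_Kurzweil_Integration.integral_add absolutely_integrable_imp_integrable set_integrable_mult_right B.V_sq_integrable[OF w J])
      then show ?thesis using K[OF y] N[OF B.sub_I[OF J]] by linarith
    qed
    then have "bounded_right (\<lambda>t. B.en g (qd g) t + ?N t)" unfolding bounded_right_def by blast
    moreover have "AE t\<in>B.J in lebesgue. 0 \<le> B.en g (qd g) t + ?N t"
      using B.Q_ge r_pos B.omega_pos by eventually_elim (use B.J_sub in \<open>auto simp: B.en_def\<close>)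
    ultimately show "finite_int_right b (\<lambda>t. B.en g (qd g) t + ?N t)" using finite_int_right_iff[OF i] by blast
  qed
qed

end

theorem theorem11p19:
  fixes a b :: ereal
    and p q r s ga gb :: "real \<Rightarrow> real"
    and \<gamma>0 \<mu> :: real
  assumes coeffs: "sl_coefficients a b p q r s"
    and p_pos: "AE x\<in>einterval a b in lebesgue. p x > 0"
    and T0_bounded: "bounded_below_by (weighted_measure a b r) (dom_T0 a b p q r s) (tau a b p q r s) \<gamma>0"
    and ga: "ga \<in> D_tau a b p s"
    and gb: "gb \<in> D_tau a b p s"
    and ga_pos: "\<forall>\<^sub>F c in at_right a. \<forall>x\<in>einterval a c. ga x > 0"
    and gb_pos: "\<forall>\<^sub>F d in at_left b. \<forall>x\<in>einterval d b. gb x > 0"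
    and q_a: "\<forall>\<^sub>F c in at_right a. AE x\<in>einterval a c in lebesgue.
        q x \<ge> \<mu> * r x - s x * (quasi_deriv a b p s ga x / ga x)
               + vector_derivative (quasi_deriv a b p s ga) (at x) / ga x"
    and q_b: "\<forall>\<^sub>F d in at_left b. AE x\<in>einterval d b in lebesgue.
        q x \<ge> \<mu> * r x - s x * (quasi_deriv a b p s gb x / gb x)
               + vector_derivative (quasi_deriv a b p s gb) (at x) / gb x"
  shows
    "(finite_int_left a (\<lambda>x. 1 / (p x * (ga x)\<^sup>2)) \<and>
     infinite_int_right b (\<lambda>x. 1 / (p x * (gb x)\<^sup>2)) \<longrightarrow>
       S_F a b p q r s = L2_graph (weighted_measure a b r)
         {g \<in> dom_Tmax a b p q r s.
            finite_int_right b (\<lambda>x. p x * (gb x)\<^sup>2 *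
              (cmod (vector_derivative (\<lambda>y. g y / complex_of_real (gb y)) (at x)))\<^sup>2) \<and>
            finite_int_left a (\<lambda>x. p x * (ga x)\<^sup>2 *
              (cmod (vector_derivative (\<lambda>y. g y / complex_of_real (ga y)) (at x)))\<^sup>2) \<and>
            (((\<lambda>x. g x / complex_of_real (ga x)) \<circ> real_of_ereal) \<longlongrightarrow> 0) (at_right a)}
         (tau a b p q r s) \<and>
       (\<forall>f \<in> Domain (S_F a b p q r s).
          finite_int_left a (\<lambda>x. \<bar>q x - vector_derivative (quasi_deriv a b p s ga) (at x) / ga x
              + s x * (quasi_deriv a b p s ga x / ga x)\<bar> * (cmod (f x))\<^sup>2) \<and>
          finite_int_right b (\<lambda>x. \<bar>q x - vector_derivative (quasi_deriv a b p s gb) (at x) / gb x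
              + s x * (quasi_deriv a b p s gb x / gb x)\<bar> * (cmod (f x))\<^sup>2))) \<and>
     (finite_int_left a (\<lambda>x. 1 / (p x * (ga x)\<^sup>2)) \<and>
     finite_int_right b (\<lambda>x. 1 / (p x * (gb x)\<^sup>2)) \<longrightarrow>
       S_F a b p q r s = L2_graph (weighted_measure a b r)
         {g \<in> dom_Tmax a b p q r s.
            finite_int_left a (\<lambda>x. p x * (ga x)\<^sup>2 *
              (cmod (vector_derivative (\<lambda>y. g y / complex_of_real (ga y)) (at x)))\<^sup>2) \<and>
            finite_int_right b (\<lambda>x. p x * (gb x)\<^sup>2 *
              (cmod (vector_derivative (\<lambda>y. g y / complex_of_real (gb y)) (at x)))\<^sup>2) \<and>
            (((\<lambda>x. g x / complex_of_real (ga x)) \<circ> real_of_ereal) \<longlongrightarrow> 0) (at_right a) \<and>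
            (((\<lambda>x. g x / complex_of_real (gb x)) \<circ> real_of_ereal) \<longlongrightarrow> 0) (at_left b)}
         (tau a b p q r s))"
proof -
  interpret sl_problem a b p q r s by unfold_locales (fact coeffs p_pos)+
  \<comment> \<open>A point of (a,b) that separates the two end pieces: c0 < e < d0, and therefore
    c1 < d1.\<close>
  obtain e where e: "a < ereal e" "ereal e < b" using ereal_dense2[OF ab] by blast
  obtain a' where a': "a < a'" "\<And>c. a < c \<Longrightarrow> c < a' \<Longrightarrow> (\<forall>x\<in>einterval a c. ga x > 0) \<and> (AE x\<in>einterval a c in lebesgue.
        q x \<ge> \<mu> * r x - s x * (quasi_deriv a b p s ga x / ga x) + vector_derivative (quasi_deriv a b p s ga) (at x) / ga x)"
    using eventually_conj[OF ga_pos q_a] unfolding eventually_at_right[OF ab] by blast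
  obtain b' where b': "b' < b" "\<And>d. b' < d \<Longrightarrow> d < b \<Longrightarrow> (\<forall>x\<in>einterval d b. gb x > 0) \<and> (AE x\<in>einterval d b in lebesgue.
        q x \<ge> \<mu> * r x - s x * (quasi_deriv a b p s gb x / gb x) + vector_derivative (quasi_deriv a b p s gb) (at x) / gb x)"
    using eventually_conj[OF gb_pos q_b] unfolding eventually_at_left[OF ab] by blast
  obtain c0 where c0: "a < c0" "c0 < min a' (ereal e)" using dense[of a "min a' (ereal e)"] a'(1) e(1) by auto
  obtain d0 where d0: "max b' (ereal e) < d0" "d0 < b" using dense[of "max b' (ereal e)" b] b'(1) e(2) by auto
  obtain c1 where c1: "a < ereal c1" "ereal c1 < c0" using ereal_dense2[OF c0(1)] by blast
  obtain d1 where d1: "d0 < ereal d1" "ereal d1 < b" using ereal_dense2[OF d0(2)] by blast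
  have "c0 < ereal e" "ereal e < d0" using c0 d0 by auto
  then have "ereal c1 < ereal d1" using c1(2) d1(1) by (meson less_trans)
  then have c1d1: "c1 < d1" by simp
  have "c0 \<le> b" "a \<le> d0" using \<open>c0 < ereal e\<close> \<open>ereal e < d0\<close> e by (meson less_trans less_imp_le)+
  then have sub: "einterval a c0 \<subseteq> einterval a b" "einterval d0 b \<subseteq> einterval a b"
    by (simp_all add: einterval_mono)
  interpret E: sl_endpoints a b p q r s c0 d0 ga gb \<mu>
  proof unfold_locales
    show "einterval a c0 \<subseteq> einterval a b" "einterval d0 b \<subseteq> einterval a b" by (fact sub)+
    show "ga \<in> D_tau a b p s" "gb \<in> D_tau a b p s" by (fact ga gb)+
    show "ga x > 0" if "x \<in> einterval a c0" for x using a'(2)[OF c0(1)] c0(2) that by simp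
    show "gb x > 0" if "x \<in> einterval d0 b" for x using b'(2)[OF _ d0(2)] d0(1) that by simp
    show "AE x\<in>einterval a c0 in lebesgue. q x \<ge> \<mu> * r x - s x * (quasi_deriv a b p s ga x / ga x)
        + vector_derivative (quasi_deriv a b p s ga) (at x) / ga x" using a'(2)[OF c0(1)] c0(2) by simp
    show "AE x\<in>einterval d0 b in lebesgue. q x \<ge> \<mu> * r x - s x * (quasi_deriv a b p s gb x / gb x)
        + vector_derivative (quasi_deriv a b p s gb) (at x) / gb x" using b'(2)[OF _ d0(2)] d0(1) by simp
  qed
  have c1J: "c1 \<in> einterval a c0" and d1J: "d1 \<in> einterval d0 b" using c1 d1 by (auto simp: einterval_def)
  obtain C where C: "C \<ge> 0" "\<And>w w1 h x y. sol w w1 h \<Longrightarrow> x \<in> I \<Longrightarrow> y \<in> I \<Longrightarrow> x \<le> c1 \<Longrightarrow> d1 \<le> y \<Longrightarrow>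
    integral {x..c1} (E.A.en w w1) + integral {d1..y} (E.B.en w w1) + 1/2 * integral {c1..d1} (\<lambda>t. inverse (p t) * (cmod (w1 t))\<^sup>2)
    \<le> integral {x..y} (\<lambda>t. r t * Re (cnj (w t) * h t)) + C * integral {x..y} (\<lambda>t. r t * (cmod (w t))\<^sup>2)
      - E.A.bf w w1 x + E.B.bf w w1 y"
    by (rule E.coercive[OF c1J d1J c1d1]) blast
  \<comment> \<open>All three terms on the left of the coercivity estimate are nonnegative; dropping
    them leaves the required lower bound with \<gamma> = -C.\<close>
  interpret S: sl_friedrichs a b p q r s c0 d0 ga gb \<mu> "- C" c1 d1
  proof unfold_locales
    fix w w1 h x y assume H: "sol w w1 h" "x \<in> I" "y \<in> I" "x \<le> c1" "d1 \<le> y"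
    have cdI: "{c1..d1} \<subseteq> I" by (rule Icc_subset_einterval) (use c1J d1J sub in auto)
    note L = E.left_sub[OF c1J H(2,4)] and R = E.right_sub[OF d1J H(3,5)]
    have "0 \<le> integral {x..c1} (E.A.en w w1)" by (rule integral_nonneg_AE[OF E.A.V_sq_integrable(4)[OF H(1) L] E.A.en_ge(3)[OF L]])
    moreover have "0 \<le> integral {d1..y} (E.B.en w w1)" by (rule integral_nonneg_AE[OF E.B.V_sq_integrable(4)[OF H(1) R] E.B.en_ge(3)[OF R]])
    moreover have "0 \<le> integral {c1..d1} (\<lambda>t. inverse (p t) * (cmod (w1 t))\<^sup>2)"
    proof (rule integral_nonneg_AE)
      show "(\<lambda>t. inverse (p t) * (cmod (w1 t))\<^sup>2) absolutely_integrable_on {c1..d1}"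
        using sol_continuous(2)[OF H(1)] by (intro coeff_times_continuous cdI continuous_intros) (rule continuous_on_subset[OF _ cdI])
    qed (use inverse_p_nonneg[OF cdI] in \<open>auto elim!: eventually_mono\<close>)
    ultimately show "0 \<le> integral {x..y} (\<lambda>t. r t * Re (cnj (w t) * h t)) - - C * integral {x..y} (\<lambda>t. r t * (cmod (w t))\<^sup>2)
      - E.A.bf w w1 x + E.B.bf w w1 y"
      using C(2)[OF H] by simp
  qed (use c1J d1J c1d1 in auto)
  have dom: "{g \<in> dom_Tmax a b p q r s.
      S.bounded_left (\<lambda>x. E.A.\<omega> x * (cmod (E.A.V g (qd g) x))\<^sup>2) \<and> S.bounded_right (\<lambda>x. E.B.\<omega> x * (cmod (E.B.V g (qd g) x))\<^sup>2) \<and> P g}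
    = {g \<in> dom_Tmax a b p q r s.
            finite_int_left a (\<lambda>x. p x * (ga x)\<^sup>2 *
              (cmod (vector_derivative (\<lambda>y. g y / complex_of_real (ga y)) (at x)))\<^sup>2) \<and>
            finite_int_right b (\<lambda>x. p x * (gb x)\<^sup>2 *
              (cmod (vector_derivative (\<lambda>y. g y / complex_of_real (gb y)) (at x)))\<^sup>2) \<and> P g}" for P
    using S.finite_quotient_iff[OF dom_Tmax_sol] by blast
  have pot: "\<forall>f \<in> Domain (S_F a b p q r s).
          finite_int_left a (\<lambda>x. \<bar>q x - vector_derivative (quasi_deriv a b p s ga) (at x) / ga x
              + s x * (quasi_deriv a b p s ga x / ga x)\<bar> * (cmod (f x))\<^sup>2) \<and>
          finite_int_right b (\<lambda>x. \<bar>q x - vector_derivative (quasi_deriv a b p s gb) (at x) / gb x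
              + s x * (quasi_deriv a b p s gb x / gb x)\<bar> * (cmod (f x))\<^sup>2)"
    using S.friedrichs_domain_potential unfolding S_F_def E.A.Q_def E.B.Q_def by blast
  note eq = S.friedrichs_ext_eq[unfolded dom, folded S_F_def]
  show ?thesis
  proof (intro conjI impI)
    assume H: "finite_int_left a (\<lambda>x. 1 / (p x * (ga x)\<^sup>2)) \<and> infinite_int_right b (\<lambda>x. 1 / (p x * (gb x)\<^sup>2))"
    show "\<forall>f \<in> Domain (S_F a b p q r s).
          finite_int_left a (\<lambda>x. \<bar>q x - vector_derivative (quasi_deriv a b p s ga) (at x) / ga x
              + s x * (quasi_deriv a b p s ga x / ga x)\<bar> * (cmod (f x))\<^sup>2) \<and>
          finite_int_right b (\<lambda>x. \<bar>q x - vector_derivative (quasi_deriv a b p s gb) (at x) / gb x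
              + s x * (quasi_deriv a b p s gb x / gb x)\<bar> * (cmod (f x))\<^sup>2)" by (fact pot)
    \<comment> \<open>The finiteness of the integral of \<omega> at b is rewritten to a truth value:
      \<open>False\<close> makes the implication in \<open>friedrichs_ext_eq\<close> void, and
      \<open>True\<close> in the other case turns it into the second boundary condition.\<close>
    have om: "S.bounded_left E.A.\<omega>" and inf: "S.bounded_right E.B.\<omega> = False"
      using H S.infinite_int_right_imp by (simp_all add: S.finite_omega_iff[symmetric])
    show "S_F a b p q r s = L2_graph (weighted_measure a b r)
         {g \<in> dom_Tmax a b p q r s.
            finite_int_right b (\<lambda>x. p x * (gb x)\<^sup>2 *
              (cmod (vector_derivative (\<lambda>y. g y / complex_of_real (gb y)) (at x)))\<^sup>2) \<and>
            finite_int_left a (\<lambda>x. p x * (ga x)\<^sup>2 *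
              (cmod (vector_derivative (\<lambda>y. g y / complex_of_real (ga y)) (at x)))\<^sup>2) \<and>
            (((\<lambda>x. g x / complex_of_real (ga x)) \<circ> real_of_ereal) \<longlongrightarrow> 0) (at_right a)}
         (tau a b p q r s)"
      unfolding eq[OF om] inf S.vanish_left_iff by (rule arg_cong[where f="\<lambda>D. L2_graph M D \<tau>"]) blast
  next
    assume H: "finite_int_left a (\<lambda>x. 1 / (p x * (ga x)\<^sup>2)) \<and> finite_int_right b (\<lambda>x. 1 / (p x * (gb x)\<^sup>2))"
    have om: "S.bounded_left E.A.\<omega>" and fin: "S.bounded_right E.B.\<omega> = True"
      using H by (simp_all add: S.finite_omega_iff[symmetric])
    show "S_F a b p q r s = L2_graph (weighted_measure a b r)
         {g \<in> dom_Tmax a b p q r s.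
            finite_int_left a (\<lambda>x. p x * (ga x)\<^sup>2 *
              (cmod (vector_derivative (\<lambda>y. g y / complex_of_real (ga y)) (at x)))\<^sup>2) \<and>
            finite_int_right b (\<lambda>x. p x * (gb x)\<^sup>2 *
              (cmod (vector_derivative (\<lambda>y. g y / complex_of_real (gb y)) (at x)))\<^sup>2) \<and>
            (((\<lambda>x. g x / complex_of_real (ga x)) \<circ> real_of_ereal) \<longlongrightarrow> 0) (at_right a) \<and>
            (((\<lambda>x. g x / complex_of_real (gb x)) \<circ> real_of_ereal) \<longlongrightarrow> 0) (at_left b)}
         (tau a b p q r s)"
      unfolding eq[OF om] fin S.vanish_left_iff S.vanish_right_iff by (rule arg_cong[where f="\<lambda>D. L2_graph M D \<tau>"]) blast
  qed
qed

end
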